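(* Let $n\ge 1$ and let $\mu,g,f$ satisfy the structural assumptions $(S)$. Let $u$ be $C^2_{\rm loc}$ in the interior of $\mathbb{R}^{n+1}_+$, and assume that $u$ is a bounded and stable weak solution of $$\begin{cases} -{\rm div}\,(\mu(x)\nabla u)+g(x,u)=0 & \text{on } \mathbb{R}^{n+1}_+,\\ -\mu(x)u_x=f(u) & \text{on } \partial\mathbb{R}^{n+1}_+.\end{cases}$$ Assume furthermore that for all $r>0$, $|\nabla_y u|\in L^\infty(\overline{B_r^+})$. Then, for any $R>0$ and any $\phi:\mathbb{R}^{n+1}\to\mathbb{R}$ which is Lipschitz and vanishes on $\mathbb{R}^{n+1}_+\setminus B_R$, we have $$\int_{\mathcal{R}^{n+1}_+}\mu(x)\,\phi^2\left(\mathcal{K}^2|\nabla_y u|^2+\big|\nabla_L|\nabla_y u|\big|^2\right)\le\int_{\mathbb{R}^{n+1}_+}\mu(x)\,|\nabla_y u|^2|\nabla\phi|^2 .$$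
   Context: Notation. Points of $\mathbb{R}^{n+1}_+:=\mathbb{R}^n\times(0,+\infty)$ are written $(y,x)$ with $y\in\mathbb{R}^n$, $x>0$; $\partial\mathbb{R}^{n+1}_+=\mathbb{R}^n\times\{0\}$. $\nabla$ is the full gradient in $(y,x)$, $\nabla_y$ the gradient in $y$, $u_x=\partial_x u$, $u_{y_j}=\partial_{y_j}u$. $B_R$ is the ball of radius $R$ centered at $0$ in $\mathbb{R}^{n+1}$ and $B_R^+:=B_R\cap\mathbb{R}^{n+1}_+$. Structural assumptions $(S)$ on $\mu:(0,+\infty)\to\mathbb{R}$, $g:(0,+\infty)\times\mathbb{R}\to\mathbb{R}$, $f:\mathbb{R}\to\mathbb{R}$: (i) $\mu\in L^1((0,r))$ for any $r>0$, and for every $K\Subset\mathbb{R}^{n+1}_+$ there are $\mu_1,\mu_2>0$, possibly depending on $K$, with $\mu_1\le\mu(x)\le\mu_2$ for all $(y,x)\in K$. (ii) $\mu$ is an $A_2$-Muckenhoupt weight: there exists $\kappa>0$ such that $\int_a^b\mu(x)\,dx\int_a^b\frac{1}{\mu(x)}\,dx\le\kappa(b-a)^2$ for any $b\ge a\ge 0$. (iii) The map $x\mapsto g(x,0)$ belongs to $L^\infty((0,r))$ for any $r>0$; for any $x>0$ the map $u\mapsto g(x,u)$ is locally Lipschitz; and for any $R,M>0$ there exists $C>0$, possibly depending on $R$ and $M$, such that $\sup_{0<x<R,\,|u|<M}|g_u(x,u)|\le C$. (iv) $f$ is locally Lipschitz in $\mathbb{R}$. Here $g_u=\partial g/\partial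 u$ and $f'$ are the derivatives of these locally Lipschitz functions (existing almost everywhere). Admissible test functions: for some $R>0$, $\xi$ is a real function on $\mathbb{R}^{n+1}_+$ that is bounded, locally Lipschitz in the interior of $\mathbb{R}^{n+1}_+$, vanishes on $\mathbb{R}^{n+1}_+\setminus B_R$, and satisfies $\mu(x)|\nabla\xi|^2\in L^1(B_R^+)$. Weak solution: $u\in L^\infty_{\rm loc}(\overline{\mathbb{R}^{n+1}_+})$, $\mu(x)|\nabla u|^2\in L^1(B_R^+)$ for any $R>0$, and $$\int_{\mathbb{R}^{n+1}_+}\mu(x)\nabla u\cdot\nabla\xi+\int_{\mathbb{R}^{n+1}_+}g(x,u)\,\xi=\int_{\partial\mathbb{R}^{n+1}_+}f(u)\,\xi$$ for every admissible $\xi$. Stable: for every admissible $\xi$ (vanishing outside $B_R$), $$\int_{B_R^+}\mu(x)|\nabla\xi|^2+\int_{B_R^+}g_u(x,u)\xi^2-\int_{B_R\cap\partial\mathbb{R}^{n+1}_+}f'(u)\xi^2\ge 0 .$$ Geometric quantities: $\mathcal{R}^{n+1}_+:=\{(y,x)\in\mathbb{R}^n\times(0,+\infty):\nabla_y u(y,x)\ne 0\}$. For fixed $x>0$ and $c\in\mathbb{R}$, let $S:=\{y\in\mathbb{R}^n: u(y,x)=c\}$ and $L:=\{y\in S:\nabla_y u(y,x)\neq 0\}$, which is a smooth manifold (a hypersurface in $\mathbb{R}^n$). For $y_o\in L$ and $G$ smooth near $y_o$, the tangential gradient is $$\nabla_L G(y_o):=\nabla_y G(y_o)-\left(\nabla_y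 G(y_o)\cdot\frac{\nabla_y u(y_o,x)}{|\nabla_y u(y_o,x)|}\right)\frac{\nabla_y u(y_o,x)}{|\nabla_y u(y_o,x)|}.$$ Let $\kappa_1(y,x),\dots,\kappa_{n-1}(y,x)$ be the principal curvatures of $L$ at $y\in L$, and $\mathcal{K}(y,x):=\sqrt{\sum_{j=1}^{n-1}(\kappa_j(y,x))^2}$. At each $(y,x)\in\mathcal{R}^{n+1}_+$ these are computed for the level set of $u(\cdot,x)$ through $y$. *)

theory Defs
  imports "HOL-Analysis.Analysis"
begin

text \<open>
  Points \<open>(y, x)\<close> of $R^n \times R$ have type \<^typ>\<open>(real^'n) \<times> real\<close>; the norm of this product
  type is the Euclidean one.
\<close>

definition half_space :: "((real^'n) \<times> real) set"
  where "half_space = {p. 0 < snd p}"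

definition half_ball :: "real \<Rightarrow> ((real^'n) \<times> real) set"
  where "half_ball R = ball 0 R \<inter> half_space"

text \<open>
  Functions in weighted Sobolev spaces have values on the boundary only in the sense of traces.
  For an \<open>A\<^sub>2\<close> weight \<open>\<mu>\<close> the function \<open>1/\<mu>\<close> is integrable near 0, so, if \<open>v\<close> is locally Lipschitz
  in the half-space and \<open>\<mu> \<bar>\<nabla>v\<bar>\<^sup>2\<close> is integrable on half-balls, then for almost every \<open>y\<close> the function
  \<open>v (y, \<cdot>)\<close> has an integrable derivative near 0, and the limit below exists.
\<close>

definition trace :: "((real^'n) \<times> real \<Rightarrow> real) \<Rightarrow> real^'n \<Rightarrow> real"
  where "trace v y = Lim (at_right 0) (\<lambda>x. v (y, x))"

definition grad :: "('a::real_inner \<Rightarrow> real) \<Rightarrow> 'a \<Rightarrow> 'a"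
  where "grad v p = (SOME D. GDERIV v p :> D)"

definition grad_y :: "((real^'n) \<times> real \<Rightarrow> real) \<Rightarrow> (real^'n) \<times> real \<Rightarrow> real^'n"
  where "grad_y u p = grad (\<lambda>y. u (y, snd p)) (fst p)"

definition C2_on :: "'a::real_normed_vector set \<Rightarrow> ('a \<Rightarrow> real) \<Rightarrow> bool"
  where "C2_on S v \<longleftrightarrow>
    (\<exists>(Dv :: 'a \<Rightarrow> 'a \<Rightarrow>\<^sub>L real) (D2v :: 'a \<Rightarrow> 'a \<Rightarrow>\<^sub>L 'a \<Rightarrow>\<^sub>L real).
      (\<forall>p\<in>S. (v has_derivative blinfun_apply (Dv p)) (at p)) \<and>
      (\<forall>p\<in>S. (Dv has_derivative blinfun_apply (D2v p)) (at p)) \<and>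
      continuous_on S D2v)"

abbreviation locally_lipschitz_on :: "'a::metric_space set \<Rightarrow> ('a \<Rightarrow> real) \<Rightarrow> bool"
  where "locally_lipschitz_on S h \<equiv> local_lipschitz (UNIV :: real set) S (\<lambda>_. h)"

definition Linfty_on :: "'a::euclidean_space set \<Rightarrow> ('a \<Rightarrow> real) \<Rightarrow> bool"
  where "Linfty_on S h \<longleftrightarrow>
    h \<in> borel_measurable (lebesgue_on S) \<and> (\<exists>C. AE p in lebesgue_on S. \<bar>h p\<bar> \<le> C)"

text \<open>
  A locally Lipschitz function is differentiable only almost everywhere. A version \<open>h'\<close> of its
  derivative is unconstrained at the points where \<open>h\<close> is not differentiable.
\<close>

definition derivative_version :: "(real \<Rightarrow> real) \<Rightarrow> (real \<Rightarrow> real) \<Rightarrow> bool"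
  where "derivative_version h h' \<longleftrightarrow>
    (\<forall>t D. (h has_real_derivative D) (at t) \<longrightarrow> h' t = D)"

text \<open>
  The integrals are taken in \<^typ>\<open>ennreal\<close>: with Bochner integrals, a weight whose reciprocal is not
  integrable would satisfy the condition trivially (its integral would be 0).
\<close>

definition muckenhoupt_A2 :: "(real \<Rightarrow> real) \<Rightarrow> bool"
  where "muckenhoupt_A2 \<mu> \<longleftrightarrow>
    (\<exists>\<kappa>>0. \<forall>a b. 0 \<le> a \<longrightarrow> a \<le> b \<longrightarrow>
      (\<integral>\<^sup>+x\<in>{a<..<b}. ennreal (\<mu> x) \<partial>lebesgue) * (\<integral>\<^sup>+x\<in>{a<..<b}. ennreal (1 / \<mu> x) \<partial>lebesgue)
        \<le> ennreal (\<kappa> * (b - a)\<^sup>2))"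

definition admissible :: "(real \<Rightarrow> real) \<Rightarrow> real \<Rightarrow> ((real^'n) \<times> real \<Rightarrow> real) \<Rightarrow> bool"
  where "admissible \<mu> R \<xi> \<longleftrightarrow>
    bounded (\<xi> ` half_space) \<and>
    locally_lipschitz_on half_space \<xi> \<and>
    (\<forall>p\<in>half_space - ball 0 R. \<xi> p = 0) \<and>
    set_integrable lebesgue (half_ball R) (\<lambda>p. \<mu> (snd p) * (norm (grad \<xi> p))\<^sup>2)"

text \<open>
  The Bochner integral of a function that is not integrable is 0, so the two definitions below ask
  explicitly that the integrals they mention exist. The gradient of \<open>u\<close> is the classical one, hence
  \<open>weak_solution\<close> is meant for functions that are differentiable in the half-space.
\<close>

definition weak_solution ::
    "(real \<Rightarrow> real) \<Rightarrow> (real \<Rightarrow> real \<Rightarrow> real) \<Rightarrow> (real \<Rightarrow> real) \<Rightarrow> ((real^'n) \<times> real \<Rightarrow> real) \<Rightarrow> bool"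
  where "weak_solution \<mu> g f u \<longleftrightarrow>
    (\<forall>K. compact K \<and> K \<subseteq> closure half_space \<longrightarrow> Linfty_on K u) \<and>
    (\<forall>R>0. set_integrable lebesgue (half_ball R) (\<lambda>p. \<mu> (snd p) * (norm (grad u p))\<^sup>2)) \<and>
    (\<forall>R>0. \<forall>\<xi>. admissible \<mu> R \<xi> \<longrightarrow>
      set_integrable lebesgue half_space (\<lambda>p. \<mu> (snd p) * (grad u p \<bullet> grad \<xi> p)) \<and>
      set_integrable lebesgue half_space (\<lambda>p. g (snd p) (u p) * \<xi> p) \<and>
      integrable lebesgue (\<lambda>y. f (trace u y) * trace \<xi> y) \<and>
      (LINT p:half_space|lebesgue. \<mu> (snd p) * (grad u p \<bullet> grad \<xi> p))
        + (LINT p:half_space|lebesgue. g (snd p) (u p) * \<xi> p)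
        = (LINT y|lebesgue. f (trace u y) * trace \<xi> y))"

definition stable_solution ::
    "(real \<Rightarrow> real) \<Rightarrow> (real \<Rightarrow> real \<Rightarrow> real) \<Rightarrow> (real \<Rightarrow> real) \<Rightarrow> ((real^'n) \<times> real \<Rightarrow> real) \<Rightarrow> bool"
  where "stable_solution \<mu> g' f' u \<longleftrightarrow>
    (\<forall>R>0. \<forall>\<xi>. admissible \<mu> R \<xi> \<longrightarrow>
      set_integrable lebesgue (half_ball R) (\<lambda>p. g' (snd p) (u p) * (\<xi> p)\<^sup>2) \<and>
      set_integrable lebesgue (ball 0 R) (\<lambda>y. f' (trace u y) * (trace \<xi> y)\<^sup>2) \<and>
      (LINT p:half_ball R|lebesgue. \<mu> (snd p) * (norm (grad \<xi> p))\<^sup>2)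
        + (LINT p:half_ball R|lebesgue. g' (snd p) (u p) * (\<xi> p)\<^sup>2)
        - (LINT y:ball 0 R|lebesgue. f' (trace u y) * (trace \<xi> y)\<^sup>2) \<ge> 0)"

text \<open>
  Here \<open>v\<close> is a function on $R^n$ with \<open>grad v y \<noteq> 0\<close>; the geometric objects are those of the level
  set of \<open>v\<close> through \<open>y\<close>, near \<open>y\<close>. Principal curvatures are the eigenvalues of the shape operator
  on the tangent space. This operator is self-adjoint, so the multiplicity of an eigenvalue is the
  dimension of its eigenspace, and \<open>curvature_norm\<close> is the square root of the sum of the squares of the
  \<open>n - 1\<close> principal curvatures, counted with multiplicity.
\<close>

definition unit_normal :: "('a::euclidean_space \<Rightarrow> real) \<Rightarrow> 'a \<Rightarrow> 'a"
  where "unit_normal v y = grad v y /\<^sub>R norm (grad v y)"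

definition shape_operator :: "('a::euclidean_space \<Rightarrow> real) \<Rightarrow> 'a \<Rightarrow> 'a \<Rightarrow> 'a"
  where "shape_operator v y w = - frechet_derivative (unit_normal v) (at y) w"

definition principal_space :: "('a::euclidean_space \<Rightarrow> real) \<Rightarrow> 'a \<Rightarrow> real \<Rightarrow> 'a set"
  where "principal_space v y k = {w. w \<bullet> grad v y = 0 \<and> shape_operator v y w = k *\<^sub>R w}"

definition principal_curvatures :: "('a::euclidean_space \<Rightarrow> real) \<Rightarrow> 'a \<Rightarrow> real set"
  where "principal_curvatures v y = {k. \<exists>w\<in>principal_space v y k. w \<noteq> 0}"

definition curvature_norm :: "('a::euclidean_space \<Rightarrow> real) \<Rightarrow> 'a \<Rightarrow> real"
  where "curvature_norm v y =
    sqrt (\<Sum>k\<in>principal_curvatures v y. real (dim (principal_space v y k)) * k\<^sup>2)"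

definition tangential_grad :: "('a::euclidean_space \<Rightarrow> real) \<Rightarrow> ('a \<Rightarrow> real) \<Rightarrow> 'a \<Rightarrow> 'a"
  where "tangential_grad v G y = grad G y - (grad G y \<bullet> unit_normal v y) *\<^sub>R unit_normal v y"

definition regular_set :: "((real^'n) \<times> real \<Rightarrow> real) \<Rightarrow> ((real^'n) \<times> real) set"
  where "regular_set u = {p\<in>half_space. grad_y u p \<noteq> 0}"

definition level_curvature :: "((real^'n) \<times> real \<Rightarrow> real) \<Rightarrow> (real^'n) \<times> real \<Rightarrow> real"
  where "level_curvature u p = curvature_norm (\<lambda>y. u (y, snd p)) (fst p)"

definition level_grad ::
    "((real^'n) \<times> real \<Rightarrow> real) \<Rightarrow> ((real^'n) \<times> real \<Rightarrow> real) \<Rightarrow> (real^'n) \<times> real \<Rightarrow> real^'n"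
  where "level_grad u G p = tangential_grad (\<lambda>y. u (y, snd p)) (\<lambda>y. G (y, snd p)) (fst p)"

end

theory Submission imports Defs begin

text \<open>
  Fix a unit vector \<open>b\<close> of $R^n$. The difference quotient \<open>w\<^sub>h\<close> of \<open>u\<close> in direction \<open>b\<close> satisfies a weak
  equation; testing it with \<open>\<eta>\<^sup>2 w\<^sub>h\<close> bounds the weighted energy of \<open>w\<^sub>h\<close> uniformly in \<open>h\<close>, so that
  \<open>u\<^sub>b\<close> has finite energy and \<open>\<eta> u\<^sub>b\<close> is an admissible test function. As \<open>h\<close> tends to 0 (Fatou's lemma for
  the gradient term, dominated convergence for the others) one obtains
  \<open>\<integral>\<mu>\<bar>\<nabla>(\<eta> u\<^sub>b)\<bar>\<^sup>2 + \<integral>g\<^sub>u (\<eta> u\<^sub>b)\<^sup>2 - \<integral>f' (\<eta> u\<^sub>b)\<^sup>2 \<le> \<integral>\<mu> u\<^sub>b\<^sup>2 \<bar>\<nabla>\<eta>\<bar>\<^sup>2\<close>.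
  Summing over \<open>b\<close> and subtracting the stability inequality for \<open>\<eta> \<bar>\<nabla>\<^sub>y u\<bar>\<close> cancels the terms with \<open>f'\<close> and
  \<open>g\<^sub>u\<close> and leaves
  \<open>\<integral>\<mu> \<eta>\<^sup>2 (\<Sum>\<^sub>b \<bar>\<nabla>u\<^sub>b\<bar>\<^sup>2 - \<bar>\<nabla>\<bar>\<nabla>\<^sub>y u\<bar>\<bar>\<^sup>2) \<le> \<integral>\<mu> \<bar>\<nabla>\<^sub>y u\<bar>\<^sup>2 \<bar>\<nabla>\<eta>\<bar>\<^sup>2\<close>.
  The bracket dominates \<open>K\<^sup>2 \<bar>\<nabla>\<^sub>y u\<bar>\<^sup>2 + \<bar>\<nabla>\<^sub>L \<bar>\<nabla>\<^sub>y u\<bar>\<bar>\<^sup>2\<close> pointwise by the identity of Sternberg and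
  Zumbrun. Rademacher's theorem gives the derivatives of the Lipschitz functions that occur.
\<close>

section \<open>Rademacher's theorem\<close>

text \<open>\<open>u\<close> is C^2 only in the interior, and \<open>f\<close> and \<open>g\<close>
  are merely Lipschitz in \<open>u\<close>, so the equation cannot be differentiated: neither finite
  energy of \<open>u_b\<close> up to the boundary nor a boundary condition for \<open>u_b\<close> is
  given. Three obstacles shape the proof. First, \<open>g'\<close> and \<open>f'\<close> are
  arbitrary on null sets of values, which \<open>u\<close> may take on sets of positive measure;
  there \<open>u_b\<close> vanishes almost everywhere, so the limits of the difference quotients and
  the terms with \<open>g'\<close>, \<open>f'\<close> are both 0. Second, the boundary term contains
  the trace of \<open>u_b\<close>, whereas the quotients of the trace of \<open>u\<close> converge
  to its derivative. The two agree almost everywhere: the A2 condition makes \<open>1/\<mu>\<close>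
  integrable near 0, and with the uniform energy bound this keeps traces and nearby slices close in
  L^1, uniformly in the increment. Third, strong convergence of the gradients is not known; Fatou's
  lemma gives just the upper bound on the energy of \<open>\<eta> u_b\<close> that the comparison
  with stability requires. Stability enters twice: as the final inequality, and as the source of
  integrability, hence measurability, of the terms with \<open>g'\<close> and
  \<open>f'\<close>.\<close>

lemma lmeasurable_outer_open:
  fixes T :: "'a::euclidean_space set"
  assumes T: "T \<in> lmeasurable" and e: "0 < e"
  obtains U where "open U" "T \<subseteq> U" "U \<in> lmeasurable" "measure lebesgue U < measure lebesgue T + e"
proof -
  obtain U where U: "open U" "T \<subseteq> U" "U - T \<in> lmeasurable" "emeasure lebesgue (U - T) < ennreal e"
    using sets_lebesgue_outer_open[OF fmeasurableD[OF T] e] by blast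
  have Ueq: "U = T \<union> (U - T)"
    using U(2) by blast
  then have lm: "U \<in> lmeasurable"
    using T U(3) by (metis fmeasurable.Un)
  have "measure lebesgue (U - T) < e"
    using U(3,4) e by (simp add: emeasure_eq_measure2 ennreal_less_iff)
  moreover have "measure lebesgue U \<le> measure lebesgue T + measure lebesgue (U - T)"
    using measure_Un_le[of T lebesgue "U - T"] Ueq T U(3) by (metis fmeasurableD)
  ultimately show ?thesis
    using that U lm by fastforce
qed

text \<open>Vitali's theorem extracts from the given short intervals a disjoint family inside an
  open set barely larger than \<open>T\<close> that covers \<open>S\<close> up to a null set.
  Monotonicity turns their images into intervals at most \<open>a\<close> times as long, and the
  Lipschitz bound keeps the image of the null set null. The supersets \<open>T\<close> and
  \<open>T'\<close> stand in for outer measures, because \<open>S\<close> need not be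
  measurable.\<close>

lemma outer_measure_image_le:
  fixes h :: "real \<Rightarrow> real"
  assumes h: "mono h" "M-lipschitz_on UNIV h" and a: "0 \<le> a"
    and T: "S \<subseteq> T" "T \<in> lmeasurable" and e: "0 < e"
    and S: "\<And>x d. x \<in> S \<Longrightarrow> 0 < d \<Longrightarrow>
      \<exists>p q. p < q \<and> p \<le> x \<and> x \<le> q \<and> q - p < d \<and> h q - h p \<le> a * (q - p)"
  obtains T' where "T' \<in> lmeasurable" "h ` S \<subseteq> T'" "measure lebesgue T' \<le> a * measure lebesgue T + e"
proof -
  \<comment> \<open>Dividing by \<open>a + 1\<close> instead of \<open>a\<close> also covers
    \<open>a = 0\<close>.\<close>
  obtain U where U: "open U" "T \<subseteq> U" "U \<in> lmeasurable" "measure lebesgue U < measure lebesgue T + e / (a + 1)"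
    using lmeasurable_outer_open[OF T(2), of "e / (a + 1)"] a e by auto
  define K where "K = {(c::real, r::real). 0 < r \<and> cball c r \<subseteq> U \<and> h (c + r) - h (c - r) \<le> a * (2 * r)}"
  have "\<exists>i. i \<in> K \<and> x \<in> cball (fst i) (snd i) \<and> snd i < d" if x: "x \<in> S" and d: "0 < d" for x d
  proof -
    obtain \<delta> where \<delta>: "0 < \<delta>" "ball x \<delta> \<subseteq> U"
      using U x T by (meson openE subsetD)
    obtain p q where pq: "p < q" "p \<le> x" "x \<le> q" "q - p < min d \<delta>" "h q - h p \<le> a * (q - p)"
      using S[OF x, of "min d \<delta>"] d \<delta> by auto
    define c r where "c = (p + q) / 2" and "r = (q - p) / 2"
    have cr: "p = c - r" "q = c + r"
      by (auto simp: c_def r_def field_simps)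
    have "cball c r = {p..q}"
      by (simp add: cball_eq_atLeastAtMost cr)
    moreover have "{p..q} \<subseteq> ball x \<delta>"
      using pq by (auto simp: dist_real_def)
    ultimately have "(c, r) \<in> K \<and> x \<in> cball c r \<and> r < d"
      using pq \<delta> by (auto simp: K_def cr)
    then show ?thesis
      by (intro exI[of _ "(c, r)"]) auto
  qed
  note fine = this
  have pos: "0 < snd i" if "i \<in> K" for i
    using that by (auto simp: K_def)
  obtain C where C: "countable C" "C \<subseteq> K"
    "pairwise (\<lambda>i j. disjnt (cball (fst i) (snd i)) (cball (fst j) (snd j))) C"
    "negligible (S - (\<Union>i\<in>C. cball (fst i) (snd i)))"
    by (rule Vitali_covering_theorem_cballs[of K snd S fst, OF pos fine])
  define N where "N = S - (\<Union>i\<in>C. cball (fst i) (snd i))"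
  have negN: "negligible (h ` N)"
  proof (rule negligible_locally_Lipschitz_image)
    fix x assume "x \<in> N"
    show "\<exists>T B. open T \<and> x \<in> T \<and> (\<forall>y\<in>N \<inter> T. norm (h y - h x) \<le> B * norm (y - x))"
      using h(2) by (intro exI[of _ UNIV] exI[of _ M]) (auto simp: lipschitz_on_def dist_norm)
  qed (use C in \<open>auto simp: N_def\<close>)
  define I where "I i = {h (fst i - snd i)..h (fst i + snd i)}" for i
  have I_lm: "I i \<in> lmeasurable" for i
    using lmeasurable_cbox[of "h (fst i - snd i)" "h (fst i + snd i)"] by (simp add: I_def)
  \<comment> \<open>A bound on all finite subfamilies passes to the countable union.\<close>
  have fin: "measure lebesgue (\<Union>i\<in>F. I i) \<le> a * measure lebesgue U" if F: "F \<subseteq> C" "finite F" for F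
  proof -
    have "measure lebesgue (\<Union>i\<in>F. I i) \<le> (\<Sum>i\<in>F. measure lebesgue (I i))"
      using F I_lm by (intro measure_UNION_le) auto
    also have "\<dots> \<le> (\<Sum>i\<in>F. a * measure lebesgue (cball (fst i) (snd i)))"
    proof (rule sum_mono)
      fix i assume "i \<in> F"
      then have "i \<in> K"
        using F C by auto
      then have r: "0 < snd i" and le: "h (fst i + snd i) - h (fst i - snd i) \<le> a * (2 * snd i)"
        by (auto simp: K_def)
      have "measure lebesgue (cball (fst i) (snd i)) = 2 * snd i"
        using r by (simp add: cball_eq_atLeastAtMost)
      moreover have "h (fst i - snd i) \<le> h (fst i + snd i)"
        using r by (intro monoD[OF h(1)]) auto
      ultimately show "measure lebesgue (I i) \<le> a * measure lebesgue (cball (fst i) (snd i))"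
        using le by (simp add: I_def)
    qed
    also have "\<dots> = a * measure lebesgue (\<Union>i\<in>F. cball (fst i) (snd i))"
    proof -
      have "measure lebesgue (\<Union>i\<in>F. cball (fst i) (snd i)) = (\<Sum>i\<in>F. measure lebesgue (cball (fst i) (snd i)))"
      proof (rule measure_negligible_finite_Union_image)
        show "pairwise (\<lambda>x y. negligible (cball (fst x) (snd x) \<inter> cball (fst y) (snd y))) F"
          using pairwise_subset[OF C(3) F(1)] unfolding pairwise_def disjnt_def by simp
      qed (use F in auto)
      then show ?thesis
        by (simp add: sum_distrib_left)
    qed
    also have "\<dots> \<le> a * measure lebesgue U"
    proof (intro mult_left_mono a measure_mono_fmeasurable)
      show "(\<Union>i\<in>F. cball (fst i) (snd i)) \<subseteq> U"
      proof -
        have "cball (fst i) (snd i) \<subseteq> U" if "i \<in> K" for i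
          using that by (cases i) (simp add: K_def)
        then show ?thesis
          using F C(2) by blast
      qed
      show "(\<Union>i\<in>F. cball (fst i) (snd i)) \<in> sets lebesgue"
        using F by (intro sets.finite_UN) auto
    qed (use U in auto)
    finally show ?thesis .
  qed
  have U1: "(\<Union>i\<in>C. I i) \<in> lmeasurable"
    using fmeasurable_UN_bound[OF C(1) I_lm fin] by blast
  have U2: "measure lebesgue (\<Union>i\<in>C. I i) \<le> a * measure lebesgue U"
    using measure_UN_bound[OF C(1) I_lm fin] by blast
  show ?thesis
  proof
    show "(\<Union>i\<in>C. I i) \<union> h ` N \<in> lmeasurable"
      using U1 negN negligible_imp_measurable by blast
    show "h ` S \<subseteq> (\<Union>i\<in>C. I i) \<union> h ` N"
    proof
      fix z assume "z \<in> h ` S"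
      then obtain x where x: "x \<in> S" "z = h x" by auto
      show "z \<in> (\<Union>i\<in>C. I i) \<union> h ` N"
      proof (cases "x \<in> N")
        case False
        then obtain i where i: "i \<in> C" "x \<in> cball (fst i) (snd i)"
          using x by (auto simp: N_def)
        then have "h x \<in> I i"
          unfolding I_def cball_eq_atLeastAtMost using monoD[OF h(1)] by auto
        then show ?thesis
          using i x by auto
      qed (use x in auto)
    qed
    have "measure lebesgue ((\<Union>i\<in>C. I i) \<union> h ` N) \<le> measure lebesgue (\<Union>i\<in>C. I i) + measure lebesgue (h ` N)"
      using U1 negN by (intro measure_Un_le) (auto simp: negligible_imp_sets)
    also have "\<dots> \<le> a * measure lebesgue U"
      using U2 negN by (simp add: negligible_imp_measure0)
    also have "\<dots> \<le> a * (measure lebesgue T + e / (a + 1))"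
      using U a by (intro mult_left_mono) auto
    also have "\<dots> \<le> a * measure lebesgue T + e"
      using a e by (simp add: field_simps)
    finally show "measure lebesgue ((\<Union>i\<in>C. I i) \<union> h ` N) \<le> a * measure lebesgue T + e" .
  qed
qed

text \<open>The infimum of the measures of measurable supersets, finite thanks to \<open>T0\<close>,
  is at most \<open>c\<close> times itself and hence 0.\<close>

lemma negligible_of_contraction:
  assumes T0: "S \<subseteq> T0" "T0 \<in> lmeasurable" and c: "0 \<le> c" "c < 1"
    and step: "\<And>T e. S \<subseteq> T \<Longrightarrow> T \<in> lmeasurable \<Longrightarrow> 0 < e \<Longrightarrow>
      \<exists>T'. S \<subseteq> T' \<and> T' \<in> lmeasurable \<and> measure lebesgue T' \<le> c * measure lebesgue T + e"
  shows "negligible S"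
proof -
  define X where "X = {measure lebesgue T |T. S \<subseteq> T \<and> T \<in> lmeasurable}"
  have bdd: "bdd_below X" and ne: "X \<noteq> {}"
    using T0 by (auto simp: X_def intro!: bdd_belowI[of _ 0])
  have ge0: "0 \<le> Inf X"
    using ne by (intro cInf_greatest) (auto simp: X_def)
  have "Inf X \<le> c * Inf X + e" if e: "0 < e" for e
  proof -
    obtain T where T: "S \<subseteq> T" "T \<in> lmeasurable" "measure lebesgue T < Inf X + e / 2"
    proof -
      obtain m where "m \<in> X" "m < Inf X + e / 2"
        using cInf_lessD[OF ne, of "Inf X + e / 2"] e by auto
      then show ?thesis
        using that by (auto simp: X_def)
    qed
    obtain T' where T': "S \<subseteq> T'" "T' \<in> lmeasurable" "measure lebesgue T' \<le> c * measure lebesgue T + e / 2"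
      using step[OF T(1,2), of "e / 2"] e by auto
    have "Inf X \<le> measure lebesgue T'"
      using T' bdd by (intro cInf_lower) (auto simp: X_def)
    also have "\<dots> \<le> c * (Inf X + e / 2) + e / 2"
      using T' T c by (smt (verit) mult_left_mono)
    also have "\<dots> \<le> c * Inf X + e"
    proof -
      have "c * (e / 2) \<le> e / 2"
        using c e mult_right_mono[of c 1 "e / 2"] by simp
      then show ?thesis
        unfolding distrib_left by linarith
    qed
    finally show ?thesis .
  qed
  then have "Inf X \<le> c * Inf X"
    by (meson field_le_epsilon)
  then have "(1 - c) * Inf X \<le> 0"
    by (simp add: algebra_simps)
  then have Inf0: "Inf X = 0"
    using c ge0 by (smt (verit) mult_pos_pos)
  show ?thesis
    unfolding negligible_outer
  proof (intro allI impI)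
    fix e :: real assume "0 < e"
    then obtain m where "m \<in> X" "m < e"
      using cInf_lessD[OF ne, of e] Inf0 by auto
    then show "\<exists>T. S \<subseteq> T \<and> T \<in> lmeasurable \<and> measure lebesgue T < e"
      by (auto simp: X_def)
  qed
qed

lemma negligible_if_bounded_parts:
  fixes S :: "'a::euclidean_space set"
  assumes "\<And>n::nat. negligible (S \<inter> cball 0 (real n))"
  shows "negligible S"
proof -
  have "S = (\<Union>n. S \<inter> cball 0 (real n))"
    using real_arch_simple by auto
  then show ?thesis
    using assms negligible_Union_nat by metis
qed

text \<open>
  By Vitali coverings \<open>f\<close> maps \<open>S\<close> to a set of outer measure at most \<open>a\<close> times that of \<open>S\<close>, and its
  inverse shrinks the outer measure of \<open>f ` S\<close> by the factor \<open>1 / b\<close>; since \<open>a / b < 1\<close>, \<open>S\<close> is null.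
\<close>

lemma lipschitz_oscillation_negligible:
  fixes f :: "real \<Rightarrow> real"
  assumes f: "\<And>x y. x \<le> y \<Longrightarrow> y - x \<le> f y - f x" "\<And>x y. x \<le> y \<Longrightarrow> f y - f x \<le> M * (y - x)"
    and ab: "0 < a" "a < b"
    and S: "\<And>x d. x \<in> S \<Longrightarrow> 0 < d \<Longrightarrow> \<exists>p q. p < q \<and> p \<le> x \<and> x \<le> q \<and> q - p < d \<and> f q - f p \<le> a * (q - p)"
      "\<And>x d. x \<in> S \<Longrightarrow> 0 < d \<Longrightarrow> \<exists>p q. p < q \<and> p \<le> x \<and> x \<le> q \<and> q - p < d \<and> b * (q - p) \<le> f q - f p"
  shows "negligible S"
proof (rule negligible_if_bounded_parts)
  fix n :: nat
  have fmono: "mono f"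
    using f(1) by (auto intro!: monoI) (smt (verit))
  have M: "1 \<le> M"
    using f(1)[of 0 1] f(2)[of 0 1] by simp
  have flip: "M-lipschitz_on UNIV f"
  proof (rule lipschitz_onI)
    fix x y :: real
    show "dist (f x) (f y) \<le> M * dist x y"
      using f(1)[of x y] f(1)[of y x] f(2)[of x y] f(2)[of y x] by (cases "x \<le> y") (auto simp: dist_real_def)
  qed (use M in auto)
  have inj: "inj f"
    using f(1) by (auto intro!: injI) (smt (verit))
  have cont: "continuous_on UNIV f"
    using flip lipschitz_on_continuous_on by blast
  have surj: "surj f"
  proof -
    have "\<exists>x. f x = z" for z
    proof -
      define r where "r = \<bar>z - f 0\<bar>"
      have "f (- r) \<le> z" "z \<le> f r"
        using f(1)[of "-r" 0] f(1)[of 0 r] by (auto simp: r_def)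
      then show ?thesis
        using IVT'[of f "-r" z r] continuous_on_subset[OF cont] by (auto simp: r_def)
    qed
    then show ?thesis by (metis surj_def)
  qed
  define g where "g = inv f"
  have fg: "f (g z) = z" and gf: "g (f z) = z" for z
    using inj surj by (auto simp: g_def surj_f_inv_f)
  have g1: "g x \<le> g y" "g y - g x \<le> y - x" "(y - x) \<le> M * (g y - g x)" if "x \<le> y" for x y
  proof -
    show *: "g x \<le> g y"
    proof (rule ccontr)
      assume "\<not> ?thesis"
      then show False
        using f(1)[of "g y" "g x"] fg[of x] fg[of y] that by auto
    qed
    show "g y - g x \<le> y - x" "(y - x) \<le> M * (g y - g x)"
      using f(1)[OF *] f(2)[OF *] by (simp_all add: fg)
  qed
  have gmono: "mono g"
    using g1 by (auto intro: monoI)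
  have glip: "1-lipschitz_on UNIV g"
  proof (rule lipschitz_onI)
    fix x y :: real
    show "dist (g x) (g y) \<le> 1 * dist x y"
      using g1(1,2)[of x y] g1(1,2)[of y x] by (cases "x \<le> y") (auto simp: dist_real_def)
  qed auto
  let ?S = "S \<inter> cball 0 (real n)"
  show "negligible ?S"
  proof (rule negligible_of_contraction[of _ "cball 0 (real n)" "a / b"])
    fix T and e :: real
    assume T: "?S \<subseteq> T" "T \<in> lmeasurable" and e: "0 < e"
    \<comment> \<open>The error of the first image is divided by \<open>b\<close> on the way back,
      so \<open>b * e / 2\<close> leaves \<open>e / 2\<close>.\<close>
    have be: "0 < b * e / 2"
      using ab e by auto
    obtain T1 where T1: "T1 \<in> lmeasurable" "f ` ?S \<subseteq> T1" "measure lebesgue T1 \<le> a * measure lebesgue T + b * e / 2"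
    proof (rule outer_measure_image_le[OF fmono flip _ T be, of a])
      show "\<exists>p q. p < q \<and> p \<le> x \<and> x \<le> q \<and> q - p < d \<and> f q - f p \<le> a * (q - p)"
        if "x \<in> ?S" "0 < d" for x d
        using S(1)[of x d] that by blast
    qed (use ab in auto)
    \<comment> \<open>Steep intervals of \<open>f\<close> are flat intervals of its inverse: growth
      at rate at least \<open>b\<close> becomes growth at rate at most \<open>1 / b\<close>. Asking
      for length below \<open>d / M\<close> makes the image intervals shorter than
      \<open>d\<close>.\<close>
    have st: "\<exists>p q. p < q \<and> p \<le> z \<and> z \<le> q \<and> q - p < d \<and> g q - g p \<le> (1 / b) * (q - p)"
      if z: "z \<in> f ` ?S" and d: "0 < d" for z d
    proof -
      obtain x where x: "x \<in> S" "z = f x"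
        using z by auto
      obtain p q where pq: "p < q" "p \<le> x" "x \<le> q" "q - p < d / M" "b * (q - p) \<le> f q - f p"
        using S(2)[OF x(1), of "d / M"] d M by auto
      have "f p < f q"
        using f(1)[of p q] pq by auto
      moreover have "f p \<le> z" "z \<le> f q"
        using pq x monoD[OF fmono] by auto
      moreover have "f q - f p < d"
      proof -
        have "f q - f p \<le> M * (q - p)"
          using f(2) pq by auto
        also have "\<dots> < d"
          using pq(4) M by (simp add: field_simps)
        finally show ?thesis .
      qed
      moreover have "g (f q) - g (f p) \<le> (1 / b) * (f q - f p)"
        using pq ab by (simp add: gf field_simps)
      ultimately show ?thesis
        by blast
    qed
    obtain T2 where T2: "T2 \<in> lmeasurable" "g ` f ` ?S \<subseteq> T2" "measure lebesgue T2 \<le> (1 / b) * measure lebesgue T1 + e / 2"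
      by (rule outer_measure_image_le[OF gmono glip _ T1(2,1), of "1 / b" "e / 2"])
        (use st ab e in auto)
    have "?S \<subseteq> T2"
      using T2(2) by (simp add: image_image gf)
    moreover have "measure lebesgue T2 \<le> a / b * measure lebesgue T + e"
    proof -
      have "(1 / b) * measure lebesgue T1 \<le> (1 / b) * (a * measure lebesgue T + b * e / 2)"
        using T1(3) ab by (intro mult_left_mono) auto
      also have "\<dots> = a / b * measure lebesgue T + e / 2"
        using ab by (simp add: field_simps)
      finally show ?thesis
        using T2(3) by simp
    qed
    ultimately show "\<exists>T'. ?S \<subseteq> T' \<and> T' \<in> lmeasurable \<and> measure lebesgue T' \<le> a / b * measure lebesgue T + e"
      using T2(1) by blast
  qed (use ab in auto)
qed

lemma lipschitz_on_real_bound: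
  fixes f :: "'a::real_normed_vector \<Rightarrow> real"
  assumes "L-lipschitz_on X f" "x \<in> X" "y \<in> X"
  shows "\<bar>f x - f y\<bar> \<le> L * norm (x - y)"
  using lipschitz_onD[OF assms] by (simp add: dist_norm)

text \<open>Adding \<open>(L + 1) * x\<close> brings all chord slopes into \<open>[1, M]\<close>, as
  \<open>lipschitz_oscillation_negligible\<close> requires. If the slopes of short intervals around
  \<open>x\<close> do not converge, rationals \<open>a < b\<close> separate their lower and upper
  limits, and \<open>x\<close> lies in one of countably many null sets. Intervals that contain
  \<open>x\<close> inside or at an endpoint treat both one-sided quotients at once.\<close>

theorem lebesgue_differentiation_lipschitz:
  fixes f :: "real \<Rightarrow> real"
  assumes f: "L-lipschitz_on UNIV f"
  shows "negligible {x. \<not> f differentiable (at x)}"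
proof -
  have L0: "0 \<le> L"
    using f lipschitz_on_nonneg by blast
  define g where "g x = f x + (L + 1) * x" for x
  define M where "M = 2 * L + 1"
  have gg: "y - x \<le> g y - g x" "g y - g x \<le> M * (y - x)" if "x \<le> y" for x y
    using lipschitz_on_real_bound[OF f, of y x] that by (auto simp: g_def M_def algebra_simps)
  define A where "A a b = {x. (\<forall>d>0. \<exists>p q. p < q \<and> p \<le> x \<and> x \<le> q \<and> q - p < d \<and> g q - g p \<le> a * (q - p)) \<and>
      (\<forall>d>0. \<exists>p q. p < q \<and> p \<le> x \<and> x \<le> q \<and> q - p < d \<and> b * (q - p) \<le> g q - g p)}" for a b
  have Aneg: "negligible (A a b)" if "0 < a" "a < b" for a b
    by (rule lipschitz_oscillation_negligible[where f = g and M = M, OF gg that]) (auto simp: A_def)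
  define I where "I = {(a, b). a \<in> \<rat> \<and> b \<in> \<rat> \<and> 0 < a \<and> a < (b::real)}"
  have "countable I"
    by (rule countable_subset[of _ "\<rat> \<times> \<rat>"]) (auto simp: I_def countable_rat)
  then have neg: "negligible (\<Union>(a, b)\<in>I. A a b)"
    by (intro negligible_countable_Union) (auto simp: I_def intro: Aneg)
  have "f differentiable (at x)" if x: "x \<notin> (\<Union>(a, b)\<in>I. A a b)" for x
  proof -
    \<comment> \<open>The slopes that bound all short quotients from below; \<open>Sup Q\<close> is
      the lower derivative at \<open>x\<close> and turns out to be the derivative.\<close>
    define Q where "Q = {a. \<exists>d>0. \<forall>p q. p < q \<longrightarrow> p \<le> x \<longrightarrow> x \<le> q \<longrightarrow> q - p < d \<longrightarrow> a * (q - p) \<le> g q - g p}"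
    have Q1: "1 \<in> Q"
      using gg(1) by (auto simp: Q_def intro!: exI[of _ 1])
    have QM: "a \<le> M" if a: "a \<in> Q" for a
    proof -
      obtain d where d: "0 < d" "\<And>p q. p < q \<Longrightarrow> p \<le> x \<Longrightarrow> x \<le> q \<Longrightarrow> q - p < d \<Longrightarrow> a * (q - p) \<le> g q - g p"
        using a by (auto simp: Q_def)
      have "a * (d / 2) \<le> g (x + d / 2) - g x"
        using d(2)[of x "x + d / 2"] d(1) by simp
      also have "\<dots> \<le> M * (d / 2)"
        using gg(2)[of x "x + d / 2"] d(1) by simp
      finally show ?thesis
        using d(1) by simp
    qed
    have bdd: "bdd_above Q"
      by (rule bdd_aboveI[of _ M]) (rule QM)
    define c where "c = Sup Q"
    have c1: "1 \<le> c"
      using cSup_upper[OF Q1 bdd] by (simp add: c_def)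
    have lim: "\<exists>d>0. \<forall>y. norm (y - x) < d \<longrightarrow> norm (g y - g x - (y - x) * c) \<le> e * norm (y - x)" if e: "0 < e" for e
    proof -
      obtain a' where a': "a' \<in> Q" "c - e < a'"
        using less_cSup_iff[of Q "c - e"] Q1 bdd e unfolding c_def by auto
      obtain d1 where d1: "0 < d1" "\<And>p q. p < q \<Longrightarrow> p \<le> x \<Longrightarrow> x \<le> q \<Longrightarrow> q - p < d1 \<Longrightarrow> a' * (q - p) \<le> g q - g p"
        using a' by (auto simp: Q_def)
      \<comment> \<open>Since \<open>a > c\<close> is not in \<open>Q\<close>, quotients at most
        \<open>a\<close> occur at every scale. Avoiding \<open>A a b\<close> then forces all
        quotients at small scales below \<open>b\<close>, hence below \<open>c + e\<close>.\<close>
      obtain a where a: "a \<in> \<rat>" "c < a" "a < c + e"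
        using Rats_dense_in_real[of c "c + e"] e by auto
      obtain b where b: "b \<in> \<rat>" "a < b" "b < c + e"
        using Rats_dense_in_real[of a "c + e"] a by auto
      have "a \<notin> Q"
        using cSup_upper[OF _ bdd, of a] a(2) by (force simp: c_def)
      then have 1: "\<forall>d>0. \<exists>p q. p < q \<and> p \<le> x \<and> x \<le> q \<and> q - p < d \<and> g q - g p \<le> a * (q - p)"
        unfolding Q_def by (smt (verit) mem_Collect_eq)
      have "(a, b) \<in> I"
        using a b c1 by (auto simp: I_def)
      then have "x \<notin> A a b"
        using x by auto
      then obtain d2 where d2: "0 < d2" "\<And>p q. p < q \<Longrightarrow> p \<le> x \<Longrightarrow> x \<le> q \<Longrightarrow> q - p < d2 \<Longrightarrow> g q - g p < b * (q - p)"
        using 1 unfolding A_def by (smt (verit) mem_Collect_eq)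
      have "\<bar>g q - g p - c * (q - p)\<bar> \<le> e * (q - p)"
        if pq: "p < q" "p \<le> x" "x \<le> q" "q - p < min d1 d2" for p q
      proof -
        have "a' * (q - p) \<le> g q - g p" "g q - g p < b * (q - p)"
          using d1(2) d2(2) pq by auto
        moreover have "(c - e) * (q - p) \<le> a' * (q - p)" "b * (q - p) \<le> (c + e) * (q - p)"
          using a' b pq by (intro mult_right_mono; simp)+
        ultimately show ?thesis
          by (simp add: abs_le_iff algebra_simps)
      qed
      note est = this
      have "norm (g y - g x - (y - x) * c) \<le> e * norm (y - x)" if "norm (y - x) < min d1 d2" for y
      proof (cases "y = x")
        case False
        then show ?thesis
          using est[of x y] est[of y x] that by (cases "x < y") (auto simp: algebra_simps)
      qed simp
      then show ?thesis
        using d1(1) d2(1) by (intro exI[of _ "min d1 d2"]) auto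
    qed
    have "(g has_derivative (\<lambda>h. h * c)) (at x)"
      unfolding has_derivative_at_alt using lim bounded_linear_mult_left by blast
    then have "((\<lambda>y. g y - (L + 1) * y) has_derivative (\<lambda>h. h * c - (L + 1) * h)) (at x)"
      by (intro derivative_intros)
    then show ?thesis
      by (auto simp: g_def differentiable_def)
  qed
  then show ?thesis
    by (intro negligible_subset[OF neg]) auto
qed

text \<open>A mean value inequality for a derivative that exists only almost everywhere. Once
  \<open>L * x\<close> is added, the function is monotone; it maps the points of differentiability
  to a set of measure at most \<open>(C + L) * (q - p)\<close>, up to an arbitrary error, and the
  remaining points to a null set. By the intermediate value theorem these images fill the interval
  between the end values.\<close>

lemma real_derivative_bound_imp_increment_le:
  fixes f :: "real \<Rightarrow> real"
  assumes f: "L-lipschitz_on UNIV f" and pq: "p \<le> q" and C: "0 \<le> C"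
    and D: "\<And>t D. p < t \<Longrightarrow> t < q \<Longrightarrow> (f has_real_derivative D) (at t) \<Longrightarrow> D \<le> C"
  shows "f q - f p \<le> C * (q - p)"
proof -
  have L0: "0 \<le> L"
    using f lipschitz_on_nonneg by blast
  define h where "h x = f x + L * x" for x
  have hmono: "mono h"
  proof (rule monoI)
    fix x y :: real assume "x \<le> y"
    then show "h x \<le> h y"
      using lipschitz_on_real_bound[OF f, of x y] by (simp add: h_def algebra_simps)
  qed
  have hlip: "(2 * L)-lipschitz_on UNIV h"
  proof (rule lipschitz_onI)
    fix x y :: real
    have "\<bar>L * x - L * y\<bar> = L * \<bar>x - y\<bar>"
      using L0 by (metis abs_mult abs_of_nonneg right_diff_distrib)
    then show "dist (h x) (h y) \<le> 2 * L * dist x y"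
      using lipschitz_on_real_bound[OF f UNIV_I UNIV_I, of x y] abs_triangle_ineq[of "f x - f y" "L * x - L * y"]
      unfolding h_def dist_real_def real_norm_def by (simp add: algebra_simps)
  qed (use L0 in auto)
  have hcont: "continuous_on UNIV h"
    using hlip lipschitz_on_continuous_on by blast
  define N where "N = {x. \<not> f differentiable (at x)}"
  have N: "negligible N"
    using lebesgue_differentiation_lipschitz[OF f] by (simp add: N_def)
  have negN: "negligible (h ` N)"
  proof (rule negligible_locally_Lipschitz_image[OF _ N])
    fix x assume "x \<in> N"
    show "\<exists>T B. open T \<and> x \<in> T \<and> (\<forall>y\<in>N \<inter> T. norm (h y - h x) \<le> B * norm (y - x))"
      using lipschitz_on_real_bound[OF hlip] by (intro exI[of _ UNIV] exI[of _ "2 * L"]) auto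
  qed auto
  define S where "S = {p<..<q} - N"
  have "h q - h p \<le> (C + L) * (q - p) + e" if e: "0 < e" for e
  proof -
    \<comment> \<open>The \<open>+ 1\<close> keeps the denominator positive when
      \<open>p = q\<close>.\<close>
    define e1 where "e1 = e / 2 / (q - p + 1)"
    have e1: "0 < e1" "e1 * (q - p) \<le> e / 2"
      using e pq by (auto simp: e1_def field_simps)
    have st: "\<exists>p q. p < q \<and> p \<le> x \<and> x \<le> q \<and> q - p < d \<and> h q - h p \<le> (C + L + e1) * (q - p)"
      if x: "x \<in> S" and d: "0 < d" for x d
    proof -
      obtain D' where D': "(f has_real_derivative D') (at x)"
        using x by (auto simp: S_def N_def real_differentiable_def)
      have "D' \<le> C"
        using D[OF _ _ D'] x by (auto simp: S_def)
      obtain r where r: "0 < r" "\<And>y. norm (y - x) < r \<Longrightarrow> norm (f y - f x - D' * (y - x)) \<le> e1 * norm (y - x)"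
        using D' e1 unfolding has_field_derivative_def has_derivative_at_alt by blast
      define y where "y = x + min r d / 2"
      have y: "x < y" "y - x < d" "norm (y - x) < r"
        using r(1) d by (auto simp: y_def)
      have "f y - f x \<le> (D' + e1) * (y - x)"
        using r(2)[OF y(3)] y(1) by (simp add: algebra_simps)
      also have "\<dots> \<le> (C + e1) * (y - x)"
        using \<open>D' \<le> C\<close> y by (intro mult_right_mono) auto
      finally have "h y - h x \<le> (C + L + e1) * (y - x)"
        by (simp add: h_def algebra_simps)
      then show ?thesis
        using y by (intro exI[of _ x] exI[of _ y]) auto
    qed
    have Spq: "S \<subseteq> {p<..<q}"
      by (auto simp: S_def)
    have pos: "0 \<le> C + L + e1" "0 < e / 2"
      using C L0 e1 e by auto
    obtain T' where T': "T' \<in> lmeasurable" "h ` S \<subseteq> T'"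
      "measure lebesgue T' \<le> (C + L + e1) * measure lebesgue {p<..<q} + e / 2"
      by (rule outer_measure_image_le[OF hmono hlip pos(1) Spq lmeasurable_interval(2) pos(2) st])
    define N1 where "N1 = h ` N \<union> {h p, h q}"
    have N1: "negligible N1"
      using negN by (simp add: N1_def)
    have "{h p..h q} \<subseteq> T' \<union> N1"
    proof
      fix z assume z: "z \<in> {h p..h q}"
      then obtain x where x: "p \<le> x" "x \<le> q" "h x = z"
        using IVT'[of h p z q] pq continuous_on_subset[OF hcont] by auto
      then show "z \<in> T' \<union> N1"
        using T'(2) by (cases "x = p \<or> x = q \<or> x \<in> N") (auto simp: S_def N1_def)
    qed
    then have "measure lebesgue {h p..h q} \<le> measure lebesgue (T' \<union> N1)"
      using fmeasurable.Un[OF T'(1) negligible_imp_measurable[OF N1]] by (intro measure_mono_fmeasurable) auto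
    also have "\<dots> \<le> measure lebesgue T' + measure lebesgue N1"
      using T' N1 by (intro measure_Un_le) (auto intro: negligible_imp_sets)
    also have "measure lebesgue N1 = 0"
      using N1 by (rule negligible_imp_measure0)
    finally have "measure lebesgue {h p..h q} \<le> (C + L + e1) * (q - p) + e / 2"
      using T'(3) pq by simp
    moreover have "measure lebesgue {h p..h q} = h q - h p"
      using monoD[OF hmono pq] by simp
    ultimately show ?thesis
      using e1(2) by (simp add: algebra_simps)
  qed
  then have "h q - h p \<le> (C + L) * (q - p)"
    by (meson field_le_epsilon)
  then show ?thesis
    by (simp add: h_def algebra_simps)
qed

section \<open>Rademacher's theorem in several variables\<close>

lemma negligible_if_lines_negligible:
  fixes B :: "'a::euclidean_space set"
  assumes B: "B \<in> sets borel" and lines: "\<And>z. negligible {t::real. z + t *\<^sub>R v \<in> B}"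
  shows "negligible B"
proof -
  have [measurable]: "B \<in> sets borel" by (fact B)
  \<comment> \<open>Averaging over translations along \<open>v\<close> by \<open>t\<close> in
    \<open>[0, 1]\<close> replaces a choice of coordinates: Fubini in \<open>(z, t)\<close> gives 0
    when \<open>t\<close> is integrated first and, by translation invariance, the measure of
    \<open>B\<close> when \<open>z\<close> is.\<close>
  let ?F = "\<lambda>z t. indicator {0..1::real} t * indicator B (z + t *\<^sub>R v) :: ennreal"
  have meas: "case_prod ?F \<in> borel_measurable (lborel \<Otimes>\<^sub>M lborel)"
    by measurable
  have "(\<integral>\<^sup>+t. (\<integral>\<^sup>+z. ?F z t \<partial>lborel) \<partial>lborel) = (\<integral>\<^sup>+z. (\<integral>\<^sup>+t. ?F z t \<partial>lborel) \<partial>lborel)"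
    using lborel_pair.Fubini'[OF meas] by simp
  also have "\<dots> = (\<integral>\<^sup>+z. 0 \<partial>(lborel::'a measure))"
  proof (rule nn_integral_cong)
    fix z :: 'a
    have "AE t in lborel. t \<notin> {t. z + t *\<^sub>R v \<in> B}"
    proof -
      have "{t. z + t *\<^sub>R v \<in> B} \<in> sets borel"
        by measurable
      then have "{t. z + t *\<^sub>R v \<in> B} \<in> null_sets lborel"
        using lines[of z] by (simp add: negligible_iff_null_sets null_sets_completion_iff)
      then show ?thesis
        by (rule AE_not_in)
    qed
    then have "AE t in lborel. ?F z t = 0"
      by eventually_elim (auto simp: indicator_def)
    then show "(\<integral>\<^sup>+t. ?F z t \<partial>lborel) = 0"
      by (subst nn_integral_0_iff_AE) measurable
  qed
  also have "(\<integral>\<^sup>+t. (\<integral>\<^sup>+z. ?F z t \<partial>lborel) \<partial>lborel) = (\<integral>\<^sup>+t. indicator {0..1::real} t * emeasure lborel B \<partial>lborel)"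
  proof (rule nn_integral_cong)
    fix t :: real
    have "(\<integral>\<^sup>+z. indicator B (z + t *\<^sub>R v) \<partial>lborel) = (\<integral>\<^sup>+z. indicator B z \<partial>(distr lborel borel ((+) (t *\<^sub>R v))))"
      by (subst nn_integral_distr) (auto simp: add.commute)
    also have "\<dots> = emeasure lborel B"
      by (simp add: lborel_distr_plus)
    finally show "(\<integral>\<^sup>+z. ?F z t \<partial>lborel) = indicator {0..1::real} t * emeasure lborel B"
      by (simp add: nn_integral_cmult)
  qed
  also have "\<dots> = emeasure lborel B"
    by (simp add: nn_integral_multc)
  finally have "emeasure lborel B = 0" by simp
  then show ?thesis
    using B by (simp add: negligible_iff_null_sets null_sets_completionI null_setsI)
qed

lemma countable_denseE:
  obtains D :: "'a::second_countable_topology set"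
  where "countable D" "\<forall>X. open X \<longrightarrow> X \<noteq> {} \<longrightarrow> (\<exists>d\<in>D. d \<in> X)"
  using countable_dense_exists[where 'a = 'a] by blast

definition affine_approx :: "('a::euclidean_space \<Rightarrow> real) \<Rightarrow> 'a set \<Rightarrow> 'a \<Rightarrow> real \<Rightarrow> real \<Rightarrow> 'a set"
  where "affine_approx f S p e d =
    {x. \<forall>h\<in>span S. norm h < d \<longrightarrow> \<bar>f (x + h) - f x - p \<bullet> h\<bar> \<le> e * norm h}"

text \<open>The slope \<open>p\<close> may depend on \<open>e\<close>. In this form \<open>p\<close>
  can be restricted to a countable dense set and \<open>d\<close> to reciprocals of integers, which
  gives access to Borel sets and Fubini; the slopes are shown to converge only at the end, for
  \<open>S = Basis\<close>.\<close>

definition diff_along :: "('a::euclidean_space \<Rightarrow> real) \<Rightarrow> 'a set \<Rightarrow> 'a set"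
  where "diff_along f S = {x. \<forall>e>0. \<exists>p. \<exists>d>0. x \<in> affine_approx f S p e d}"

lemma closed_affine_approx:
  assumes "continuous_on UNIV f"
  shows "closed (affine_approx f S p e d)"
proof -
  have c: "continuous_on UNIV (\<lambda>x. f (x + h))" for h
    by (rule continuous_on_compose2[OF assms]) (auto intro!: continuous_intros)
  have "closed {x. \<bar>f (x + h) - f x - p \<bullet> h\<bar> \<le> e * norm h}" for h
    using c assms by (intro closed_Collect_le continuous_intros)
  then have "closed (\<Inter>h\<in>{h. h \<in> span S \<and> norm h < d}. {x. \<bar>f (x + h) - f x - p \<bullet> h\<bar> \<le> e * norm h})"
    by (intro closed_INT) auto
  moreover have "(\<Inter>h\<in>{h. h \<in> span S \<and> norm h < d}. {x. \<bar>f (x + h) - f x - p \<bullet> h\<bar> \<le> e * norm h}) = affine_approx f S p e d"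
    unfolding affine_approx_def by blast
  ultimately show ?thesis by simp
qed

lemma affine_approx_perturb:
  assumes x: "x \<in> affine_approx f S p e d" and q: "norm (q - p) \<le> e'" and d': "d' \<le> d"
  shows "x \<in> affine_approx f S q (e + e') d'"
proof -
  have "\<bar>f (x + h) - f x - q \<bullet> h\<bar> \<le> (e + e') * norm h" if h: "h \<in> span S" "norm h < d'" for h
  proof -
    have "\<bar>f (x + h) - f x - p \<bullet> h\<bar> \<le> e * norm h"
      using x h d' by (auto simp: affine_approx_def)
    moreover have "\<bar>(q - p) \<bullet> h\<bar> \<le> e' * norm h"
      using Cauchy_Schwarz_ineq2[of "q - p" h] mult_right_mono[OF q norm_ge_zero[of h]] by linarith
    ultimately show ?thesis
      by (simp add: inner_diff_left algebra_simps)
  qed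
  then show ?thesis by (simp add: affine_approx_def)
qed

lemma diff_along_countable:
  fixes f :: "'a::euclidean_space \<Rightarrow> real"
  assumes D: "\<And>X::'a set. open X \<Longrightarrow> X \<noteq> {} \<Longrightarrow> \<exists>d\<in>D. d \<in> X"
    and x: "x \<in> diff_along f S" and e: "0 < e"
  shows "\<exists>p\<in>D. \<exists>m::nat. x \<in> affine_approx f S p e (1 / real (Suc m))"
proof -
  obtain p d where pd: "0 < d" "x \<in> affine_approx f S p (e / 2) d"
  proof -
    have "\<forall>e>0. \<exists>p d. 0 < d \<and> x \<in> affine_approx f S p e d"
      using x by (auto simp: diff_along_def)
    then show ?thesis
      using that half_gt_zero[OF e] by blast
  qed
  obtain q where q: "q \<in> D" "q \<in> ball p (e / 2)"
    using D[of "ball p (e / 2)"] e by auto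
  obtain m where m: "1 / real (Suc m) < d"
    using nat_approx_posE[OF pd(1)] by blast
  have "x \<in> affine_approx f S q (e / 2 + e / 2) (1 / real (Suc m))"
    using q m by (intro affine_approx_perturb[OF pd(2)]) (auto simp: dist_norm norm_minus_commute)
  then show ?thesis
    using q by auto
qed

lemma diff_alongI:
  assumes "\<And>i::nat. \<exists>p. \<exists>d>0. x \<in> affine_approx f S p (1 / real (Suc i)) d"
  shows "x \<in> diff_along f S"
  unfolding diff_along_def
proof (intro CollectI allI impI)
  fix e :: real assume "0 < e"
  then obtain i where i: "1 / real (Suc i) < e"
    using nat_approx_posE by blast
  obtain p d where pd: "0 < d" "x \<in> affine_approx f S p (1 / real (Suc i)) d"
    using assms by blast
  have "x \<in> affine_approx f S p e d"
    unfolding affine_approx_def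
  proof (intro CollectI ballI impI)
    fix h assume h: "h \<in> span S" "norm h < d"
    have "1 / real (Suc i) * norm h \<le> e * norm h"
      using i by (intro mult_right_mono) auto
    then show "\<bar>f (x + h) - f x - p \<bullet> h\<bar> \<le> e * norm h"
      using pd h unfolding affine_approx_def by fastforce
  qed
  then show "\<exists>p. \<exists>d>0. x \<in> affine_approx f S p e d"
    using pd by blast
qed

lemma negligible_not_diff_along_direction:
  fixes f :: "'a::euclidean_space \<Rightarrow> real"
  assumes f: "L-lipschitz_on UNIV f" and b: "b \<in> Basis"
  shows "negligible (- diff_along f {b})"
proof -
  have cont: "continuous_on UNIV f"
    using f lipschitz_on_continuous_on by blast
  obtain D :: "'a set" where "countable D" "\<forall>X. open X \<longrightarrow> X \<noteq> {} \<longrightarrow> (\<exists>d\<in>D. d \<in> X)"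
    by (rule countable_denseE)
  note D = this(1) this(2)[rule_format]
  \<comment> \<open>A Borel set inside \<open>diff_along f {b}\<close>: the quantifiers run over
    countable sets and each \<open>affine_approx\<close> is closed. Its complement is null on every
    line in direction \<open>b\<close> by the one-dimensional theorem.\<close>
  define G where "G = (\<Inter>i::nat. \<Union>p\<in>D. \<Union>m::nat. affine_approx f {b} p (1 / real (Suc i)) (1 / real (Suc m)))"
  have borel: "- G \<in> sets borel"
    unfolding G_def using D(1)
    by (intro borel_comp sets.countable_INT'' sets.countable_UN'' borel_closed closed_affine_approx cont) auto
  have "negligible {t::real. z + t *\<^sub>R b \<in> - G}" for z
  proof -
    let ?g = "\<lambda>t. f (z + t *\<^sub>R b)"
    have "L-lipschitz_on UNIV ?g"
    proof (rule lipschitz_onI)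
      fix s t :: real
      show "dist (?g s) (?g t) \<le> L * dist s t"
        using lipschitz_onD[OF f UNIV_I UNIV_I, of "z + s *\<^sub>R b" "z + t *\<^sub>R b"] b
        by (simp add: dist_norm scaleR_diff_left[symmetric])
    qed (use f lipschitz_on_nonneg in blast)
    then have neg: "negligible {t. \<not> ?g differentiable (at t)}"
      by (rule lebesgue_differentiation_lipschitz)
    have "z + t *\<^sub>R b \<in> G" if t: "?g differentiable (at t)" for t
    proof -
      obtain c where c: "(?g has_real_derivative c) (at t)"
        using t by (auto simp: real_differentiable_def)
      have "z + t *\<^sub>R b \<in> diff_along f {b}"
        unfolding diff_along_def
      proof (intro CollectI allI impI)
        fix e :: real assume "0 < e"
        then obtain d where d: "0 < d" "\<And>y. norm (y - t) < d \<Longrightarrow> norm (?g y - ?g t - c * (y - t)) \<le> e * norm (y - t)"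
          using c unfolding has_field_derivative_def has_derivative_at_alt by blast
        have "z + t *\<^sub>R b \<in> affine_approx f {b} (c *\<^sub>R b) e d"
          unfolding affine_approx_def
        proof (intro CollectI ballI impI)
          fix h assume h: "h \<in> span {b}" "norm h < d"
          then obtain s where s: "h = s *\<^sub>R b"
            by (auto simp: span_singleton)
          then have "norm (?g (t + s) - ?g t - c * ((t + s) - t)) \<le> e * norm ((t + s) - t)"
            using h b by (intro d) auto
          then show "\<bar>f (z + t *\<^sub>R b + h) - f (z + t *\<^sub>R b) - (c *\<^sub>R b) \<bullet> h\<bar> \<le> e * norm h"
            using b s by (simp add: scaleR_add_left add.assoc mult.commute[of c])
        qed
        then show "\<exists>p. \<exists>d>0. z + t *\<^sub>R b \<in> affine_approx f {b} p e d"
          using d by blast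
      qed
      then show ?thesis
        unfolding G_def using diff_along_countable[OF D(2)] by (intro INT_I) (simp add: Bex_def)
    qed
    then show ?thesis
      by (intro negligible_subset[OF neg]) auto
  qed
  then have "negligible (- G)"
    by (rule negligible_if_lines_negligible[OF borel])
  moreover have "G \<subseteq> diff_along f {b}"
  proof
    fix x assume x: "x \<in> G"
    show "x \<in> diff_along f {b}"
    proof (rule diff_alongI)
      fix i :: nat
      obtain p m where "x \<in> affine_approx f {b} p (1 / real (Suc i)) (1 / real (Suc m))"
        using x unfolding G_def by blast
      then show "\<exists>p. \<exists>d>0. x \<in> affine_approx f {b} p (1 / real (Suc i)) d"
        by (intro exI[of _ p] exI[of _ "1 / real (Suc m)"]) auto
    qed
  qed
  ultimately show ?thesis
    by (auto intro: negligible_subset)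
qed

lemma infdist_lipschitz: "1-lipschitz_on UNIV (\<lambda>x. infdist x A)"
  by (rule lipschitz_onI) (auto simp: dist_real_def infdist_triangle_abs)

text \<open>
  If \<open>f\<close> is uniformly close to an affine function along \<open>span S\<close> on a closed set \<open>E\<close>, then at almost every
  \<open>x \<in> E\<close> the distance to \<open>E\<close> has derivative 0 in direction \<open>b\<close>, so that \<open>x + t b\<close> can be replaced by a
  point of \<open>E\<close> up to an error \<open>o(t)\<close>. This gives differentiability along \<open>span (insert b S)\<close>.
\<close>

lemma negligible_not_diff_along:
  fixes f :: "'a::euclidean_space \<Rightarrow> real"
  assumes f: "L-lipschitz_on UNIV f" and S: "finite S" "S \<subseteq> Basis"
  shows "negligible (- diff_along f S)"
  using S
proof (induction S)
  case empty
  have "diff_along f {} = UNIV"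
    by (auto simp: diff_along_def affine_approx_def intro: exI[of _ 1])
  then show ?case by simp
next
  case (insert b S)
  then have b: "b \<in> Basis" "b \<notin> S" "S \<subseteq> Basis"
    by auto
  have L0: "0 \<le> L"
    using f lipschitz_on_nonneg by blast
  have cont: "continuous_on UNIV f"
    using f lipschitz_on_continuous_on by blast
  obtain D :: "'a set" where "countable D" "\<forall>X. open X \<longrightarrow> X \<noteq> {} \<longrightarrow> (\<exists>d\<in>D. d \<in> X)"
    by (rule countable_denseE)
  note D = this(1) this(2)[rule_format]
  define E where "E i p m = affine_approx f S p (1 / real (Suc i)) (1 / real (Suc m))" for i m :: nat and p
  \<comment> \<open>The closed sets \<open>E i p m\<close> form a countable family, so one null set
    serves all of them.\<close>
  define N where "N = - diff_along f S \<union> - diff_along f {b} \<union>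
    (\<Union>i. \<Union>p\<in>D. \<Union>m. - diff_along (\<lambda>x. infdist x (E i p m)) {b})"
  have "negligible (\<Union>i. \<Union>p\<in>D. \<Union>m. - diff_along (\<lambda>x. infdist x (E i p m)) {b})"
    using D(1) by (intro negligible_countable_Union countable_image)
      (auto intro!: negligible_countable_Union negligible_not_diff_along_direction[OF infdist_lipschitz b(1)])
  then have N: "negligible N"
    unfolding N_def using insert.IH b(3) negligible_not_diff_along_direction[OF f b(1)]
    by (intro negligible_Un) auto
  have "x \<in> diff_along f (insert b S)" if x: "x \<notin> N" for x
    unfolding diff_along_def
  proof (intro CollectI allI impI)
    fix e :: real assume e: "0 < e"
    \<comment> \<open>The constant anticipates the final sum: two Lipschitz errors
      \<open>L * (2 * \<epsilon>)\<close> from moving into \<open>E\<close>, and two affine errors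
      \<open>\<epsilon>\<close>.\<close>
    obtain i where i: "1 / real (Suc i) < e / (4 * L + 2)"
      using nat_approx_posE[of "e / (4 * L + 2)"] e L0 by (auto simp: field_simps)
    define \<epsilon> where "\<epsilon> = 1 / real (Suc i)"
    have \<epsilon>: "0 < \<epsilon>" "(4 * L + 2) * \<epsilon> \<le> e"
      using i L0 by (auto simp: \<epsilon>_def field_simps)
    obtain p m where p: "p \<in> D" and xE: "x \<in> E i p m"
      using diff_along_countable[OF D(2), of x f S \<epsilon>] x \<epsilon> by (auto simp: N_def E_def \<epsilon>_def)
    let ?E = "E i p m"
    have Eprop: "\<bar>f (z + h) - f z - p \<bullet> h\<bar> \<le> \<epsilon> * norm h"
      if "z \<in> ?E" "h \<in> span S" "norm h < 1 / real (Suc m)" for z h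
      using that by (auto simp: E_def affine_approx_def \<epsilon>_def)
    have Ecl: "closed ?E"
      using closed_affine_approx[OF cont] by (simp add: E_def)
    have "x \<in> diff_along (\<lambda>x. infdist x ?E) {b}"
      using x p by (auto simp: N_def)
    then obtain p1 d1 where d1: "0 < d1" "x \<in> affine_approx (\<lambda>x. infdist x ?E) {b} p1 \<epsilon> d1"
      using \<epsilon>(1) by (auto simp: diff_along_def)
    have dist1: "\<bar>infdist (x + t *\<^sub>R b) ?E - t * (p1 \<bullet> b)\<bar> \<le> \<epsilon> * \<bar>t\<bar>" if t: "\<bar>t\<bar> < d1" for t
    proof -
      have "t *\<^sub>R b \<in> span {b}"
        by (simp add: span_base span_scale)
      then show ?thesis
        using d1(2) t b(1) xE by (auto simp: affine_approx_def)
    qed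
    \<comment> \<open>The distance is nonnegative and vanishes at \<open>x\<close>, so its
      approximations at \<open>t\<close> and at \<open>- t\<close> together bound the linear part by
      \<open>\<epsilon> * \<bar>t\<bar>\<close>.\<close>
    have dist2: "infdist (x + t *\<^sub>R b) ?E \<le> 2 * \<epsilon> * \<bar>t\<bar>" if t: "\<bar>t\<bar> < d1" for t
      using dist1[OF t] dist1[of "- t"] t infdist_nonneg[of "x + t *\<^sub>R b" ?E] infdist_nonneg[of "x + (- t) *\<^sub>R b" ?E]
      by simp
    have "x \<in> diff_along f {b}"
      using x by (auto simp: N_def)
    then obtain p2 d2 where d2: "0 < d2" "x \<in> affine_approx f {b} p2 \<epsilon> d2"
      using \<epsilon>(1) by (auto simp: diff_along_def)
    have f2: "\<bar>f (x + t *\<^sub>R b) - f x - t * (p2 \<bullet> b)\<bar> \<le> \<epsilon> * \<bar>t\<bar>" if t: "\<bar>t\<bar> < d2" for t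
    proof -
      have "t *\<^sub>R b \<in> span {b}"
        by (simp add: span_base span_scale)
      then show ?thesis
        using d2(2) t b(1) by (auto simp: affine_approx_def)
    qed
    \<comment> \<open>The slope \<open>p\<close> with its \<open>b\<close> component replaced by
      that of \<open>p2\<close>. Since \<open>b\<close> is orthogonal to \<open>span S\<close>,
      \<open>q\<close> acts like \<open>p\<close> on \<open>span S\<close> and like
      \<open>p2\<close> along \<open>b\<close>.\<close>
    define q where "q = p + ((p2 - p) \<bullet> b) *\<^sub>R b"
    define d where "d = min (min d1 d2) (1 / real (Suc m))"
    have "x \<in> affine_approx f (insert b S) q e d"
      unfolding affine_approx_def
    proof (intro CollectI ballI impI)
      fix w assume w: "w \<in> span (insert b S)" "norm w < d"
      obtain t where t: "w - t *\<^sub>R b \<in> span S"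
        using w(1) span_breakdown_eq by metis
      define h where "h = w - t *\<^sub>R b"
      have h: "h \<in> span S" "w = t *\<^sub>R b + h"
        using t by (auto simp: h_def)
      have hb: "b \<bullet> h = 0"
      proof -
        have "orthogonal b h"
          using b inner_not_same_Basis[OF b(1)]
          by (intro orthogonal_to_span[OF h(1)]) (auto simp: orthogonal_def subset_iff)
        then show ?thesis by (simp add: orthogonal_def)
      qed
      have tn: "\<bar>t\<bar> \<le> norm w"
      proof -
        have "t = w \<bullet> b"
          using h(2) hb b(1) by (simp add: inner_add_left inner_commute[of h b])
        then show ?thesis
          using b(1) by (metis Basis_le_norm)
      qed
      have hn: "norm h \<le> norm w"
      proof -
        have "(norm w)\<^sup>2 = (norm (t *\<^sub>R b))\<^sup>2 + (norm h)\<^sup>2"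
          unfolding h(2) by (rule norm_add_Pythagorean) (simp add: orthogonal_def hb)
        then have "(norm h)\<^sup>2 \<le> (norm w)\<^sup>2"
          using zero_le_power2[of "norm (t *\<^sub>R b)"] by linarith
        then show ?thesis
          by (rule power2_le_imp_le) simp
      qed
      \<comment> \<open>The uniform estimate along \<open>span S\<close> holds at points of
        \<open>E\<close>, so \<open>x + t *\<^sub>R b\<close> is exchanged for its nearest point
        \<open>z\<close> there.\<close>
      obtain z where z: "z \<in> ?E" "infdist (x + t *\<^sub>R b) ?E = dist (x + t *\<^sub>R b) z"
        using infdist_attains_inf[OF Ecl] xE by blast
      have zn: "norm (x + t *\<^sub>R b - z) \<le> 2 * \<epsilon> * \<bar>t\<bar>"
        using dist2[of t] z(2) tn w(2) by (simp add: d_def dist_norm)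
      have "\<bar>f (x + w) - f (z + h)\<bar> \<le> L * norm (x + t *\<^sub>R b - z)"
        using lipschitz_on_real_bound[OF f UNIV_I UNIV_I, of "x + w" "z + h"] by (simp add: h(2) algebra_simps)
      also have "\<dots> \<le> L * (2 * \<epsilon> * \<bar>t\<bar>)"
        using zn L0 by (intro mult_left_mono)
      finally have 1: "\<bar>f (x + w) - f (z + h)\<bar> \<le> L * (2 * \<epsilon> * \<bar>t\<bar>)" .
      have "\<bar>f (x + t *\<^sub>R b) - f z\<bar> \<le> L * norm (x + t *\<^sub>R b - z)"
        using lipschitz_on_real_bound[OF f UNIV_I UNIV_I] by simp
      also have "\<dots> \<le> L * (2 * \<epsilon> * \<bar>t\<bar>)"
        using zn L0 by (intro mult_left_mono)
      finally have 2: "\<bar>f (x + t *\<^sub>R b) - f z\<bar> \<le> L * (2 * \<epsilon> * \<bar>t\<bar>)" .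
      have 3: "\<bar>f (z + h) - f z - p \<bullet> h\<bar> \<le> \<epsilon> * norm h"
        using Eprop[OF z(1) h(1)] hn w(2) by (simp add: d_def)
      have 4: "\<bar>f (x + t *\<^sub>R b) - f x - t * (p2 \<bullet> b)\<bar> \<le> \<epsilon> * \<bar>t\<bar>"
        using f2 tn w(2) by (simp add: d_def)
      have qw: "q \<bullet> w = p \<bullet> h + t * (p2 \<bullet> b)"
        using hb b(1) by (simp add: q_def h(2) inner_add_left inner_add_right inner_diff_left algebra_simps)
      have "\<bar>f (x + w) - f x - q \<bullet> w\<bar> \<le> L * (2 * \<epsilon> * \<bar>t\<bar>) + L * (2 * \<epsilon> * \<bar>t\<bar>) + \<epsilon> * norm h + \<epsilon> * \<bar>t\<bar>"
        using 1 2 3 4 unfolding qw by linarith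
      also have "\<dots> \<le> L * (2 * \<epsilon> * norm w) + L * (2 * \<epsilon> * norm w) + \<epsilon> * norm w + \<epsilon> * norm w"
        using tn hn L0 \<epsilon>(1) by (intro add_mono mult_left_mono) auto
      also have "\<dots> = ((4 * L + 2) * \<epsilon>) * norm w"
        by (simp add: algebra_simps)
      also have "\<dots> \<le> e * norm w"
        using \<epsilon>(2) by (intro mult_right_mono) auto
      finally show "\<bar>f (x + w) - f x - q \<bullet> w\<bar> \<le> e * norm w" .
    qed
    moreover have "0 < d"
      using d1 d2 by (simp add: d_def)
    ultimately show "\<exists>p. \<exists>d>0. x \<in> affine_approx f (insert b S) p e d"
      by blast
  qed
  then show ?case
    by (intro negligible_subset[OF N]) auto
qed

text \<open>Two affine approximations valid on a common ball have slopes that differ by at most the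
  sum of their errors. So the slopes for the errors \<open>1 / real (Suc i)\<close> form a Cauchy
  sequence, and the limit is the gradient.\<close>

lemma diff_along_Basis_imp_differentiable:
  fixes f :: "'a::euclidean_space \<Rightarrow> real"
  assumes x: "x \<in> diff_along f Basis"
  shows "f differentiable (at x)"
proof -
  have "\<exists>p d. 0 < d \<and> x \<in> affine_approx f Basis p (1 / real (Suc i)) d" for i :: nat
    using x by (auto simp: diff_along_def)
  then obtain p d where d: "\<And>i::nat. 0 < d i" and ap: "\<And>i. x \<in> affine_approx f Basis (p i) (1 / real (Suc i)) (d i)"
    by metis
  have est: "\<bar>f (x + h) - f x - p i \<bullet> h\<bar> \<le> 1 / real (Suc i) * norm h" if "norm h < d i" for i h
    using ap[of i] that by (simp add: affine_approx_def span_Basis)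
  have diff: "norm (p i - p j) \<le> 1 / real (Suc i) + 1 / real (Suc j)" for i j
  proof (cases "p i = p j")
    case False
    define v where "v = p i - p j"
    define s where "s = min (d i) (d j) / 2 / norm v"
    have v: "0 < norm v"
      using False by (simp add: v_def)
    then have s: "0 < s" "norm (s *\<^sub>R v) < d i" "norm (s *\<^sub>R v) < d j"
      using d[of i] d[of j] by (auto simp: s_def)
    have "\<bar>(p i - p j) \<bullet> (s *\<^sub>R v)\<bar> \<le> 1 / real (Suc i) * norm (s *\<^sub>R v) + 1 / real (Suc j) * norm (s *\<^sub>R v)"
      using est[OF s(2)] est[OF s(3)] unfolding inner_diff_left by linarith
    then have "s * (norm v * norm v) \<le> s * ((1 / real (Suc i) + 1 / real (Suc j)) * norm v)"
      using s(1) by (simp add: v_def[symmetric] dot_square_norm power2_eq_square abs_mult algebra_simps)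
    then have "norm v * norm v \<le> (1 / real (Suc i) + 1 / real (Suc j)) * norm v"
      using s(1) by (simp only: mult_le_cancel_left_pos)
    then show ?thesis
      using v by (simp only: mult_le_cancel_right_pos v_def[symmetric])
  qed auto
  have "Cauchy p"
  proof (rule metric_CauchyI)
    fix e :: real assume "0 < e"
    then obtain M where M: "1 / real (Suc M) < e / 2"
      using nat_approx_posE[of "e / 2"] by auto
    have "dist (p i) (p j) < e" if "M \<le> i" "M \<le> j" for i j
    proof -
      have "1 / real (Suc i) \<le> 1 / real (Suc M)" "1 / real (Suc j) \<le> 1 / real (Suc M)"
        using that by (auto simp: field_simps)
      then show ?thesis
        using diff[of i j] M unfolding dist_norm by linarith
    qed
    then show "\<exists>M. \<forall>m\<ge>M. \<forall>n\<ge>M. dist (p m) (p n) < e"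
      by blast
  qed
  then obtain q where q: "p \<longlonglongrightarrow> q"
    using Cauchy_convergent convergent_def by blast
  have pq: "norm (p i - q) \<le> 1 / real (Suc i)" for i
  proof (rule LIMSEQ_le)
    show "(\<lambda>j. norm (p i - p j)) \<longlonglongrightarrow> norm (p i - q)"
      using q by (intro tendsto_intros)
    have "(\<lambda>j. 1 / real (Suc i) + 1 / real (Suc j)) \<longlonglongrightarrow> 1 / real (Suc i) + 0"
      by (intro tendsto_intros LIMSEQ_Suc[OF lim_1_over_n])
    then show "(\<lambda>j. 1 / real (Suc i) + 1 / real (Suc j)) \<longlonglongrightarrow> 1 / real (Suc i)"
      by simp
  qed (use diff in auto)
  have "(f has_derivative (\<lambda>h. q \<bullet> h)) (at x)"
    unfolding has_derivative_at_alt
  proof (intro conjI allI impI)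
    show "bounded_linear (\<lambda>h. q \<bullet> h)"
      by (rule bounded_linear_inner_right)
    fix e :: real assume "0 < e"
    then obtain i where i: "1 / real (Suc i) < e / 2"
      using nat_approx_posE[of "e / 2"] by auto
    have "norm (f y - f x - q \<bullet> (y - x)) \<le> e * norm (y - x)" if y: "norm (y - x) < d i" for y
    proof -
      have "\<bar>f y - f x - p i \<bullet> (y - x)\<bar> \<le> 1 / real (Suc i) * norm (y - x)"
        using est[OF y] by simp
      moreover have "\<bar>(p i - q) \<bullet> (y - x)\<bar> \<le> 1 / real (Suc i) * norm (y - x)"
        using Cauchy_Schwarz_ineq2[of "p i - q" "y - x"] mult_right_mono[OF pq[of i] norm_ge_zero[of "y - x"]] by linarith
      moreover have "1 / real (Suc i) * norm (y - x) \<le> e / 2 * norm (y - x)"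
        using i by (intro mult_right_mono) auto
      ultimately show ?thesis
        unfolding inner_diff_left real_norm_def by linarith
    qed
    then show "\<exists>d>0. \<forall>y. norm (y - x) < d \<longrightarrow> norm (f y - f x - q \<bullet> (y - x)) \<le> e * norm (y - x)"
      using d by blast
  qed
  then show ?thesis
    by (auto simp: differentiable_def)
qed

theorem rademacher:
  fixes f :: "'a::euclidean_space \<Rightarrow> real"
  assumes "L-lipschitz_on UNIV f"
  shows "negligible {x. \<not> f differentiable (at x)}"
  using negligible_not_diff_along[OF assms finite_Basis order_refl]
  by (rule negligible_subset) (auto dest: diff_along_Basis_imp_differentiable)

text \<open>Composition with the nearest-point projection onto the ball, which is 1-Lipschitz by
  convexity, keeps the constant.\<close>

lemma lipschitz_cball_extension:
  fixes f :: "'a::euclidean_space \<Rightarrow> real"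
  assumes f: "L-lipschitz_on (cball c r) f" and r: "0 \<le> r"
  obtains g where "L-lipschitz_on UNIV g" "\<And>x. x \<in> cball c r \<Longrightarrow> g x = f x"
proof
  let ?P = "closest_point (cball c r)"
  have P: "?P x \<in> cball c r" for x
    using r by (intro closest_point_in_set) auto
  show "L-lipschitz_on UNIV (f \<circ> ?P)"
  proof (rule lipschitz_onI)
    fix x y
    have "dist (f (?P x)) (f (?P y)) \<le> L * dist (?P x) (?P y)"
      using lipschitz_onD[OF f P P] .
    also have "\<dots> \<le> L * dist x y"
      using r lipschitz_on_nonneg[OF f] by (intro mult_left_mono closest_point_lipschitz) auto
    finally show "dist ((f \<circ> ?P) x) ((f \<circ> ?P) y) \<le> L * dist x y"
      by simp
  qed (rule lipschitz_on_nonneg[OF f])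
  show "(f \<circ> ?P) x = f x" if "x \<in> cball c r" for x
    using that by (simp add: closest_point_self)
qed

lemma locally_lipschitz_onE:
  assumes f: "locally_lipschitz_on X f" and X: "open X" "x \<in> X"
  obtains r L where "0 < r" "cball x r \<subseteq> X" "L-lipschitz_on (cball x r) f"
proof -
  obtain u L where u: "0 < u" "L-lipschitz_on (cball x u \<inter> X) f"
    using f X(2) unfolding local_lipschitz_def by (metis Int_UNIV_right UNIV_I centre_in_cball less_imp_le)
  obtain v where v: "0 < v" "cball x v \<subseteq> X"
    using X open_contains_cball by blast
  show ?thesis
  proof
    show "cball x (min u v) \<subseteq> X"
      using v(2) by auto
    then show "L-lipschitz_on (cball x (min u v)) f"
      by (intro lipschitz_on_subset[OF u(2)]) auto
  qed (use u v in auto)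
qed

lemma locally_lipschitz_onI:
  assumes "\<And>x. x \<in> X \<Longrightarrow> \<exists>r>0. \<exists>L. L-lipschitz_on (cball x r \<inter> X) f"
  shows "locally_lipschitz_on X f"
  using assms unfolding local_lipschitz_def by blast

text \<open>Being null is a local property, and inside a small ball the function has the same points
  of differentiability as a global Lipschitz extension.\<close>

corollary rademacher_local:
  fixes f :: "'a::euclidean_space \<Rightarrow> real"
  assumes f: "locally_lipschitz_on X f" and X: "open X"
  shows "negligible {x\<in>X. \<not> f differentiable (at x)}"
proof (subst locally_negligible_alt, rule ballI)
  fix x assume "x \<in> {x\<in>X. \<not> f differentiable (at x)}"
  then have x: "x \<in> X" "\<not> f differentiable (at x)"
    by auto
  obtain r L where r: "0 < r" "cball x r \<subseteq> X" "L-lipschitz_on (cball x r) f"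
    using locally_lipschitz_onE[OF f X x(1)] .
  obtain g where g: "L-lipschitz_on UNIV g" "\<And>y. y \<in> cball x r \<Longrightarrow> g y = f y"
    using lipschitz_cball_extension[OF r(3)] r(1) by auto
  let ?U = "{x\<in>X. \<not> f differentiable (at x)} \<inter> ball x r"
  have "?U \<subseteq> {x. \<not> g differentiable (at x)}"
  proof
    fix y assume y: "y \<in> ?U"
    have "\<not> g differentiable (at y)"
    proof
      assume "g differentiable (at y)"
      then obtain D where "(g has_derivative D) (at y)"
        by (auto simp: differentiable_def)
      then have "(f has_derivative D) (at y)"
        by (rule has_derivative_transform_within_open[of _ _ _ _ "ball x r"]) (use y g in auto)
      then have "f differentiable (at y)"
        by (auto simp: differentiable_def)
      then show False
        using y by auto
    qed
    then show "y \<in> {x. \<not> g differentiable (at x)}" by auto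
  qed
  then have "negligible ?U"
    using rademacher[OF g(1)] negligible_subset by blast
  then show "\<exists>U. openin (top_of_set {x\<in>X. \<not> f differentiable (at x)}) U \<and> x \<in> U \<and> negligible U"
    using x r by (intro exI[of _ ?U]) (auto simp: openin_open)
qed

section \<open>Preimages of null sets\<close>

text \<open>\<open>T\<close> splits into countably many small pieces on each of which one lower
  constant holds; there \<open>\<Phi>\<close> is injective with Lipschitz inverse, and Lipschitz
  maps preserve null sets.\<close>

lemma negligible_if_image_negligible:
  fixes \<Phi> :: "'a::euclidean_space \<Rightarrow> 'a"
  assumes \<Phi>: "\<And>y. y \<in> T \<Longrightarrow> \<exists>m>0. \<exists>d>0. \<forall>z. norm (z - y) < d \<longrightarrow> m * norm (z - y) \<le> norm (\<Phi> z - \<Phi> y)"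
    and neg: "negligible (\<Phi> ` T)"
  shows "negligible T"
proof -
  obtain D :: "'a set" where "countable D" "\<forall>X. open X \<longrightarrow> X \<noteq> {} \<longrightarrow> (\<exists>d\<in>D. d \<in> X)"
    by (rule countable_denseE)
  note D = this(1) this(2)[rule_format]
  \<comment> \<open>Half the radius puts any two points of \<open>P k c\<close> within the distance
    \<open>1 / real (Suc k)\<close> at which the lower estimate applies.\<close>
  define P where "P k c = {y\<in>T. y \<in> ball c (1 / real (Suc k) / 2) \<and>
    (\<forall>z. norm (z - y) < 1 / real (Suc k) \<longrightarrow> 1 / real (Suc k) * norm (z - y) \<le> norm (\<Phi> z - \<Phi> y))}" for k :: nat and c
  have negP: "negligible (P k c)" for k c
  proof -
    have close: "norm (z - y) < 1 / real (Suc k)" if "y \<in> P k c" "z \<in> P k c" for y z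
    proof -
      have "norm (z - c) < 1 / real (Suc k) / 2" "norm (c - y) < 1 / real (Suc k) / 2"
        using that unfolding P_def by (simp_all add: dist_norm norm_minus_commute)
      moreover have "norm (z - y) \<le> norm (z - c) + norm (c - y)"
        using norm_triangle_ineq[of "z - c" "c - y"] by simp
      ultimately show ?thesis
        by linarith
    qed
    have low: "1 / real (Suc k) * norm (z - y) \<le> norm (\<Phi> z - \<Phi> y)" if "y \<in> P k c" "z \<in> P k c" for y z
      using close[OF that] that by (auto simp: P_def)
    have low': "norm (z - y) \<le> real (Suc k) * norm (\<Phi> z - \<Phi> y)" if "y \<in> P k c" "z \<in> P k c" for y z
      using low[OF that] by (simp add: field_simps)
    have inj: "inj_on \<Phi> (P k c)"
    proof (rule inj_onI)
      fix y z assume "y \<in> P k c" "z \<in> P k c" "\<Phi> y = \<Phi> z"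
      then show "y = z"
        using low'[of y z] by simp
    qed
    let ?g = "inv_into (P k c) \<Phi>"
    have "negligible (?g ` \<Phi> ` P k c)"
    proof (rule negligible_locally_Lipschitz_image)
      show "negligible (\<Phi> ` P k c)"
        by (rule negligible_subset[OF neg]) (auto simp: P_def)
      fix w assume "w \<in> \<Phi> ` P k c"
      then show "\<exists>T B. open T \<and> w \<in> T \<and> (\<forall>y\<in>\<Phi> ` P k c \<inter> T. norm (?g y - ?g w) \<le> B * norm (y - w))"
        using low' inj by (intro exI[of _ UNIV] exI[of _ "real (Suc k)"]) (auto simp: inv_into_f_f)
    qed auto
    moreover have "?g ` \<Phi> ` P k c = P k c"
      using inj by (force simp: inv_into_f_f image_image)
    ultimately show ?thesis by simp
  qed
  have "T \<subseteq> (\<Union>k. \<Union>c\<in>D. P k c)"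
  proof
    fix y assume y: "y \<in> T"
    obtain m d where md: "0 < m" "0 < d" "\<And>z. norm (z - y) < d \<Longrightarrow> m * norm (z - y) \<le> norm (\<Phi> z - \<Phi> y)"
      using \<Phi>[OF y] by auto
    obtain k where k: "1 / real (Suc k) < min m d"
      using nat_approx_posE[of "min m d"] md by auto
    obtain c where c: "c \<in> D" "c \<in> ball y (1 / real (Suc k) / 2)"
      using D(2)[of "ball y (1 / real (Suc k) / 2)"] by auto
    have "1 / real (Suc k) * norm (z - y) \<le> norm (\<Phi> z - \<Phi> y)" if "norm (z - y) < 1 / real (Suc k)" for z
    proof -
      have "1 / real (Suc k) * norm (z - y) \<le> m * norm (z - y)"
        using k by (intro mult_right_mono) auto
      also have "\<dots> \<le> norm (\<Phi> z - \<Phi> y)"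
        using md(3) that k by auto
      finally show ?thesis .
    qed
    then have "y \<in> P k c"
      using y c by (auto simp: P_def dist_commute)
    then show "y \<in> (\<Union>k. \<Union>c\<in>D. P k c)"
      using c by blast
  qed
  moreover have "negligible (\<Union>k. \<Union>c\<in>D. P k c)"
    using D(1) by (intro negligible_countable_Union countable_image) (auto intro!: negligible_countable_Union negP)
  ultimately show ?thesis
    using negligible_subset by blast
qed

lemma negligible_inner_preimage:
  assumes N: "negligible (N::real set)" and b: "b \<in> Basis"
  shows "negligible {z::'a::euclidean_space. z \<bullet> b \<in> N}"
proof -
  \<comment> \<open>The argument along lines needs a Borel set, so \<open>N\<close> is enlarged to a
    Borel null set.\<close>
  obtain N' where N': "N \<subseteq> N'" "N' \<in> null_sets lborel"
    using N by (auto simp: negligible_iff_null_sets null_sets_completion_iff2)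
  have [measurable]: "N' \<in> sets borel"
    using N' by auto
  have "negligible {z::'a. z \<bullet> b \<in> N'}"
  proof (rule negligible_if_lines_negligible)
    show "{z::'a. z \<bullet> b \<in> N'} \<in> sets borel"
      by measurable
    fix z :: 'a
    have "{t. z + t *\<^sub>R b \<in> {z. z \<bullet> b \<in> N'}} = {t. t - (- (z \<bullet> b)) \<in> N'}"
      using b by (auto simp: inner_add_left add.commute)
    then show "negligible {t. z + t *\<^sub>R b \<in> {z. z \<bullet> b \<in> N'}}"
      using null_sets_translation[OF N'(2), of "- (z \<bullet> b)"] by (simp add: negligible_iff_null_sets null_sets_completionI)
  qed
  then show ?thesis
    by (rule negligible_subset) (use N' in auto)
qed

text \<open>
  Applied with \<open>N\<close> the set where \<open>g (x, \<cdot>)\<close> or \<open>f\<close> is not differentiable: almost everywhere on the preimage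
  of \<open>N\<close> the derivative of \<open>u\<close> vanishes, so the arbitrary values of \<open>g'\<close> and \<open>f'\<close> there do not matter.
\<close>

lemma negligible_regular_preimage:
  fixes v :: "'a::euclidean_space \<Rightarrow> real"
  assumes N: "negligible N" and b: "b \<in> Basis"
  shows "negligible {y. v y \<in> N \<and> (\<exists>D. (v has_derivative D) (at y) \<and> D b \<noteq> 0)}" (is "negligible ?T")
proof (rule negligible_if_image_negligible)
  \<comment> \<open>\<open>\<Phi>\<close> overwrites the \<open>b\<close> coordinate of
    \<open>y\<close> by \<open>v y\<close>, so it sends \<open>?T\<close> into a null set of slabs.
    Its derivative \<open>A\<close> is the identity modulo \<open>b\<close> and multiplies
    \<open>b\<close> by \<open>D b\<close>; hence it is injective where \<open>D b\<close> is
    nonzero, and \<open>\<Phi>\<close> cannot shrink distances from \<open>y\<close> too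
    much.\<close>
  let ?\<Phi> = "\<lambda>y. y + (v y - y \<bullet> b) *\<^sub>R b"
  have "?\<Phi> ` ?T \<subseteq> {z. z \<bullet> b \<in> N}"
    using b by (auto simp: inner_add_left)
  then show "negligible (?\<Phi> ` ?T)"
    using negligible_inner_preimage[OF N b] negligible_subset by blast
  fix y assume "y \<in> ?T"
  then obtain D where D: "(v has_derivative D) (at y)" "D b \<noteq> 0"
    by auto
  interpret D: bounded_linear D
    using D(1) by (rule has_derivative_bounded_linear)
  define A where "A w = w + (D w - w \<bullet> b) *\<^sub>R b" for w
  have A: "(?\<Phi> has_derivative A) (at y)"
    unfolding A_def by (auto intro!: derivative_eq_intros D(1))
  then have linA: "linear A"
    using has_derivative_linear by blast
  have "inj A"
    unfolding linear_injective_0[OF linA]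
  proof (intro allI impI)
    fix w assume w: "A w = 0"
    then have "w = (w \<bullet> b - D w) *\<^sub>R b"
      by (simp add: A_def algebra_simps)
    then obtain c where c: "w = c *\<^sub>R b" by blast
    have "A w = (c * D b) *\<^sub>R b"
      using b by (simp add: A_def c D.scaleR algebra_simps)
    then have "c * D b = 0"
      using w b by auto
    then show "w = 0"
      using D(2) c by auto
  qed
  then obtain B where B: "0 < B" "\<And>w. B * norm w \<le> norm (A w)"
    using linear_inj_bounded_below_pos[OF linA] by blast
  obtain d where d: "0 < d" "\<And>z. norm (z - y) < d \<Longrightarrow> norm (?\<Phi> z - ?\<Phi> y - A (z - y)) \<le> B / 2 * norm (z - y)"
    using A B(1) unfolding has_derivative_at_alt by (metis half_gt_zero)
  have "B / 2 * norm (z - y) \<le> norm (?\<Phi> z - ?\<Phi> y)" if "norm (z - y) < d" for z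
  proof -
    have "norm (A (z - y)) \<le> norm (?\<Phi> z - ?\<Phi> y) + norm (?\<Phi> z - ?\<Phi> y - A (z - y))"
      using norm_triangle_ineq4[of "?\<Phi> z - ?\<Phi> y" "?\<Phi> z - ?\<Phi> y - A (z - y)"] by simp
    then show ?thesis
      using d(2)[OF that] B(2)[of "z - y"] by linarith
  qed
  then show "\<exists>m>0. \<exists>d>0. \<forall>z. norm (z - y) < d \<longrightarrow> m * norm (z - y) \<le> norm (?\<Phi> z - ?\<Phi> y)"
    using B(1) d(1) by (intro exI[of _ "B / 2"] conjI exI[of _ d]) auto
qed

section \<open>Gradients and the geometry of level sets\<close>

lemma inner_sum_Basis_bounded_linear:
  fixes D :: "'a::euclidean_space \<Rightarrow> real"
  assumes "bounded_linear D"
  shows "h \<bullet> (\<Sum>b\<in>Basis. D b *\<^sub>R b) = D h"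
proof -
  interpret D: bounded_linear D by fact
  have "D h = D (\<Sum>b\<in>Basis. (h \<bullet> b) *\<^sub>R b)"
    by (simp add: euclidean_representation)
  also have "\<dots> = (\<Sum>b\<in>Basis. (h \<bullet> b) * D b)"
    by (simp add: D.sum D.scaleR)
  finally show ?thesis
    by (simp add: inner_sum_right mult.commute)
qed

lemma grad_unique:
  assumes "(v has_derivative (\<lambda>h. h \<bullet> D)) (at p)"
  shows "grad v p = D"
  unfolding grad_def
proof (rule some_equality)
  show "GDERIV v p :> D"
    using assms by (simp add: gderiv_def)
  fix D' assume "GDERIV v p :> D'"
  then have "(v has_derivative (\<lambda>h. h \<bullet> D')) (at p)"
    by (simp add: gderiv_def)
  then have "(\<lambda>h. h \<bullet> D') = (\<lambda>h. h \<bullet> D)"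
    using assms has_derivative_unique by blast
  then have "(D' - D) \<bullet> D' = (D' - D) \<bullet> D"
    by (rule fun_cong)
  then have "(D' - D) \<bullet> (D' - D) = 0"
    by (simp add: inner_diff_right)
  then show "D' = D"
    by simp
qed

lemma grad_has_derivative:
  fixes v :: "'a::euclidean_space \<Rightarrow> real"
  assumes "v differentiable (at p)"
  shows "(v has_derivative (\<lambda>h. h \<bullet> grad v p)) (at p)"
proof -
  obtain D where D: "(v has_derivative D) (at p)"
    using assms by (auto simp: differentiable_def)
  then have D': "(v has_derivative (\<lambda>h. h \<bullet> (\<Sum>b\<in>Basis. D b *\<^sub>R b))) (at p)"
    by (simp add: inner_sum_Basis_bounded_linear[OF has_derivative_bounded_linear[OF D]])
  show ?thesis
    using D' grad_unique[OF D'] by simp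
qed

lemma grad_cong_open:
  assumes "open X" "p \<in> X" "\<And>q. q \<in> X \<Longrightarrow> v q = w q"
  shows "grad v p = grad w p"
proof -
  have "(v has_derivative F) (at p) \<longleftrightarrow> (w has_derivative F) (at p)" for F
  proof
    assume "(v has_derivative F) (at p)"
    then show "(w has_derivative F) (at p)"
      by (rule has_derivative_transform_within_open[OF _ assms])
  next
    assume "(w has_derivative F) (at p)"
    then show "(v has_derivative F) (at p)"
      by (rule has_derivative_transform_within_open[OF _ assms(1,2)]) (simp add: assms(3))
  qed
  then show ?thesis
    by (simp add: grad_def gderiv_def)
qed

lemma grad_mult:
  fixes v w :: "'a::euclidean_space \<Rightarrow> real"
  assumes "v differentiable (at p)" "w differentiable (at p)"
  shows "grad (\<lambda>q. v q * w q) p = v p *\<^sub>R grad w p + w p *\<^sub>R grad v p"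
proof (rule grad_unique)
  have "((\<lambda>q. v q * w q) has_derivative (\<lambda>h. v p * (h \<bullet> grad w p) + h \<bullet> grad v p * w p)) (at p)"
    using assms by (intro has_derivative_mult grad_has_derivative)
  then show "((\<lambda>q. v q * w q) has_derivative (\<lambda>h. h \<bullet> (v p *\<^sub>R grad w p + w p *\<^sub>R grad v p))) (at p)"
    by (simp add: inner_add_right mult.commute)
qed

section \<open>Symmetry of second derivatives\<close>

lemma second_difference:
  fixes v :: "'a::real_normed_vector \<Rightarrow> real" and V :: "'a \<Rightarrow> 'a \<Rightarrow>\<^sub>L real" and V2 :: "'a \<Rightarrow> 'a \<Rightarrow>\<^sub>L 'a \<Rightarrow>\<^sub>L real"
  assumes V: "\<And>q. q \<in> ball p r \<Longrightarrow> (v has_derivative V q) (at q)"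
    and V2: "\<And>q. q \<in> ball p r \<Longrightarrow> (V has_derivative V2 q) (at q)"
    and s: "0 < s" "s * (norm a + norm b) < r"
  shows "\<exists>q. norm (q - p) \<le> s * (norm a + norm b) \<and>
    v (p + s *\<^sub>R a + s *\<^sub>R b) - v (p + s *\<^sub>R a) - v (p + s *\<^sub>R b) + v p = s * s * V2 q b a"
proof -
  have near: "norm (x *\<^sub>R a + y *\<^sub>R b) \<le> s * (norm a + norm b)" if "0 \<le> x" "x \<le> s" "0 \<le> y" "y \<le> s" for x y
  proof -
    have "norm (x *\<^sub>R a + y *\<^sub>R b) \<le> x * norm a + y * norm b"
      using norm_triangle_ineq[of "x *\<^sub>R a" "y *\<^sub>R b"] that by simp
    also have "\<dots> \<le> s * norm a + s * norm b"
      using that by (intro add_mono mult_right_mono) auto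
    finally show ?thesis by (simp add: distrib_left)
  qed
  have inball: "p + x *\<^sub>R a + y *\<^sub>R b \<in> ball p r" if "0 \<le> x" "x \<le> s" "0 \<le> y" "y \<le> s" for x y
    using near[OF that] s(2) norm_minus_cancel[of "x *\<^sub>R a + y *\<^sub>R b"] by (simp add: dist_norm algebra_simps)
  \<comment> \<open>The first mean value theorem runs along \<open>a\<close> for the increment in
    direction \<open>b\<close>, the second along \<open>b\<close> for the resulting difference of
    derivatives.\<close>
  define G where "G t = v (p + t *\<^sub>R a + s *\<^sub>R b) - v (p + t *\<^sub>R a + 0 *\<^sub>R b)" for t
  have dv: "((\<lambda>t. v (p + t *\<^sub>R a + y *\<^sub>R b)) has_real_derivative V (p + t *\<^sub>R a + y *\<^sub>R b) a) (at t)"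
    if "0 \<le> t" "t \<le> s" "0 \<le> y" "y \<le> s" for t y
  proof -
    have "((\<lambda>t. p + t *\<^sub>R a + y *\<^sub>R b) has_derivative (\<lambda>h. h *\<^sub>R a)) (at t)"
      by (auto intro!: derivative_eq_intros)
    from has_derivative_compose[OF this V[OF inball[OF that]]]
    have "((\<lambda>t. v (p + t *\<^sub>R a + y *\<^sub>R b)) has_derivative (\<lambda>h. h * V (p + t *\<^sub>R a + y *\<^sub>R b) a)) (at t)"
      by (simp add: blinfun.scaleR_right)
    then show ?thesis
      by (rule has_derivative_imp_has_field_derivative) simp
  qed
  have "\<exists>z>0. z < s \<and> G s - G 0 = (s - 0) * (V (p + z *\<^sub>R a + s *\<^sub>R b) a - V (p + z *\<^sub>R a + 0 *\<^sub>R b) a)"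
    unfolding G_def using s(1) by (intro MVT2 DERIV_diff dv) auto
  then obtain z where z: "0 < z" "z < s" "G s - G 0 = s * (V (p + z *\<^sub>R a + s *\<^sub>R b) a - V (p + z *\<^sub>R a + 0 *\<^sub>R b) a)"
    by auto
  have dV: "((\<lambda>y. V (p + z *\<^sub>R a + y *\<^sub>R b) a) has_real_derivative V2 (p + z *\<^sub>R a + y *\<^sub>R b) b a) (at y)"
    if "0 \<le> y" "y \<le> s" for y
  proof -
    have 1: "((\<lambda>y. p + z *\<^sub>R a + y *\<^sub>R b) has_derivative (\<lambda>h. h *\<^sub>R b)) (at y)"
      by (auto intro!: derivative_eq_intros)
    have "p + z *\<^sub>R a + y *\<^sub>R b \<in> ball p r"
      using inball z that by simp
    from has_derivative_compose[OF 1 V2[OF this]]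
    have "((\<lambda>y. V (p + z *\<^sub>R a + y *\<^sub>R b)) has_derivative (\<lambda>h. h *\<^sub>R V2 (p + z *\<^sub>R a + y *\<^sub>R b) b)) (at y)"
      by (simp add: blinfun.scaleR_right)
    then have "((\<lambda>y. V (p + z *\<^sub>R a + y *\<^sub>R b) a) has_derivative (\<lambda>h. (h *\<^sub>R V2 (p + z *\<^sub>R a + y *\<^sub>R b) b) a)) (at y)"
      by (rule bounded_linear.has_derivative[OF blinfun.bounded_linear_left])
    then show ?thesis
      by (rule has_derivative_imp_has_field_derivative) (simp add: blinfun.scaleR_left)
  qed
  have "\<exists>w>0. w < s \<and> V (p + z *\<^sub>R a + s *\<^sub>R b) a - V (p + z *\<^sub>R a + 0 *\<^sub>R b) a = (s - 0) * V2 (p + z *\<^sub>R a + w *\<^sub>R b) b a"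
    using s(1) by (intro MVT2 dV) auto
  then obtain w where w: "0 < w" "w < s"
    "V (p + z *\<^sub>R a + s *\<^sub>R b) a - V (p + z *\<^sub>R a + 0 *\<^sub>R b) a = s * V2 (p + z *\<^sub>R a + w *\<^sub>R b) b a"
    by auto
  have "G s - G 0 = s * s * V2 (p + z *\<^sub>R a + w *\<^sub>R b) b a"
    using z(3) w(3) by simp
  moreover have "G s - G 0 = v (p + s *\<^sub>R a + s *\<^sub>R b) - v (p + s *\<^sub>R a) - v (p + s *\<^sub>R b) + v p"
    by (simp add: G_def)
  moreover have "norm ((p + z *\<^sub>R a + w *\<^sub>R b) - p) \<le> s * (norm a + norm b)"
    using near[of z w] z w by (simp add: add.assoc)
  ultimately show ?thesis
    by (intro exI[of _ "p + z *\<^sub>R a + w *\<^sub>R b"]) simp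
qed

text \<open>The second difference does not change when \<open>a\<close> and \<open>b\<close> are
  exchanged, and by \<open>second_difference\<close> it is a value of the second derivative at a
  nearby point with the arguments in either order. Continuity moves both points to
  \<open>p\<close>.\<close>

lemma second_derivative_symmetric:
  fixes v :: "'a::real_normed_vector \<Rightarrow> real" and V :: "'a \<Rightarrow> 'a \<Rightarrow>\<^sub>L real" and V2 :: "'a \<Rightarrow> 'a \<Rightarrow>\<^sub>L 'a \<Rightarrow>\<^sub>L real"
  assumes X: "open X" "p \<in> X"
    and V: "\<And>q. q \<in> X \<Longrightarrow> (v has_derivative V q) (at q)"
    and V2: "\<And>q. q \<in> X \<Longrightarrow> (V has_derivative V2 q) (at q)"
    and cont: "continuous_on X V2"
  shows "V2 p a b = V2 p b a"
proof (rule ccontr)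
  assume ne: "V2 p a b \<noteq> V2 p b a"
  define e where "e = \<bar>V2 p a b - V2 p b a\<bar> / 2"
  have e: "0 < e"
    using ne by (simp add: e_def)
  have c: "continuous_on X (\<lambda>q. V2 q x y)" for x y
    by (intro continuous_intros cont)
  obtain d1 where d1: "0 < d1" "\<And>q. q \<in> X \<Longrightarrow> dist q p < d1 \<Longrightarrow> dist (V2 q a b) (V2 p a b) < e"
    using c[of a b] X(2) e unfolding continuous_on_iff by blast
  obtain d2 where d2: "0 < d2" "\<And>q. q \<in> X \<Longrightarrow> dist q p < d2 \<Longrightarrow> dist (V2 q b a) (V2 p b a) < e"
    using c[of b a] X(2) e unfolding continuous_on_iff by blast
  obtain r where r: "0 < r" "ball p r \<subseteq> X"
    using X openE by blast
  define t where "t = min r (min d1 d2)"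
  define N where "N = norm a + norm b + 1"
  define s where "s = t / 2 / N"
  have t: "0 < t"
    using r d1 d2 by (simp add: t_def)
  have pos: "0 < N"
    using norm_ge_zero[of a] norm_ge_zero[of b] unfolding N_def by linarith
  have s: "0 < s"
    using t pos by (simp add: s_def)
  have "s * (norm a + norm b) \<le> s * N"
    using s by (intro mult_left_mono) (auto simp: N_def)
  also have "\<dots> = t / 2"
    using pos by (simp add: s_def)
  finally have st: "s * (norm a + norm b) < t"
    using t by linarith
  have V': "(v has_derivative V q) (at q)" "(V has_derivative V2 q) (at q)" if "q \<in> ball p r" for q
    using V V2 r that by auto
  have st1: "s * (norm a + norm b) < r" and st2: "s * (norm b + norm a) < r"
    using st by (simp_all add: t_def add.commute)
  obtain q1 where q1: "norm (q1 - p) \<le> s * (norm a + norm b)"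
    "v (p + s *\<^sub>R a + s *\<^sub>R b) - v (p + s *\<^sub>R a) - v (p + s *\<^sub>R b) + v p = s * s * V2 q1 b a"
    using second_difference[OF V' s st1] by blast
  obtain q2 where q2: "norm (q2 - p) \<le> s * (norm b + norm a)"
    "v (p + s *\<^sub>R b + s *\<^sub>R a) - v (p + s *\<^sub>R b) - v (p + s *\<^sub>R a) + v p = s * s * V2 q2 a b"
    using second_difference[OF V' s st2] by blast
  have "s * s * V2 q1 b a = s * s * V2 q2 a b"
    using q1(2) q2(2) by (simp add: algebra_simps)
  then have eq: "V2 q1 b a = V2 q2 a b"
    using s by simp
  have n1: "dist q1 p < t" and n2: "dist q2 p < t"
    using q1(1) q2(1) st by (simp_all add: dist_norm add.commute)
  then have "q1 \<in> X" "q2 \<in> X"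
    using r(2) by (auto simp: t_def dist_commute)
  then have "dist (V2 q1 b a) (V2 p b a) < e" "dist (V2 q2 a b) (V2 p a b) < e"
    using d1(2) d2(2) n1 n2 by (auto simp: t_def)
  then show False
    using abs_triangle_ineq[of "V2 p a b - V2 q2 a b" "V2 q2 a b - V2 p b a"]
    unfolding eq e_def dist_real_def by (simp add: abs_minus_commute)
qed

text \<open>The derivatives quantified in \<open>C2_on\<close> are identified with
  \<open>grad\<close> and its derivative, so that the Hessian becomes a symmetric map of the space
  into itself and can be handled by inner products.\<close>

lemma C2_onE:
  fixes v :: "'a::euclidean_space \<Rightarrow> real"
  assumes v: "C2_on X v" and X: "open X"
  obtains H :: "'a \<Rightarrow> 'a \<Rightarrow> 'a"
  where "\<And>p. p \<in> X \<Longrightarrow> (v has_derivative (\<lambda>h. h \<bullet> grad v p)) (at p)"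
    "\<And>p. p \<in> X \<Longrightarrow> (grad v has_derivative H p) (at p)"
    "\<And>p h k. p \<in> X \<Longrightarrow> H p h \<bullet> k = H p k \<bullet> h"
    "\<And>h. continuous_on X (\<lambda>p. H p h)"
proof -
  obtain V :: "'a \<Rightarrow> 'a \<Rightarrow>\<^sub>L real" and V2 :: "'a \<Rightarrow> 'a \<Rightarrow>\<^sub>L 'a \<Rightarrow>\<^sub>L real" where
    V: "\<And>p. p \<in> X \<Longrightarrow> (v has_derivative V p) (at p)"
    and V2: "\<And>p. p \<in> X \<Longrightarrow> (V has_derivative V2 p) (at p)"
    and cont: "continuous_on X V2"
    using v unfolding C2_on_def by blast
  define H where "H p h = (\<Sum>b\<in>Basis. V2 p h b *\<^sub>R b)" for p h
  have gradV: "grad v p = (\<Sum>b\<in>Basis. V p b *\<^sub>R b)" if "p \<in> X" for p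
  proof (rule grad_unique)
    show "(v has_derivative (\<lambda>h. h \<bullet> (\<Sum>b\<in>Basis. V p b *\<^sub>R b))) (at p)"
      using V[OF that] by (simp add: inner_sum_Basis_bounded_linear[OF blinfun.bounded_linear_right])
  qed
  show ?thesis
  proof
    fix p assume p: "p \<in> X"
    show "(v has_derivative (\<lambda>h. h \<bullet> grad v p)) (at p)"
      using V[OF p] p by (simp add: gradV inner_sum_Basis_bounded_linear[OF blinfun.bounded_linear_right])
    have "((\<lambda>q. V q b) has_derivative (\<lambda>h. V2 p h b)) (at p)" for b
      by (rule bounded_linear.has_derivative[OF blinfun.bounded_linear_left V2[OF p]])
    then have "((\<lambda>q. \<Sum>b\<in>Basis. V q b *\<^sub>R b) has_derivative H p) (at p)"
      unfolding H_def by (intro has_derivative_sum has_derivative_scaleR_left)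
    then show "(grad v has_derivative H p) (at p)"
      by (rule has_derivative_transform_within_open[OF _ X p]) (simp add: gradV)
    have H: "H p h \<bullet> k = V2 p h k" for h k
      unfolding H_def using inner_sum_Basis_bounded_linear[OF blinfun.bounded_linear_right, of k "V2 p h"]
      by (simp add: inner_commute)
    show "H p h \<bullet> k = H p k \<bullet> h" for h k
      unfolding H by (rule second_derivative_symmetric[OF X p V V2 cont])
  next
    have "continuous_on X (\<lambda>p. V2 p h b)" for h b
      using blinfun.continuous_on[OF blinfun.continuous_on[OF cont continuous_on_const] continuous_on_const] .
    then show "continuous_on X (\<lambda>p. H p h)" for h
      unfolding H_def by (intro continuous_on_sum continuous_on_scaleR continuous_on_const)
  qed
qed

section \<open>Curvatures of level sets\<close>

lemma bessel_inequality:
  fixes x :: "'a::real_inner"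
  assumes F: "finite F" "pairwise orthogonal F" "\<And>b. b \<in> F \<Longrightarrow> norm b = 1"
  shows "(\<Sum>b\<in>F. (x \<bullet> b)\<^sup>2) \<le> (norm x)\<^sup>2"
proof -
  define y where "y = (\<Sum>b\<in>F. (x \<bullet> b) *\<^sub>R b)"
  have xy: "x \<bullet> y = (\<Sum>b\<in>F. (x \<bullet> b)\<^sup>2)"
    by (simp add: y_def inner_sum_right power2_eq_square)
  have "b \<bullet> y = x \<bullet> b" if b: "b \<in> F" for b
  proof -
    have "b \<bullet> y = (\<Sum>c\<in>F. (x \<bullet> c) * (b \<bullet> c))"
      by (simp add: y_def inner_sum_right)
    also have "\<dots> = (\<Sum>c\<in>F. if c = b then x \<bullet> b else 0)"
    proof (rule sum.cong)
      fix c assume c: "c \<in> F"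
      show "(x \<bullet> c) * (b \<bullet> c) = (if c = b then x \<bullet> b else 0)"
        using F(2,3) b c by (auto simp: pairwise_def orthogonal_def dot_square_norm)
    qed simp
    finally show ?thesis
      using F(1) b by simp
  qed
  then have yy: "y \<bullet> y = (\<Sum>b\<in>F. (x \<bullet> b)\<^sup>2)"
    by (subst (1) y_def) (simp add: inner_sum_left power2_eq_square)
  have "0 \<le> (x - y) \<bullet> (x - y)"
    by simp
  also have "(x - y) \<bullet> (x - y) = x \<bullet> x - 2 * (x \<bullet> y) + y \<bullet> y"
    by (simp add: inner_diff_left inner_diff_right inner_commute)
  finally show ?thesis
    using xy yy by (simp add: dot_square_norm)
qed

lemma sum_norm_sq_eq:
  fixes x :: "'a::euclidean_space"
  shows "(norm x)\<^sup>2 = (\<Sum>i\<in>Basis. (x \<bullet> i)\<^sup>2)"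
  unfolding power2_norm_eq_inner by (subst euclidean_inner) (simp add: power2_eq_square)

text \<open>With \<open>A\<close> the Hessian, the right side is the squared Hilbert-Schmidt norm of
  \<open>A\<close> on the tangent space. Up to sign, the shape operator is the tangential part of
  this restriction divided by the length of the gradient, and the tangential gradient of that length
  is its normal part. Bessel's inequality for an orthonormal family of principal directions gives
  \<le> without diagonalizing the shape operator.\<close>

lemma geometric_inequality:
  fixes v :: "'a::euclidean_space \<Rightarrow> real"
  assumes A: "(grad v has_derivative A) (at y)"
    and sym: "\<And>h k. A h \<bullet> k = A k \<bullet> h"
    and a: "grad v y \<noteq> 0"
  defines "\<nu> \<equiv> grad v y /\<^sub>R norm (grad v y)"
  shows "(curvature_norm v y)\<^sup>2 * (norm (grad v y))\<^sup>2 + (norm (tangential_grad v (\<lambda>z. norm (grad v z)) y))\<^sup>2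
    \<le> (\<Sum>i\<in>Basis. (norm (A i))\<^sup>2) - (norm (A \<nu>))\<^sup>2"
proof -
  interpret A: bounded_linear A
    using A by (rule has_derivative_bounded_linear)
  define n where "n = norm (grad v y)"
  have n: "0 < n"
    using a by (simp add: n_def)
  have \<nu>1: "norm \<nu> = 1"
    using n by (simp add: \<nu>_def n_def)
  have nu: "\<nu> \<bullet> \<nu> = 1"
    using \<nu>1 by (simp add: dot_square_norm)
  have av: "grad v y = n *\<^sub>R \<nu>"
    using n by (simp add: \<nu>_def n_def)
  have dnorm: "((\<lambda>z. norm (grad v z)) has_derivative (\<lambda>h. h \<bullet> A \<nu>)) (at y)"
  proof -
    have "((\<lambda>z. norm (grad v z)) has_derivative (\<lambda>h. A h \<bullet> sgn (grad v y))) (at y)"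
      using has_derivative_compose[OF A has_derivative_norm[OF a]] .
    moreover have "sgn (grad v y) = \<nu>"
      by (simp add: sgn_div_norm \<nu>_def)
    moreover have "A h \<bullet> \<nu> = h \<bullet> A \<nu>" for h
      using sym[of h \<nu>] by (simp add: inner_commute)
    ultimately show ?thesis by simp
  qed
  define N where "N = A \<nu> - (A \<nu> \<bullet> \<nu>) *\<^sub>R \<nu>"
  have tang: "tangential_grad v (\<lambda>z. norm (grad v z)) y = N"
    unfolding tangential_grad_def grad_unique[OF dnorm] by (simp add: unit_normal_def N_def \<nu>_def)
  define S where "S = shape_operator v y"
  \<comment> \<open>\<open>A \<nu>\<close> is the gradient of the norm, so normalizing the gradient
    merely removes from \<open>A w\<close> its component along \<open>\<nu>\<close>.\<close>
  have S: "S w = - (1 / n) *\<^sub>R (A w - (w \<bullet> A \<nu>) *\<^sub>R \<nu>)" for w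
  proof -
    have inv: "((\<lambda>z. inverse (norm (grad v z))) has_derivative (\<lambda>h. - (inverse n * (h \<bullet> A \<nu>) * inverse n))) (at y)"
      using Deriv.has_derivative_inverse[OF _ dnorm] n by (simp add: n_def)
    have "(unit_normal v has_derivative (\<lambda>h. inverse n *\<^sub>R A h + (- (inverse n * (h \<bullet> A \<nu>) * inverse n)) *\<^sub>R grad v y)) (at y)"
      using has_derivative_scaleR[OF inv A] unfolding unit_normal_def n_def .
    then have "frechet_derivative (unit_normal v) (at y) = (\<lambda>h. inverse n *\<^sub>R A h + (- (inverse n * (h \<bullet> A \<nu>) * inverse n)) *\<^sub>R grad v y)"
      by (rule frechet_derivative_at[symmetric])
    then have "S w = - (inverse n *\<^sub>R A w + (- (inverse n * (w \<bullet> A \<nu>) * inverse n)) *\<^sub>R n *\<^sub>R \<nu>)"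
      by (simp add: S_def shape_operator_def av)
    also have "\<dots> = - (1 / n) *\<^sub>R (A w - (w \<bullet> A \<nu>) *\<^sub>R \<nu>)"
      using n by (simp add: scaleR_diff_right divide_inverse)
    finally show ?thesis .
  qed
  have Ssym: "S w \<bullet> w' = S w' \<bullet> w" if "w \<bullet> \<nu> = 0" "w' \<bullet> \<nu> = 0" for w w'
    using that sym[of w w'] by (simp add: S inner_diff_left inner_commute[of \<nu>])
  define E where "E k = principal_space v y k" for k
  have E: "E k = {w. w \<bullet> \<nu> = 0 \<and> S w = k *\<^sub>R w}" for k
    using n by (auto simp: E_def principal_space_def S_def av)
  have Eorth: "w \<bullet> w' = 0" if "w \<in> E k" "w' \<in> E k'" "k \<noteq> k'" for w w' k k'
  proof -
    have "k * (w \<bullet> w') = k' * (w \<bullet> w')"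
      using Ssym[of w w'] that by (simp add: E inner_commute)
    then show ?thesis using that(3) by simp
  qed
  have Esub: "subspace (E k)" for k
  proof -
    have "S 0 = 0" "S (w + w') = S w + S w'" "S (c *\<^sub>R w) = c *\<^sub>R S w" for w w' c
      by (simp_all add: S A.zero A.add A.scaleR inner_add_left algebra_simps add_divide_distrib)
    then show ?thesis
      by (auto simp: subspace_def E inner_add_left scaleR_add_right)
  qed
  define K where "K = principal_curvatures v y"
  have "(curvature_norm v y)\<^sup>2 * n\<^sup>2 + (norm N)\<^sup>2 \<le> (\<Sum>i\<in>Basis. (norm (A i))\<^sup>2) - (norm (A \<nu>))\<^sup>2"
  proof -
    have "\<forall>k. \<exists>B. B \<subseteq> E k \<and> pairwise orthogonal B \<and> (\<forall>x\<in>B. norm x = 1) \<and> independent B \<and> card B = dim (E k)"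
      using orthonormal_basis_subspace[OF Esub] by metis
    then obtain B where B: "\<And>k. B k \<subseteq> E k" "\<And>k. pairwise orthogonal (B k)" "\<And>k x. x \<in> B k \<Longrightarrow> norm x = 1"
      "\<And>k. independent (B k)" "\<And>k. card (B k) = dim (E k)"
      by metis
    have Bfin: "finite (B k)" for k
      using B(4) independent_imp_finite by blast
    \<comment> \<open>A sum over an infinite set is 0 by convention, so passing to \<open>K'\<close>
      preserves \<open>curvature_norm\<close> whether or not \<open>K\<close> is finite.\<close>
    define K' where "K' = (if finite K then K else {})"
    have K': "finite K'" by (simp add: K'_def)
    define U where "U = (\<Union>k\<in>K'. B k)"
    have U: "finite U"
      using K' Bfin by (simp add: U_def)
    have disj: "B k \<inter> B k' = {}" if "k \<noteq> k'" for k k'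
    proof -
      have "False" if x: "x \<in> B k" "x \<in> B k'" for x
        using Eorth[of x k x k'] B(1)[of k] B(1)[of k'] B(3)[OF x(1)] x \<open>k \<noteq> k'\<close> by (auto simp: dot_square_norm)
      then show ?thesis by blast
    qed
    have "(curvature_norm v y)\<^sup>2 = (\<Sum>k\<in>K. real (dim (E k)) * k\<^sup>2)"
      unfolding curvature_norm_def K_def E_def by (intro real_sqrt_pow2 sum_nonneg) auto
    also have "\<dots> = (\<Sum>k\<in>K'. real (dim (E k)) * k\<^sup>2)"
      by (simp add: K'_def)
    also have "\<dots> = (\<Sum>k\<in>K'. \<Sum>b\<in>B k. (norm (S b))\<^sup>2)"
    proof (rule sum.cong)
      fix k assume "k \<in> K'"
      have "(norm (S b))\<^sup>2 = k\<^sup>2" if "b \<in> B k" for b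
        using B(1)[of k] B(3)[OF that] that by (auto simp: E)
      then show "real (dim (E k)) * k\<^sup>2 = (\<Sum>b\<in>B k. (norm (S b))\<^sup>2)"
        by (simp add: B(5))
    qed simp
    also have "\<dots> = (\<Sum>b\<in>U. (norm (S b))\<^sup>2)"
      unfolding U_def using K' Bfin disj by (intro sum.UNION_disjoint[symmetric]) auto
    finally have curv: "(curvature_norm v y)\<^sup>2 = (\<Sum>b\<in>U. (norm (S b))\<^sup>2)" .
    have UE: "\<exists>k. b \<in> B k" "b \<bullet> \<nu> = 0" "norm b = 1" if "b \<in> U" for b
    proof -
      obtain k where k: "b \<in> B k"
        using \<open>b \<in> U\<close> by (auto simp: U_def)
      then show "\<exists>k. b \<in> B k" by blast
      show "norm b = 1"
        using B(3)[OF k] .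
      have "b \<in> E k"
        using k B(1) by blast
      then show "b \<bullet> \<nu> = 0"
        by (simp add: E)
    qed
    have orth: "pairwise orthogonal (insert \<nu> U)"
    proof -
      have "orthogonal b b'" if bb: "b \<in> U" "b' \<in> U" "b \<noteq> b'" for b b'
      proof -
        obtain k k' where kk: "b \<in> B k" "b' \<in> B k'"
          using UE(1) bb by blast
        show ?thesis
        proof (cases "k = k'")
          case True
          then show ?thesis
            using B(2)[of k] kk bb(3) by (auto simp: pairwise_def)
        next
          case False
          have "b \<in> E k" "b' \<in> E k'"
            using kk B(1) by blast+
          then show ?thesis
            using Eorth False by (auto simp: orthogonal_def)
        qed
      qed
      then show ?thesis
        using UE(2) by (auto simp: pairwise_def orthogonal_def inner_commute)
    qed
    have \<nu>U: "\<nu> \<notin> U"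
      using UE(2) nu by force
    \<comment> \<open>\<open>A\<close> after projection to the tangent space; this is what takes the
      direction \<open>\<nu>\<close> out of the Hilbert-Schmidt sum.\<close>
    define T where "T i = A (i - (i \<bullet> \<nu>) *\<^sub>R \<nu>)" for i
    \<comment> \<open>Including \<open>\<nu>\<close> in the orthonormal family produces the
      subtracted normal part; summed over \<open>i\<close> it is the squared norm of
      \<open>N\<close>.\<close>
    have bessel: "(\<Sum>b\<in>U. (T i \<bullet> b)\<^sup>2) \<le> (norm (T i))\<^sup>2 - (T i \<bullet> \<nu>)\<^sup>2" for i
    proof -
      have "norm b = 1" if "b \<in> insert \<nu> U" for b
        using that UE(3) \<nu>1 by blast
      from bessel_inequality[OF _ orth this, of "T i"] show ?thesis
        using U \<nu>U by simp
    qed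
    \<comment> \<open>Symmetry of \<open>A\<close> moves \<open>b\<close> to the other side: up to
      sign, the coordinates of \<open>n *\<^sub>R S b\<close> are the products
      \<open>T i \<bullet> b\<close>.\<close>
    have nS: "n\<^sup>2 * (norm (S b))\<^sup>2 = (\<Sum>i\<in>Basis. (T i \<bullet> b)\<^sup>2)" if b: "b \<in> U" for b
    proof -
      have "n\<^sup>2 * (norm (S b))\<^sup>2 = (norm (A b - (b \<bullet> A \<nu>) *\<^sub>R \<nu>))\<^sup>2"
        using n by (simp add: S power_mult_distrib power_divide)
      also have "\<dots> = (\<Sum>i\<in>Basis. ((A b - (b \<bullet> A \<nu>) *\<^sub>R \<nu>) \<bullet> i)\<^sup>2)"
        by (rule sum_norm_sq_eq)
      also have "\<dots> = (\<Sum>i\<in>Basis. (T i \<bullet> b)\<^sup>2)"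
      proof (rule sum.cong)
        fix i :: 'a
        have "T i \<bullet> b = A b \<bullet> i - (i \<bullet> \<nu>) * (b \<bullet> A \<nu>)"
          using sym[of i b] by (simp add: T_def A.diff A.scaleR inner_diff_left inner_commute[of b])
        then show "((A b - (b \<bullet> A \<nu>) *\<^sub>R \<nu>) \<bullet> i)\<^sup>2 = (T i \<bullet> b)\<^sup>2"
          by (simp add: inner_diff_left inner_commute[of \<nu>] mult.commute)
      qed simp
      finally show ?thesis .
    qed
    have "(curvature_norm v y)\<^sup>2 * n\<^sup>2 = (\<Sum>b\<in>U. n\<^sup>2 * (norm (S b))\<^sup>2)"
      by (simp add: curv sum_distrib_left mult.commute)
    also have "\<dots> = (\<Sum>b\<in>U. \<Sum>i\<in>Basis. (T i \<bullet> b)\<^sup>2)"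
      by (intro sum.cong nS) auto
    also have "\<dots> = (\<Sum>i\<in>Basis. \<Sum>b\<in>U. (T i \<bullet> b)\<^sup>2)"
      by (rule sum.swap)
    also have "\<dots> \<le> (\<Sum>i\<in>Basis. (norm (T i))\<^sup>2 - (T i \<bullet> \<nu>)\<^sup>2)"
      by (intro sum_mono bessel)
    also have "\<dots> = (\<Sum>i\<in>Basis. (norm (T i))\<^sup>2) - (\<Sum>i\<in>Basis. (T i \<bullet> \<nu>)\<^sup>2)"
      by (simp add: sum_subtractf)
    also have "(\<Sum>i\<in>Basis. (T i \<bullet> \<nu>)\<^sup>2) = (norm N)\<^sup>2"
    proof -
      have "T i \<bullet> \<nu> = N \<bullet> i" for i
        using sym[of i \<nu>] by (simp add: T_def N_def A.diff A.scaleR inner_diff_left inner_commute[of \<nu>] mult.commute)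
      then show ?thesis by (simp add: sum_norm_sq_eq)
    qed
    also have "(\<Sum>i\<in>Basis. (norm (T i))\<^sup>2) = (\<Sum>i\<in>Basis. (norm (A i))\<^sup>2) - (norm (A \<nu>))\<^sup>2"
    proof -
      have "(norm (T i))\<^sup>2 = (norm (A i))\<^sup>2 - 2 * ((i \<bullet> \<nu>) * (A i \<bullet> A \<nu>)) + (\<nu> \<bullet> i)\<^sup>2 * (norm (A \<nu>))\<^sup>2" for i
      proof -
        have Ti: "T i = A i - (\<nu> \<bullet> i) *\<^sub>R A \<nu>"
          by (simp add: T_def A.diff A.scaleR inner_commute)
        have "T i \<bullet> T i = A i \<bullet> A i - 2 * ((i \<bullet> \<nu>) * (A i \<bullet> A \<nu>)) + (\<nu> \<bullet> i)\<^sup>2 * (A \<nu> \<bullet> A \<nu>)"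
          unfolding Ti by (simp add: inner_diff_left inner_diff_right inner_commute power2_eq_square algebra_simps)
        then show ?thesis
          unfolding power2_norm_eq_inner .
      qed
      then have "(\<Sum>i\<in>Basis. (norm (T i))\<^sup>2) = (\<Sum>i\<in>Basis. (norm (A i))\<^sup>2) - 2 * (\<Sum>i\<in>Basis. (i \<bullet> \<nu>) * (A i \<bullet> A \<nu>))
          + (\<Sum>i\<in>Basis. (\<nu> \<bullet> i)\<^sup>2) * (norm (A \<nu>))\<^sup>2"
        by (simp add: sum.distrib sum_subtractf sum_distrib_left sum_distrib_right)
      moreover have "(\<Sum>i\<in>Basis. (\<nu> \<bullet> i)\<^sup>2) = 1"
        using sum_norm_sq_eq[of \<nu>] \<nu>1 by simp
      moreover have "(\<Sum>i\<in>Basis. (i \<bullet> \<nu>) * (A i \<bullet> A \<nu>)) = (norm (A \<nu>))\<^sup>2"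
      proof -
        have "A \<nu> = A (\<Sum>i\<in>Basis. (\<nu> \<bullet> i) *\<^sub>R i)"
          by (simp add: euclidean_representation)
        also have "\<dots> = (\<Sum>i\<in>Basis. (\<nu> \<bullet> i) *\<^sub>R A i)"
          by (simp add: A.sum A.scaleR)
        finally have "A \<nu> \<bullet> A \<nu> = (\<Sum>i\<in>Basis. (\<nu> \<bullet> i) *\<^sub>R A i) \<bullet> A \<nu>"
          by simp
        also have "\<dots> = (\<Sum>i\<in>Basis. (i \<bullet> \<nu>) * (A i \<bullet> A \<nu>))"
          by (simp add: inner_sum_left inner_commute[of \<nu>])
        finally show ?thesis
          by (simp add: power2_norm_eq_inner)
      qed
      ultimately show ?thesis by simp
    qed
    finally show ?thesis by simp
  qed
  then show ?thesis
    by (simp add: tang n_def)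
qed

section \<open>Traces\<close>

lemma AE_lebesgue_negligible: "negligible {x. \<not> P x} \<longleftrightarrow> (AE x in lebesgue. P x)"
  by (simp add: negligible_iff_null_sets completion.AE_iff_null_sets)

lemma AE_lebesgueI: "negligible N \<Longrightarrow> (\<And>x. x \<notin> N \<Longrightarrow> P x) \<Longrightarrow> (AE x in lebesgue. P x)"
  unfolding AE_lebesgue_negligible[symmetric] by (rule negligible_subset) auto

lemma lebesgue_translation:
  fixes c :: "'a::euclidean_space"
  shows "lebesgue = distr lebesgue lebesgue (\<lambda>x. x + c)" "(\<lambda>x. x + c) \<in> lebesgue \<rightarrow>\<^sub>M lebesgue"
proof -
  have eq: "(\<lambda>x. c + (\<Sum>j\<in>Basis. (1 * (x \<bullet> j)) *\<^sub>R j)) = (\<lambda>x. x + c)"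
    by (simp add: euclidean_representation add.commute)
  show "(\<lambda>x. x + c) \<in> lebesgue \<rightarrow>\<^sub>M lebesgue"
    using lebesgue_affine_measurable[of "\<lambda>_. 1" c] unfolding eq by simp
  show "lebesgue = distr lebesgue lebesgue (\<lambda>x. x + c)"
    using lebesgue_affine_euclidean[of "\<lambda>_. 1" c] unfolding eq by (simp add: density_1)
qed

lemma integrable_lebesgue_translation:
  fixes F :: "'a::euclidean_space \<Rightarrow> real"
  assumes "integrable lebesgue F"
  shows "integrable lebesgue (\<lambda>x. F (x + c))"
proof -
  have "integrable (distr lebesgue lebesgue (\<lambda>x. x + c)) F"
    using assms lebesgue_translation(1)[of c] by simp
  then show ?thesis
    by (rule integrable_distr[OF lebesgue_translation(2)])
qed

lemma integral_lebesgue_translation: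
  fixes F :: "'a::euclidean_space \<Rightarrow> real"
  assumes "F \<in> borel_measurable lebesgue"
  shows "integral\<^sup>L lebesgue (\<lambda>x. F (x + c)) = integral\<^sup>L lebesgue F"
proof -
  have "integral\<^sup>L (distr lebesgue lebesgue (\<lambda>x. x + c)) F = integral\<^sup>L lebesgue (\<lambda>x. F (x + c))"
    by (rule integral_distr[OF lebesgue_translation(2) assms])
  then show ?thesis
    using lebesgue_translation(1)[of c] by simp
qed

text \<open>Fubini is applied to a Borel set, whereas \<open>E\<close> is only Lebesgue measurable.
  So \<open>E\<close> is split into a Borel set, whose sections are null along with those of
  \<open>E\<close>, and a subset of a Borel null set.\<close>

lemma negligible_sections:
  fixes E :: "('a::euclidean_space \<times> 'b::euclidean_space) set"
  assumes E: "E \<in> sets lebesgue" and sec: "\<And>x. negligible {y. (y, x) \<in> E}"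
  shows "negligible E"
proof -
  obtain S N N' where S: "E = S \<union> N" "N \<subseteq> N'" "N' \<in> null_sets lborel" "S \<in> sets lborel"
    using sets_completionE[OF E] by metis
  have [measurable]: "S \<in> sets borel"
    using S by simp
  have S': "S \<in> sets (lborel \<Otimes>\<^sub>M lborel)"
    unfolding lborel_prod by (fact S(4))
  have "emeasure (lborel \<Otimes>\<^sub>M lborel) S = (\<integral>\<^sup>+x. emeasure lborel ((\<lambda>y. (y, x)) -` S) \<partial>lborel)"
    by (rule lborel_pair.emeasure_pair_measure_alt2[OF S'])
  also have "\<dots> = (\<integral>\<^sup>+x. 0 \<partial>(lborel::'b measure))"
  proof (rule nn_integral_cong)
    fix x :: 'b
    have "(\<lambda>y. (y, x)) -` S \<in> sets borel"
      using sets_Pair2[OF S', of x] by simp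
    moreover have "negligible ((\<lambda>y. (y, x)) -` S)"
      by (rule negligible_subset[OF sec[of x]]) (auto simp: S(1))
    ultimately show "emeasure lborel ((\<lambda>y. (y, x)) -` S) = 0"
      by (simp add: negligible_iff_null_sets null_sets_completion_iff null_setsD1)
  qed
  finally have "S \<in> null_sets lborel"
    using S(4) by (simp add: lborel_prod null_setsI)
  then have 1: "negligible S" and 2: "negligible N'"
    using S(3) by (auto simp: negligible_iff_null_sets null_sets_completionI)
  show ?thesis
    unfolding S(1) by (rule negligible_Un[OF 1 negligible_subset[OF 2 S(2)]])
qed

lemma negligible_snd_preimage:
  assumes "negligible (N::real set)"
  shows "negligible {p::'a::euclidean_space \<times> real. snd p \<in> N}"
proof -
  have "(0, 1) \<in> (Basis :: ('a \<times> real) set)"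
    by (simp add: Basis_prod_def)
  from negligible_inner_preimage[OF assms this] show ?thesis
    by (simp add: inner_prod_def)
qed

lemma AE_lebesgue_snd:
  assumes "AE x in lebesgue. P (x::real)"
  shows "AE p in lebesgue. P (snd (p::'a::euclidean_space \<times> real))"
  using negligible_snd_preimage[of "{x. \<not> P x}"] assms unfolding AE_lebesgue_negligible[symmetric] by simp

lemma at_right_limit_if_cauchy:
  fixes w :: "real \<Rightarrow> real"
  assumes w: "\<And>e. 0 < e \<Longrightarrow> \<exists>d>0. \<forall>s t. 0 < s \<and> s < d \<and> 0 < t \<and> t < d \<longrightarrow> \<bar>w s - w t\<bar> \<le> e"
  shows "\<exists>l. (w \<longlongrightarrow> l) (at_right 0)"
proof -
  define X where "X i = w (1 / real (Suc i))" for i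
  have small: "\<exists>M. \<forall>i\<ge>M. 1 / real (Suc i) < d" if d: "0 < d" for d
  proof -
    obtain M where M: "1 / real (Suc M) < d"
      using nat_approx_posE[OF d] .
    have "1 / real (Suc i) < d" if "M \<le> i" for i
    proof -
      have "1 / real (Suc i) \<le> 1 / real (Suc M)"
        using that by (auto simp: field_simps)
      then show ?thesis using M by linarith
    qed
    then show ?thesis by blast
  qed
  have "Cauchy X"
  proof (rule metric_CauchyI)
    fix e :: real assume e: "0 < e"
    obtain d where d: "0 < d" "\<And>s t. 0 < s \<Longrightarrow> s < d \<Longrightarrow> 0 < t \<Longrightarrow> t < d \<Longrightarrow> \<bar>w s - w t\<bar> \<le> e / 2"
      using w[of "e / 2"] e by auto
    obtain M where M: "\<And>i. M \<le> i \<Longrightarrow> 1 / real (Suc i) < d"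
      using small[OF d(1)] by blast
    have "dist (X i) (X j) < e" if "M \<le> i" "M \<le> j" for i j
      using d(2)[of "1 / real (Suc i)" "1 / real (Suc j)"] M that e by (simp add: X_def dist_real_def)
    then show "\<exists>M. \<forall>m\<ge>M. \<forall>n\<ge>M. dist (X m) (X n) < e" by blast
  qed
  then obtain l where l: "X \<longlonglongrightarrow> l"
    using Cauchy_convergent convergent_def by blast
  have "(w \<longlongrightarrow> l) (at_right 0)"
    unfolding tendsto_iff
  proof (intro allI impI)
    fix e :: real assume e: "0 < e"
    obtain d where d: "0 < d" "\<And>s t. 0 < s \<Longrightarrow> s < d \<Longrightarrow> 0 < t \<Longrightarrow> t < d \<Longrightarrow> \<bar>w s - w t\<bar> \<le> e / 2"
      using w[of "e / 2"] e by auto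
    obtain M where M: "\<And>i. M \<le> i \<Longrightarrow> 1 / real (Suc i) < d"
      using small[OF d(1)] by blast
    have "dist (w s) l < e" if s: "0 < s" "s < d" for s
    proof -
      have "(\<lambda>i. \<bar>w s - X i\<bar>) \<longlonglongrightarrow> \<bar>w s - l\<bar>"
        using l by (intro tendsto_intros)
      moreover have "\<forall>i\<ge>M. \<bar>w s - X i\<bar> \<le> e / 2"
        using d(2)[OF s] M by (simp add: X_def)
      ultimately have "\<bar>w s - l\<bar> \<le> e / 2"
        by (intro LIMSEQ_le_const2[where X = "\<lambda>i. \<bar>w s - X i\<bar>"]) auto
      then show ?thesis
        using e by (simp add: dist_real_def)
    qed
    then show "eventually (\<lambda>s. dist (w s) l < e) (at_right 0)"
      using d(1) unfolding eventually_at_right_field by blast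
  qed
  then show ?thesis by blast
qed

lemma increment_le_nn_integral:
  fixes w :: "real \<Rightarrow> real"
  assumes w: "\<And>x. s \<le> x \<Longrightarrow> x \<le> t \<Longrightarrow> (w has_real_derivative w' x) (at x)"
    and cont: "continuous_on {s..t} w'" and st: "s \<le> t"
  shows "ennreal \<bar>w t - w s\<bar> \<le> (\<integral>\<^sup>+x\<in>{s..t}. ennreal \<bar>w' x\<bar> \<partial>lborel)"
proof -
  have "has_bochner_integral lborel (\<lambda>x. indicator {s..t} x *\<^sub>R w' x) (w t - w s)"
    by (rule has_bochner_integral_FTC_Icc[OF st])
       (use w cont in \<open>auto simp: has_real_derivative_iff_has_vector_derivative[symmetric] intro: has_field_derivative_at_within\<close>)
  then have "ennreal (norm (w t - w s)) \<le> (\<integral>\<^sup>+x. norm (indicator {s..t} x *\<^sub>R w' x) \<partial>lborel)"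
    by (rule has_bochner_integral_norm_bound)
  also have "\<dots> = (\<integral>\<^sup>+x\<in>{s..t}. ennreal \<bar>w' x\<bar> \<partial>lborel)"
    by (intro nn_integral_cong) (auto simp: indicator_def)
  finally show ?thesis by simp
qed

lemma nn_integral_Ioo_tendsto_0:
  fixes F :: "real \<Rightarrow> ennreal"
  assumes [measurable]: "F \<in> borel_measurable borel" and fin: "(\<integral>\<^sup>+x\<in>{0<..<1}. F x \<partial>lborel) < \<infinity>"
  shows "(\<lambda>i. \<integral>\<^sup>+x\<in>{0<..<1 / real (Suc i)}. F x \<partial>lborel) \<longlonglongrightarrow> 0"
proof -
  have "(\<lambda>i. \<integral>\<^sup>+x\<in>{0<..<1 / real (Suc i)}. F x \<partial>lborel) \<longlonglongrightarrow> (\<integral>\<^sup>+x. 0 \<partial>(lborel::real measure))"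
  proof (rule nn_integral_dominated_convergence[where w = "\<lambda>x. F x * indicator {0<..<1} x"])
    show "AE x in lborel. F x * indicator {0<..<1 / real (Suc j)} x \<le> F x * indicator {0<..<1} x" for j
    proof (rule AE_I2)
      fix x :: real
      have "1 / real (Suc j) \<le> 1" by simp
      then have imp: "x < 1 / real (Suc j) \<Longrightarrow> x < 1" by linarith
      show "F x * indicator {0<..<1 / real (Suc j)} x \<le> F x * indicator {0<..<1} x"
        by (auto simp: indicator_def dest: imp simp del: of_nat_Suc)
    qed
    show "AE x in lborel. (\<lambda>i. F x * indicator {0<..<1 / real (Suc i)} x) \<longlonglongrightarrow> 0"
    proof (rule AE_I2)
      fix x :: real
      show "(\<lambda>i. F x * indicator {0<..<1 / real (Suc i)} x) \<longlonglongrightarrow> 0"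
      proof (cases "0 < x")
        case True
        obtain M where M: "1 / real (Suc M) < x"
          using nat_approx_posE[OF True] .
        have "F x * indicator {0<..<1 / real (Suc i)} x = 0" if "M \<le> i" for i
        proof -
          have "1 / real (Suc i) \<le> 1 / real (Suc M)"
            using that by (auto simp: field_simps)
          then show ?thesis using M by (simp add: indicator_def)
        qed
        then have "eventually (\<lambda>i. F x * indicator {0<..<1 / real (Suc i)} x = 0) sequentially"
          unfolding eventually_sequentially by blast
        then show ?thesis
          by (rule tendsto_eventually)
      qed simp
    qed
  qed (use fin in auto)
  then show ?thesis by simp
qed

text \<open>Increments within \<open>(0, d)\<close> are bounded by the integral of the derivative
  there, which tends to 0 with \<open>d\<close>. This yields the limit by Cauchy's criterion, and
  the error bound by moving the endpoints to 0 and to \<open>\<delta>\<close>.\<close>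

lemma at_right_limit_of_integrable_derivative:
  fixes w :: "real \<Rightarrow> real"
  assumes w: "\<And>x. 0 < x \<Longrightarrow> (w has_real_derivative w' x) (at x)"
    and cont: "continuous_on {0<..} w'"
    and fin: "(\<integral>\<^sup>+x\<in>{0<..<1}. ennreal \<bar>w' x\<bar> \<partial>lborel) < \<infinity>"
  obtains l where "(w \<longlongrightarrow> l) (at_right 0)"
    "\<forall>\<delta>>0. ennreal \<bar>l - w \<delta>\<bar> \<le> (\<integral>\<^sup>+x\<in>{0<..<\<delta>}. ennreal \<bar>w' x\<bar> \<partial>lborel)"
proof -
  define I where "I d = (\<integral>\<^sup>+x\<in>{0<..<d}. ennreal \<bar>w' x\<bar> \<partial>lborel)" for d :: real
  have inc: "ennreal \<bar>w t - w s\<bar> \<le> I d" if st: "0 < s" "s \<le> t" "t < d" for s t d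
  proof -
    have "ennreal \<bar>w t - w s\<bar> \<le> (\<integral>\<^sup>+x\<in>{s..t}. ennreal \<bar>w' x\<bar> \<partial>lborel)"
      using st by (intro increment_le_nn_integral w continuous_on_subset[OF cont]) auto
    also have "\<dots> \<le> I d"
      unfolding I_def using st by (intro nn_integral_mono) (auto simp: indicator_def)
    finally show ?thesis .
  qed
  have inc2: "ennreal \<bar>w t - w s\<bar> \<le> I d" if "0 < s" "0 < t" "t < d" "s < d" for s t d
    using inc[of s t d] inc[of t s d] that by (cases "s \<le> t") (auto simp: abs_minus_commute)
  define F where "F x = ennreal \<bar>indicator {0<..} x *\<^sub>R w' x\<bar>" for x
  have [measurable]: "F \<in> borel_measurable borel"
    unfolding F_def using borel_measurable_continuous_on_indicator[OF _ cont] by measurable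
  have IF: "I d = (\<integral>\<^sup>+x\<in>{0<..<d}. F x \<partial>lborel)" for d
    unfolding I_def F_def by (intro nn_integral_cong) (auto simp: indicator_def)
  have lim0: "(\<lambda>i. I (1 / real (Suc i))) \<longlonglongrightarrow> 0"
    unfolding IF by (rule nn_integral_Ioo_tendsto_0) (use fin in \<open>simp_all add: IF[symmetric] I_def[symmetric]\<close>)
  have "\<exists>l. (w \<longlongrightarrow> l) (at_right 0)"
  proof (rule at_right_limit_if_cauchy)
    fix e :: real assume e: "0 < e"
    have "eventually (\<lambda>i. I (1 / real (Suc i)) < ennreal e) sequentially"
      using lim0 e by (intro order_tendstoD) auto
    then obtain i where i: "I (1 / real (Suc i)) < ennreal e"
      unfolding eventually_sequentially by blast
    have "\<bar>w s - w t\<bar> \<le> e" if "0 < s" "s < 1 / real (Suc i)" "0 < t" "t < 1 / real (Suc i)" for s t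
    proof -
      have "ennreal \<bar>w s - w t\<bar> \<le> ennreal e"
        using inc2[of t s "1 / real (Suc i)"] that i by (meson less_imp_le order_trans)
      then show ?thesis using e by simp
    qed
    then show "\<exists>d>0. \<forall>s t. 0 < s \<and> s < d \<and> 0 < t \<and> t < d \<longrightarrow> \<bar>w s - w t\<bar> \<le> e"
      by (intro exI[of _ "1 / real (Suc i)"]) auto
  qed
  then obtain l where l: "(w \<longlongrightarrow> l) (at_right 0)" by blast
  have "ennreal \<bar>l - w \<delta>\<bar> \<le> I \<delta>" if \<delta>: "0 < \<delta>" for \<delta>
  proof -
    have ev: "ennreal \<bar>w s - w t\<bar> \<le> I \<delta>" if "0 < s" "s < \<delta>" "0 < t" "t < \<delta>" for s t
      using inc2[of t s \<delta>] that by simp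
    \<comment> \<open>Increments are controlled for points strictly below \<open>\<delta>\<close>,
      so the upper endpoint is reached by left continuity.\<close>
    have c: "(w \<longlongrightarrow> w \<delta>) (at_left \<delta>)"
      using DERIV_isCont[OF w[OF \<delta>]] by (simp add: isCont_def filterlim_at_split)
    have 1: "ennreal \<bar>l - w t\<bar> \<le> I \<delta>" if t: "0 < t" "t < \<delta>" for t
    proof (rule tendsto_upperbound)
      show "((\<lambda>s. ennreal \<bar>w s - w t\<bar>) \<longlongrightarrow> ennreal \<bar>l - w t\<bar>) (at_right 0)"
        using l by (intro tendsto_intros)
      show "eventually (\<lambda>s. ennreal \<bar>w s - w t\<bar> \<le> I \<delta>) (at_right 0)"
        unfolding eventually_at_right_field using ev t by (intro exI[of _ \<delta>]) auto
    qed simp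
    show ?thesis
    proof (rule tendsto_upperbound)
      show "((\<lambda>t. ennreal \<bar>l - w t\<bar>) \<longlongrightarrow> ennreal \<bar>l - w \<delta>\<bar>) (at_left \<delta>)"
        using c by (intro tendsto_intros)
      show "eventually (\<lambda>t. ennreal \<bar>l - w t\<bar> \<le> I \<delta>) (at_left \<delta>)"
        unfolding eventually_at_left_field using 1 \<delta> by (intro exI[of _ 0]) auto
    qed simp
  qed
  then show ?thesis
    using that l unfolding I_def by blast
qed

section \<open>Traces and vertical variation\<close>

lemma trace_eqI:
  assumes "((\<lambda>x. v (y, x)) \<longlongrightarrow> l) (at_right 0)"
  shows "trace v y = l"
  unfolding trace_def using assms by (intro tendsto_Lim) auto

lemma open_half_space: "open (half_space :: ((real^'n) \<times> real) set)"
  unfolding half_space_def by (intro open_Collect_less continuous_intros)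

lemma open_half_ball: "open (half_ball R :: ((real^'n) \<times> real) set)"
  unfolding half_ball_def by (intro open_Int open_half_space) auto

definition C1_on :: "'a::euclidean_space set \<Rightarrow> ('a \<Rightarrow> real) \<Rightarrow> bool"
  where "C1_on X v \<longleftrightarrow> (\<forall>p\<in>X. v differentiable (at p)) \<and> continuous_on X (grad v)"

text \<open>Valued in \<open>ennreal\<close> because finiteness can be expected only for almost
  every \<open>y\<close>. Where the variation up to height 1 is finite, the trace exists, and the
  variation up to \<open>\<delta>\<close> bounds its distance from the slice at height
  \<open>\<delta>\<close>.\<close>

definition vertical_variation :: "((real^'n) \<times> real \<Rightarrow> real) \<Rightarrow> real \<Rightarrow> real^'n \<Rightarrow> ennreal"
  where "vertical_variation v \<delta> y = (\<integral>\<^sup>+x\<in>{0<..<\<delta>}. ennreal \<bar>snd (grad v (y, x))\<bar> \<partial>lborel)"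

lemma C1_on_vertical_derivative:
  assumes v: "C1_on half_space v" and x: "0 < x"
  shows "((\<lambda>x. v (y, x)) has_real_derivative snd (grad v (y, x))) (at x)"
proof -
  have "v differentiable (at (y, x))"
    using v x by (simp add: C1_on_def half_space_def)
  then have d: "(v has_derivative (\<lambda>h. h \<bullet> grad v (y, x))) (at (y, x))"
    by (rule grad_has_derivative)
  have e: "((\<lambda>x. (y, x)) has_derivative (\<lambda>h. (0, h))) (at x)"
    by (auto intro!: derivative_eq_intros)
  have "((\<lambda>x. v (y, x)) has_derivative (\<lambda>h. (0, h) \<bullet> grad v (y, x))) (at x)"
    using has_derivative_compose[OF e d] .
  then show ?thesis
    by (rule has_derivative_imp_has_field_derivative) (simp add: inner_prod_def)
qed

lemma C1_on_vertical_continuous: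
  assumes "C1_on half_space v"
  shows "continuous_on {0<..} (\<lambda>x. snd (grad v (y, x)))"
proof -
  have "continuous_on half_space (grad v)"
    using assms by (simp add: C1_on_def)
  then have "continuous_on {0<..} (\<lambda>x. grad v (y, x))"
    by (rule continuous_on_compose2) (auto intro!: continuous_on_Pair continuous_on_const continuous_on_id simp: half_space_def)
  then show ?thesis
    by (rule continuous_on_snd)
qed

lemma C1_on_trace:
  assumes v: "C1_on half_space v" and fin: "vertical_variation v 1 y < \<infinity>"
  shows "((\<lambda>x. v (y, x)) \<longlongrightarrow> trace v y) (at_right 0)"
    "0 < \<delta> \<Longrightarrow> ennreal \<bar>trace v y - v (y, \<delta>)\<bar> \<le> vertical_variation v \<delta> y"
proof -
  obtain l where l: "((\<lambda>x. v (y, x)) \<longlongrightarrow> l) (at_right 0)"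
    "\<forall>\<delta>>0. ennreal \<bar>l - v (y, \<delta>)\<bar> \<le> (\<integral>\<^sup>+x\<in>{0<..<\<delta>}. ennreal \<bar>snd (grad v (y, x))\<bar> \<partial>lborel)"
    by (rule at_right_limit_of_integrable_derivative[OF C1_on_vertical_derivative[OF v] C1_on_vertical_continuous[OF v]
        fin[unfolded vertical_variation_def]])
  show "((\<lambda>x. v (y, x)) \<longlongrightarrow> trace v y) (at_right 0)"
    using l(1) trace_eqI[of v y l] by simp
  show "0 < \<delta> \<Longrightarrow> ennreal \<bar>trace v y - v (y, \<delta>)\<bar> \<le> vertical_variation v \<delta> y"
    using l(2) trace_eqI[of v y l, OF l(1)] by (simp add: vertical_variation_def)
qed

lemma vertical_variation_measurable [measurable]:
  assumes v: "C1_on half_space v"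
  shows "vertical_variation v \<delta> \<in> borel_measurable borel"
proof -
  have "continuous_on half_space (\<lambda>p. snd (grad v p))"
    using v by (intro continuous_intros) (simp add: C1_on_def)
  then have [measurable]: "(\<lambda>p. indicator half_space p *\<^sub>R snd (grad v p)) \<in> borel_measurable borel"
    by (intro borel_measurable_continuous_on_indicator) (intro borel_open open_half_space)
  have eq: "vertical_variation v \<delta> = (\<lambda>y. \<integral>\<^sup>+x\<in>{0<..<\<delta>}. ennreal \<bar>indicator half_space (y, x) *\<^sub>R snd (grad v (y, x))\<bar> \<partial>lborel)"
    unfolding vertical_variation_def
    by (intro ext nn_integral_cong) (auto simp: indicator_def half_space_def)
  have "(\<lambda>y. \<integral>\<^sup>+x\<in>{0<..<\<delta>}. ennreal \<bar>indicator half_space (y, x) *\<^sub>R snd (grad v (y, x))\<bar> \<partial>lborel) \<in> borel_measurable lborel"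
    by measurable
  then show ?thesis
    unfolding eq by simp
qed

text \<open>A weighted Young inequality, integrated by Fubini. The energy carries the factor
  \<open>\<epsilon>\<close>, the integral of \<open>1 / m\<close> over \<open>(0, \<delta>)\<close>
  the factor \<open>1 / \<epsilon>\<close>. As the latter integral tends to 0 with
  \<open>\<delta>\<close> once \<open>1 / m\<close> is integrable, the bound becomes small by
  sending first \<open>\<delta>\<close> and then \<open>\<epsilon>\<close> to 0.\<close>

lemma vertical_variation_integral_le:
  fixes v :: "(real^'n) \<times> real \<Rightarrow> real"
  assumes v: "C1_on half_space v" and m: "m \<in> borel_measurable borel" "\<And>x. 0 < m x" and \<epsilon>: "0 < \<epsilon>" and \<delta>: "\<delta> \<le> 1"
  shows "(\<integral>\<^sup>+y\<in>ball 0 r. vertical_variation v \<delta> y \<partial>lborel)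
    \<le> ennreal \<epsilon> * (\<integral>\<^sup>+p\<in>ball 0 r \<times> {0<..<1}. ennreal (m (snd p) * (norm (grad v p))\<^sup>2) \<partial>lborel)
      + ennreal (1 / \<epsilon>) * (\<integral>\<^sup>+x\<in>{0<..<\<delta>}. ennreal (1 / m x) \<partial>lborel) * emeasure lborel (ball (0::real^'n) r)"
proof -
  let ?B = "ball (0::real^'n) r"
  have [measurable]: "m \<in> borel_measurable borel" by (fact m)
  have cont: "continuous_on half_space (grad v)"
    using v by (simp add: C1_on_def)
  \<comment> \<open>Extension by 0 makes the gradient a Borel function on the whole space, where
    Fubini is applied.\<close>
  define G where "G p = indicator half_space p *\<^sub>R grad v p" for p
  have [measurable]: "G \<in> borel_measurable borel"
    unfolding G_def[abs_def] using cont by (intro borel_measurable_continuous_on_indicator) (intro borel_open open_half_space)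
  have pt: "\<bar>snd a\<bar> \<le> \<epsilon> * (m x * (norm a)\<^sup>2) + 1 / \<epsilon> * (1 / m x)" for a :: "(real^'n) \<times> real" and x
  proof -
    define t where "t = \<epsilon> * m x"
    have t: "0 < t" using \<epsilon> m(2) by (simp add: t_def)
    have "\<bar>snd a\<bar> \<le> t * (snd a)\<^sup>2 + 1 / t"
    proof (cases "\<bar>snd a\<bar> \<le> 1 / t")
      case True
      have "0 \<le> t * (snd a)\<^sup>2" using t by simp
      then show ?thesis using True by linarith
    next
      case False
      then have "1 \<le> t * \<bar>snd a\<bar>"
        using t by (simp add: field_simps)
      then have "1 * \<bar>snd a\<bar> \<le> t * \<bar>snd a\<bar> * \<bar>snd a\<bar>"
        by (intro mult_right_mono) auto
      then have "\<bar>snd a\<bar> \<le> t * (snd a)\<^sup>2"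
        by (simp add: power2_eq_square abs_mult[symmetric] mult.assoc)
      moreover have "0 < 1 / t" using t by simp
      ultimately show ?thesis
        by linarith
    qed
    also have "\<dots> \<le> t * (norm a)\<^sup>2 + 1 / t"
    proof -
      have "(snd a)\<^sup>2 \<le> (norm a)\<^sup>2"
        by (simp add: norm_prod_def)
      then show ?thesis
        using t by (intro add_mono mult_left_mono) auto
    qed
    finally show ?thesis by (simp add: t_def mult.assoc)
  qed
  define J0 where "J0 p = ennreal \<bar>snd (G p)\<bar> * indicator {0<..<\<delta>} (snd p) * indicator ?B (fst p)" for p
  define J1 where "J1 p = ennreal (m (snd p) * (norm (G p))\<^sup>2) * indicator {0<..<1} (snd p) * indicator ?B (fst p)" for p
  define J2 where "J2 p = ennreal (1 / m (snd p)) * indicator {0<..<\<delta>} (snd p) * indicator ?B (fst p)" for p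
  have fs: "fst \<in> borel_measurable (borel :: ((real^'n) \<times> real) measure)"
    "snd \<in> borel_measurable (borel :: ((real^'n) \<times> real) measure)"
    by (auto intro!: borel_measurable_continuous_onI continuous_on_fst continuous_on_snd continuous_on_id)
  have gs: "(\<lambda>p. snd (G p)) \<in> borel_measurable borel"
    using measurable_compose[OF \<open>G \<in> borel_measurable borel\<close> fs(2)] by simp
  have J [measurable]: "J0 \<in> borel_measurable borel" "J1 \<in> borel_measurable borel" "J2 \<in> borel_measurable borel"
  proof -
    have [measurable]: "(\<lambda>p. snd (G p)) \<in> borel_measurable borel" "(\<lambda>p. m (snd p)) \<in> borel_measurable (borel :: ((real^'n) \<times> real) measure)"
      using gs measurable_compose[OF fs(2) m(1)] by simp_all
    have [measurable]: "(\<lambda>p. indicator {0<..<d} (snd p) :: ennreal) \<in> borel_measurable (borel :: ((real^'n) \<times> real) measure)" for d :: real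
      by (rule measurable_compose[OF fs(2)]) simp
    have [measurable]: "(\<lambda>p. indicator ?B (fst p) :: ennreal) \<in> borel_measurable (borel :: ((real^'n) \<times> real) measure)"
      by (rule measurable_compose[OF fs(1) borel_measurable_indicator]) auto
    show "J0 \<in> borel_measurable borel" "J1 \<in> borel_measurable borel" "J2 \<in> borel_measurable borel"
      unfolding J0_def[abs_def] J1_def[abs_def] J2_def[abs_def] by measurable
  qed
  have fst: "(\<integral>\<^sup>+y. \<integral>\<^sup>+x. J (y, x) \<partial>lborel \<partial>lborel) = (\<integral>\<^sup>+p. J p \<partial>lborel)" if "J \<in> borel_measurable borel"
    for J :: "(real^'n) \<times> real \<Rightarrow> ennreal"
    using lborel.nn_integral_fst[of J lborel] that by (simp add: lborel_prod)
  have "(\<integral>\<^sup>+y\<in>?B. vertical_variation v \<delta> y \<partial>lborel) = (\<integral>\<^sup>+y. \<integral>\<^sup>+x. J0 (y, x) \<partial>lborel \<partial>lborel)"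
  proof (rule nn_integral_cong)
    fix y :: "real^'n"
    have "(\<lambda>x. (y, x)) \<in> borel_measurable (borel :: real measure)"
      by (intro borel_measurable_continuous_onI continuous_on_Pair continuous_on_const continuous_on_id)
    from measurable_compose[OF this gs] have [measurable]: "(\<lambda>x. snd (G (y, x))) \<in> borel_measurable borel" .
    have mm: "(\<lambda>x. ennreal \<bar>snd (G (y, x))\<bar> * indicator {0<..<\<delta>} x) \<in> borel_measurable lborel"
      by measurable
    have "vertical_variation v \<delta> y = (\<integral>\<^sup>+x. ennreal \<bar>snd (G (y, x))\<bar> * indicator {0<..<\<delta>} x \<partial>lborel)"
      unfolding vertical_variation_def by (intro nn_integral_cong) (auto simp: G_def indicator_def half_space_def)
    then show "vertical_variation v \<delta> y * indicator ?B y = (\<integral>\<^sup>+x. J0 (y, x) \<partial>lborel)"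
      using nn_integral_multc[OF mm, of "indicator ?B y"] by (simp add: J0_def)
  qed
  also have "\<dots> = (\<integral>\<^sup>+p. J0 p \<partial>lborel)"
    by (rule fst) (rule J)
  also have "\<dots> \<le> (\<integral>\<^sup>+p. ennreal \<epsilon> * J1 p + ennreal (1 / \<epsilon>) * J2 p \<partial>lborel)"
  proof (intro nn_integral_mono)
    fix p :: "(real^'n) \<times> real"
    have "ennreal \<bar>snd (G p)\<bar> \<le> ennreal (\<epsilon> * (m (snd p) * (norm (G p))\<^sup>2) + 1 / \<epsilon> * (1 / m (snd p)))"
      by (intro ennreal_leI pt)
    also have "\<dots> = ennreal \<epsilon> * ennreal (m (snd p) * (norm (G p))\<^sup>2) + ennreal (1 / \<epsilon>) * ennreal (1 / m (snd p))"
    proof -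
      have lin: "ennreal (a * b + c * d) = ennreal a * ennreal b + ennreal c * ennreal d"
        if "0 \<le> a" "0 \<le> b" "0 \<le> c" "0 \<le> d" for a b c d
        using that by (simp add: ennreal_mult)
      show ?thesis
        using \<epsilon> m(2)[of "snd p"] by (intro lin) auto
    qed
    finally have "ennreal \<bar>snd (G p)\<bar> \<le> ennreal \<epsilon> * ennreal (m (snd p) * (norm (G p))\<^sup>2) + ennreal (1 / \<epsilon>) * ennreal (1 / m (snd p))" .
    then show "J0 p \<le> ennreal \<epsilon> * J1 p + ennreal (1 / \<epsilon>) * J2 p"
      using \<delta> by (auto simp: indicator_def J0_def J1_def J2_def)
  qed
  also have "\<dots> = ennreal \<epsilon> * (\<integral>\<^sup>+p. J1 p \<partial>lborel) + ennreal (1 / \<epsilon>) * (\<integral>\<^sup>+p. J2 p \<partial>lborel)"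
    by (subst nn_integral_add) (auto simp: nn_integral_cmult)
  also have "(\<integral>\<^sup>+p. J2 p \<partial>lborel) = (\<integral>\<^sup>+y. \<integral>\<^sup>+x. J2 (y, x) \<partial>lborel \<partial>lborel)"
    by (rule fst[symmetric]) (rule J)
  also have "\<dots> = (\<integral>\<^sup>+y. (\<integral>\<^sup>+x\<in>{0<..<\<delta>}. ennreal (1 / m x) \<partial>lborel) * indicator ?B y \<partial>lborel)"
    by (intro nn_integral_cong) (simp add: J2_def nn_integral_multc)
  also have "\<dots> = (\<integral>\<^sup>+x\<in>{0<..<\<delta>}. ennreal (1 / m x) \<partial>lborel) * emeasure lborel ?B"
    by (rule nn_integral_cmult_indicator) simp
  also have "(\<integral>\<^sup>+p. J1 p \<partial>lborel) = (\<integral>\<^sup>+p\<in>?B \<times> {0<..<1}. ennreal (m (snd p) * (norm (grad v p))\<^sup>2) \<partial>lborel)"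
    by (intro nn_integral_cong) (auto simp: J1_def G_def indicator_def half_space_def)
  finally show ?thesis
    by (simp add: mult.assoc)
qed

section \<open>Locally Lipschitz functions on the half-space\<close>

lemma C1_vector_lipschitz:
  fixes f :: "'a::euclidean_space \<Rightarrow> 'b::real_normed_vector"
  assumes X: "open X" "x \<in> X" and f: "\<And>p. p \<in> X \<Longrightarrow> (f has_derivative F p) (at p)"
    and cont: "\<And>h. continuous_on X (\<lambda>p. F p h)"
  shows "\<exists>r>0. \<exists>L. cball x r \<subseteq> X \<and> L-lipschitz_on (cball x r) f"
proof -
  obtain r where r: "0 < r" "cball x r \<subseteq> X"
    using X open_contains_cball by blast
  have c: "continuous_on (cball x r) (\<lambda>p. \<Sum>b\<in>Basis. norm (F p b))"
    by (intro continuous_on_sum continuous_on_norm continuous_on_subset[OF cont r(2)])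
  have "bounded ((\<lambda>p. \<Sum>b\<in>Basis. norm (F p b)) ` cball x r)"
    by (rule compact_imp_bounded[OF compact_continuous_image[OF c compact_cball]])
  then obtain B where "\<forall>z\<in>(\<lambda>p. \<Sum>b\<in>Basis. norm (F p b)) ` cball x r. norm z \<le> B"
    unfolding bounded_iff by blast
  then have B: "norm (\<Sum>b\<in>Basis. norm (F p b)) \<le> B" if "p \<in> cball x r" for p
    using that by blast
  have "x \<in> cball x r"
    using r(1) by simp
  then have B0: "0 \<le> B"
    using order_trans[OF norm_ge_zero B] by blast
  have fp: "(f has_derivative F p) (at p)" if "p \<in> cball x r" for p
    by (rule f) (use r(2) that in blast)
  have "B-lipschitz_on (cball x r) f"
  proof (rule bounded_derivative_imp_lipschitz)
    show "(f has_derivative F p) (at p within cball x r)" if "p \<in> cball x r" for p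
      by (rule has_derivative_at_withinI[OF fp[OF that]])
    show "onorm (F p) \<le> B" if p: "p \<in> cball x r" for p
    proof (rule onorm_bound[OF B0])
      fix h
      interpret F: bounded_linear "F p"
        by (rule has_derivative_bounded_linear[OF fp[OF p]])
      have "F p h = F p (\<Sum>b\<in>Basis. (h \<bullet> b) *\<^sub>R b)"
        by (simp add: euclidean_representation)
      also have "\<dots> = (\<Sum>b\<in>Basis. (h \<bullet> b) *\<^sub>R F p b)"
        by (simp add: F.sum F.scaleR)
      finally have eq: "F p h = (\<Sum>b\<in>Basis. (h \<bullet> b) *\<^sub>R F p b)" .
      have "norm (F p h) \<le> (\<Sum>b\<in>Basis. norm ((h \<bullet> b) *\<^sub>R F p b))"
        unfolding eq by (rule norm_sum)
      also have "\<dots> \<le> (\<Sum>b\<in>Basis. norm h * norm (F p b))"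
        by (intro sum_mono) (auto intro!: mult_right_mono Basis_le_norm)
      also have "\<dots> = (\<Sum>b\<in>Basis. norm (F p b)) * norm h"
        by (simp add: sum_distrib_left[symmetric] mult.commute)
      also have "\<dots> \<le> B * norm h"
        using B[OF p] by (intro mult_right_mono) auto
      finally show "norm (F p h) \<le> B * norm h" .
    qed
  qed (use B0 in auto)
  then show ?thesis
    using r by blast
qed

lemma C1_on_locally_lipschitz:
  fixes v :: "'a::euclidean_space \<Rightarrow> real"
  assumes X: "open X" and v: "C1_on X v"
  shows "locally_lipschitz_on X v"
proof (rule locally_lipschitz_onI)
  fix x assume x: "x \<in> X"
  have "\<exists>r>0. \<exists>L. cball x r \<subseteq> X \<and> L-lipschitz_on (cball x r) v"
  proof (rule C1_vector_lipschitz[OF X x])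
    show "(v has_derivative (\<lambda>h. h \<bullet> grad v p)) (at p)" if "p \<in> X" for p
      using v that by (intro grad_has_derivative) (simp add: C1_on_def)
    show "continuous_on X (\<lambda>p. h \<bullet> grad v p)" for h
      using v by (intro continuous_on_inner continuous_on_const) (simp add: C1_on_def)
  qed
  then obtain r L where "0 < r" "L-lipschitz_on (cball x r) v"
    by blast
  then show "\<exists>r>0. \<exists>L. L-lipschitz_on (cball x r \<inter> X) v"
    using lipschitz_on_subset[of L "cball x r" v "cball x r \<inter> X"] by blast
qed

lemma locally_lipschitz_on_lipschitz:
  assumes "L-lipschitz_on X f"
  shows "locally_lipschitz_on X f"
proof (rule locally_lipschitz_onI)
  fix x
  show "\<exists>r>0. \<exists>L. L-lipschitz_on (cball x r \<inter> X) f"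
    using lipschitz_on_subset[OF assms, of "cball x 1 \<inter> X"] by (intro exI[of _ 1]) auto
qed

lemma locally_lipschitz_on_mult:
  fixes v w :: "'a::euclidean_space \<Rightarrow> real"
  assumes X: "open X" and v: "locally_lipschitz_on X v" and w: "locally_lipschitz_on X w"
  shows "locally_lipschitz_on X (\<lambda>p. v p * w p)"
proof (rule locally_lipschitz_onI)
  fix x assume x: "x \<in> X"
  obtain r1 L1 where 1: "0 < r1" "L1-lipschitz_on (cball x r1) v"
    using locally_lipschitz_onE[OF v X x] by blast
  obtain r2 L2 where 2: "0 < r2" "L2-lipschitz_on (cball x r2) w"
    using locally_lipschitz_onE[OF w X x] by blast
  define r where "r = min r1 r2"
  have r: "0 < r" using 1 2 by (simp add: r_def)
  have v1: "L1-lipschitz_on (cball x r) v" and w2: "L2-lipschitz_on (cball x r) w"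
    by (rule lipschitz_on_subset[OF 1(2)] lipschitz_on_subset[OF 2(2)]; auto simp: r_def)+
  have L: "0 \<le> L1" "0 \<le> L2"
    using 1 2 lipschitz_on_nonneg by blast+
  define A B where "A = \<bar>v x\<bar> + L1 * r" and "B = \<bar>w x\<bar> + L2 * r"
  have AB: "0 \<le> A" "0 \<le> B"
    using L r by (simp_all add: A_def B_def)
  have vA: "\<bar>v y\<bar> \<le> A" and wB: "\<bar>w y\<bar> \<le> B" if y: "y \<in> cball x r" for y
  proof -
    have yx: "norm (y - x) \<le> r" and xr: "x \<in> cball x r"
      using y r by (auto simp: dist_norm norm_minus_commute)
    have "\<bar>v y - v x\<bar> \<le> L1 * norm (y - x)" "\<bar>w y - w x\<bar> \<le> L2 * norm (y - x)"
      by (rule lipschitz_on_real_bound[OF v1 y xr] lipschitz_on_real_bound[OF w2 y xr])+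
    moreover have "L1 * norm (y - x) \<le> L1 * r" "L2 * norm (y - x) \<le> L2 * r"
      using yx L by (auto intro!: mult_left_mono)
    ultimately show "\<bar>v y\<bar> \<le> A" "\<bar>w y\<bar> \<le> B"
      unfolding A_def B_def by linarith+
  qed
  have "(A * L2 + B * L1)-lipschitz_on (cball x r) (\<lambda>p. v p * w p)"
  proof (rule lipschitz_onI)
    fix y z assume y: "y \<in> cball x r" and z: "z \<in> cball x r"
    have "v y * w y - v z * w z = v y * (w y - w z) + w z * (v y - v z)"
      by (simp add: algebra_simps)
    then have "\<bar>v y * w y - v z * w z\<bar> \<le> \<bar>v y\<bar> * \<bar>w y - w z\<bar> + \<bar>w z\<bar> * \<bar>v y - v z\<bar>"
      by (metis abs_mult abs_triangle_ineq)
    also have "\<dots> \<le> A * (L2 * norm (y - z)) + B * (L1 * norm (y - z))"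
      using vA[OF y] wB[OF z] lipschitz_on_real_bound[OF v1 y z] lipschitz_on_real_bound[OF w2 y z] AB
      by (intro add_mono mult_mono) auto
    finally show "dist (v y * w y) (v z * w z) \<le> (A * L2 + B * L1) * dist y z"
      by (simp add: dist_norm algebra_simps)
  qed (use AB L in auto)
  then show "\<exists>r>0. \<exists>L. L-lipschitz_on (cball x r \<inter> X) (\<lambda>p. v p * w p)"
    using r lipschitz_on_subset[of _ "cball x r" _ "cball x r \<inter> X"] by blast
qed

lemma AE_differentiable_half_space:
  fixes v :: "(real^'n) \<times> real \<Rightarrow> real"
  assumes "locally_lipschitz_on half_space v"
  shows "AE p in lebesgue. p \<in> half_space \<longrightarrow> v differentiable (at p)"
  using rademacher_local[OF assms open_half_space] by (rule AE_lebesgueI) auto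

lemma grad_bound_lipschitz:
  fixes v :: "'a::euclidean_space \<Rightarrow> real"
  assumes X: "open X" "p \<in> X" and v: "L-lipschitz_on X v" and d: "v differentiable (at p)"
  shows "norm (grad v p) \<le> L"
proof (cases "grad v p = 0")
  case True
  then show ?thesis using lipschitz_on_nonneg[OF v] by simp
next
  case False
  define a where "a = grad v p"
  have a: "0 < norm a" using False by (simp add: a_def)
  have "norm a \<le> L + e" if e: "0 < e" for e
  proof -
    obtain d where d: "0 < d" "\<And>y. norm (y - p) < d \<Longrightarrow> norm (v y - v p - (y - p) \<bullet> a) \<le> e * norm (y - p)"
      using grad_has_derivative[OF d] e unfolding has_derivative_at_alt a_def by blast
    obtain r where r: "0 < r" "ball p r \<subseteq> X"
      using X openE by blast
    define t where "t = min d r / 2 / norm a"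
    have t: "0 < t" "norm (t *\<^sub>R a) < d" "norm (t *\<^sub>R a) < r"
      using d(1) r(1) a by (auto simp: t_def)
    have "p + t *\<^sub>R a \<in> ball p r"
      using t(3) by (simp add: dist_norm)
    then have "\<bar>v (p + t *\<^sub>R a) - v p\<bar> \<le> L * norm (t *\<^sub>R a)"
      using lipschitz_on_real_bound[OF v, of "p + t *\<^sub>R a" p] r X(2) by auto
    moreover have "\<bar>v (p + t *\<^sub>R a) - v p - (t *\<^sub>R a) \<bullet> a\<bar> \<le> e * norm (t *\<^sub>R a)"
      using d(2)[of "p + t *\<^sub>R a"] t(2) by simp
    ultimately have "(t *\<^sub>R a) \<bullet> a \<le> (L + e) * norm (t *\<^sub>R a)"
      by (simp add: distrib_right)
    then have "(t * norm a) * norm a \<le> (t * norm a) * (L + e)"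
      using t(1) by (simp add: dot_square_norm power2_eq_square algebra_simps)
    then show ?thesis
      using t(1) a by (simp only: mult_le_cancel_left_pos mult_pos_pos)
  qed
  then show ?thesis
    unfolding a_def by (meson field_le_epsilon)
qed

text \<open>Where \<open>v\<close> is not differentiable, \<open>grad v\<close> is an arbitrary
  choice. Measurability therefore comes from completeness: by Rademacher's theorem the gradient
  agrees almost everywhere with a limit of Borel difference quotients.\<close>

lemma grad_measurable:
  fixes v :: "(real^'n) \<times> real \<Rightarrow> real"
  assumes v: "locally_lipschitz_on half_space v"
  shows "(\<lambda>p. indicator half_space p *\<^sub>R grad v p) \<in> borel_measurable lebesgue"
proof -
  let ?H = "half_space :: ((real^'n) \<times> real) set"
  have cont: "continuous_on ?H v"
    using local_lipschitz_continuous_on[OF v, of 0] by simp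
  define V where "V p = indicator ?H p *\<^sub>R v p" for p
  have V [measurable]: "V \<in> borel_measurable borel"
    unfolding V_def[abs_def] using cont by (intro borel_measurable_continuous_on_indicator borel_open open_half_space)
  \<comment> \<open>Difference quotients of the zero extension \<open>V\<close>; at a point of the
    open half-space they are eventually those of \<open>v\<close>.\<close>
  define q where "q b i p = indicator ?H p * (real (Suc i) * (V (p + (1 / real (Suc i)) *\<^sub>R b) - V p))" for b i p
  have [measurable]: "?H \<in> sets borel"
    by (intro borel_open open_half_space)
  have "(\<lambda>p. V (p + (1 / real (Suc i)) *\<^sub>R b)) \<in> borel_measurable borel" for i b
    by (rule measurable_compose[OF _ V]) (intro borel_measurable_continuous_onI continuous_intros)
  then have q [measurable]: "q b i \<in> borel_measurable borel" for b i
    unfolding q_def[abs_def] by measurable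
  define Q where "Q p = (\<Sum>b\<in>Basis. lim (\<lambda>i. q b i p) *\<^sub>R b)" for p
  have Q: "Q \<in> borel_measurable lebesgue"
    unfolding Q_def[abs_def] by (intro measurable_completion) measurable
  have "AE p in lebesgue. Q p = indicator ?H p *\<^sub>R grad v p"
    using AE_differentiable_half_space[OF v]
  proof eventually_elim
    fix p assume diff: "p \<in> ?H \<longrightarrow> v differentiable (at p)"
    have "(\<lambda>i. q b i p) \<longlonglongrightarrow> indicator ?H p * (b \<bullet> grad v p)" if b: "b \<in> Basis" for b
    proof (cases "p \<in> ?H")
      case True
      have "(v has_derivative (\<lambda>h. h \<bullet> grad v p)) (at p)"
        using diff True by (intro grad_has_derivative) auto
      then have d: "((\<lambda>t. v (p + t *\<^sub>R b)) has_derivative (\<lambda>h. (h *\<^sub>R b) \<bullet> grad v p)) (at 0)"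
        by (intro has_derivative_compose[of "\<lambda>t. p + t *\<^sub>R b" "\<lambda>h. h *\<^sub>R b" 0 UNIV v])
          (auto intro!: derivative_eq_intros)
      then have "((\<lambda>t. v (p + t *\<^sub>R b)) has_real_derivative (b \<bullet> grad v p)) (at 0)"
        by (rule has_derivative_imp_has_field_derivative) simp
      then have "((\<lambda>t. (v (p + t *\<^sub>R b) - v p) / t) \<longlongrightarrow> b \<bullet> grad v p) (at 0)"
        by (simp add: has_field_derivative_iff)
      moreover have h: "filterlim (\<lambda>i. 1 / real (Suc i)) (at 0) sequentially"
        unfolding filterlim_at using LIMSEQ_Suc[OF lim_1_over_n] by auto
      ultimately have lim: "(\<lambda>i. (v (p + (1 / real (Suc i)) *\<^sub>R b) - v p) / (1 / real (Suc i))) \<longlonglongrightarrow> b \<bullet> grad v p"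
        by (rule filterlim_compose)
      obtain r where r: "0 < r" "ball p r \<subseteq> ?H"
        using open_half_space True openE by blast
      obtain M where M: "1 / real (Suc M) < r"
        using nat_approx_posE[OF r(1)] .
      have "p + (1 / real (Suc i)) *\<^sub>R b \<in> ?H" if i: "M \<le> i" for i
      proof -
        have "1 / real (Suc i) \<le> 1 / real (Suc M)"
          using i by (auto simp: field_simps)
        then have "p + (1 / real (Suc i)) *\<^sub>R b \<in> ball p r"
          using M b by (simp add: dist_norm)
        then show ?thesis using r by blast
      qed
      then have "eventually (\<lambda>i. (v (p + (1 / real (Suc i)) *\<^sub>R b) - v p) / (1 / real (Suc i)) = q b i p) sequentially"
        unfolding eventually_sequentially
        using True by (intro exI[of _ M]) (auto simp: q_def V_def)
      then have "(\<lambda>i. q b i p) \<longlonglongrightarrow> b \<bullet> grad v p"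
        using lim by (rule Lim_transform_eventually[rotated])
      then show ?thesis
        using True by simp
    qed (simp add: q_def)
    then have "lim (\<lambda>i. q b i p) = indicator ?H p * (b \<bullet> grad v p)" if "b \<in> Basis" for b
      using that by (intro limI)
    then have "lim (\<lambda>i. q b i p) = indicator ?H p * (grad v p \<bullet> b)" if "b \<in> Basis" for b
      using that by (simp add: inner_commute)
    then have "Q p = (\<Sum>b\<in>Basis. (indicator ?H p * (grad v p \<bullet> b)) *\<^sub>R b)"
      unfolding Q_def by (intro sum.cong) auto
    also have "\<dots> = indicator ?H p *\<^sub>R (\<Sum>b\<in>Basis. (grad v p \<bullet> b) *\<^sub>R b)"
      by (simp add: scaleR_sum_right)
    finally show "Q p = indicator ?H p *\<^sub>R grad v p"
      by (simp add: euclidean_representation)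
  qed
  then show ?thesis
    by (rule borel_measurable_AE[OF Q])
qed

section \<open>Cutoff functions\<close>

definition cutoff :: "real \<Rightarrow> ((real^'n) \<times> real \<Rightarrow> real) \<Rightarrow> bool"
  where "cutoff R \<eta> \<longleftrightarrow> (\<exists>L. L-lipschitz_on half_space \<eta>) \<and> (\<forall>p\<in>half_space - ball 0 R. \<eta> p = 0)"

lemma cutoff_locally_lipschitz: "cutoff R \<eta> \<Longrightarrow> locally_lipschitz_on half_space \<eta>"
  unfolding cutoff_def using locally_lipschitz_on_lipschitz by blast

lemma cutoff_bounds:
  fixes \<eta> :: "(real^'n) \<times> real \<Rightarrow> real"
  assumes \<eta>: "cutoff R \<eta>" and R: "0 < R"
  obtains C where "0 \<le> C" "\<forall>p\<in>half_space. \<bar>\<eta> p\<bar> \<le> C"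
    "\<forall>p\<in>half_space. \<eta> differentiable (at p) \<longrightarrow> norm (grad \<eta> p) \<le> C"
proof -
  obtain L where L: "L-lipschitz_on half_space \<eta>" and z: "\<And>p. p \<in> half_space \<Longrightarrow> p \<notin> ball 0 R \<Longrightarrow> \<eta> p = 0"
    using \<eta> unfolding cutoff_def by blast
  have L0: "0 \<le> L"
    using L lipschitz_on_nonneg by blast
  \<comment> \<open>A reference point of the half-space outside the ball, where
    \<open>\<eta>\<close> vanishes; every point of the ball is within \<open>2 * R + 1\<close> of
    it.\<close>
  let ?q = "(0, R + 1) :: (real^'n) \<times> real"
  have q: "?q \<in> half_space" "\<eta> ?q = 0"
    using R z[of ?q] by (simp_all add: half_space_def)
  have "\<bar>\<eta> p\<bar> \<le> L * (2 * R + 1)" if p: "p \<in> half_space" for p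
  proof (cases "p \<in> ball 0 R")
    case True
    have "norm (p - ?q) \<le> norm p + norm ?q"
      by (rule norm_triangle_ineq4)
    also have "\<dots> \<le> 2 * R + 1"
      using True R by simp
    finally have "L * norm (p - ?q) \<le> L * (2 * R + 1)"
      using L0 by (rule mult_left_mono)
    then show ?thesis
      using lipschitz_on_real_bound[OF L p q(1)] q(2) by simp
  next
    case False
    then show ?thesis
      using z[OF p] L0 R by simp
  qed
  moreover have "norm (grad \<eta> p) \<le> L" if "p \<in> half_space" "\<eta> differentiable (at p)" for p
    using grad_bound_lipschitz[OF open_half_space that(1) L that(2)] .
  ultimately show ?thesis
    using L0 R by (intro that[of "max L (L * (2 * R + 1))"]) (auto simp: le_max_iff_disj)
qed

lemma cutoff_power2:
  assumes \<eta>: "cutoff R \<eta>" and R: "0 < R"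
  shows "cutoff R (\<lambda>p. (\<eta> p)\<^sup>2)"
proof -
  obtain C where C: "0 \<le> C" "\<forall>p\<in>half_space. \<bar>\<eta> p\<bar> \<le> C"
    using cutoff_bounds[OF \<eta> R] .
  obtain L where L: "L-lipschitz_on half_space \<eta>" and z: "\<forall>p\<in>half_space - ball 0 R. \<eta> p = 0"
    using \<eta> unfolding cutoff_def by blast
  have "(2 * C * L)-lipschitz_on half_space (\<lambda>p. (\<eta> p)\<^sup>2)"
  proof (rule lipschitz_onI)
    fix p q :: "(real^'a) \<times> real" assume p: "p \<in> half_space" and q: "q \<in> half_space"
    have "(\<eta> p)\<^sup>2 - (\<eta> q)\<^sup>2 = (\<eta> p + \<eta> q) * (\<eta> p - \<eta> q)"
      by (simp add: power2_eq_square algebra_simps)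
    then have "\<bar>(\<eta> p)\<^sup>2 - (\<eta> q)\<^sup>2\<bar> = \<bar>\<eta> p + \<eta> q\<bar> * \<bar>\<eta> p - \<eta> q\<bar>"
      by (simp add: abs_mult)
    also have "\<dots> \<le> (2 * C) * (L * norm (p - q))"
    proof (intro mult_mono)
      have "\<bar>\<eta> p\<bar> \<le> C" "\<bar>\<eta> q\<bar> \<le> C"
        using C(2) p q by blast+
      then show "\<bar>\<eta> p + \<eta> q\<bar> \<le> 2 * C" by linarith
    qed (use C lipschitz_on_real_bound[OF L p q] in auto)
    finally show "dist ((\<eta> p)\<^sup>2) ((\<eta> q)\<^sup>2) \<le> 2 * C * L * dist p q"
      by (simp add: dist_norm mult.assoc)
  qed (use C lipschitz_on_nonneg[OF L] in auto)
  then show ?thesis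
    using z unfolding cutoff_def by auto
qed

lemma cutoff_trace:
  assumes \<eta>: "cutoff R \<eta>"
  shows "((\<lambda>x. \<eta> (y, x)) \<longlongrightarrow> trace \<eta> y) (at_right 0)"
proof -
  obtain L where L: "L-lipschitz_on half_space \<eta>"
    using \<eta> unfolding cutoff_def by blast
  have L0: "0 \<le> L"
    using L lipschitz_on_nonneg by blast
  have "\<exists>l. ((\<lambda>x. \<eta> (y, x)) \<longlongrightarrow> l) (at_right 0)"
  proof (rule at_right_limit_if_cauchy)
    fix e :: real assume e: "0 < e"
    have "\<bar>\<eta> (y, s) - \<eta> (y, t)\<bar> \<le> e" if st: "0 < s" "s < e / (L + 1)" "0 < t" "t < e / (L + 1)" for s t
    proof -
      have "\<bar>\<eta> (y, s) - \<eta> (y, t)\<bar> \<le> L * norm ((y, s) - (y, t))"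
        using st by (intro lipschitz_on_real_bound[OF L]) (auto simp: half_space_def)
      also have "\<dots> = L * \<bar>s - t\<bar>"
        by (simp add: norm_Pair)
      also have "\<dots> \<le> (L + 1) * (e / (L + 1))"
        using st L0 by (intro mult_mono) auto
      finally show ?thesis
        using L0 by simp
    qed
    then show "\<exists>d>0. \<forall>s t. 0 < s \<and> s < d \<and> 0 < t \<and> t < d \<longrightarrow> \<bar>\<eta> (y, s) - \<eta> (y, t)\<bar> \<le> e"
      using e L0 by (intro exI[of _ "e / (L + 1)"]) auto
  qed
  then show ?thesis
    using trace_eqI[of \<eta> y] by force
qed

lemma trace_mult:
  assumes "((\<lambda>x. v (y, x)) \<longlongrightarrow> a) (at_right 0)" "((\<lambda>x. w (y, x)) \<longlongrightarrow> b) (at_right 0)"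
  shows "trace (\<lambda>p. v p * w p) y = a * b"
  by (rule trace_eqI) (intro tendsto_mult assms)

lemma trace_outside_ball:
  assumes \<xi>: "\<forall>p\<in>half_space - ball 0 R. \<xi> p = 0" and y: "y \<notin> ball 0 R"
  shows "trace \<xi> y = 0"
proof (rule trace_eqI)
  have "\<xi> (y, x) = 0" if "0 < x" for x
  proof -
    have "norm y \<le> norm (y, x)"
      using norm_fst_le[of y x] .
    then show ?thesis
      using \<xi> y that by (auto simp: half_space_def)
  qed
  then have "eventually (\<lambda>x. \<xi> (y, x) = 0) (at_right 0)"
    unfolding eventually_at_right_field by (intro exI[of _ 1]) auto
  then show "((\<lambda>x. \<xi> (y, x)) \<longlongrightarrow> 0) (at_right 0)"
    by (rule tendsto_eventually)
qed

text \<open>On the sphere itself the function may fail to be differentiable, which is why only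
  almost every point is covered. This turns gradient integrals over the half-ball into integrals
  over the half-space.\<close>

lemma AE_grad_zero_outside_ball:
  fixes \<xi> :: "(real^'n) \<times> real \<Rightarrow> real"
  assumes \<xi>: "\<forall>p\<in>half_space - ball 0 R. \<xi> p = 0"
  shows "AE p in lebesgue. p \<in> half_space - half_ball R \<longrightarrow> grad \<xi> p = 0"
proof (rule AE_lebesgueI)
  show "negligible (sphere (0 :: (real^'n) \<times> real) R)"
    by (rule negligible_sphere)
  fix p :: "(real^'n) \<times> real" assume "p \<notin> sphere 0 R"
  show "p \<in> half_space - half_ball R \<longrightarrow> grad \<xi> p = 0"
  proof
    assume "p \<in> half_space - half_ball R"
    with \<open>p \<notin> sphere 0 R\<close> have p: "p \<in> half_space - cball 0 R"
      by (auto simp: half_ball_def)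
    have "open (half_space - cball (0 :: (real^'n) \<times> real) R)"
      by (intro open_Diff open_half_space) auto
    then have "grad \<xi> p = grad (\<lambda>_. 0) p"
      using p by (rule grad_cong_open) (use \<xi> in \<open>auto\<close>)
    also have "\<dots> = 0"
      by (rule grad_unique) simp
    finally show "grad \<xi> p = 0" .
  qed
qed

section \<open>Translations parallel to the boundary\<close>

lemma has_derivative_translate:
  fixes v :: "'a::real_normed_vector \<Rightarrow> 'b::real_normed_vector"
  shows "((\<lambda>p. v (p + c)) has_derivative D) (at p) \<longleftrightarrow> (v has_derivative D) (at (p + c))"
proof
  assume d: "((\<lambda>p. v (p + c)) has_derivative D) (at p)"
  have "((\<lambda>q. q - c) has_derivative (\<lambda>h. h)) (at (p + c))"
    by (auto intro!: derivative_eq_intros)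
  from has_derivative_compose[OF this, of "\<lambda>p. v (p + c)" D] d
  show "(v has_derivative D) (at (p + c))" by simp
next
  assume d: "(v has_derivative D) (at (p + c))"
  have "((\<lambda>q. q + c) has_derivative (\<lambda>h. h)) (at p)"
    by (auto intro!: derivative_eq_intros)
  from has_derivative_compose[OF this d]
  show "((\<lambda>p. v (p + c)) has_derivative D) (at p)" by simp
qed

lemma grad_translate:
  fixes v :: "'a::real_inner \<Rightarrow> real"
  shows "grad (\<lambda>p. v (p + c)) p = grad v (p + c)"
  unfolding grad_def gderiv_def has_derivative_translate ..

lemma trace_translate: "trace (\<lambda>p. v (p + (c, 0))) y = trace v (y + c)"
  by (simp add: trace_def)

lemma locally_lipschitz_on_translate:
  fixes v :: "'a::real_normed_vector \<Rightarrow> real"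
  assumes v: "locally_lipschitz_on X v" and X: "\<And>p. p + c \<in> X \<longleftrightarrow> p \<in> X"
  shows "locally_lipschitz_on X (\<lambda>p. v (p + c))"
proof (rule locally_lipschitz_onI)
  fix x assume "x \<in> X"
  then have xc: "x + c \<in> X" by (simp add: X)
  then obtain r L where r: "0 < r" "L-lipschitz_on (cball (x + c) r \<inter> X) v"
    using v unfolding local_lipschitz_def by (metis Int_UNIV_right UNIV_I centre_in_cball less_imp_le)
  have "L-lipschitz_on (cball x r \<inter> X) (\<lambda>p. v (p + c))"
  proof (rule lipschitz_onI)
    fix p q assume "p \<in> cball x r \<inter> X" "q \<in> cball x r \<inter> X"
    then have "p + c \<in> cball (x + c) r \<inter> X" "q + c \<in> cball (x + c) r \<inter> X"
      using X by (auto simp: dist_norm)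
    from lipschitz_onD[OF r(2) this] show "dist (v (p + c)) (v (q + c)) \<le> L * dist p q"
      by (simp add: dist_norm)
  qed (rule lipschitz_on_nonneg[OF r(2)])
  then show "\<exists>r>0. \<exists>L. L-lipschitz_on (cball x r \<inter> X) (\<lambda>p. v (p + c))"
    using r(1) by blast
qed

lemma half_space_shift: "p + (c, 0) \<in> half_space \<longleftrightarrow> p \<in> half_space"
  by (simp add: half_space_def)

lemma half_ball_subset_half_space: "half_ball R \<subseteq> half_space"
  by (simp add: half_ball_def)

lemma half_ball_shift:
  fixes p :: "(real^'n) \<times> real"
  assumes "p \<in> half_ball R" "norm c \<le> 1"
  shows "p + (c, 0) \<in> half_ball (R + 1)"
proof -
  have "norm (p + (c, 0)) \<le> norm p + norm (c, 0::real)"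
    by (rule norm_triangle_ineq)
  then show ?thesis
    using assms by (simp add: half_ball_def half_space_shift norm_Pair)
qed

lemma half_sets [simp]:
  "half_space \<in> sets lebesgue" "half_ball R \<in> sets lebesgue" "ball a r \<in> sets lebesgue"
  "half_space \<in> sets borel" "half_ball R \<in> sets borel"
  by (auto intro!: borel_open open_half_space open_half_ball sets_completionI_sets)

lemma half_ball_finite: "emeasure lebesgue (half_ball R :: ((real^'n) \<times> real) set) < \<infinity>"
proof -
  have "emeasure lebesgue (half_ball R :: ((real^'n) \<times> real) set) \<le> emeasure lebesgue (ball (0 :: (real^'n) \<times> real) R)"
    by (rule emeasure_mono) (auto simp: half_ball_def)
  also have "\<dots> < \<infinity>"
    using emeasure_lborel_ball_finite[of "0 :: (real^'n) \<times> real" R] by simp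
  finally show ?thesis .
qed

lemma nn_integral_lebesgue: "(\<integral>\<^sup>+x. F x \<partial>lebesgue) = (\<integral>\<^sup>+x. F x \<partial>lborel)"
  by (rule nn_integral_completion)

section \<open>Stable weak solutions\<close>

locale stable_weak_solution =
  fixes \<mu> :: "real \<Rightarrow> real"
    and g g' :: "real \<Rightarrow> real \<Rightarrow> real"
    and f f' :: "real \<Rightarrow> real"
    and u :: "(real^'n) \<times> real \<Rightarrow> real"
  assumes mu_L1: "\<And>r. 0 < r \<Longrightarrow> set_integrable lebesgue {0<..<r} \<mu>"
    and mu_bounds: "\<And>K :: ((real^'n) \<times> real) set. compact (closure K) \<Longrightarrow> closure K \<subseteq> half_space \<Longrightarrow>
      \<exists>\<mu>1>0. \<exists>\<mu>2>0. \<forall>(y, x)\<in>K. \<mu>1 \<le> \<mu> x \<and> \<mu> x \<le> \<mu>2"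
    and mu_A2: "muckenhoupt_A2 \<mu>"
    and g_lipschitz: "\<And>x. 0 < x \<Longrightarrow> locally_lipschitz_on UNIV (g x)"
    and g_deriv_bound: "\<And>r M. 0 < r \<Longrightarrow> 0 < M \<Longrightarrow>
      \<exists>C>0. \<forall>x t D. 0 < x \<and> x < r \<and> \<bar>t\<bar> < M \<and> (g x has_real_derivative D) (at t) \<longrightarrow> \<bar>D\<bar> \<le> C"
    and f_lipschitz: "locally_lipschitz_on UNIV f"
    and g': "\<And>x. 0 < x \<Longrightarrow> derivative_version (g x) (g' x)"
    and f': "derivative_version f f'"
    and u_C2: "C2_on half_space u"
    and u_bounded: "bounded (u ` half_space)"
    and u_solution: "weak_solution \<mu> g f u"
    and u_stable: "stable_solution \<mu> g' f' u"
    and u_grad_y: "\<And>r. 0 < r \<Longrightarrow> Linfty_on (closure (half_ball r)) (\<lambda>p. norm (grad_y u p))"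
begin

section \<open>The weight and the weighted energy\<close>

lemma mu_pos: "0 < x \<Longrightarrow> 0 < \<mu> x"
  using mu_bounds[of "{(0, x)}"] by (force simp: half_space_def)

lemma weight_version:
  "\<exists>m. m \<in> borel_measurable borel \<and> (\<forall>x. 0 < m x) \<and> (AE x in lebesgue. 0 < x \<longrightarrow> m x = \<mu> x)"
proof -
  \<comment> \<open>Integrability on bounded intervals makes this truncation Lebesgue measurable, as
    a limit of functions supported on \<open>(0, i + 1)\<close>.\<close>
  define \<mu>0 where "\<mu>0 x = indicator {0<..} x * \<mu> x" for x
  have "\<mu>0 \<in> borel_measurable lebesgue"
  proof (rule borel_measurable_LIMSEQ_real)
    show "(\<lambda>x. indicator {0<..<real (Suc i)} x *\<^sub>R \<mu> x) \<in> borel_measurable lebesgue" for i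
      using mu_L1[of "real (Suc i)"] unfolding set_integrable_def by (intro borel_measurable_integrable) auto
    fix x
    obtain M :: nat where M: "x < real M"
      using reals_Archimedean2 by blast
    have "indicator {0<..<real (Suc i)} x *\<^sub>R \<mu> x = \<mu>0 x" if "M \<le> i" for i
    proof -
      have "x < real (Suc i)"
        using M that by simp
      then show ?thesis by (simp add: \<mu>0_def indicator_def del: of_nat_Suc)
    qed
    then have "eventually (\<lambda>i. indicator {0<..<real (Suc i)} x *\<^sub>R \<mu> x = \<mu>0 x) sequentially"
      unfolding eventually_sequentially by blast
    then show "(\<lambda>i. indicator {0<..<real (Suc i)} x *\<^sub>R \<mu> x) \<longlonglongrightarrow> \<mu>0 x"
      by (rule tendsto_eventually)
  qed
  then obtain m0 where m0: "m0 \<in> borel_measurable lborel" "AE x in lborel. \<mu>0 x = m0 x"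
    using completion_ex_borel_measurable_real by blast
  \<comment> \<open>The value 1 where \<open>m0\<close> is not positive keeps \<open>m\<close>
    positive everywhere, so that \<open>1 / m\<close> and Young's inequality need no
    exceptions.\<close>
  define m where "m x = (if 0 < m0 x then m0 x else 1)" for x
  have [measurable]: "m0 \<in> borel_measurable borel"
    using m0(1) by simp
  have "m \<in> borel_measurable borel"
    unfolding m_def[abs_def] by measurable
  moreover have "AE x in lebesgue. 0 < x \<longrightarrow> m x = \<mu> x"
    using AE_completion[OF m0(2)]
  proof eventually_elim
    fix x assume "\<mu>0 x = m0 x"
    then show "0 < x \<longrightarrow> m x = \<mu> x"
      using mu_pos[of x] by (auto simp: m_def \<mu>0_def)
  qed
  ultimately show ?thesis
    by (intro exI[of _ m]) (auto simp: m_def)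
qed

text \<open>
  \<open>\<mu>\<close> itself is only Lebesgue measurable and is arbitrary on the negative half-line, whereas the iterated
  integrals below are taken with respect to \<^const>\<open>lborel\<close>.
\<close>

definition wt :: "real \<Rightarrow> real"
  where "wt = (SOME m. m \<in> borel_measurable borel \<and> (\<forall>x. 0 < m x) \<and> (AE x in lebesgue. 0 < x \<longrightarrow> m x = \<mu> x))"

lemma wt: "wt \<in> borel_measurable borel" "0 < wt x" "AE x in lebesgue. 0 < x \<longrightarrow> wt x = \<mu> x"
  using someI_ex[OF weight_version] unfolding wt_def[symmetric] by blast+

lemma AE_wt: "AE p in lebesgue. p \<in> half_space \<longrightarrow> wt (snd (p :: (real^'n) \<times> real)) = \<mu> (snd p)"
  using AE_lebesgue_snd[OF wt(3)] by (simp add: half_space_def)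

lemma wt_integral_finite: "0 < r \<Longrightarrow> (\<integral>\<^sup>+x\<in>{0<..<r}. ennreal (wt x) \<partial>lborel) < \<infinity>"
proof -
  assume r: "0 < r"
  have "(\<integral>\<^sup>+x\<in>{0<..<r}. ennreal (wt x) \<partial>lborel) = (\<integral>\<^sup>+x\<in>{0<..<r}. ennreal (wt x) \<partial>lebesgue)"
    by (simp add: nn_integral_lebesgue)
  also have "\<dots> = (\<integral>\<^sup>+x. ennreal (norm (indicator {0<..<r} x *\<^sub>R \<mu> x)) \<partial>lebesgue)"
  proof (rule nn_integral_cong_AE)
    show "AE x in lebesgue. ennreal (wt x) * indicator {0<..<r} x = ennreal (norm (indicator {0<..<r} x *\<^sub>R \<mu> x))"
      using wt(3) by eventually_elim (auto simp: indicator_def mu_pos less_imp_le)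
  qed
  also have "\<dots> < \<infinity>"
    using mu_L1[OF r] unfolding set_integrable_def integrable_iff_bounded by simp
  finally show ?thesis .
qed

lemma inverse_wt_integral_finite: "(\<integral>\<^sup>+x\<in>{0<..<1}. ennreal (1 / wt x) \<partial>lborel) < \<infinity>"
proof -
  obtain k where k: "\<And>a b. 0 \<le> a \<Longrightarrow> a \<le> b \<Longrightarrow>
      (\<integral>\<^sup>+x\<in>{a<..<b}. ennreal (\<mu> x) \<partial>lebesgue) * (\<integral>\<^sup>+x\<in>{a<..<b}. ennreal (1 / \<mu> x) \<partial>lebesgue) \<le> ennreal (k * (b - a)\<^sup>2)"
    using mu_A2 unfolding muckenhoupt_A2_def by blast
  define A B where "A = (\<integral>\<^sup>+x\<in>{0<..<1}. ennreal (wt x) \<partial>lborel)"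
    and "B = (\<integral>\<^sup>+x\<in>{0<..<1}. ennreal (1 / wt x) \<partial>lborel)"
  have "(\<integral>\<^sup>+x\<in>{0<..<1}. ennreal (\<mu> x) \<partial>lebesgue) = A"
    unfolding A_def nn_integral_lebesgue[symmetric]
    by (rule nn_integral_cong_AE) (use wt(3) in eventually_elim, auto simp: indicator_def)
  moreover have "(\<integral>\<^sup>+x\<in>{0<..<1}. ennreal (1 / \<mu> x) \<partial>lebesgue) = B"
    unfolding B_def nn_integral_lebesgue[symmetric]
    by (rule nn_integral_cong_AE) (use wt(3) in eventually_elim, auto simp: indicator_def)
  ultimately have AB: "A * B \<le> ennreal k"
    using k[of 0 1] by simp
  have [measurable]: "wt \<in> borel_measurable borel" by (rule wt)
  \<comment> \<open>In \<open>ennreal\<close> 0 times infinity is 0, so the A2 bound on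
    \<open>A * B\<close> controls \<open>B\<close> only once \<open>A\<close> is known to be
    positive.\<close>
  have "A \<noteq> 0"
  proof
    assume "A = 0"
    have "ennreal (wt x) \<noteq> 0" for x
      using wt(2)[of x] by (simp add: ennreal_eq_0_iff)
    moreover have "AE x in lborel. ennreal (wt x) * indicator {0<..<1} x = 0"
      using \<open>A = 0\<close> unfolding A_def by (subst (asm) nn_integral_0_iff_AE) auto
    ultimately have "AE x in lborel. x \<notin> {0<..<1::real}"
      by (elim eventually_mono) (auto simp: indicator_def split: if_splits)
    then have "{0<..<1::real} \<in> null_sets lborel"
      by (subst AE_iff_null_sets) auto
    then show False
      by (auto simp: null_sets_def)
  qed
  then have "B \<noteq> \<infinity>"
    using AB by (auto simp: ennreal_mult_top top_unique)
  then show ?thesis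
    by (simp add: B_def less_top[symmetric])
qed

lemma mu_snd_measurable: "(\<lambda>p. indicator (half_space :: ((real^'n) \<times> real) set) p * \<mu> (snd p)) \<in> borel_measurable lebesgue"
proof (rule borel_measurable_AE)
  have fs: "snd \<in> borel_measurable (borel :: ((real^'n) \<times> real) measure)"
    by (auto intro!: borel_measurable_continuous_onI continuous_on_snd continuous_on_id)
  have [measurable]: "(\<lambda>p. wt (snd p)) \<in> borel_measurable (borel :: ((real^'n) \<times> real) measure)"
    by (rule measurable_compose[OF fs wt(1)])
  have [measurable]: "half_space \<in> sets (borel :: ((real^'n) \<times> real) measure)" by simp
  have "(\<lambda>p. indicator (half_space :: ((real^'n) \<times> real) set) p * wt (snd p)) \<in> borel_measurable borel"
    by measurable
  then show "(\<lambda>p. indicator (half_space :: ((real^'n) \<times> real) set) p * wt (snd p)) \<in> borel_measurable lebesgue"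
    by (intro measurable_completion) simp
  show "AE p in lebesgue. indicator (half_space :: ((real^'n) \<times> real) set) p * wt (snd p) = indicator half_space p * \<mu> (snd p)"
    using AE_wt by eventually_elim (auto simp: indicator_def)
qed

lemma mu_half_ball_integrable:
  assumes R: "0 < R"
  shows "set_integrable lebesgue (half_ball R) (\<lambda>p :: (real^'n) \<times> real. \<mu> (snd p))"
  unfolding set_integrable_def
proof (rule integrableI_bounded)
  have "(\<lambda>p. indicator (half_ball R) p * (indicator (half_space :: ((real^'n) \<times> real) set) p * \<mu> (snd p))) \<in> borel_measurable lebesgue"
    by (intro borel_measurable_times borel_measurable_indicator mu_snd_measurable half_sets)
  moreover have "(\<lambda>p. indicator (half_ball R) p * (indicator (half_space :: ((real^'n) \<times> real) set) p * \<mu> (snd p)))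
      = (\<lambda>p. indicator (half_ball R) p *\<^sub>R \<mu> (snd p))"
    by (auto simp: indicator_def half_ball_def)
  ultimately show "(\<lambda>p :: (real^'n) \<times> real. indicator (half_ball R) p *\<^sub>R \<mu> (snd p)) \<in> borel_measurable lebesgue"
    by simp
  let ?B = "ball (0::real^'n) R"
  \<comment> \<open>The half-ball lies in the cylinder of radius and height \<open>R\<close>, on
    which the integral of the weight factorizes.\<close>
  define J where "J p = indicator ?B (fst p) * (ennreal (wt (snd p)) * indicator {0<..<R} (snd p))" for p
  have fs: "fst \<in> borel_measurable (borel :: ((real^'n) \<times> real) measure)"
    "snd \<in> borel_measurable (borel :: ((real^'n) \<times> real) measure)"
    by (auto intro!: borel_measurable_continuous_onI continuous_on_fst continuous_on_snd continuous_on_id)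
  have [measurable]: "wt \<in> borel_measurable borel" by (rule wt)
  have wI: "(\<lambda>x. ennreal (wt x) * indicator {0<..<R} x) \<in> borel_measurable borel"
    by measurable
  have J: "J \<in> borel_measurable borel"
    unfolding J_def[abs_def]
    by (intro borel_measurable_times_ennreal measurable_compose[OF fs(1) borel_measurable_indicator] measurable_compose[OF fs(2) wI]) auto
  have "(\<integral>\<^sup>+p. ennreal (norm (indicator (half_ball R) p *\<^sub>R \<mu> (snd p))) \<partial>(lebesgue :: ((real^'n) \<times> real) measure)) \<le> (\<integral>\<^sup>+p. J p \<partial>lebesgue)"
  proof (rule nn_integral_mono_AE)
    show "AE p in lebesgue. ennreal (norm (indicator (half_ball R) p *\<^sub>R \<mu> (snd p))) \<le> J p"
      using AE_wt
    proof eventually_elim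
      fix p :: "(real^'n) \<times> real" assume p: "p \<in> half_space \<longrightarrow> wt (snd p) = \<mu> (snd p)"
      show "ennreal (norm (indicator (half_ball R) p *\<^sub>R \<mu> (snd p))) \<le> J p"
      proof (cases "p \<in> half_ball R")
        case True
        then have "norm (fst p) < R" "\<bar>snd p\<bar> < R" "0 < snd p"
          using norm_fst_le[of "fst p" "snd p"] norm_snd_le[of "snd p" "fst p"] by (auto simp: half_ball_def half_space_def)
        then show ?thesis
          using True p mu_pos[of "snd p"] by (simp add: J_def half_space_def)
      qed simp
    qed
  qed
  also have "\<dots> = (\<integral>\<^sup>+y. \<integral>\<^sup>+x. J (y, x) \<partial>lborel \<partial>lborel)"
    using lborel.nn_integral_fst[of J lborel] J by (simp add: lborel_prod nn_integral_lebesgue)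
  also have "\<dots> = (\<integral>\<^sup>+y. (\<integral>\<^sup>+x\<in>{0<..<R}. ennreal (wt x) \<partial>lborel) * indicator ?B y \<partial>lborel)"
    using wI by (intro nn_integral_cong) (simp add: J_def nn_integral_cmult mult.commute)
  also have "\<dots> = (\<integral>\<^sup>+x\<in>{0<..<R}. ennreal (wt x) \<partial>lborel) * emeasure lborel ?B"
    by (rule nn_integral_cmult_indicator) simp
  also have "\<dots> < \<infinity>"
    using wt_integral_finite[OF R] emeasure_lborel_ball_finite[of "0::real^'n" R] by (simp add: ennreal_mult_less_top)
  finally show "(\<integral>\<^sup>+p. ennreal (norm (indicator (half_ball R) p *\<^sub>R \<mu> (snd p))) \<partial>(lebesgue :: ((real^'n) \<times> real) measure)) < \<infinity>" .
qed

lemma grad_sq_measurable: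
  assumes v: "locally_lipschitz_on half_space (v :: (real^'n) \<times> real \<Rightarrow> real)"
  shows "(\<lambda>p. indicator half_space p * (\<mu> (snd p) * (norm (grad v p))\<^sup>2)) \<in> borel_measurable lebesgue"
proof -
  define a where "a p = indicator (half_space :: ((real^'n) \<times> real) set) p * \<mu> (snd p)" for p
  define d where "d p = indicator half_space p *\<^sub>R grad v p" for p
  have [measurable]: "a \<in> borel_measurable lebesgue" "d \<in> borel_measurable lebesgue"
    unfolding a_def[abs_def] d_def[abs_def] by (rule mu_snd_measurable grad_measurable[OF v])+
  have "(\<lambda>p. a p * (norm (d p))\<^sup>2) \<in> borel_measurable lebesgue"
    by measurable
  then have "(\<lambda>p. (indicator half_space p * \<mu> (snd p)) * (norm (indicator half_space p *\<^sub>R grad v p))\<^sup>2) \<in> borel_measurable lebesgue"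
    unfolding a_def d_def .
  moreover have "(\<lambda>p. (indicator half_space p * \<mu> (snd p)) * (norm (indicator half_space p *\<^sub>R grad v p))\<^sup>2)
      = (\<lambda>p. indicator half_space p * (\<mu> (snd p) * (norm (grad v p))\<^sup>2))"
    by (auto simp: indicator_def)
  ultimately show ?thesis by simp
qed

text \<open>Valued in \<open>ennreal\<close> so that Fatou's lemma can be applied before finiteness
  is known.\<close>

definition energy :: "real \<Rightarrow> ((real^'n) \<times> real \<Rightarrow> real) \<Rightarrow> ennreal"
  where "energy R v = (\<integral>\<^sup>+p\<in>half_ball R. ennreal (\<mu> (snd p) * (norm (grad v p))\<^sup>2) \<partial>lebesgue)"

lemma energy_integrable:
  assumes v: "locally_lipschitz_on half_space v"
  shows "set_integrable lebesgue (half_ball R) (\<lambda>p. \<mu> (snd p) * (norm (grad v p))\<^sup>2) \<longleftrightarrow> energy R v < \<infinity>"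
proof -
  have eq: "(\<lambda>p. indicator (half_ball R) p *\<^sub>R (\<mu> (snd p) * (norm (grad v p))\<^sup>2))
      = (\<lambda>p. indicator (half_ball R) p * (indicator half_space p * (\<mu> (snd p) * (norm (grad v p))\<^sup>2)))"
    by (auto simp: indicator_def half_ball_def)
  have "(\<lambda>p. indicator (half_ball R) p *\<^sub>R (\<mu> (snd p) * (norm (grad v p))\<^sup>2)) \<in> borel_measurable lebesgue"
    unfolding eq by (intro borel_measurable_times borel_measurable_indicator grad_sq_measurable v half_sets)
  moreover have "(\<integral>\<^sup>+p. ennreal (norm (indicator (half_ball R) p *\<^sub>R (\<mu> (snd p) * (norm (grad v p))\<^sup>2))) \<partial>lebesgue) = energy R v"
    unfolding energy_def
  proof (rule nn_integral_cong)
    fix p :: "(real^'n) \<times> real"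
    show "ennreal (norm (indicator (half_ball R) p *\<^sub>R (\<mu> (snd p) * (norm (grad v p))\<^sup>2)))
      = ennreal (\<mu> (snd p) * (norm (grad v p))\<^sup>2) * indicator (half_ball R) p"
      using mu_pos[of "snd p"] by (cases "p \<in> half_ball R") (auto simp: half_ball_def half_space_def)
  qed
  ultimately show ?thesis
    unfolding set_integrable_def integrable_iff_bounded by simp
qed

text \<open>Squaring the product rule bounds the energy of the product by that of \<open>v\<close>
  plus the weight of the half-ball. It is applied to the difference quotients, to the derivatives
  \<open>du b\<close> and to the length of the horizontal gradient.\<close>

lemma admissible_mult:
  assumes \<eta>: "cutoff R \<eta>" and R: "0 < R" and vl: "locally_lipschitz_on half_space v"
    and vC: "\<forall>p\<in>half_ball R. \<bar>v p\<bar> \<le> C" and E: "energy R v < \<infinity>"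
  shows "admissible \<mu> R (\<lambda>p. \<eta> p * v p)"
    and "AE p in lebesgue. p \<in> half_space \<longrightarrow> \<eta> differentiable (at p) \<and> v differentiable (at p) \<and>
      grad (\<lambda>p. \<eta> p * v p) p = \<eta> p *\<^sub>R grad v p + v p *\<^sub>R grad \<eta> p"
proof -
  let ?\<xi> = "\<lambda>p. \<eta> p * v p"
  obtain D where D: "0 \<le> D" "\<forall>p\<in>half_space. \<bar>\<eta> p\<bar> \<le> D"
    "\<forall>p\<in>half_space. \<eta> differentiable (at p) \<longrightarrow> norm (grad \<eta> p) \<le> D"
    by (rule cutoff_bounds[OF \<eta> R])
  have z: "\<forall>p\<in>half_space - ball 0 R. \<eta> p = 0"
    using \<eta> by (simp add: cutoff_def)
  have ll: "locally_lipschitz_on half_space ?\<xi>"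
    by (rule locally_lipschitz_on_mult[OF open_half_space cutoff_locally_lipschitz[OF \<eta>] vl])
  show gr: "AE p in lebesgue. p \<in> half_space \<longrightarrow> \<eta> differentiable (at p) \<and> v differentiable (at p) \<and>
      grad ?\<xi> p = \<eta> p *\<^sub>R grad v p + v p *\<^sub>R grad \<eta> p"
    using AE_differentiable_half_space[OF vl] AE_differentiable_half_space[OF cutoff_locally_lipschitz[OF \<eta>]]
    by eventually_elim (auto simp: grad_mult)
  have "0 \<le> \<bar>C\<bar>" by simp
  have bd: "\<bar>?\<xi> p\<bar> \<le> D * \<bar>C\<bar>" if p: "p \<in> half_space" for p
  proof (cases "p \<in> half_ball R")
    case True
    have "\<bar>\<eta> p\<bar> \<le> D" "\<bar>v p\<bar> \<le> \<bar>C\<bar>"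
      using D(2) p bspec[OF vC True] by auto
    then show ?thesis
      unfolding abs_mult using D(1) by (intro mult_mono) auto
  next
    case False
    then have "\<eta> p = 0"
      using z p by (auto simp: half_ball_def)
    then show ?thesis using D(1) by simp
  qed
  define G where "G p = 2 * D\<^sup>2 * (\<mu> (snd p) * (norm (grad v p))\<^sup>2) + 2 * C\<^sup>2 * D\<^sup>2 * \<mu> (snd p)" for p
  have "set_integrable lebesgue (half_ball R) G"
    unfolding G_def
    by (intro set_integral_add set_integrable_mult_right energy_integrable[OF vl, THEN iffD2] E mu_half_ball_integrable R)
  then have intG: "integrable lebesgue (\<lambda>p. indicator (half_ball R) p *\<^sub>R G p)"
    by (simp add: set_integrable_def)
  have "integrable lebesgue (\<lambda>p. indicator (half_ball R) p *\<^sub>R (\<mu> (snd p) * (norm (grad ?\<xi> p))\<^sup>2))"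
  proof (rule Bochner_Integration.integrable_bound[OF intG])
    have eq: "(\<lambda>p. indicator (half_ball R) p *\<^sub>R (\<mu> (snd p) * (norm (grad ?\<xi> p))\<^sup>2))
        = (\<lambda>p. indicator (half_ball R) p * (indicator half_space p * (\<mu> (snd p) * (norm (grad ?\<xi> p))\<^sup>2)))"
      by (auto simp: indicator_def half_ball_def)
    show "(\<lambda>p. indicator (half_ball R) p *\<^sub>R (\<mu> (snd p) * (norm (grad ?\<xi> p))\<^sup>2)) \<in> borel_measurable lebesgue"
      unfolding eq by (intro borel_measurable_times borel_measurable_indicator grad_sq_measurable ll half_sets)
    show "AE p in lebesgue. norm (indicator (half_ball R) p *\<^sub>R (\<mu> (snd p) * (norm (grad ?\<xi> p))\<^sup>2))
        \<le> norm (indicator (half_ball R) p *\<^sub>R G p)"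
      using gr
    proof eventually_elim
      fix p assume p: "p \<in> half_space \<longrightarrow> \<eta> differentiable (at p) \<and> v differentiable (at p) \<and>
        grad ?\<xi> p = \<eta> p *\<^sub>R grad v p + v p *\<^sub>R grad \<eta> p"
      show "norm (indicator (half_ball R) p *\<^sub>R (\<mu> (snd p) * (norm (grad ?\<xi> p))\<^sup>2)) \<le> norm (indicator (half_ball R) p *\<^sub>R G p)"
      proof (cases "p \<in> half_ball R")
        case True
        then have pH: "p \<in> half_space" by (simp add: half_ball_def)
        then have m: "0 < \<mu> (snd p)" using mu_pos by (simp add: half_space_def)
        have "norm (grad ?\<xi> p) \<le> norm (\<eta> p *\<^sub>R grad v p) + norm (v p *\<^sub>R grad \<eta> p)"
          using p pH norm_triangle_ineq[of "\<eta> p *\<^sub>R grad v p" "v p *\<^sub>R grad \<eta> p"] by simp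
        also have "\<dots> \<le> D * norm (grad v p) + \<bar>C\<bar> * D"
        proof -
          have "\<bar>\<eta> p\<bar> * norm (grad v p) \<le> D * norm (grad v p)"
            using D(2) pH by (intro mult_right_mono) auto
          moreover have "\<bar>v p\<bar> * norm (grad \<eta> p) \<le> \<bar>C\<bar> * D"
            using bspec[OF vC True] D(3) p pH by (intro mult_mono) auto
          ultimately show ?thesis by simp
        qed
        finally have "(norm (grad ?\<xi> p))\<^sup>2 \<le> (D * norm (grad v p) + \<bar>C\<bar> * D)\<^sup>2"
          by (intro power_mono) auto
        also have "\<dots> \<le> 2 * (D * norm (grad v p))\<^sup>2 + 2 * (\<bar>C\<bar> * D)\<^sup>2"
          using sum_squares_bound[of "D * norm (grad v p)" "\<bar>C\<bar> * D"] by (simp add: power2_sum)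
        also have "\<dots> = 2 * D\<^sup>2 * (norm (grad v p))\<^sup>2 + 2 * C\<^sup>2 * D\<^sup>2"
          by (simp add: power_mult_distrib)
        finally have "\<mu> (snd p) * (norm (grad ?\<xi> p))\<^sup>2 \<le> \<mu> (snd p) * (2 * D\<^sup>2 * (norm (grad v p))\<^sup>2 + 2 * C\<^sup>2 * D\<^sup>2)"
          using m by (intro mult_left_mono) auto
        also have "\<dots> = G p"
          by (simp add: G_def algebra_simps)
        finally have "\<mu> (snd p) * (norm (grad ?\<xi> p))\<^sup>2 \<le> \<bar>G p\<bar>"
          by linarith
        then show ?thesis
          using True m by (simp add: abs_mult)
      qed simp
    qed
  qed
  moreover have "bounded (?\<xi> ` half_space)"
    unfolding bounded_iff by (intro exI[of _ "D * \<bar>C\<bar>"]) (use bd in auto)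
  ultimately show "admissible \<mu> R ?\<xi>"
    unfolding admissible_def set_integrable_def using ll z by auto
qed

subsection \<open>Difference quotients\<close>

definition du :: "real^'n \<Rightarrow> (real^'n) \<times> real \<Rightarrow> real"
  where "du b p = fst (grad u p) \<bullet> b"

definition dq :: "real^'n \<Rightarrow> real \<Rightarrow> (real^'n) \<times> real \<Rightarrow> real"
  where "dq b h p = (u (p + (h *\<^sub>R b, 0)) - u p) / h"

lemma u_derivative: "p \<in> half_space \<Longrightarrow> (u has_derivative (\<lambda>h. h \<bullet> grad u p)) (at p)"
  by (rule C2_onE[OF u_C2 open_half_space]) blast

lemma u_C1: "C1_on half_space u"
proof -
  obtain H where H: "\<And>p. p \<in> half_space \<Longrightarrow> (grad u has_derivative H p) (at p)"
    by (rule C2_onE[OF u_C2 open_half_space]) blast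
  have "continuous_on half_space (grad u)"
    using H by (intro continuous_at_imp_continuous_on ballI has_derivative_continuous)
  then show ?thesis
    using u_derivative by (auto simp: C1_on_def differentiable_def)
qed

lemma grad_y_eq: "p \<in> half_space \<Longrightarrow> grad_y u p = fst (grad u p)"
proof -
  assume p: "p \<in> half_space"
  obtain y x where yx: "p = (y, x)" by (cases p)
  have e: "((\<lambda>y. (y, x)) has_derivative (\<lambda>h. (h, 0))) (at y)"
    by (auto intro!: derivative_eq_intros)
  have "((\<lambda>y. u (y, x)) has_derivative (\<lambda>h. (h, 0) \<bullet> grad u p)) (at y)"
    using has_derivative_compose[OF e u_derivative[OF p, unfolded yx]] yx by simp
  then have "((\<lambda>y. u (y, x)) has_derivative (\<lambda>h. h \<bullet> fst (grad u p))) (at y)"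
    by (simp add: inner_prod_def)
  then show ?thesis
    unfolding grad_y_def yx by (simp add: grad_unique)
qed

lemma du_C1: "C1_on half_space (du b)"
proof -
  obtain H where H: "\<And>p. p \<in> half_space \<Longrightarrow> (grad u has_derivative H p) (at p)"
    "\<And>p h k. p \<in> half_space \<Longrightarrow> H p h \<bullet> k = H p k \<bullet> h"
    "\<And>h. continuous_on half_space (\<lambda>p. H p h)"
    by (rule C2_onE[OF u_C2 open_half_space]) blast
  have eq: "du b = (\<lambda>p. grad u p \<bullet> (b, 0))"
    by (simp add: du_def inner_prod_def fun_eq_iff)
  have d: "(du b has_derivative (\<lambda>h. h \<bullet> H p (b, 0))) (at p)" if p: "p \<in> half_space" for p
  proof -
    have "(du b has_derivative (\<lambda>h. H p h \<bullet> (b, 0))) (at p)"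
      unfolding eq by (rule has_derivative_inner_left[OF H(1)[OF p]])
    moreover have "H p h \<bullet> (b, 0) = h \<bullet> H p (b, 0)" for h
      using H(2)[OF p, of h "(b, 0)"] by (simp only: inner_commute)
    ultimately show ?thesis by simp
  qed
  have "continuous_on half_space (grad (du b))"
    using H(3)[of "(b, 0)"] by (rule continuous_on_eq) (simp add: grad_unique[OF d])
  then show ?thesis
    using d by (auto simp: C1_on_def differentiable_def)
qed

lemma dq_grad:
  assumes p: "p \<in> half_space"
  shows "dq b h differentiable (at p)" "grad (dq b h) p = (1 / h) *\<^sub>R (grad u (p + (h *\<^sub>R b, 0)) - grad u p)"
proof -
  have "((\<lambda>p. u (p + (h *\<^sub>R b, 0))) has_derivative (\<lambda>k. k \<bullet> grad u (p + (h *\<^sub>R b, 0)))) (at p)"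
    unfolding has_derivative_translate using p by (intro u_derivative) (simp add: half_space_shift)
  then have "((\<lambda>p. (1 / h) * (u (p + (h *\<^sub>R b, 0)) - u p)) has_derivative
      (\<lambda>k. (1 / h) * (k \<bullet> grad u (p + (h *\<^sub>R b, 0)) - k \<bullet> grad u p))) (at p)"
    by (intro has_derivative_mult_right has_derivative_diff u_derivative p)
  then have d: "(dq b h has_derivative (\<lambda>k. k \<bullet> ((1 / h) *\<^sub>R (grad u (p + (h *\<^sub>R b, 0)) - grad u p)))) (at p)"
    by (simp add: dq_def[abs_def] inner_diff_right diff_divide_distrib)
  show "dq b h differentiable (at p)"
    using d by (auto simp: differentiable_def)
  show "grad (dq b h) p = (1 / h) *\<^sub>R (grad u (p + (h *\<^sub>R b, 0)) - grad u p)"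
    by (rule grad_unique[OF d])
qed

lemma dq_C1: "C1_on half_space (dq b h)"
proof -
  have c: "continuous_on half_space (grad u)"
    using u_C1 by (simp add: C1_on_def)
  have "continuous_on half_space (\<lambda>p. grad u (p + (h *\<^sub>R b, 0)))"
    by (rule continuous_on_compose2[OF c]) (auto intro!: continuous_intros simp: half_space_def)
  then have "continuous_on half_space (\<lambda>p. (1 / h) *\<^sub>R (grad u (p + (h *\<^sub>R b, 0)) - grad u p))"
    using c by (intro continuous_on_scaleR continuous_on_const continuous_on_diff)
  then have "continuous_on half_space (grad (dq b h))"
    by (rule continuous_on_eq) (simp add: dq_grad)
  then show ?thesis
    by (auto simp: C1_on_def dq_grad)
qed

text \<open>The essential bound is a pointwise one in the interior: by continuity of the gradient
  the set where it fails is open, and it is null.\<close>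

lemma grad_y_bounded:
  assumes r: "0 < r"
  obtains C where "0 \<le> C" "\<forall>p\<in>half_ball r. norm (fst (grad u p)) \<le> C"
proof -
  obtain C where C: "AE p in lebesgue_on (closure (half_ball r)). \<bar>norm (grad_y u p)\<bar> \<le> C"
    using u_grad_y[OF r] unfolding Linfty_on_def by blast
  let ?c = "closure (half_ball r) :: ((real^'n) \<times> real) set"
  have "?c \<inter> space lebesgue \<in> sets lebesgue"
    by (auto intro!: sets_completionI_sets borel_closed)
  then have AE: "AE p in lebesgue. p \<in> ?c \<longrightarrow> \<bar>norm (grad_y u p)\<bar> \<le> C"
    using C by (simp add: AE_restrict_space_iff)
  define X where "X = {p \<in> half_ball r. C < norm (fst (grad u p))}"
  have "continuous_on (half_ball r) (\<lambda>p. norm (fst (grad u p)))"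
    using u_C1 half_ball_subset_half_space
    by (intro continuous_on_norm continuous_on_fst) (auto simp: C1_on_def intro: continuous_on_subset)
  then have "open (half_ball r \<inter> (\<lambda>p. norm (fst (grad u p))) -` {C<..})"
    by (rule continuous_open_preimage) (auto intro: open_half_ball)
  then have "open X"
    by (simp add: X_def vimage_def Int_def)
  moreover have "negligible X"
  proof -
    have "negligible {p. \<not> (p \<in> ?c \<longrightarrow> \<bar>norm (grad_y u p)\<bar> \<le> C)}"
      using AE by (simp only: AE_lebesgue_negligible)
    then show ?thesis
    proof (rule negligible_subset)
      show "X \<subseteq> {p. \<not> (p \<in> ?c \<longrightarrow> \<bar>norm (grad_y u p)\<bar> \<le> C)}"
      proof
        fix p assume "p \<in> X"
        then have p: "p \<in> half_ball r" "C < norm (fst (grad u p))"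
          by (simp_all add: X_def)
        have "p \<in> ?c"
          using p(1) closure_subset by blast
        moreover have "p \<in> half_space"
          using p(1) half_ball_subset_half_space by blast
        ultimately show "p \<in> {p. \<not> (p \<in> ?c \<longrightarrow> \<bar>norm (grad_y u p)\<bar> \<le> C)}"
          using p(2) by (simp add: grad_y_eq)
      qed
    qed
  qed
  ultimately have "X = {}"
    using open_not_negligible by blast
  then have "\<not> C < norm (fst (grad u p))" if "p \<in> half_ball r" for p
    using that unfolding X_def by blast
  then have "norm (fst (grad u p)) \<le> max 0 C" if "p \<in> half_ball r" for p
    using that by (simp add: not_less le_max_iff_disj)
  then show ?thesis
    by (intro that[of "max 0 C"]) auto
qed

text \<open>By the mean value theorem a difference quotient is a value of \<open>du b\<close> at a
  point shifted by less than 1; hence the detour through the half-ball of radius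
  \<open>r + 1\<close>.\<close>

lemma du_dq_bounded:
  assumes r: "0 < r"
  obtains C where "0 \<le> C" "\<forall>b\<in>Basis. \<forall>p\<in>half_ball r. \<bar>du b p\<bar> \<le> C"
    "\<forall>b\<in>Basis. \<forall>h. 0 < h \<and> h \<le> 1 \<longrightarrow> (\<forall>p\<in>half_ball r. \<bar>dq b h p\<bar> \<le> C)"
proof -
  obtain C where C: "0 \<le> C" "\<forall>p\<in>half_ball (r + 1). norm (fst (grad u p)) \<le> C"
    using grad_y_bounded[of "r + 1"] r by auto
  have du: "\<bar>du b p\<bar> \<le> C" if b: "b \<in> Basis" and p: "p \<in> half_ball (r + 1)" for b p
  proof -
    have "\<bar>du b p\<bar> \<le> norm (fst (grad u p))"
      unfolding du_def using b by (rule Basis_le_norm)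
    then show ?thesis using C(2) p by force
  qed
  have "\<bar>dq b h p\<bar> \<le> C" if b: "b \<in> Basis" and h: "0 < h" "h \<le> 1" and p: "p \<in> half_ball r" for b h p
  proof -
    have pt: "p + (t *\<^sub>R b, 0) \<in> half_ball (r + 1)" if "0 \<le> t" "t \<le> h" for t
      using b h p that by (intro half_ball_shift) auto
    have d: "((\<lambda>t. u (p + (t *\<^sub>R b, 0))) has_real_derivative du b (p + (t *\<^sub>R b, 0))) (at t)" if t: "0 \<le> t" "t \<le> h" for t
    proof -
      have e: "((\<lambda>t. p + (t *\<^sub>R b, 0)) has_derivative (\<lambda>k. (k *\<^sub>R b, 0))) (at t)"
        by (auto intro!: derivative_eq_intros)
      have "p + (t *\<^sub>R b, 0) \<in> half_space"
        using pt[OF t] half_ball_subset_half_space by blast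
      from has_derivative_compose[OF e u_derivative[OF this]]
      show ?thesis
        by (rule has_derivative_imp_has_field_derivative) (simp add: du_def inner_prod_def inner_commute)
    qed
    obtain z where z: "0 < z" "z < h" "u (p + (h *\<^sub>R b, 0)) - u (p + (0 *\<^sub>R b, 0)) = (h - 0) * du b (p + (z *\<^sub>R b, 0))"
      using MVT2[OF h(1) d] by auto
    have "dq b h p = du b (p + (z *\<^sub>R b, 0))"
      using z(3) h by (simp add: dq_def zero_prod_def[symmetric])
    then show ?thesis
      using du[OF b pt] z by simp
  qed
  moreover have "p \<in> half_ball (r + 1)" if "p \<in> half_ball r" for p :: "(real^'n) \<times> real"
    using that by (auto simp: half_ball_def)
  ultimately show ?thesis
    using C(1) du by (intro that[of C]) auto
qed

lemma energy_u_finite: "0 < R \<Longrightarrow> energy R u < \<infinity>"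
  using u_solution unfolding weak_solution_def
  by (subst energy_integrable[symmetric]) (auto intro: C1_on_locally_lipschitz[OF open_half_space u_C1])

text \<open>The bound degenerates like \<open>1 / h\<^sup>2\<close>. Finiteness for each single
  \<open>h\<close> is enough to make the test functions admissible; the bound uniform in
  \<open>h\<close> is then drawn from the equation.\<close>

lemma energy_dq_finite:
  assumes R: "0 < R" and b: "b \<in> Basis" and h: "0 < h" "h \<le> 1"
  shows "energy R (dq b h) < \<infinity>"
proof -
  let ?c = "(h *\<^sub>R b, 0) :: (real^'n) \<times> real"
  define F where "F p = indicator (half_ball (R + 1)) p *\<^sub>R (\<mu> (snd p) * (norm (grad u p))\<^sup>2)" for p
  have "set_integrable lebesgue (half_ball (R + 1)) (\<lambda>p. \<mu> (snd p) * (norm (grad u p))\<^sup>2)"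
    using energy_integrable[OF C1_on_locally_lipschitz[OF open_half_space u_C1]] energy_u_finite[of "R + 1"] R by simp
  then have intF: "integrable lebesgue F"
    by (simp add: set_integrable_def F_def[abs_def])
  then have intF': "integrable lebesgue (\<lambda>p. F (p + ?c))"
    by (rule integrable_lebesgue_translation)
  have ll: "locally_lipschitz_on half_space (dq b h)"
    by (rule C1_on_locally_lipschitz[OF open_half_space dq_C1])
  have "integrable lebesgue (\<lambda>p. indicator (half_ball R) p *\<^sub>R (\<mu> (snd p) * (norm (grad (dq b h) p))\<^sup>2))"
  proof (rule Bochner_Integration.integrable_bound)
    show "integrable lebesgue (\<lambda>p. 2 / h\<^sup>2 * (F (p + ?c) + F p))"
      using intF intF' by (intro integrable_mult_right Bochner_Integration.integrable_add)
    have eq: "(\<lambda>p. indicator (half_ball R) p *\<^sub>R (\<mu> (snd p) * (norm (grad (dq b h) p))\<^sup>2))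
        = (\<lambda>p. indicator (half_ball R) p * (indicator half_space p * (\<mu> (snd p) * (norm (grad (dq b h) p))\<^sup>2)))"
      by (auto simp: indicator_def half_ball_def)
    show "(\<lambda>p. indicator (half_ball R) p *\<^sub>R (\<mu> (snd p) * (norm (grad (dq b h) p))\<^sup>2)) \<in> borel_measurable lebesgue"
      unfolding eq by (intro borel_measurable_times borel_measurable_indicator grad_sq_measurable ll half_sets)
    show "AE p in lebesgue. norm (indicator (half_ball R) p *\<^sub>R (\<mu> (snd p) * (norm (grad (dq b h) p))\<^sup>2))
        \<le> norm (2 / h\<^sup>2 * (F (p + ?c) + F p))"
    proof (rule AE_I2)
      fix p :: "(real^'n) \<times> real"
      have F0: "0 \<le> F p" for p
        using mu_pos[of "snd p"] by (auto simp: F_def indicator_def half_ball_def half_space_def less_imp_le)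
      show "norm (indicator (half_ball R) p *\<^sub>R (\<mu> (snd p) * (norm (grad (dq b h) p))\<^sup>2)) \<le> norm (2 / h\<^sup>2 * (F (p + ?c) + F p))"
      proof (cases "p \<in> half_ball R")
        case True
        then have pH: "p \<in> half_space" by (simp add: half_ball_def)
        then have m: "0 < \<mu> (snd p)" using mu_pos by (simp add: half_space_def)
        have pc: "p + ?c \<in> half_ball (R + 1)" "p \<in> half_ball (R + 1)"
          using True b h half_ball_shift[of p R "h *\<^sub>R b"] by (auto simp: half_ball_def)
        have "norm (grad (dq b h) p) \<le> (norm (grad u (p + ?c)) + norm (grad u p)) / h"
          using norm_triangle_ineq4[of "grad u (p + ?c)" "grad u p"] h pH by (simp add: dq_grad divide_right_mono)
        then have "(norm (grad (dq b h) p))\<^sup>2 \<le> ((norm (grad u (p + ?c)) + norm (grad u p)) / h)\<^sup>2"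
          by (intro power_mono) auto
        also have "\<dots> \<le> 2 / h\<^sup>2 * ((norm (grad u (p + ?c)))\<^sup>2 + (norm (grad u p))\<^sup>2)"
          using sum_squares_bound[of "norm (grad u (p + ?c))" "norm (grad u p)"] h
          by (simp add: power_divide power2_sum divide_right_mono)
        finally have "\<mu> (snd p) * (norm (grad (dq b h) p))\<^sup>2 \<le> \<mu> (snd p) * (2 / h\<^sup>2 * ((norm (grad u (p + ?c)))\<^sup>2 + (norm (grad u p))\<^sup>2))"
          using m by (intro mult_left_mono) auto
        also have "\<dots> = 2 / h\<^sup>2 * (F (p + ?c) + F p)"
          using pc by (simp add: F_def algebra_simps)
        finally show ?thesis
          using True m F0[of p] F0[of "p + ?c"] h by (simp add: abs_mult)
      next
        case False
        then show ?thesis by simp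
      qed
    qed
  qed
  then show ?thesis
    using energy_integrable[OF ll] by (simp add: set_integrable_def)
qed

lemma admissible_integrable_half_space:
  fixes \<xi> :: "(real^'n) \<times> real \<Rightarrow> real"
  assumes \<xi>: "admissible \<mu> R \<xi>"
  shows "integrable lebesgue (\<lambda>p. indicator half_space p * (\<mu> (snd p) * (norm (grad \<xi> p))\<^sup>2))"
proof -
  have ll: "locally_lipschitz_on half_space \<xi>" and z: "\<forall>p\<in>half_space - ball 0 R. \<xi> p = 0"
    and int: "integrable lebesgue (\<lambda>p. indicator (half_ball R) p *\<^sub>R (\<mu> (snd p) * (norm (grad \<xi> p))\<^sup>2))"
    using \<xi> by (simp_all add: admissible_def set_integrable_def)
  show ?thesis
  proof (rule integrable_cong_AE_imp[OF int grad_sq_measurable[OF ll]])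
    show "AE p in lebesgue. indicator (half_ball R) p *\<^sub>R (\<mu> (snd p) * (norm (grad \<xi> p))\<^sup>2)
        = indicator half_space p * (\<mu> (snd p) * (norm (grad \<xi> p))\<^sup>2)"
      using AE_grad_zero_outside_ball[OF z]
      by eventually_elim (auto simp: indicator_def half_ball_def)
  qed
qed

lemma admissible_translate:
  fixes \<xi> :: "(real^'n) \<times> real \<Rightarrow> real"
  assumes \<xi>: "admissible \<mu> R \<xi>" and c: "norm c \<le> 1"
  shows "admissible \<mu> (R + 1) (\<lambda>p. \<xi> (p + (c, 0)))"
  unfolding admissible_def
proof (intro conjI ballI)
  have ll: "locally_lipschitz_on half_space \<xi>" and z: "\<forall>p\<in>half_space - ball 0 R. \<xi> p = 0"
    and bd: "bounded (\<xi> ` half_space)"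
    using \<xi> by (simp_all add: admissible_def)
  have "(\<lambda>p. \<xi> (p + (c, 0))) ` half_space \<subseteq> \<xi> ` half_space"
    by (auto simp: half_space_def)
  then show "bounded ((\<lambda>p. \<xi> (p + (c, 0))) ` half_space)"
    by (rule bounded_subset[OF bd])
  show ll': "locally_lipschitz_on half_space (\<lambda>p. \<xi> (p + (c, 0)))"
    by (rule locally_lipschitz_on_translate[OF ll half_space_shift])
  fix p :: "(real^'n) \<times> real" assume p: "p \<in> half_space - ball 0 (R + 1)"
  have "norm p \<le> norm (p + (c, 0)) + norm c"
    using norm_triangle_ineq4[of "p + (c, 0)" "(c, 0)"] by (simp add: norm_Pair)
  then have "p + (c, 0) \<in> half_space - ball 0 R"
    using p c by (simp add: half_space_shift norm_Pair)
  then show "\<xi> (p + (c, 0)) = 0"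
    using z by blast
next
  have "integrable lebesgue (\<lambda>p. indicator half_space (p + (c, 0)) * (\<mu> (snd (p + (c, 0))) * (norm (grad \<xi> (p + (c, 0))))\<^sup>2))"
    by (rule integrable_lebesgue_translation[OF admissible_integrable_half_space[OF \<xi>]])
  moreover have "indicator half_space (p + (c, 0)) = (indicator half_space p :: real)" for p :: "(real^'n) \<times> real"
    by (simp add: indicator_def half_space_shift)
  ultimately have "set_integrable lebesgue half_space (\<lambda>p. \<mu> (snd p) * (norm (grad (\<lambda>p. \<xi> (p + (c, 0))) p))\<^sup>2)"
    by (simp add: set_integrable_def grad_translate)
  then show "set_integrable lebesgue (half_ball (R + 1)) (\<lambda>p. \<mu> (snd p) * (norm (grad (\<lambda>p. \<xi> (p + (c, 0))) p))\<^sup>2)"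
    by (rule set_integrable_subset) (auto simp: half_ball_def)
qed

lemma weak_formD:
  assumes "0 < R" "admissible \<mu> R \<xi>"
  shows "integrable lebesgue (\<lambda>p. indicator half_space p * (\<mu> (snd p) * (grad u p \<bullet> grad \<xi> p)))"
    "integrable lebesgue (\<lambda>p. indicator half_space p * (g (snd p) (u p) * \<xi> p))"
    "integrable lebesgue (\<lambda>y. f (trace u y) * trace \<xi> y)"
    "(\<integral>p. indicator half_space p * (\<mu> (snd p) * (grad u p \<bullet> grad \<xi> p)) \<partial>lebesgue)
      + (\<integral>p. indicator half_space p * (g (snd p) (u p) * \<xi> p) \<partial>lebesgue) = (\<integral>y. f (trace u y) * trace \<xi> y \<partial>lebesgue)"
  using u_solution assms unfolding weak_solution_def set_integrable_def set_lebesgue_integral_def real_scaleR_def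
  by blast+

text \<open>The test function is shifted back and the integrals are translated. This works because
  \<open>\<mu>\<close> and \<open>g\<close> depend on position only through \<open>x\<close>, and
  the shift is parallel to the boundary.\<close>

lemma weak_form_shifted:
  fixes \<xi> :: "(real^'n) \<times> real \<Rightarrow> real"
  assumes R: "0 < R" and \<xi>: "admissible \<mu> R \<xi>" and c: "norm c \<le> 1"
  shows "integrable lebesgue (\<lambda>p. indicator half_space p * (\<mu> (snd p) * (grad u (p + (c, 0)) \<bullet> grad \<xi> p)))"
    "integrable lebesgue (\<lambda>p. indicator half_space p * (g (snd p) (u (p + (c, 0))) * \<xi> p))"
    "integrable lebesgue (\<lambda>y. f (trace u (y + c)) * trace \<xi> y)"
    "(\<integral>p. indicator half_space p * (\<mu> (snd p) * (grad u (p + (c, 0)) \<bullet> grad \<xi> p)) \<partial>lebesgue)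
      + (\<integral>p. indicator half_space p * (g (snd p) (u (p + (c, 0))) * \<xi> p) \<partial>lebesgue)
      = (\<integral>y. f (trace u (y + c)) * trace \<xi> y \<partial>lebesgue)"
proof -
  let ?\<xi> = "\<lambda>p. \<xi> (p + (- c, 0))"
  define A where "A p = indicator half_space p * (\<mu> (snd p) * (grad u p \<bullet> grad ?\<xi> p))" for p
  define B where "B p = indicator half_space p * (g (snd p) (u p) * ?\<xi> p)" for p
  define F where "F y = f (trace u y) * trace ?\<xi> y" for y
  have adm: "admissible \<mu> (R + 1) ?\<xi>"
    using admissible_translate[OF \<xi>, of "- c"] c by simp
  have "0 < R + 1" using R by simp
  note W = weak_formD[OF this adm, folded A_def B_def F_def]
  have ind: "indicator half_space (p + (c, 0)) = (indicator half_space p :: real)" for p :: "(real^'n) \<times> real"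
    by (simp add: indicator_def half_space_shift)
  have A': "A (p + (c, 0)) = indicator half_space p * (\<mu> (snd p) * (grad u (p + (c, 0)) \<bullet> grad \<xi> p))" for p
    unfolding A_def ind grad_translate by (simp add: zero_prod_def[symmetric] add.assoc)
  have B': "B (p + (c, 0)) = indicator half_space p * (g (snd p) (u (p + (c, 0))) * \<xi> p)" for p
    unfolding B_def ind by (simp add: zero_prod_def[symmetric] add.assoc)
  have F': "F (y + c) = f (trace u (y + c)) * trace \<xi> y" for y
    unfolding F_def trace_translate by simp
  show "integrable lebesgue (\<lambda>p. indicator half_space p * (\<mu> (snd p) * (grad u (p + (c, 0)) \<bullet> grad \<xi> p)))"
    "integrable lebesgue (\<lambda>p. indicator half_space p * (g (snd p) (u (p + (c, 0))) * \<xi> p))"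
    "integrable lebesgue (\<lambda>y. f (trace u (y + c)) * trace \<xi> y)"
    unfolding A'[symmetric] B'[symmetric] F'[symmetric]
    by (rule integrable_lebesgue_translation W)+
  show "(\<integral>p. indicator half_space p * (\<mu> (snd p) * (grad u (p + (c, 0)) \<bullet> grad \<xi> p)) \<partial>lebesgue)
      + (\<integral>p. indicator half_space p * (g (snd p) (u (p + (c, 0))) * \<xi> p) \<partial>lebesgue)
      = (\<integral>y. f (trace u (y + c)) * trace \<xi> y \<partial>lebesgue)"
    unfolding A'[symmetric] B'[symmetric] F'[symmetric]
    using W(4) integral_lebesgue_translation[of A "(c, 0)"] integral_lebesgue_translation[of B "(c, 0)"] integral_lebesgue_translation[of F c]
      borel_measurable_integrable[OF W(1)] borel_measurable_integrable[OF W(2)] borel_measurable_integrable[OF W(3)] by simp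
qed

end

subsection \<open>Traces of the solution and of its difference quotients\<close>

lemma derivative_sequence:
  fixes F :: "'a::real_normed_vector \<Rightarrow> 'b::real_normed_vector"
  assumes F: "(F has_derivative D) (at p)"
  shows "(\<lambda>k. real (Suc k) *\<^sub>R (F (p + (1 / real (Suc k)) *\<^sub>R v) - F p)) \<longlonglongrightarrow> D v"
proof (rule metric_LIMSEQ_I)
  interpret D: bounded_linear D
    by (rule has_derivative_bounded_linear[OF F])
  fix e :: real assume e: "0 < e"
  define c where "c = norm v + 1"
  define e1 where "e1 = e / 2 / c"
  have v1: "0 < c"
    using norm_ge_zero[of v] unfolding c_def by linarith
  have e1: "0 < e1"
    using e v1 by (simp add: e1_def)
  have e1v: "e1 * norm v < e"
  proof -
    have "e1 * norm v \<le> e1 * c"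
      using e1 by (intro mult_left_mono) (auto simp: c_def)
    also have "\<dots> = e / 2"
      using v1 unfolding e1_def by simp
    finally show ?thesis using e by linarith
  qed
  obtain d where d: "0 < d" "\<And>y. norm (y - p) < d \<Longrightarrow> norm (F y - F p - D (y - p)) \<le> e1 * norm (y - p)"
    using F e1 unfolding has_derivative_at_alt by blast
  have "0 < d / c"
    using d(1) v1 by simp
  then obtain N where N: "1 / real (Suc N) < d / c"
    using nat_approx_posE by blast
  have "dist (real (Suc k) *\<^sub>R (F (p + (1 / real (Suc k)) *\<^sub>R v) - F p)) (D v) < e" if k: "N \<le> k" for k
  proof -
    define h where "h = 1 / real (Suc k)"
    have h: "0 < h" and hinv: "real (Suc k) = 1 / h" by (simp_all add: h_def)
    have "h \<le> 1 / real (Suc N)"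
      using k by (auto simp: h_def field_simps)
    then have hd: "h < d / c" using N by linarith
    have "h * norm v \<le> h * c"
      using h by (intro mult_left_mono) (auto simp: c_def)
    also have "\<dots> < d"
      using hd v1 by (simp only: pos_less_divide_eq)
    finally have "norm ((p + h *\<^sub>R v) - p) < d"
      using h by simp
    from d(2)[OF this] have est: "norm (F (p + h *\<^sub>R v) - F p - h *\<^sub>R D v) \<le> e1 * (h * norm v)"
      using h by (simp add: D.scaleR)
    have "(1 / h) *\<^sub>R (F (p + h *\<^sub>R v) - F p) - D v = (1 / h) *\<^sub>R (F (p + h *\<^sub>R v) - F p - h *\<^sub>R D v)"
      using h by (simp add: scaleR_diff_right)
    then have "norm ((1 / h) *\<^sub>R (F (p + h *\<^sub>R v) - F p) - D v) = (1 / h) * norm (F (p + h *\<^sub>R v) - F p - h *\<^sub>R D v)"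
      using h by simp
    also have "\<dots> \<le> (1 / h) * (e1 * (h * norm v))"
      using est h by (intro mult_left_mono) auto
    also have "\<dots> = e1 * norm v"
      using h by simp
    also have "\<dots> < e" by (rule e1v)
    finally show ?thesis
      unfolding dist_norm hinv h_def[symmetric] using h by simp
  qed
  then show "\<exists>N. \<forall>k\<ge>N. dist (real (Suc k) *\<^sub>R (F (p + (1 / real (Suc k)) *\<^sub>R v) - F p)) (D v) < e"
    by blast
qed

lemma locally_lipschitz_on_compact:
  fixes G :: "'a::metric_space \<Rightarrow> real"
  assumes G: "locally_lipschitz_on UNIV G" and X: "compact X"
  obtains L where "L-lipschitz_on X G"
proof -
  have "local_lipschitz {0::real} X (\<lambda>_. G)"
    by (rule local_lipschitz_subset[OF G]) auto
  then obtain L where "\<forall>t\<in>{0::real}. L-lipschitz_on X G"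
    by (rule local_lipschitz_compact_implies_lipschitz[OF _ X]) auto
  then show ?thesis
    using that by blast
qed

text \<open>The hypothesis bounds derivatives only where they exist. A globally Lipschitz extension
  makes \<open>real_derivative_bound_imp_increment_le\<close> applicable to the function and to its
  negative. For \<open>G = g x\<close> this yields a Lipschitz constant independent of
  \<open>x\<close>.\<close>

lemma lipschitz_of_derivative_bound:
  fixes G :: "real \<Rightarrow> real"
  assumes G: "locally_lipschitz_on UNIV G" and C: "0 \<le> C"
    and D: "\<And>t D. \<bar>t\<bar> < M \<Longrightarrow> (G has_real_derivative D) (at t) \<Longrightarrow> \<bar>D\<bar> \<le> C"
    and st: "\<bar>s\<bar> < M" "\<bar>t\<bar> < M"
  shows "\<bar>G s - G t\<bar> \<le> C * \<bar>s - t\<bar>"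
proof -
  have M: "0 \<le> M" using st by linarith
  obtain L0 where L0: "L0-lipschitz_on (cball 0 M) G"
    using locally_lipschitz_on_compact[OF G compact_cball] .
  obtain E where E: "L0-lipschitz_on UNIV E" "\<And>x. x \<in> cball 0 M \<Longrightarrow> E x = G x"
    using lipschitz_cball_extension[OF L0 M] by auto
  have DE: "\<bar>D\<bar> \<le> C" if "\<bar>x\<bar> < M" "(E has_real_derivative D) (at x)" for x D
  proof -
    have "(G has_real_derivative D) (at x)"
      by (rule has_field_derivative_transform_within_open[OF that(2), of "ball 0 M"]) (use that(1) E(2) in auto)
    then show ?thesis
      using D that(1) by blast
  qed
  have le: "\<bar>E q - E p\<bar> \<le> C * (q - p)" if pq: "p \<le> q" "- M < p" "q < M" for p q
  proof -
    have "E q - E p \<le> C * (q - p)"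
      by (rule real_derivative_bound_imp_increment_le[OF E(1) pq(1) C]) (use DE pq in force)
    moreover have "(- E q) - (- E p) \<le> C * (q - p)"
    proof (rule real_derivative_bound_imp_increment_le[OF _ pq(1) C])
      show "L0-lipschitz_on UNIV (\<lambda>x. - E x)"
        using E(1) by simp
      fix x D assume x: "p < x" "x < q" "((\<lambda>x. - E x) has_real_derivative D) (at x)"
      then have "(E has_real_derivative - D) (at x)"
        using DERIV_minus[OF x(3)] by simp
      moreover have "\<bar>x\<bar> < M"
        using x pq by linarith
      ultimately have "\<bar>- D\<bar> \<le> C"
        by (intro DE)
      then show "D \<le> C"
        by simp
    qed
    ultimately show ?thesis by linarith
  qed
  have "\<bar>E s - E t\<bar> \<le> C * \<bar>s - t\<bar>"
  proof (cases "s \<le> t")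
    case True
    then show ?thesis using le[of s t] st by (simp add: abs_minus_commute)
  next
    case False
    then show ?thesis using le[of t s] st by simp
  qed
  then show ?thesis
    using E(2) st by simp
qed

context stable_weak_solution
begin

lemma u_bound: obtains M where "0 < M" "\<forall>p\<in>half_space. \<bar>u p\<bar> < M"
proof -
  obtain M where "\<forall>x\<in>u ` half_space. norm x \<le> M"
    using u_bounded unfolding bounded_iff by blast
  then have "\<forall>p\<in>half_space. \<bar>u p\<bar> < \<bar>M\<bar> + 1"
    by force
  then show ?thesis
    by (intro that[of "\<bar>M\<bar> + 1"]) auto
qed

lemma g_increment_bound:
  assumes R: "0 < R" and M: "0 < M"
  obtains C where "0 \<le> C" "\<forall>x s t. 0 < x \<and> x < R \<and> \<bar>s\<bar> < M \<and> \<bar>t\<bar> < M \<longrightarrow> \<bar>g x s - g x t\<bar> \<le> C * \<bar>s - t\<bar>"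
proof -
  obtain C where C: "0 < C" "\<forall>x t D. 0 < x \<and> x < R \<and> \<bar>t\<bar> < M \<and> (g x has_real_derivative D) (at t) \<longrightarrow> \<bar>D\<bar> \<le> C"
    using g_deriv_bound[OF R M] by blast
  have "\<bar>g x s - g x t\<bar> \<le> C * \<bar>s - t\<bar>" if "0 < x" "x < R" "\<bar>s\<bar> < M" "\<bar>t\<bar> < M" for x s t
  proof (rule lipschitz_of_derivative_bound[OF g_lipschitz[OF that(1)] _ _ that(3,4)])
    show "0 \<le> C" using C(1) by simp
    show "\<bar>D\<bar> \<le> C" if "\<bar>t\<bar> < M" "(g x has_real_derivative D) (at t)" for t D
      using C(2) that \<open>0 < x\<close> \<open>x < R\<close> by blast
  qed
  then show ?thesis
    using C(1) by (intro that[of C]) auto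
qed

text \<open>The constant is uniform in the height, so it carries over to the trace.\<close>

lemma slice_lipschitz:
  assumes r: "0 < r"
  obtains C where "\<forall>x. 0 < x \<and> x < 1 \<longrightarrow> C-lipschitz_on (ball 0 r) (\<lambda>y. u (y, x))"
proof -
  obtain C where C: "0 \<le> C" "\<forall>p\<in>half_ball (r + 1). norm (fst (grad u p)) \<le> C"
    using grad_y_bounded[of "r + 1"] r by auto
  have "C-lipschitz_on (ball 0 r) (\<lambda>y. u (y, x))" if x: "0 < x" "x < 1" for x
  proof (rule bounded_derivative_imp_lipschitz)
    fix y :: "real^'n" assume y: "y \<in> ball 0 r"
    have p: "(y, x) \<in> half_space" using x by (simp add: half_space_def)
    have e: "((\<lambda>y. (y, x)) has_derivative (\<lambda>h. (h, 0))) (at y)"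
      by (auto intro!: derivative_eq_intros)
    have "((\<lambda>y. u (y, x)) has_derivative (\<lambda>h. (h, 0) \<bullet> grad u (y, x))) (at y)"
      using has_derivative_compose[OF e u_derivative[OF p]] .
    then have "((\<lambda>y. u (y, x)) has_derivative (\<lambda>h. h \<bullet> fst (grad u (y, x)))) (at y)"
      by (simp add: inner_prod_def)
    then show "((\<lambda>y. u (y, x)) has_derivative (\<lambda>h. h \<bullet> fst (grad u (y, x)))) (at y within ball 0 r)"
      by (rule has_derivative_at_withinI)
    have "norm (y, x) \<le> norm y + norm x"
      by (rule norm_Pair_le)
    then have "(y, x) \<in> half_ball (r + 1)"
      using y x by (simp add: half_ball_def half_space_def)
    then have b: "norm (fst (grad u (y, x))) \<le> C"
      using C(2) by blast
    show "onorm (\<lambda>h. h \<bullet> fst (grad u (y, x))) \<le> C"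
    proof (rule onorm_bound[OF C(1)])
      fix h
      have "norm (h \<bullet> fst (grad u (y, x))) \<le> norm h * norm (fst (grad u (y, x)))"
        by (simp add: Cauchy_Schwarz_ineq2)
      also have "\<dots> \<le> norm h * C"
        using b by (intro mult_left_mono) auto
      finally show "norm (h \<bullet> fst (grad u (y, x))) \<le> C * norm h"
        by (simp add: mult.commute)
    qed
  qed (use C in auto)
  then show ?thesis
    by (intro that[of C]) auto
qed

definition wc :: "real \<Rightarrow> ennreal"
  where "wc \<delta> = (\<integral>\<^sup>+x\<in>{0<..<\<delta>}. ennreal (1 / wt x) \<partial>lborel)"

lemma wc_tendsto_0: "(\<lambda>i. wc (1 / real (Suc i))) \<longlonglongrightarrow> 0"
proof -
  have [measurable]: "wt \<in> borel_measurable borel" by (rule wt)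
  have "(\<lambda>x. ennreal (1 / wt x)) \<in> borel_measurable borel" by measurable
  then show ?thesis
    unfolding wc_def by (rule nn_integral_Ioo_tendsto_0) (rule inverse_wt_integral_finite)
qed

text \<open>The half-ball of radius \<open>r + 1\<close> contains the cylinder of radius
  \<open>r\<close> and height 1 on which the Fubini estimate was made.\<close>

lemma vertical_variation_bound:
  assumes v: "C1_on half_space v" and \<epsilon>: "0 < \<epsilon>" and \<delta>: "\<delta> \<le> 1" and r: "0 < r"
  shows "(\<integral>\<^sup>+y\<in>ball 0 r. vertical_variation v \<delta> y \<partial>lborel)
    \<le> ennreal \<epsilon> * energy (r + 1) v + ennreal (1 / \<epsilon>) * wc \<delta> * emeasure lborel (ball (0::real^'n) r)"
proof -
  have "(\<integral>\<^sup>+p\<in>ball 0 r \<times> {0<..<1}. ennreal (wt (snd p) * (norm (grad v p))\<^sup>2) \<partial>lborel)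
      = (\<integral>\<^sup>+p\<in>ball 0 r \<times> {0<..<1}. ennreal (wt (snd p) * (norm (grad v p))\<^sup>2) \<partial>lebesgue)"
    by (rule nn_integral_lebesgue[symmetric])
  also have "\<dots> \<le> energy (r + 1) v"
    unfolding energy_def
  proof (rule nn_integral_mono_AE)
    show "AE p in lebesgue. ennreal (wt (snd p) * (norm (grad v p))\<^sup>2) * indicator (ball 0 r \<times> {0<..<1}) p
        \<le> ennreal (\<mu> (snd p) * (norm (grad v p))\<^sup>2) * indicator (half_ball (r + 1)) p"
      using AE_wt
    proof eventually_elim
      fix p :: "(real^'n) \<times> real" assume p: "p \<in> half_space \<longrightarrow> wt (snd p) = \<mu> (snd p)"
      show "ennreal (wt (snd p) * (norm (grad v p))\<^sup>2) * indicator (ball 0 r \<times> {0<..<1}) p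
        \<le> ennreal (\<mu> (snd p) * (norm (grad v p))\<^sup>2) * indicator (half_ball (r + 1)) p"
      proof (cases "p \<in> ball 0 r \<times> {0<..<1}")
        case True
        obtain y x where yx: "p = (y, x)" by (cases p)
        have "norm (y, x) \<le> norm y + norm x"
          by (rule norm_Pair_le)
        then have "p \<in> half_ball (r + 1)"
          using True by (simp add: half_ball_def half_space_def yx)
        then show ?thesis
          using True p by (simp add: half_ball_def)
      qed simp
    qed
  qed
  finally have le: "(\<integral>\<^sup>+p\<in>ball 0 r \<times> {0<..<1}. ennreal (wt (snd p) * (norm (grad v p))\<^sup>2) \<partial>lborel) \<le> energy (r + 1) v" .
  show ?thesis
    unfolding wc_def
    by (rule order_trans[OF vertical_variation_integral_le[OF v wt(1,2) \<epsilon> \<delta>]]) (intro add_mono mult_left_mono le, auto)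
qed

lemma AE_vertical_variation_finite:
  assumes v: "C1_on half_space v" and E: "\<And>R. 0 < R \<Longrightarrow> energy R v < \<infinity>"
  shows "AE y in lebesgue. vertical_variation v 1 y < \<infinity>"
proof -
  have [measurable]: "vertical_variation v 1 \<in> borel_measurable borel"
    by (rule vertical_variation_measurable[OF v])
  have "AE y in lborel. y \<in> ball 0 (real (Suc n)) \<longrightarrow> vertical_variation v 1 y < \<infinity>" for n
  proof -
    let ?B = "ball (0::real^'n) (real (Suc n))"
    have "(\<integral>\<^sup>+y\<in>?B. vertical_variation v 1 y \<partial>lborel) \<le> ennreal 1 * energy (real (Suc n) + 1) v + ennreal (1 / 1) * wc 1 * emeasure lborel ?B"
      by (rule vertical_variation_bound[OF v]) auto
    also have "\<dots> < \<infinity>"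
      using E[of "real (Suc n) + 1"] inverse_wt_integral_finite emeasure_lborel_ball_finite[of "0::real^'n" "real (Suc n)"]
      by (simp add: wc_def ennreal_mult_less_top del: of_nat_Suc)
    finally have fin: "(\<integral>\<^sup>+y\<in>?B. vertical_variation v 1 y \<partial>lborel) \<noteq> \<infinity>"
      by simp
    have "?B \<in> sets borel" by simp
    then have "(\<lambda>y. vertical_variation v 1 y * indicator ?B y) \<in> borel_measurable lborel"
      by measurable
    from nn_integral_PInf_AE[OF this fin]
    show ?thesis
      by eventually_elim (auto simp: less_top[symmetric] indicator_def)
  qed
  then have "AE y in lborel. \<forall>n. y \<in> ball 0 (real (Suc n)) \<longrightarrow> vertical_variation v 1 y < \<infinity>"
    unfolding AE_all_countable by blast
  then have "AE y in lborel. vertical_variation v 1 y < \<infinity>"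
  proof eventually_elim
    fix y :: "real^'n" assume y: "\<forall>n. y \<in> ball 0 (real (Suc n)) \<longrightarrow> vertical_variation v 1 y < \<infinity>"
    obtain n where "norm y < real n"
      using reals_Archimedean2 by blast
    then have "y \<in> ball 0 (real (Suc n))" by simp
    then show "vertical_variation v 1 y < \<infinity>" using y by blast
  qed
  then show ?thesis
    by (rule AE_completion)
qed

text \<open>Finite vertical variation gives the limit for almost every \<open>z\<close>. Such points
  are dense, and the Lipschitz bound of the slices, uniform in the height, carries the Cauchy
  property to every \<open>y\<close>. Existence everywhere allows the trace to be translated,
  differenced and differentiated.\<close>

lemma trace_u: "((\<lambda>x. u (y, x)) \<longlongrightarrow> trace u y) (at_right 0)"
proof -
  have "\<exists>l. ((\<lambda>x. u (y, x)) \<longlongrightarrow> l) (at_right 0)"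
  proof (rule at_right_limit_if_cauchy)
    fix e :: real assume e: "0 < e"
    have r: "0 < norm y + 1" using norm_ge_zero[of y] by linarith
    obtain C where C: "\<forall>x. 0 < x \<and> x < 1 \<longrightarrow> C-lipschitz_on (ball 0 (norm y + 1)) (\<lambda>y. u (y, x))"
      using slice_lipschitz[OF r] .
    have C0: "0 \<le> C"
    proof -
      have "C-lipschitz_on (ball 0 (norm y + 1)) (\<lambda>y. u (y, 1 / 2))"
        using C by simp
      then show ?thesis by (rule lipschitz_on_nonneg)
    qed
    \<comment> \<open>Small enough for a Lipschitz error of at most \<open>e / 3\<close> and for
      \<open>z\<close> to stay in the ball of radius \<open>norm y + 1\<close>.\<close>
    define \<rho> where "\<rho> = min 1 (e / 3 / (C + 1))"
    have \<rho>: "0 < \<rho>" using e C0 by (simp add: \<rho>_def)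
    have "negligible {z. \<not> vertical_variation u 1 z < \<infinity>}"
      using AE_vertical_variation_finite[OF u_C1 energy_u_finite] by (simp only: AE_lebesgue_negligible)
    moreover have "\<not> negligible (ball y \<rho>)"
      using \<rho> by (intro open_not_negligible) auto
    ultimately obtain z where z: "z \<in> ball y \<rho>" "vertical_variation u 1 z < \<infinity>"
      using negligible_subset[of "{z. \<not> vertical_variation u 1 z < \<infinity>}" "ball y \<rho>"] by blast
    have zy: "norm (y - z) < \<rho>" using z(1) by (simp add: dist_norm)
    have "norm z \<le> norm y + norm (y - z)"
      using norm_triangle_ineq4[of y "y - z"] by simp
    then have zB: "z \<in> ball 0 (norm y + 1)" "y \<in> ball 0 (norm y + 1)"
      using zy by (auto simp: \<rho>_def)
    \<comment> \<open>Two Lipschitz errors \<open>e / 3\<close> and two errors \<open>e / 6\<close>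
      will add up to \<open>e\<close>.\<close>
    have "eventually (\<lambda>x. dist (u (z, x)) (trace u z) < e / 6) (at_right 0)"
      using C1_on_trace(1)[OF u_C1 z(2)] e by (intro tendstoD) auto
    then obtain d where d: "0 < d" "\<And>x. 0 < x \<Longrightarrow> x < d \<Longrightarrow> dist (u (z, x)) (trace u z) < e / 6"
      unfolding eventually_at_right_field by auto
    have uyz: "\<bar>u (y, x) - u (z, x)\<bar> \<le> e / 3" if x: "0 < x" "x < 1" for x
    proof -
      have "\<bar>u (y, x) - u (z, x)\<bar> \<le> C * norm (y - z)"
        using C x zB by (intro lipschitz_on_real_bound[of C "ball 0 (norm y + 1)" "\<lambda>y. u (y, x)"]) auto
      also have "\<dots> \<le> (C + 1) * (e / 3 / (C + 1))"
        using zy C0 e by (intro mult_mono) (auto simp: \<rho>_def)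
      also have "\<dots> = e / 3"
      proof -
        have "c * (e / 3 / c) = e / 3" if "c \<noteq> 0" for c :: real
          using that by simp
        moreover have "C + 1 \<noteq> 0" using C0 by linarith
        ultimately show ?thesis by blast
      qed
      finally show ?thesis .
    qed
    have "\<bar>u (y, s) - u (y, t)\<bar> \<le> e" if st: "0 < s" "s < min d 1" "0 < t" "t < min d 1" for s t
      using uyz[of s] uyz[of t] d(2)[of s] d(2)[of t] st unfolding dist_real_def by linarith
    then show "\<exists>d>0. \<forall>s t. 0 < s \<and> s < d \<and> 0 < t \<and> t < d \<longrightarrow> \<bar>u (y, s) - u (y, t)\<bar> \<le> e"
      using d(1) by (intro exI[of _ "min d 1"]) auto
  qed
  then show ?thesis
    using trace_eqI[of u y] by force
qed

lemma eventually_at_right_lt: "0 < d \<Longrightarrow> eventually (\<lambda>x. 0 < x \<and> x < d) (at_right (0::real))"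
  unfolding eventually_at_right_field by (intro exI[of _ d]) auto

lemma trace_u_bound:
  assumes "\<forall>p\<in>half_space. \<bar>u p\<bar> < M"
  shows "\<bar>trace u y\<bar> \<le> M"
proof (rule tendsto_upperbound)
  show "((\<lambda>x. \<bar>u (y, x)\<bar>) \<longlongrightarrow> \<bar>trace u y\<bar>) (at_right 0)"
    by (intro tendsto_rabs trace_u)
  have "eventually (\<lambda>x. 0 < x \<and> x < 1) (at_right (0::real))"
    by (rule eventually_at_right_lt) simp
  then show "eventually (\<lambda>x. \<bar>u (y, x)\<bar> \<le> M) (at_right 0)"
  proof eventually_elim
    fix x :: real assume "0 < x \<and> x < 1"
    then have "(y, x) \<in> half_space" by (simp add: half_space_def)
    then show "\<bar>u (y, x)\<bar> \<le> M" using assms less_imp_le by blast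
  qed
qed simp

lemma trace_u_lipschitz:
  assumes r: "0 < r"
  obtains C where "C-lipschitz_on (ball 0 r) (trace u)"
proof -
  obtain C where C: "\<forall>x. 0 < x \<and> x < 1 \<longrightarrow> C-lipschitz_on (ball 0 r) (\<lambda>y. u (y, x))"
    using slice_lipschitz[OF r] .
  have C0: "0 \<le> C"
  proof -
    have "C-lipschitz_on (ball 0 r) (\<lambda>y. u (y, 1 / 2))"
      using C by simp
    then show ?thesis by (rule lipschitz_on_nonneg)
  qed
  have "C-lipschitz_on (ball 0 r) (trace u)"
  proof (rule lipschitz_onI[OF _ C0])
    fix y z :: "real^'n" assume yz: "y \<in> ball 0 r" "z \<in> ball 0 r"
    show "dist (trace u y) (trace u z) \<le> C * dist y z"
    proof (rule tendsto_upperbound)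
      show "((\<lambda>x. dist (u (y, x)) (u (z, x))) \<longlongrightarrow> dist (trace u y) (trace u z)) (at_right 0)"
        by (intro tendsto_dist trace_u)
      have "eventually (\<lambda>x. 0 < x \<and> x < 1) (at_right (0::real))"
        by (rule eventually_at_right_lt) simp
      then show "eventually (\<lambda>x. dist (u (y, x)) (u (z, x)) \<le> C * dist y z) (at_right 0)"
        by eventually_elim (use C lipschitz_onD[OF _ yz] in blast)
    qed simp
  qed
  then show ?thesis by (rule that)
qed

lemma AE_trace_u_differentiable: "AE y in lebesgue. trace u differentiable (at y)"
proof -
  have "negligible {y \<in> ball 0 (real (Suc n)). \<not> trace u differentiable (at y)}" for n
  proof -
    obtain C where "C-lipschitz_on (ball 0 (real (Suc n))) (trace u)"
      using trace_u_lipschitz[of "real (Suc n)"] by auto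
    then show ?thesis
      by (intro rademacher_local locally_lipschitz_on_lipschitz) auto
  qed
  then have N: "negligible (\<Union>n. {y \<in> ball 0 (real (Suc n)). \<not> trace u differentiable (at y)})"
    by (rule negligible_Union_nat)
  show ?thesis
  proof (rule AE_lebesgueI[OF N], rule ccontr)
    fix y assume y: "y \<notin> (\<Union>n. {y \<in> ball 0 (real (Suc n)). \<not> trace u differentiable (at y)})"
      and nd: "\<not> trace u differentiable (at y)"
    obtain n where "norm y < real n"
      using reals_Archimedean2 by blast
    then have "y \<in> ball 0 (real (Suc n))" by simp
    then show False using y nd by blast
  qed
qed

lemma trace_dq:
  "((\<lambda>x. dq b h (y, x)) \<longlongrightarrow> (trace u (y + h *\<^sub>R b) - trace u y) / h) (at_right 0)"
  unfolding dq_def by (cases "h = 0") (auto intro!: tendsto_intros trace_u)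

end

subsection \<open>Energy estimates\<close>

text \<open>Completing the square. With \<open>a\<close> the gradient of \<open>w\<close> and
  \<open>d\<close> that of a cutoff \<open>e\<close>, the left side pairs \<open>a\<close> with the
  gradient of \<open>e\<^sup>2 w\<close>; the right side is the energy density of \<open>e w\<close>
  minus an error free of derivatives of \<open>w\<close>.\<close>

lemma caccioppoli_identity:
  fixes a d :: "'a::real_inner"
  shows "a \<bullet> (e\<^sup>2 *\<^sub>R a + w *\<^sub>R ((2 * e) *\<^sub>R d)) = (norm (e *\<^sub>R a + w *\<^sub>R d))\<^sup>2 - w\<^sup>2 * (norm d)\<^sup>2"
  unfolding power2_norm_eq_inner
  by (simp add: inner_add_left inner_add_right inner_commute power2_eq_square algebra_simps)

context stable_weak_solution
begin

lemma difference_weak_form: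
  fixes \<xi> :: "(real^'n) \<times> real \<Rightarrow> real"
  assumes R: "0 < R" and \<xi>: "admissible \<mu> R \<xi>" and b: "b \<in> Basis" and h: "0 < h" "h \<le> 1"
  shows "integrable lebesgue (\<lambda>p. indicator half_space p * (\<mu> (snd p) * (grad (dq b h) p \<bullet> grad \<xi> p)))"
    "integrable lebesgue (\<lambda>p. indicator half_space p * ((g (snd p) (u (p + (h *\<^sub>R b, 0))) - g (snd p) (u p)) / h * \<xi> p))"
    "integrable lebesgue (\<lambda>y. (f (trace u (y + h *\<^sub>R b)) - f (trace u y)) / h * trace \<xi> y)"
    "(\<integral>p. indicator half_space p * (\<mu> (snd p) * (grad (dq b h) p \<bullet> grad \<xi> p)) \<partial>lebesgue)
      + (\<integral>p. indicator half_space p * ((g (snd p) (u (p + (h *\<^sub>R b, 0))) - g (snd p) (u p)) / h * \<xi> p) \<partial>lebesgue)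
      = (\<integral>y. (f (trace u (y + h *\<^sub>R b)) - f (trace u y)) / h * trace \<xi> y \<partial>lebesgue)"
proof -
  define c where "c = h *\<^sub>R b"
  have c: "norm c \<le> 1" using b h by (simp add: c_def)
  define A A' where "A p = indicator half_space p * (\<mu> (snd p) * (grad u p \<bullet> grad \<xi> p))"
    and "A' p = indicator half_space p * (\<mu> (snd p) * (grad u (p + (c, 0)) \<bullet> grad \<xi> p))" for p
  define B B' where "B p = indicator half_space p * (g (snd p) (u p) * \<xi> p)"
    and "B' p = indicator half_space p * (g (snd p) (u (p + (c, 0))) * \<xi> p)" for p
  define F F' where "F y = f (trace u y) * trace \<xi> y" and "F' y = f (trace u (y + c)) * trace \<xi> y" for y
  note W = weak_formD[OF R \<xi>, folded A_def B_def F_def]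
  note W' = weak_form_shifted[OF R \<xi> c, folded A'_def B'_def F'_def]
  have eA: "indicator half_space p * (\<mu> (snd p) * (grad (dq b h) p \<bullet> grad \<xi> p)) = 1 / h * (A' p - A p)" for p
    by (cases "p \<in> half_space") (simp_all add: A_def A'_def dq_grad c_def inner_diff_left algebra_simps)
  have eB: "indicator half_space p * ((g (snd p) (u (p + (h *\<^sub>R b, 0))) - g (snd p) (u p)) / h * \<xi> p) = 1 / h * (B' p - B p)" for p
    using h by (simp add: B_def B'_def c_def field_simps)
  have eF: "(f (trace u (y + h *\<^sub>R b)) - f (trace u y)) / h * trace \<xi> y = 1 / h * (F' y - F y)" for y
    using h by (simp add: F_def F'_def c_def field_simps)
  show "integrable lebesgue (\<lambda>p. indicator half_space p * (\<mu> (snd p) * (grad (dq b h) p \<bullet> grad \<xi> p)))"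
    "integrable lebesgue (\<lambda>p. indicator half_space p * ((g (snd p) (u (p + (h *\<^sub>R b, 0))) - g (snd p) (u p)) / h * \<xi> p))"
    "integrable lebesgue (\<lambda>y. (f (trace u (y + h *\<^sub>R b)) - f (trace u y)) / h * trace \<xi> y)"
    unfolding eA eB eF using W W' by (intro integrable_mult_right Bochner_Integration.integrable_diff; simp)+
  have "(\<integral>p. A' p \<partial>lebesgue) - (\<integral>p. A p \<partial>lebesgue) + ((\<integral>p. B' p \<partial>lebesgue) - (\<integral>p. B p \<partial>lebesgue))
      = (\<integral>p. F' p \<partial>lebesgue) - (\<integral>p. F p \<partial>lebesgue)"
    using W(4) W'(4) by simp
  then have "1 / h * (((\<integral>p. A' p \<partial>lebesgue) - (\<integral>p. A p \<partial>lebesgue)) + ((\<integral>p. B' p \<partial>lebesgue) - (\<integral>p. B p \<partial>lebesgue)))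
      = 1 / h * ((\<integral>p. F' p \<partial>lebesgue) - (\<integral>p. F p \<partial>lebesgue))"
    by simp
  then show "(\<integral>p. indicator half_space p * (\<mu> (snd p) * (grad (dq b h) p \<bullet> grad \<xi> p)) \<partial>lebesgue)
      + (\<integral>p. indicator half_space p * ((g (snd p) (u (p + (h *\<^sub>R b, 0))) - g (snd p) (u p)) / h * \<xi> p) \<partial>lebesgue)
      = (\<integral>y. (f (trace u (y + h *\<^sub>R b)) - f (trace u y)) / h * trace \<xi> y \<partial>lebesgue)"
    unfolding eA eB eF
    using W(1-3) W'(1-3) by (simp only: integral_mult_right_zero Bochner_Integration.integral_diff distrib_left)
qed

text \<open>This is the error term of \<open>caccioppoli_identity\<close>. Its majorant depends on
  \<open>v\<close> only through the bound \<open>C\<close>, so it is common to all difference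
  quotients.\<close>

lemma weighted_cutoff_term:
  fixes \<eta> v :: "(real^'n) \<times> real \<Rightarrow> real"
  assumes \<eta>: "cutoff R \<eta>" and R: "0 < R" and v: "C1_on half_space v"
    and C: "\<forall>p\<in>half_ball R. \<bar>v p\<bar> \<le> C" and D: "\<forall>p\<in>half_space. \<eta> differentiable (at p) \<longrightarrow> norm (grad \<eta> p) \<le> D"
  shows "integrable lebesgue (\<lambda>p. indicator half_space p * (\<mu> (snd p) * ((v p)\<^sup>2 * (norm (grad \<eta> p))\<^sup>2)))" (is "integrable _ ?F")
    and "AE p in lebesgue. \<bar>indicator half_space p * (\<mu> (snd p) * ((v p)\<^sup>2 * (norm (grad \<eta> p))\<^sup>2))\<bar>
      \<le> C\<^sup>2 * D\<^sup>2 * (indicator (half_ball R) p * \<mu> (snd p))"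
proof -
  have z: "\<forall>p\<in>half_space - ball 0 R. \<eta> p = 0"
    using \<eta> by (simp add: cutoff_def)
  show bd: "AE p in lebesgue. \<bar>?F p\<bar> \<le> C\<^sup>2 * D\<^sup>2 * (indicator (half_ball R) p * \<mu> (snd p))"
    using AE_grad_zero_outside_ball[OF z] AE_differentiable_half_space[OF cutoff_locally_lipschitz[OF \<eta>]]
  proof eventually_elim
    fix p assume z: "p \<in> half_space - half_ball R \<longrightarrow> grad \<eta> p = 0" and d: "p \<in> half_space \<longrightarrow> \<eta> differentiable (at p)"
    show "\<bar>?F p\<bar> \<le> C\<^sup>2 * D\<^sup>2 * (indicator (half_ball R) p * \<mu> (snd p))"
    proof (cases "p \<in> half_ball R")
      case True
      then have pH: "p \<in> half_space" by (simp add: half_ball_def)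
      then have m: "0 < \<mu> (snd p)" using mu_pos by (simp add: half_space_def)
      have "(v p)\<^sup>2 \<le> C\<^sup>2"
        using C True by (metis abs_le_square_iff abs_of_nonneg abs_ge_zero order_trans)
      moreover have "(norm (grad \<eta> p))\<^sup>2 \<le> D\<^sup>2"
        using D d pH by (intro power_mono) auto
      ultimately have "(v p)\<^sup>2 * (norm (grad \<eta> p))\<^sup>2 \<le> C\<^sup>2 * D\<^sup>2"
        by (intro mult_mono) auto
      then have "\<mu> (snd p) * ((v p)\<^sup>2 * (norm (grad \<eta> p))\<^sup>2) \<le> \<mu> (snd p) * (C\<^sup>2 * D\<^sup>2)"
        using m by (intro mult_left_mono) auto
      then show ?thesis
        using True pH m by (simp add: abs_mult mult.commute)
    next
      case False
      then show ?thesis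
        using z by (cases "p \<in> half_space") auto
    qed
  qed
  have "continuous_on half_space v"
    using local_lipschitz_continuous_on[OF C1_on_locally_lipschitz[OF open_half_space v], of 0] by simp
  then have "(\<lambda>p. indicator half_space p *\<^sub>R v p) \<in> borel_measurable borel"
    by (intro borel_measurable_continuous_on_indicator borel_open open_half_space)
  then have vm: "(\<lambda>p. indicator half_space p *\<^sub>R v p) \<in> borel_measurable lebesgue"
    by (intro measurable_completion) simp
  define a where "a p = indicator half_space p *\<^sub>R v p" for p
  define d where "d p = indicator half_space p * (\<mu> (snd p) * (norm (grad \<eta> p))\<^sup>2)" for p
  have [measurable]: "a \<in> borel_measurable lebesgue" "d \<in> borel_measurable lebesgue"
    unfolding a_def[abs_def] d_def[abs_def]
    by (rule vm grad_sq_measurable[OF cutoff_locally_lipschitz[OF \<eta>]])+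
  have "(\<lambda>p. (a p)\<^sup>2 * d p) \<in> borel_measurable lebesgue"
    by measurable
  moreover have "(\<lambda>p. (a p)\<^sup>2 * d p) = ?F"
    by (auto simp: a_def d_def indicator_def)
  ultimately have Fm: "?F \<in> borel_measurable lebesgue" by simp
  have "integrable lebesgue (\<lambda>p :: (real^'n) \<times> real. C\<^sup>2 * D\<^sup>2 * (indicator (half_ball R) p * \<mu> (snd p)))"
    using mu_half_ball_integrable[OF R] unfolding set_integrable_def real_scaleR_def by (intro integrable_mult_right)
  then show "integrable lebesgue ?F"
    by (rule Bochner_Integration.integrable_bound[OF _ Fm]) (use bd in eventually_elim, auto)
qed

definition grad_term :: "((real^'n) \<times> real \<Rightarrow> real) \<Rightarrow> (real^'n) \<times> real \<Rightarrow> real"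
  where "grad_term v p = indicator half_space p * (\<mu> (snd p) * (norm (grad v p))\<^sup>2)"

definition weight_term :: "((real^'n) \<times> real \<Rightarrow> real) \<Rightarrow> ((real^'n) \<times> real \<Rightarrow> real) \<Rightarrow> (real^'n) \<times> real \<Rightarrow> real"
  where "weight_term \<eta> v p = indicator half_space p * (\<mu> (snd p) * ((v p)\<^sup>2 * (norm (grad \<eta> p))\<^sup>2))"

definition bulk_term :: "((real^'n) \<times> real \<Rightarrow> real) \<Rightarrow> real^'n \<Rightarrow> real \<Rightarrow> (real^'n) \<times> real \<Rightarrow> real"
  where "bulk_term \<eta> b h p = indicator half_space p *
    ((g (snd p) (u (p + (h *\<^sub>R b, 0))) - g (snd p) (u p)) / h * ((\<eta> p)\<^sup>2 * dq b h p))"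

text \<open>The last quotient is the trace of \<open>dq b h\<close>, so the test function behind
  this term is the same as in \<open>bulk_term\<close>.\<close>

definition boundary_term :: "((real^'n) \<times> real \<Rightarrow> real) \<Rightarrow> real^'n \<Rightarrow> real \<Rightarrow> real^'n \<Rightarrow> real"
  where "boundary_term \<eta> b h y = (f (trace u (y + h *\<^sub>R b)) - f (trace u y)) / h *
    ((trace \<eta> y)\<^sup>2 * ((trace u (y + h *\<^sub>R b) - trace u y) / h))"

text \<open>Because \<open>caccioppoli_identity\<close> is an equality, nothing is lost before the
  limit. This matters for the constant: the coefficient 1 of \<open>weight_term\<close> is the one
  on the right side of the final inequality.\<close>

lemma energy_identity:
  assumes \<eta>: "cutoff R \<eta>" and R: "0 < R" and b: "b \<in> Basis" and h: "0 < h" "h \<le> 1"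
  shows "integrable lebesgue (grad_term (\<lambda>p. \<eta> p * dq b h p))"
    "integrable lebesgue (bulk_term \<eta> b h)"
    "integrable lebesgue (boundary_term \<eta> b h)"
    "integral\<^sup>L lebesgue (grad_term (\<lambda>p. \<eta> p * dq b h p))
      = integral\<^sup>L lebesgue (weight_term \<eta> (dq b h)) - integral\<^sup>L lebesgue (bulk_term \<eta> b h) + integral\<^sup>L lebesgue (boundary_term \<eta> b h)"
proof -
  let ?w = "dq b h"
  let ?\<xi> = "\<lambda>p. (\<eta> p)\<^sup>2 * ?w p"
  have \<eta>2: "cutoff R (\<lambda>p. (\<eta> p)\<^sup>2)"
    by (rule cutoff_power2[OF \<eta> R])
  have wl: "locally_lipschitz_on half_space ?w"
    by (rule C1_on_locally_lipschitz[OF open_half_space dq_C1])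
  obtain C where C: "0 \<le> C" "\<forall>b\<in>Basis. \<forall>p\<in>half_ball R. \<bar>du b p\<bar> \<le> C"
    "\<forall>b\<in>Basis. \<forall>h. 0 < h \<and> h \<le> 1 \<longrightarrow> (\<forall>p\<in>half_ball R. \<bar>dq b h p\<bar> \<le> C)"
    by (rule du_dq_bounded[OF R])
  have wC: "\<forall>p\<in>half_ball R. \<bar>?w p\<bar> \<le> C"
    using C(3) b h by blast
  note E = energy_dq_finite[OF R b h]
  note adm2 = admissible_mult[OF \<eta>2 R wl wC E]
  note adm1 = admissible_mult[OF \<eta> R wl wC E]
  note W = difference_weak_form[OF R adm2(1) b h]
  have tr: "trace ?\<xi> y = (trace \<eta> y)\<^sup>2 * ((trace u (y + h *\<^sub>R b) - trace u y) / h)" for y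
    by (rule trace_mult[OF tendsto_power[OF cutoff_trace[OF \<eta>]] trace_dq])
  show bulk: "integrable lebesgue (bulk_term \<eta> b h)"
    using W(2) by (simp add: bulk_term_def[abs_def])
  have bt: "(f (trace u (y + h *\<^sub>R b)) - f (trace u y)) / h * trace ?\<xi> y = boundary_term \<eta> b h y" for y
    by (simp only: boundary_term_def tr)
  show bdry: "integrable lebesgue (boundary_term \<eta> b h)"
    using W(3) unfolding bt .
  obtain D where D: "0 \<le> D" "\<forall>p\<in>half_space. \<bar>\<eta> p\<bar> \<le> D"
    "\<forall>p\<in>half_space. \<eta> differentiable (at p) \<longrightarrow> norm (grad \<eta> p) \<le> D"
    by (rule cutoff_bounds[OF \<eta> R])
  have wt: "integrable lebesgue (weight_term \<eta> ?w)"
    using weighted_cutoff_term(1)[OF \<eta> R dq_C1 wC D(3)] by (simp add: weight_term_def[abs_def])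
  show gt: "integrable lebesgue (grad_term (\<lambda>p. \<eta> p * ?w p))"
    using admissible_integrable_half_space[OF adm1(1)] by (simp add: grad_term_def[abs_def])
  define A where "A p = indicator half_space p * (\<mu> (snd p) * (grad ?w p \<bullet> grad ?\<xi> p))" for p
  have A: "integrable lebesgue A"
    using W(1) by (simp add: A_def[abs_def])
  have "AE p in lebesgue. A p = grad_term (\<lambda>p. \<eta> p * ?w p) p - weight_term \<eta> ?w p"
    using adm1(2) adm2(2)
  proof eventually_elim
    fix p assume 1: "p \<in> half_space \<longrightarrow> \<eta> differentiable at p \<and> ?w differentiable at p \<and>
        grad (\<lambda>p. \<eta> p * ?w p) p = \<eta> p *\<^sub>R grad ?w p + ?w p *\<^sub>R grad \<eta> p"
      and 2: "p \<in> half_space \<longrightarrow> (\<lambda>p. (\<eta> p)\<^sup>2) differentiable at p \<and> ?w differentiable at p \<and>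
        grad ?\<xi> p = (\<eta> p)\<^sup>2 *\<^sub>R grad ?w p + ?w p *\<^sub>R grad (\<lambda>p. (\<eta> p)\<^sup>2) p"
    show "A p = grad_term (\<lambda>p. \<eta> p * ?w p) p - weight_term \<eta> ?w p"
    proof (cases "p \<in> half_space")
      case True
      have "grad (\<lambda>p. (\<eta> p)\<^sup>2) p = (2 * \<eta> p) *\<^sub>R grad \<eta> p"
        using 1 True grad_mult[of \<eta> p \<eta>] by (simp add: power2_eq_square scaleR_add_left[symmetric])
      then have "grad ?w p \<bullet> grad ?\<xi> p = grad ?w p \<bullet> ((\<eta> p)\<^sup>2 *\<^sub>R grad ?w p + ?w p *\<^sub>R ((2 * \<eta> p) *\<^sub>R grad \<eta> p))"
        using 2 True by simp
      also have "\<dots> = (norm (grad (\<lambda>p. \<eta> p * ?w p) p))\<^sup>2 - (?w p)\<^sup>2 * (norm (grad \<eta> p))\<^sup>2"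
        using 1 True by (simp only: caccioppoli_identity)
      finally have "grad ?w p \<bullet> grad ?\<xi> p = (norm (grad (\<lambda>p. \<eta> p * ?w p) p))\<^sup>2 - (?w p)\<^sup>2 * (norm (grad \<eta> p))\<^sup>2" .
      then show ?thesis
        using True by (simp add: A_def grad_term_def weight_term_def right_diff_distrib)
    qed (simp add: A_def grad_term_def weight_term_def)
  qed
  then have "integral\<^sup>L lebesgue A = (\<integral>p. grad_term (\<lambda>p. \<eta> p * ?w p) p - weight_term \<eta> ?w p \<partial>lebesgue)"
    using A gt wt by (intro integral_cong_AE) auto
  also have "\<dots> = integral\<^sup>L lebesgue (grad_term (\<lambda>p. \<eta> p * ?w p)) - integral\<^sup>L lebesgue (weight_term \<eta> ?w)"
    using gt wt by (rule Bochner_Integration.integral_diff)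
  finally have "integral\<^sup>L lebesgue A = integral\<^sup>L lebesgue (grad_term (\<lambda>p. \<eta> p * ?w p)) - integral\<^sup>L lebesgue (weight_term \<eta> ?w)" .
  moreover have "integral\<^sup>L lebesgue A + integral\<^sup>L lebesgue (bulk_term \<eta> b h) = integral\<^sup>L lebesgue (boundary_term \<eta> b h)"
    using W(4) unfolding bt by (simp add: A_def[abs_def] bulk_term_def[abs_def])
  ultimately show "integral\<^sup>L lebesgue (grad_term (\<lambda>p. \<eta> p * ?w p))
      = integral\<^sup>L lebesgue (weight_term \<eta> ?w) - integral\<^sup>L lebesgue (bulk_term \<eta> b h) + integral\<^sup>L lebesgue (boundary_term \<eta> b h)"
    by linarith
qed

lemma trace_difference_bound:
  assumes C: "\<forall>p\<in>half_ball R. \<bar>dq b h p\<bar> \<le> C" and y: "y \<in> ball 0 R"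
  shows "\<bar>(trace u (y + h *\<^sub>R b) - trace u y) / h\<bar> \<le> C"
proof (rule tendsto_upperbound)
  show "((\<lambda>x. \<bar>dq b h (y, x)\<bar>) \<longlongrightarrow> \<bar>(trace u (y + h *\<^sub>R b) - trace u y) / h\<bar>) (at_right 0)"
    by (intro tendsto_rabs trace_dq)
  have "0 < R - norm y" using y by simp
  from eventually_at_right_lt[OF this]
  show "eventually (\<lambda>x. \<bar>dq b h (y, x)\<bar> \<le> C) (at_right 0)"
  proof eventually_elim
    fix x :: real assume x: "0 < x \<and> x < R - norm y"
    have "norm (y, x) \<le> norm y + norm x"
      by (rule norm_Pair_le)
    then have "(y, x) \<in> half_ball R"
      using x by (simp add: half_ball_def half_space_def)
    then show "\<bar>dq b h (y, x)\<bar> \<le> C" using C by blast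
  qed
qed simp

text \<open>The majorants serve twice: their integrals bound the energy uniformly in
  \<open>h\<close>, and they dominate the passage to the limit.\<close>

lemma term_dominators:
  assumes \<eta>: "cutoff R \<eta>" and R: "0 < R" and b: "b \<in> Basis"
  obtains K where "0 \<le> K"
    "\<forall>h. 0 < h \<and> h \<le> 1 \<longrightarrow> (AE p in lebesgue. \<bar>weight_term \<eta> (dq b h) p\<bar> \<le> K * (indicator (half_ball R) p * \<mu> (snd p)))"
    "\<forall>h p. 0 < h \<and> h \<le> 1 \<longrightarrow> \<bar>bulk_term \<eta> b h p\<bar> \<le> K * indicator (half_ball R) p"
    "\<forall>h y. 0 < h \<and> h \<le> 1 \<longrightarrow> \<bar>boundary_term \<eta> b h y\<bar> \<le> K * indicator (ball 0 R) y"
proof -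
  obtain C where C: "0 \<le> C" "\<forall>b\<in>Basis. \<forall>p\<in>half_ball R. \<bar>du b p\<bar> \<le> C"
    "\<forall>b\<in>Basis. \<forall>h. 0 < h \<and> h \<le> 1 \<longrightarrow> (\<forall>p\<in>half_ball R. \<bar>dq b h p\<bar> \<le> C)"
    by (rule du_dq_bounded[OF R])
  obtain D where D: "0 \<le> D" "\<forall>p\<in>half_space. \<bar>\<eta> p\<bar> \<le> D"
    "\<forall>p\<in>half_space. \<eta> differentiable (at p) \<longrightarrow> norm (grad \<eta> p) \<le> D"
    by (rule cutoff_bounds[OF \<eta> R])
  obtain M where M: "0 < M" "\<forall>p\<in>half_space. \<bar>u p\<bar> < M"
    by (rule u_bound)
  obtain G where G: "0 \<le> G" "\<forall>x s t. 0 < x \<and> x < R \<and> \<bar>s\<bar> < M \<and> \<bar>t\<bar> < M \<longrightarrow> \<bar>g x s - g x t\<bar> \<le> G * \<bar>s - t\<bar>"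
    by (rule g_increment_bound[OF R M(1)])
  obtain F where F: "F-lipschitz_on (cball 0 M) f"
    using locally_lipschitz_on_compact[OF f_lipschitz compact_cball] .
  have F0: "0 \<le> F" by (rule lipschitz_on_nonneg[OF F])
  have z: "\<forall>p\<in>half_space - ball 0 R. \<eta> p = 0"
    using \<eta> by (simp add: cutoff_def)
  \<comment> \<open>One constant for three majorants: the squared quotient times the squared cutoff
    gradient, and the squared quotient times the squared cutoff with the Lipschitz constant
    \<open>G\<close> of \<open>g\<close> or \<open>F\<close> of \<open>f\<close>.\<close>
  define K where "K = C\<^sup>2 * D\<^sup>2 + (G * C) * (D\<^sup>2 * C) + (F * C) * (D\<^sup>2 * C)"
  have K: "0 \<le> C\<^sup>2 * D\<^sup>2" "0 \<le> (G * C) * (D\<^sup>2 * C)" "0 \<le> (F * C) * (D\<^sup>2 * C)"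
    using C D G F0 by auto
  then have K0: "0 \<le> K" and K1: "C\<^sup>2 * D\<^sup>2 \<le> K" and K2: "(G * C) * (D\<^sup>2 * C) \<le> K" and K3: "(F * C) * (D\<^sup>2 * C) \<le> K"
    unfolding K_def by linarith+
  have 1: "AE p in lebesgue. \<bar>weight_term \<eta> (dq b h) p\<bar> \<le> K * (indicator (half_ball R) p * \<mu> (snd p))"
    if h: "0 < h \<and> h \<le> 1" for h
  proof -
    have wC: "\<forall>p\<in>half_ball R. \<bar>dq b h p\<bar> \<le> C" using C(3) b h by blast
    show ?thesis
      using weighted_cutoff_term(2)[OF \<eta> R dq_C1 wC D(3)]
    proof eventually_elim
      fix p assume *: "\<bar>indicator half_space p * (\<mu> (snd p) * ((dq b h p)\<^sup>2 * (norm (grad \<eta> p))\<^sup>2))\<bar>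
        \<le> C\<^sup>2 * D\<^sup>2 * (indicator (half_ball R) p * \<mu> (snd p))"
      have "0 \<le> indicator (half_ball R) p * \<mu> (snd p)"
        using mu_pos[of "snd p"] by (auto simp: indicator_def half_ball_def half_space_def less_imp_le)
      then have "C\<^sup>2 * D\<^sup>2 * (indicator (half_ball R) p * \<mu> (snd p)) \<le> K * (indicator (half_ball R) p * \<mu> (snd p))"
        using K1 by (rule mult_right_mono[rotated])
      then show "\<bar>weight_term \<eta> (dq b h) p\<bar> \<le> K * (indicator (half_ball R) p * \<mu> (snd p))"
        using * unfolding weight_term_def by linarith
    qed
  qed
  have 2: "\<bar>bulk_term \<eta> b h p\<bar> \<le> K * indicator (half_ball R) p" if h: "0 < h \<and> h \<le> 1" for h p
  proof (cases "p \<in> half_ball R")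
    case True
    then have pH: "p \<in> half_space" by (simp add: half_ball_def)
    have wC: "\<bar>dq b h p\<bar> \<le> C" using C(3) b h True by blast
    have x: "0 < snd p" "snd p < R"
      using True norm_snd_le[of "snd p" "fst p"] by (auto simp: half_ball_def half_space_def)
    have us: "\<bar>u p\<bar> < M" "\<bar>u (p + (h *\<^sub>R b, 0))\<bar> < M"
      using M(2) pH by (auto simp: half_space_shift)
    have "\<bar>(g (snd p) (u (p + (h *\<^sub>R b, 0))) - g (snd p) (u p)) / h\<bar> = \<bar>g (snd p) (u (p + (h *\<^sub>R b, 0))) - g (snd p) (u p)\<bar> / h"
      using h by simp
    also have "\<dots> \<le> (G * \<bar>u (p + (h *\<^sub>R b, 0)) - u p\<bar>) / h"
      using G(2) x us h by (intro divide_right_mono) auto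
    also have "\<dots> = G * \<bar>dq b h p\<bar>"
      using h by (simp add: dq_def)
    also have "\<dots> \<le> G * C"
      using wC G(1) by (rule mult_left_mono)
    finally have a: "\<bar>(g (snd p) (u (p + (h *\<^sub>R b, 0))) - g (snd p) (u p)) / h\<bar> \<le> G * C" .
    have "(\<eta> p)\<^sup>2 \<le> D\<^sup>2"
      using D(1,2) pH by (metis abs_le_square_iff abs_of_nonneg)
    then have e: "\<bar>(\<eta> p)\<^sup>2 * dq b h p\<bar> \<le> D\<^sup>2 * C"
      unfolding abs_mult using wC by (intro mult_mono) auto
    have "\<bar>bulk_term \<eta> b h p\<bar> \<le> (G * C) * (D\<^sup>2 * C)"
      using pH mult_mono[OF a e] G(1) C(1) by (simp add: bulk_term_def abs_mult)
    then show ?thesis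
      using True K2 by simp
  next
    case False
    then have "p \<notin> half_space \<or> \<eta> p = 0"
      using z by (auto simp: half_ball_def)
    then show ?thesis
      using K0 by (auto simp: bulk_term_def)
  qed
  have 3: "\<bar>boundary_term \<eta> b h y\<bar> \<le> K * indicator (ball 0 R) y" if h: "0 < h \<and> h \<le> 1" for h y
  proof (cases "y \<in> ball 0 R")
    case True
    have tC: "\<bar>(trace u (y + h *\<^sub>R b) - trace u y) / h\<bar> \<le> C"
      using C(3) b h True by (intro trace_difference_bound) auto
    have us: "trace u y \<in> cball 0 M" "trace u (y + h *\<^sub>R b) \<in> cball 0 M"
      using trace_u_bound[OF M(2)] by auto
    have "\<bar>(f (trace u (y + h *\<^sub>R b)) - f (trace u y)) / h\<bar> = \<bar>f (trace u (y + h *\<^sub>R b)) - f (trace u y)\<bar> / h"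
      using h by simp
    also have "\<dots> \<le> (F * norm (trace u (y + h *\<^sub>R b) - trace u y)) / h"
      using h by (intro divide_right_mono lipschitz_on_real_bound[OF F us(2,1)]) auto
    also have "\<dots> = F * \<bar>(trace u (y + h *\<^sub>R b) - trace u y) / h\<bar>"
      using h by simp
    also have "\<dots> \<le> F * C"
      using tC F0 by (rule mult_left_mono)
    finally have a: "\<bar>(f (trace u (y + h *\<^sub>R b)) - f (trace u y)) / h\<bar> \<le> F * C" .
    have "\<bar>trace \<eta> y\<bar> \<le> D"
    proof (rule tendsto_upperbound)
      show "((\<lambda>x. \<bar>\<eta> (y, x)\<bar>) \<longlongrightarrow> \<bar>trace \<eta> y\<bar>) (at_right 0)"
        by (intro tendsto_rabs cutoff_trace[OF \<eta>])
      have "eventually (\<lambda>x. 0 < x \<and> x < 1) (at_right (0::real))"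
        by (rule eventually_at_right_lt) simp
      then show "eventually (\<lambda>x. \<bar>\<eta> (y, x)\<bar> \<le> D) (at_right 0)"
      proof eventually_elim
        fix x :: real assume "0 < x \<and> x < 1"
        then have "(y, x) \<in> half_space" by (simp add: half_space_def)
        then show "\<bar>\<eta> (y, x)\<bar> \<le> D" using D(2) by blast
      qed
    qed simp
    then have "(trace \<eta> y)\<^sup>2 \<le> D\<^sup>2"
      using D(1) by (metis abs_le_square_iff abs_of_nonneg)
    then have e: "\<bar>(trace \<eta> y)\<^sup>2 * ((trace u (y + h *\<^sub>R b) - trace u y) / h)\<bar> \<le> D\<^sup>2 * C"
      unfolding abs_mult[of "(trace \<eta> y)\<^sup>2"] using tC by (intro mult_mono) auto
    have "\<bar>boundary_term \<eta> b h y\<bar> = \<bar>(f (trace u (y + h *\<^sub>R b)) - f (trace u y)) / h\<bar> * \<bar>(trace \<eta> y)\<^sup>2 * ((trace u (y + h *\<^sub>R b) - trace u y) / h)\<bar>"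
      unfolding boundary_term_def by (rule abs_mult)
    also have "\<dots> \<le> (F * C) * (D\<^sup>2 * C)"
      using mult_mono[OF a e] F0 C(1) by simp
    finally show ?thesis
      using True K3 by simp
  next
    case False
    then have "trace \<eta> y = 0"
      using trace_outside_ball[OF z] by blast
    then show ?thesis
      using False by (simp add: boundary_term_def)
  qed
  show ?thesis
    using K0 1 2 3 by (intro that[of K]) auto
qed

end

text \<open>Increments are taken along a sequence, so that only countably many exceptional null sets
  arise and the convergence theorems for sequences apply.\<close>

definition hk :: "nat \<Rightarrow> real"
  where "hk k = 1 / real (Suc k)"

lemma hk: "0 < hk k" "hk k \<le> 1" "1 / hk k = real (Suc k)"
  by (simp_all add: hk_def)

lemma hk_tendsto: "hk \<longlonglongrightarrow> 0" "filterlim hk (at_right 0) sequentially"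
proof -
  show *: "hk \<longlonglongrightarrow> 0"
    unfolding hk_def by (rule LIMSEQ_Suc[OF lim_1_over_n])
  have "eventually (\<lambda>k. hk k \<in> {0<..}) sequentially"
    using hk(1) by (intro always_eventually) auto
  then show "filterlim hk (at_right 0) sequentially"
    using * unfolding filterlim_at by (auto simp: hk_def)
qed

lemma abs_integral_le:
  fixes F G :: "'a \<Rightarrow> real"
  assumes "integrable M F" "integrable M G" "AE x in M. \<bar>F x\<bar> \<le> G x"
  shows "\<bar>integral\<^sup>L M F\<bar> \<le> integral\<^sup>L M G"
proof -
  have "\<bar>integral\<^sup>L M F\<bar> \<le> (\<integral>x. \<bar>F x\<bar> \<partial>M)"
    by (rule integral_abs_bound)
  also have "\<dots> \<le> integral\<^sup>L M G"
    using assms by (intro integral_mono_AE) auto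
  finally show ?thesis .
qed

lemma fatou_bound:
  fixes F :: "nat \<Rightarrow> 'a \<Rightarrow> ennreal"
  assumes F: "\<And>k. F k \<in> borel_measurable M" and lim: "AE x in M. (\<lambda>k. F k x) \<longlonglongrightarrow> l x"
    and B: "\<And>k. (\<integral>\<^sup>+x. F k x \<partial>M) \<le> B k" and BC: "B \<longlonglongrightarrow> C"
  shows "(\<integral>\<^sup>+x. l x \<partial>M) \<le> C"
proof -
  have "(\<integral>\<^sup>+x. l x \<partial>M) = (\<integral>\<^sup>+x. liminf (\<lambda>k. F k x) \<partial>M)"
  proof (rule nn_integral_cong_AE)
    show "AE x in M. l x = liminf (\<lambda>k. F k x)"
      using lim by eventually_elim (rule lim_imp_Liminf[symmetric], auto)
  qed
  also have "\<dots> \<le> liminf (\<lambda>k. \<integral>\<^sup>+x. F k x \<partial>M)"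
    by (rule nn_integral_liminf[OF F])
  also have "\<dots> \<le> liminf B"
    using B by (intro Liminf_mono always_eventually allI)
  also have "\<dots> = C"
    using BC by (intro lim_imp_Liminf) auto
  finally show ?thesis .
qed

lemma AE_limit_measurable:
  fixes F :: "nat \<Rightarrow> 'a::euclidean_space \<Rightarrow> real"
  assumes F: "\<And>k. F k \<in> borel_measurable lebesgue" and lim: "AE x in lebesgue. (\<lambda>k. F k x) \<longlonglongrightarrow> l x"
  shows "l \<in> borel_measurable lebesgue"
proof (rule borel_measurable_AE)
  show "(\<lambda>x. lim (\<lambda>k. F k x)) \<in> borel_measurable lebesgue"
    by (rule borel_measurable_lim_metric[OF F])
  show "AE x in lebesgue. lim (\<lambda>k. F k x) = l x"
    using lim by eventually_elim (rule limI)
qed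

context stable_weak_solution
begin

section \<open>Limits of the difference quotients and of their traces\<close>

lemma dq_tendsto:
  assumes p: "p \<in> half_space"
  shows "(\<lambda>k. dq b (hk k) p) \<longlonglongrightarrow> du b p"
proof -
  have "(\<lambda>k. real (Suc k) *\<^sub>R (u (p + (1 / real (Suc k)) *\<^sub>R (b, 0)) - u p)) \<longlonglongrightarrow> (b, 0) \<bullet> grad u p"
    by (rule derivative_sequence[OF u_derivative[OF p]])
  moreover have "real (Suc k) *\<^sub>R (u (p + (1 / real (Suc k)) *\<^sub>R (b, 0)) - u p) = dq b (hk k) p" for k
    by (simp add: dq_def hk_def mult.commute del: of_nat_Suc)
  moreover have "(b, 0) \<bullet> grad u p = du b p"
    by (simp add: du_def inner_prod_def inner_commute)
  ultimately show ?thesis by simp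
qed

lemma hessian:
  obtains H where "\<forall>p\<in>half_space. (grad u has_derivative H p) (at p)"
    "\<forall>p\<in>half_space. \<forall>h k. H p h \<bullet> k = H p k \<bullet> h"
    "\<forall>b. \<forall>p\<in>half_space. (du b has_derivative (\<lambda>h. h \<bullet> H p (b, 0))) (at p)"
    "\<forall>b. \<forall>p\<in>half_space. grad (du b) p = H p (b, 0)"
proof -
  obtain H where H: "\<And>p. p \<in> half_space \<Longrightarrow> (grad u has_derivative H p) (at p)"
    "\<And>p h k. p \<in> half_space \<Longrightarrow> H p h \<bullet> k = H p k \<bullet> h"
    by (rule C2_onE[OF u_C2 open_half_space]) blast
  have eq: "du b = (\<lambda>p. grad u p \<bullet> (b, 0))" for b
    by (simp add: du_def inner_prod_def fun_eq_iff)
  have d: "(du b has_derivative (\<lambda>h. h \<bullet> H p (b, 0))) (at p)" if p: "p \<in> half_space" for b p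
  proof -
    have "(du b has_derivative (\<lambda>h. H p h \<bullet> (b, 0))) (at p)"
      unfolding eq by (rule has_derivative_inner_left[OF H(1)[OF p]])
    moreover have "H p h \<bullet> (b, 0) = h \<bullet> H p (b, 0)" for h
      using H(2)[OF p, of h "(b, 0)"] by (simp only: inner_commute)
    ultimately show ?thesis by simp
  qed
  show ?thesis
    by (rule that[of H]) (use H d grad_unique[OF d] in auto)
qed

lemma grad_dq_tendsto:
  assumes p: "p \<in> half_space"
  shows "(\<lambda>k. grad (dq b (hk k)) p) \<longlonglongrightarrow> grad (du b) p"
proof -
  obtain H where H: "\<forall>p\<in>half_space. (grad u has_derivative H p) (at p)"
    "\<forall>p\<in>half_space. \<forall>h k. H p h \<bullet> k = H p k \<bullet> h"
    "\<forall>b. \<forall>p\<in>half_space. (du b has_derivative (\<lambda>h. h \<bullet> H p (b, 0))) (at p)"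
    "\<forall>b. \<forall>p\<in>half_space. grad (du b) p = H p (b, 0)"
    by (rule hessian)
  have "(\<lambda>k. real (Suc k) *\<^sub>R (grad u (p + (1 / real (Suc k)) *\<^sub>R (b, 0)) - grad u p)) \<longlonglongrightarrow> H p (b, 0)"
    by (rule derivative_sequence) (use H(1) p in blast)
  moreover have "real (Suc k) *\<^sub>R (grad u (p + (1 / real (Suc k)) *\<^sub>R (b, 0)) - grad u p) = grad (dq b (hk k)) p" for k
    unfolding dq_grad(2)[OF p] hk(3) by (simp add: hk_def)
  moreover have "H p (b, 0) = grad (du b) p"
    using H(4) p by simp
  ultimately show ?thesis by simp
qed

lemma cutoff_exists:
  assumes R: "0 < R"
  obtains \<zeta> :: "(real^'n) \<times> real \<Rightarrow> real" where "cutoff (R + 1) \<zeta>" "\<forall>p\<in>half_ball R. \<zeta> p = 1"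
proof -
  define \<zeta> where "\<zeta> p = max 0 (min 1 (R + 1 - norm p))" for p :: "(real^'n) \<times> real"
  have "1-lipschitz_on half_space \<zeta>"
  proof (rule lipschitz_onI)
    fix p q :: "(real^'n) \<times> real"
    have "\<bar>norm p - norm q\<bar> \<le> norm (p - q)"
      by (rule norm_triangle_ineq3)
    then show "dist (\<zeta> p) (\<zeta> q) \<le> 1 * dist p q"
      unfolding \<zeta>_def dist_norm real_norm_def by (auto simp: max_def min_def)
  qed simp
  then have "cutoff (R + 1) \<zeta>"
    unfolding cutoff_def by (auto simp: \<zeta>_def)
  moreover have "\<forall>p\<in>half_ball R. \<zeta> p = 1"
    by (auto simp: \<zeta>_def half_ball_def)
  ultimately show ?thesis by (rule that)
qed

lemma ball_integrable:
  "integrable lebesgue (indicator (half_ball R) :: (real^'n) \<times> real \<Rightarrow> real)"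
  "integrable lebesgue (indicator (ball 0 R) :: real^'n \<Rightarrow> real)"
  using half_ball_finite[of R] emeasure_lborel_ball_finite[of "0::real^'n" R]
  by (auto intro!: integrable_real_indicator)

text \<open>With a cutoff equal to 1 on the smaller half-ball, \<open>energy_identity\<close> bounds
  the energy there by the integrals of the three majorants, none of which depends on
  \<open>k\<close>.\<close>

lemma energy_dq_uniform:
  assumes R: "0 < R" and b: "b \<in> Basis"
  obtains K where "0 \<le> K" "\<forall>k. energy R (dq b (hk k)) \<le> ennreal K"
proof -
  obtain \<zeta> :: "(real^'n) \<times> real \<Rightarrow> real" where \<zeta>: "cutoff (R + 1) \<zeta>" "\<forall>p\<in>half_ball R. \<zeta> p = 1"
    by (rule cutoff_exists[OF R])
  have R1: "0 < R + 1" using R by simp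
  obtain K where K: "0 \<le> K"
    "\<forall>h. 0 < h \<and> h \<le> 1 \<longrightarrow> (AE p in lebesgue. \<bar>weight_term \<zeta> (dq b h) p\<bar> \<le> K * (indicator (half_ball (R + 1)) p * \<mu> (snd p)))"
    "\<forall>h p. 0 < h \<and> h \<le> 1 \<longrightarrow> \<bar>bulk_term \<zeta> b h p\<bar> \<le> K * indicator (half_ball (R + 1)) p"
    "\<forall>h y. 0 < h \<and> h \<le> 1 \<longrightarrow> \<bar>boundary_term \<zeta> b h y\<bar> \<le> K * indicator (ball 0 (R + 1)) y"
    by (rule term_dominators[OF \<zeta>(1) R1 b])
  obtain C where C: "0 \<le> C" "\<forall>b\<in>Basis. \<forall>p\<in>half_ball (R + 1). \<bar>du b p\<bar> \<le> C"
    "\<forall>b\<in>Basis. \<forall>h. 0 < h \<and> h \<le> 1 \<longrightarrow> (\<forall>p\<in>half_ball (R + 1). \<bar>dq b h p\<bar> \<le> C)"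
    by (rule du_dq_bounded[OF R1])
  obtain D where D: "0 \<le> D" "\<forall>p\<in>half_space. \<bar>\<zeta> p\<bar> \<le> D"
    "\<forall>p\<in>half_space. \<zeta> differentiable (at p) \<longrightarrow> norm (grad \<zeta> p) \<le> D"
    by (rule cutoff_bounds[OF \<zeta>(1) R1])
  define J1 where "J1 = integral\<^sup>L lebesgue (\<lambda>p :: (real^'n) \<times> real. K * (indicator (half_ball (R + 1)) p * \<mu> (snd p)))"
  define J2 where "J2 = integral\<^sup>L lebesgue (\<lambda>p :: (real^'n) \<times> real. K * indicator (half_ball (R + 1)) p)"
  define J3 where "J3 = integral\<^sup>L lebesgue (\<lambda>y :: real^'n. K * indicator (ball 0 (R + 1)) y)"
  have i1: "integrable lebesgue (\<lambda>p :: (real^'n) \<times> real. K * (indicator (half_ball (R + 1)) p * \<mu> (snd p)))"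
    using mu_half_ball_integrable[OF R1] unfolding set_integrable_def real_scaleR_def by (intro integrable_mult_right)
  have i2: "integrable lebesgue (\<lambda>p :: (real^'n) \<times> real. K * indicator (half_ball (R + 1)) p)"
    and i3: "integrable lebesgue (\<lambda>y :: real^'n. K * indicator (ball 0 (R + 1)) y)"
    by (intro integrable_mult_right ball_integrable)+
  have "energy R (dq b (hk k)) \<le> ennreal (J1 + J2 + J3)" for k
  proof -
    let ?w = "dq b (hk k)"
    note I = energy_identity[OF \<zeta>(1) R1 b hk(1,2)[of k]]
    have wC: "\<forall>p\<in>half_ball (R + 1). \<bar>?w p\<bar> \<le> C"
      using C(3) b hk(1,2)[of k] by blast
    have wt: "integrable lebesgue (weight_term \<zeta> ?w)"
      using weighted_cutoff_term(1)[OF \<zeta>(1) R1 dq_C1 wC D(3)] by (simp add: weight_term_def[abs_def])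
    have "\<bar>integral\<^sup>L lebesgue (weight_term \<zeta> ?w)\<bar> \<le> J1"
      unfolding J1_def using K(2) hk(1,2)[of k] by (intro abs_integral_le wt i1) blast
    moreover have "\<bar>integral\<^sup>L lebesgue (bulk_term \<zeta> b (hk k))\<bar> \<le> J2"
      unfolding J2_def using K(3) hk(1,2)[of k] by (intro abs_integral_le I i2 AE_I2) blast
    moreover have "\<bar>integral\<^sup>L lebesgue (boundary_term \<zeta> b (hk k))\<bar> \<le> J3"
      unfolding J3_def using K(4) hk(1,2)[of k] by (intro abs_integral_le I i3 AE_I2) blast
    ultimately have le: "integral\<^sup>L lebesgue (grad_term (\<lambda>p. \<zeta> p * ?w p)) \<le> J1 + J2 + J3"
      unfolding I(4) by linarith
    have pos: "0 \<le> grad_term v p" for v p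
      using mu_pos[of "snd p"] by (cases "p \<in> half_space") (auto simp: grad_term_def half_space_def)
    have "energy R ?w \<le> (\<integral>\<^sup>+p. ennreal (grad_term (\<lambda>p. \<zeta> p * ?w p) p) \<partial>lebesgue)"
      unfolding energy_def
    proof (rule nn_integral_mono)
      fix p :: "(real^'n) \<times> real"
      show "ennreal (\<mu> (snd p) * (norm (grad ?w p))\<^sup>2) * indicator (half_ball R) p \<le> ennreal (grad_term (\<lambda>p. \<zeta> p * ?w p) p)"
      proof (cases "p \<in> half_ball R")
        case True
        have "grad (\<lambda>p. \<zeta> p * ?w p) p = grad ?w p"
          by (rule grad_cong_open[OF open_half_ball True]) (use \<zeta>(2) in auto)
        then show ?thesis
          using True by (simp add: grad_term_def half_ball_def)
      qed simp
    qed
    also have "\<dots> = ennreal (integral\<^sup>L lebesgue (grad_term (\<lambda>p. \<zeta> p * ?w p)))"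
      using I(1) by (rule nn_integral_eq_integral) (simp add: pos)
    also have "\<dots> \<le> ennreal (J1 + J2 + J3)"
      using le by (rule ennreal_leI)
    finally show ?thesis .
  qed
  then have "energy R (dq b (hk k)) \<le> ennreal (max 0 (J1 + J2 + J3))" for k
    by (rule order_trans) (simp add: ennreal_leI)
  then show ?thesis
    by (intro that[of "max 0 (J1 + J2 + J3)"]) auto
qed

text \<open>Only now is \<open>\<eta> u_b\<close> known to be a test function; the same finiteness
  gives \<open>u_b\<close> a trace at almost every boundary point.\<close>

lemma energy_du_finite:
  assumes R: "0 < R" and b: "b \<in> Basis"
  shows "energy R (du b) < \<infinity>"
proof -
  obtain K where K: "0 \<le> K" "\<forall>k. energy R (dq b (hk k)) \<le> ennreal K"
    by (rule energy_dq_uniform[OF R b])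
  have "energy R (du b) \<le> ennreal K"
    unfolding energy_def
  proof (rule fatou_bound)
    fix k
    define a where "a p = indicator half_space p * (\<mu> (snd p) * (norm (grad (dq b (hk k)) p))\<^sup>2)" for p
    have [measurable]: "a \<in> borel_measurable lebesgue"
      unfolding a_def[abs_def] by (rule grad_sq_measurable[OF C1_on_locally_lipschitz[OF open_half_space dq_C1]])
    have [measurable]: "half_ball R \<in> sets (lebesgue :: ((real^'n) \<times> real) measure)" by simp
    have "(\<lambda>p. ennreal (a p) * indicator (half_ball R) p) \<in> borel_measurable lebesgue"
      by measurable
    moreover have "(\<lambda>p. ennreal (a p) * indicator (half_ball R) p)
        = (\<lambda>p. ennreal (\<mu> (snd p) * (norm (grad (dq b (hk k)) p))\<^sup>2) * indicator (half_ball R) p)"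
      by (auto simp: a_def indicator_def half_ball_def)
    ultimately show "(\<lambda>p. ennreal (\<mu> (snd p) * (norm (grad (dq b (hk k)) p))\<^sup>2) * indicator (half_ball R) p) \<in> borel_measurable lebesgue"
      by simp
    show "(\<integral>\<^sup>+p\<in>half_ball R. ennreal (\<mu> (snd p) * (norm (grad (dq b (hk k)) p))\<^sup>2) \<partial>lebesgue) \<le> ennreal K"
      using K(2) unfolding energy_def by blast
  next
    show "AE p in lebesgue. (\<lambda>k. ennreal (\<mu> (snd p) * (norm (grad (dq b (hk k)) p))\<^sup>2) * indicator (half_ball R) p)
        \<longlonglongrightarrow> ennreal (\<mu> (snd p) * (norm (grad (du b) p))\<^sup>2) * indicator (half_ball R) p"
    proof (rule AE_I2)
      fix p :: "(real^'n) \<times> real"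
      show "(\<lambda>k. ennreal (\<mu> (snd p) * (norm (grad (dq b (hk k)) p))\<^sup>2) * indicator (half_ball R) p)
        \<longlonglongrightarrow> ennreal (\<mu> (snd p) * (norm (grad (du b) p))\<^sup>2) * indicator (half_ball R) p"
      proof (cases "p \<in> half_ball R")
        case True
        then have "p \<in> half_space" by (simp add: half_ball_def)
        from grad_dq_tendsto[OF this]
        have "(\<lambda>k. ennreal (\<mu> (snd p) * (norm (grad (dq b (hk k)) p))\<^sup>2)) \<longlonglongrightarrow> ennreal (\<mu> (snd p) * (norm (grad (du b) p))\<^sup>2)"
          by (intro tendsto_ennrealI tendsto_mult tendsto_const tendsto_power tendsto_norm)
        then show ?thesis using True by simp
      qed simp
    qed
  qed simp
  then show ?thesis
    by (rule order_le_less_trans) simp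
qed

lemma continuous_trace_u: "continuous_on UNIV (trace u)"
proof -
  have "isCont (trace u) y" for y
  proof -
    have r: "0 < norm y + 1" using norm_ge_zero[of y] by linarith
    obtain C where "C-lipschitz_on (ball 0 (norm y + 1)) (trace u)"
      by (rule trace_u_lipschitz[OF r])
    then have "continuous_on (ball 0 (norm y + 1)) (trace u)"
      by (rule lipschitz_on_continuous_on)
    then show ?thesis
      by (rule continuous_on_interior) simp
  qed
  then show ?thesis
    by (simp add: continuous_on_eq_continuous_at)
qed

lemma slice_measurable:
  assumes v: "C1_on half_space v" and x: "0 < x"
  shows "(\<lambda>y. v (y, x)) \<in> borel_measurable borel"
proof -
  have "continuous_on half_space v"
    using local_lipschitz_continuous_on[OF C1_on_locally_lipschitz[OF open_half_space v], of 0] by simp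
  then have "continuous_on UNIV (\<lambda>y. v (y, x))"
    by (rule continuous_on_compose2) (use x in \<open>auto intro!: continuous_on_Pair continuous_on_const continuous_on_id simp: half_space_def\<close>)
  then show ?thesis
    by (rule borel_measurable_continuous_onI)
qed

lemma trace_dq_measurable: "(\<lambda>y. (trace u (y + h *\<^sub>R b) - trace u y) / h) \<in> borel_measurable borel"
proof -
  have c: "continuous_on UNIV (\<lambda>y. trace u (y + h *\<^sub>R b))"
    by (rule continuous_on_compose2[OF continuous_trace_u]) (auto intro!: continuous_intros)
  have [measurable]: "(\<lambda>y. trace u (y + h *\<^sub>R b)) \<in> borel_measurable borel" "trace u \<in> borel_measurable borel"
    by (rule borel_measurable_continuous_onI c continuous_trace_u)+
  show ?thesis by measurable
qed

lemma trace_dq_tendsto: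
  assumes "trace u differentiable (at y)"
  shows "(\<lambda>k. (trace u (y + hk k *\<^sub>R b) - trace u y) / hk k) \<longlonglongrightarrow> b \<bullet> grad (trace u) y"
proof -
  have "(\<lambda>k. real (Suc k) *\<^sub>R (trace u (y + (1 / real (Suc k)) *\<^sub>R b) - trace u y)) \<longlonglongrightarrow> b \<bullet> grad (trace u) y"
    by (rule derivative_sequence[OF grad_has_derivative[OF assms]])
  moreover have "real (Suc k) *\<^sub>R (trace u (y + (1 / real (Suc k)) *\<^sub>R b) - trace u y) = (trace u (y + hk k *\<^sub>R b) - trace u y) / hk k" for k
    by (simp add: hk_def mult.commute del: of_nat_Suc)
  ultimately show ?thesis by simp
qed

lemma AE_trace_du:
  assumes b: "b \<in> Basis"
  shows "AE y in lebesgue. ((\<lambda>x. du b (y, x)) \<longlongrightarrow> trace (du b) y) (at_right 0)"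
proof -
  have "AE y in lebesgue. vertical_variation (du b) 1 y < \<infinity>"
    by (rule AE_vertical_variation_finite[OF du_C1 energy_du_finite[OF _ b]])
  then show ?thesis
    by eventually_elim (rule C1_on_trace(1)[OF du_C1])
qed

text \<open>
  The trace and the height \<open>x\<close> slice of a function differ in \<open>L\<^sup>1\<close> by its vertical variation, which for the
  difference quotients is small uniformly in the increment; hence both limits may be interchanged.
\<close>

lemma AE_trace_du_eq:
  assumes b: "b \<in> Basis"
  shows "AE y in lebesgue. trace (du b) y = b \<bullet> grad (trace u) y"
proof -
  define X where "X k y = (trace u (y + hk k *\<^sub>R b) - trace u y) / hk k" for k y
  define G where "G y = b \<bullet> grad (trace u) y" for y
  have X [measurable]: "X k \<in> borel_measurable lebesgue" for k
    unfolding X_def[abs_def] using trace_dq_measurable by (intro measurable_completion) simp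
  have XG: "AE y in lebesgue. (\<lambda>k. X k y) \<longlonglongrightarrow> G y"
    using AE_trace_u_differentiable unfolding X_def G_def by eventually_elim (rule trace_dq_tendsto)
  have G [measurable]: "G \<in> borel_measurable lebesgue"
    by (rule AE_limit_measurable[OF X XG])
  have sl [measurable]: "(\<lambda>y. dq b (hk k) (y, hk i)) \<in> borel_measurable lebesgue" "(\<lambda>y. du b (y, hk i)) \<in> borel_measurable lebesgue" for k i
    using slice_measurable[OF dq_C1 hk(1)] slice_measurable[OF du_C1 hk(1)] by (auto intro!: measurable_completion)
  have DT: "AE y in lebesgue. (\<lambda>i. du b (y, hk i)) \<longlonglongrightarrow> trace (du b) y"
    using AE_trace_du[OF b] by eventually_elim (rule filterlim_compose[OF _ hk_tendsto(2)])
  have T [measurable]: "trace (du b) \<in> borel_measurable lebesgue"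
    by (rule AE_limit_measurable[OF sl(2) DT])
  have vvfin: "AE y in lebesgue. vertical_variation (dq b (hk k)) 1 y < \<infinity>" for k
    by (rule AE_vertical_variation_finite[OF dq_C1 energy_dq_finite[OF _ b hk(1,2)]])
  have "AE y in lebesgue. y \<in> ball 0 (real (Suc n)) \<longrightarrow> trace (du b) y = G y" for n
  proof -
    let ?B = "ball (0::real^'n) (real (Suc n))"
    have r: "0 < real (Suc n)" and r1: "0 < real (Suc n) + 1" by simp_all
    obtain K where K: "0 \<le> K" "\<forall>k. energy (real (Suc n) + 1) (dq b (hk k)) \<le> ennreal K"
      by (rule energy_dq_uniform[OF r1 b])
    have [measurable]: "?B \<in> sets lebesgue" by simp
    \<comment> \<open>The estimate is uniform in \<open>k\<close>, since \<open>K\<close> bounds all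
      the energies; \<open>\<epsilon>\<close> and the height \<open>hk i\<close> are still
      free.\<close>
    have step1: "(\<integral>\<^sup>+y. ennreal \<bar>X k y - dq b (hk k) (y, hk i)\<bar> * indicator ?B y \<partial>lebesgue)
        \<le> ennreal \<epsilon> * ennreal K + ennreal (1 / \<epsilon>) * wc (hk i) * emeasure lborel ?B" if \<epsilon>: "0 < \<epsilon>" for \<epsilon> k i
    proof -
      have "(\<integral>\<^sup>+y. ennreal \<bar>X k y - dq b (hk k) (y, hk i)\<bar> * indicator ?B y \<partial>lebesgue)
          \<le> (\<integral>\<^sup>+y\<in>?B. vertical_variation (dq b (hk k)) (hk i) y \<partial>lebesgue)"
      proof (rule nn_integral_mono_AE)
        show "AE y in lebesgue. ennreal \<bar>X k y - dq b (hk k) (y, hk i)\<bar> * indicator ?B y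
            \<le> vertical_variation (dq b (hk k)) (hk i) y * indicator ?B y"
          using vvfin[of k]
        proof eventually_elim
          fix y assume fin: "vertical_variation (dq b (hk k)) 1 y < \<infinity>"
          have "X k y = trace (dq b (hk k)) y"
            unfolding X_def by (rule trace_eqI[OF trace_dq, symmetric])
          then have "ennreal \<bar>X k y - dq b (hk k) (y, hk i)\<bar> \<le> vertical_variation (dq b (hk k)) (hk i) y"
            using C1_on_trace(2)[OF dq_C1 fin hk(1)] by simp
          then show "ennreal \<bar>X k y - dq b (hk k) (y, hk i)\<bar> * indicator ?B y
            \<le> vertical_variation (dq b (hk k)) (hk i) y * indicator ?B y"
            by (rule mult_right_mono) simp
        qed
      qed
      also have "\<dots> \<le> ennreal \<epsilon> * energy (real (Suc n) + 1) (dq b (hk k)) + ennreal (1 / \<epsilon>) * wc (hk i) * emeasure lborel ?B"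
        unfolding nn_integral_lebesgue by (rule vertical_variation_bound[OF dq_C1 \<epsilon> hk(2) r])
      also have "\<dots> \<le> ennreal \<epsilon> * ennreal K + ennreal (1 / \<epsilon>) * wc (hk i) * emeasure lborel ?B"
        using K(2) by (intro add_mono mult_left_mono) auto
      finally show ?thesis .
    qed
    \<comment> \<open>Here \<open>k\<close> tends to infinity at fixed positive height, where the
      difference quotients converge to \<open>du b\<close> pointwise.\<close>
    have step2: "(\<integral>\<^sup>+y. ennreal \<bar>G y - du b (y, hk i)\<bar> * indicator ?B y \<partial>lebesgue)
        \<le> ennreal \<epsilon> * ennreal K + ennreal (1 / \<epsilon>) * wc (hk i) * emeasure lborel ?B" if \<epsilon>: "0 < \<epsilon>" for \<epsilon> i
    proof (rule fatou_bound)
      show "(\<lambda>y. ennreal \<bar>X k y - dq b (hk k) (y, hk i)\<bar> * indicator ?B y) \<in> borel_measurable lebesgue" for k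
        by measurable
      show "AE y in lebesgue. (\<lambda>k. ennreal \<bar>X k y - dq b (hk k) (y, hk i)\<bar> * indicator ?B y) \<longlonglongrightarrow> ennreal \<bar>G y - du b (y, hk i)\<bar> * indicator ?B y"
        using XG
      proof eventually_elim
        fix y assume y: "(\<lambda>k. X k y) \<longlonglongrightarrow> G y"
        have "(y, hk i) \<in> half_space" using hk(1) by (simp add: half_space_def)
        then have "(\<lambda>k. ennreal \<bar>X k y - dq b (hk k) (y, hk i)\<bar>) \<longlonglongrightarrow> ennreal \<bar>G y - du b (y, hk i)\<bar>"
          by (intro tendsto_ennrealI tendsto_rabs tendsto_diff y dq_tendsto)
        then show "(\<lambda>k. ennreal \<bar>X k y - dq b (hk k) (y, hk i)\<bar> * indicator ?B y) \<longlonglongrightarrow> ennreal \<bar>G y - du b (y, hk i)\<bar> * indicator ?B y"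
          by (cases "y \<in> ?B") simp_all
      qed
      show "(\<integral>\<^sup>+y. ennreal \<bar>X k y - dq b (hk k) (y, hk i)\<bar> * indicator ?B y \<partial>lebesgue)
        \<le> ennreal \<epsilon> * ennreal K + ennreal (1 / \<epsilon>) * wc (hk i) * emeasure lborel ?B" for k
        by (rule step1[OF \<epsilon>])
    qed simp
    \<comment> \<open>Now the height tends to 0, which removes the term with \<open>wc\<close>;
      \<open>\<epsilon>\<close> is sent to 0 afterwards.\<close>
    have step3: "(\<integral>\<^sup>+y. ennreal \<bar>G y - trace (du b) y\<bar> * indicator ?B y \<partial>lebesgue) \<le> ennreal \<epsilon> * ennreal K" if \<epsilon>: "0 < \<epsilon>" for \<epsilon>
    proof (rule fatou_bound)
      show "(\<lambda>y. ennreal \<bar>G y - du b (y, hk i)\<bar> * indicator ?B y) \<in> borel_measurable lebesgue" for i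
        by measurable
      show "AE y in lebesgue. (\<lambda>i. ennreal \<bar>G y - du b (y, hk i)\<bar> * indicator ?B y) \<longlonglongrightarrow> ennreal \<bar>G y - trace (du b) y\<bar> * indicator ?B y"
        using DT
      proof eventually_elim
        fix y assume y: "(\<lambda>i. du b (y, hk i)) \<longlonglongrightarrow> trace (du b) y"
        then have "(\<lambda>i. ennreal \<bar>G y - du b (y, hk i)\<bar>) \<longlonglongrightarrow> ennreal \<bar>G y - trace (du b) y\<bar>"
          by (intro tendsto_ennrealI tendsto_rabs tendsto_diff tendsto_const)
        then show "(\<lambda>i. ennreal \<bar>G y - du b (y, hk i)\<bar> * indicator ?B y) \<longlonglongrightarrow> ennreal \<bar>G y - trace (du b) y\<bar> * indicator ?B y"
          by (cases "y \<in> ?B") simp_all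
      qed
      show "(\<integral>\<^sup>+y. ennreal \<bar>G y - du b (y, hk i)\<bar> * indicator ?B y \<partial>lebesgue)
        \<le> ennreal \<epsilon> * ennreal K + ennreal (1 / \<epsilon>) * emeasure lborel ?B * wc (hk i)" for i
        using step2[OF \<epsilon>, of i] by (simp only: mult.assoc mult.commute[of "wc (hk i)"])
      have "(\<lambda>i. ennreal (1 / \<epsilon>) * emeasure lborel ?B * wc (hk i)) \<longlonglongrightarrow> ennreal (1 / \<epsilon>) * emeasure lborel ?B * 0"
        using wc_tendsto_0 emeasure_lborel_ball_finite[of "0::real^'n" "real (Suc n)"]
        by (intro ennreal_tendsto_cmult) (auto simp: hk_def ennreal_mult_less_top)
      then have "(\<lambda>i. ennreal \<epsilon> * ennreal K + ennreal (1 / \<epsilon>) * emeasure lborel ?B * wc (hk i)) \<longlonglongrightarrow> ennreal \<epsilon> * ennreal K + ennreal (1 / \<epsilon>) * emeasure lborel ?B * 0"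
        by (rule tendsto_add[OF tendsto_const])
      then show "(\<lambda>i. ennreal \<epsilon> * ennreal K + ennreal (1 / \<epsilon>) * emeasure lborel ?B * wc (hk i)) \<longlonglongrightarrow> ennreal \<epsilon> * ennreal K"
        by simp
    qed
    have "(\<integral>\<^sup>+y. ennreal \<bar>G y - trace (du b) y\<bar> * indicator ?B y \<partial>lebesgue) \<le> 0"
    proof (rule ennreal_le_epsilon)
      fix e :: real assume e: "0 < e"
      \<comment> \<open>The \<open>+ 1\<close> allows \<open>K = 0\<close>.\<close>
      have "ennreal (e / (K + 1)) * ennreal K = ennreal (e / (K + 1) * K)"
        using e K(1) by (intro ennreal_mult[symmetric]) auto
      also have "\<dots> \<le> ennreal e"
        using e K(1) by (intro ennreal_leI) (simp add: field_simps)
      finally show "(\<integral>\<^sup>+y. ennreal \<bar>G y - trace (du b) y\<bar> * indicator ?B y \<partial>lebesgue) \<le> 0 + ennreal e"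
        using step3[of "e / (K + 1)"] e K(1) by simp
    qed
    then have "(\<integral>\<^sup>+y. ennreal \<bar>G y - trace (du b) y\<bar> * indicator ?B y \<partial>lebesgue) = 0"
      by simp
    moreover have "(\<lambda>y. ennreal \<bar>G y - trace (du b) y\<bar> * indicator ?B y) \<in> borel_measurable lebesgue"
      by measurable
    ultimately have "AE y in lebesgue. ennreal \<bar>G y - trace (du b) y\<bar> * indicator ?B y = 0"
      by (simp add: nn_integral_0_iff_AE)
    then show ?thesis
      by eventually_elim (auto simp: indicator_def)
  qed
  then have "AE y in lebesgue. \<forall>n. y \<in> ball 0 (real (Suc n)) \<longrightarrow> trace (du b) y = G y"
    unfolding AE_all_countable by blast
  then show ?thesis
  proof eventually_elim
    fix y :: "real^'n" assume y: "\<forall>n. y \<in> ball 0 (real (Suc n)) \<longrightarrow> trace (du b) y = G y"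
    obtain n where "norm y < real n"
      using reals_Archimedean2 by blast
    then have "y \<in> ball 0 (real (Suc n))" by simp
    then show "trace (du b) y = b \<bullet> grad (trace u) y" using y unfolding G_def by blast
  qed
qed

end

subsection \<open>The linearized equation\<close>

text \<open>Supplies the measurability under which \<open>negligible_sections\<close> turns null
  sections into a null set.\<close>

lemma nonconvergence_measurable:
  fixes s :: "nat \<Rightarrow> 'a \<Rightarrow> real"
  assumes [measurable]: "\<And>k. s k \<in> borel_measurable M" "L \<in> borel_measurable M"
  shows "{x\<in>space M. \<not> (\<lambda>k. s k x) \<longlonglongrightarrow> L x} \<in> sets M"
proof -
  have eq: "(\<lambda>k. s k x) \<longlonglongrightarrow> L x \<longleftrightarrow> (\<forall>i::nat. \<exists>N::nat. \<forall>k::nat. N \<le> k \<longrightarrow> \<bar>s k x - L x\<bar> < 1 / real (Suc i))" for x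
  proof
    assume "(\<lambda>k. s k x) \<longlonglongrightarrow> L x"
    then show "\<forall>i::nat. \<exists>N::nat. \<forall>k::nat. N \<le> k \<longrightarrow> \<bar>s k x - L x\<bar> < 1 / real (Suc i)"
      unfolding LIMSEQ_iff real_norm_def by simp
  next
    assume *: "\<forall>i::nat. \<exists>N::nat. \<forall>k::nat. N \<le> k \<longrightarrow> \<bar>s k x - L x\<bar> < 1 / real (Suc i)"
    show "(\<lambda>k. s k x) \<longlonglongrightarrow> L x"
      unfolding LIMSEQ_iff real_norm_def
    proof (intro allI impI)
      fix r :: real assume "0 < r"
      then obtain i where i: "1 / real (Suc i) < r"
        using nat_approx_posE by blast
      obtain N where "\<forall>k. N \<le> k \<longrightarrow> \<bar>s k x - L x\<bar> < 1 / real (Suc i)"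
        using * by blast
      then show "\<exists>no. \<forall>n\<ge>no. \<bar>s n x - L x\<bar> < r"
        using i less_trans by blast
    qed
  qed
  show ?thesis
    unfolding eq by measurable
qed

context stable_weak_solution
begin

definition bulk_limit_term :: "real \<Rightarrow> ((real^'n) \<times> real \<Rightarrow> real) \<Rightarrow> (real^'n) \<times> real \<Rightarrow> real"
  where "bulk_limit_term R \<xi> p = indicator (half_ball R) p * (g' (snd p) (u p) * (\<xi> p)\<^sup>2)"

definition boundary_limit_term :: "real \<Rightarrow> ((real^'n) \<times> real \<Rightarrow> real) \<Rightarrow> real^'n \<Rightarrow> real"
  where "boundary_limit_term R \<xi> y = indicator (ball 0 R) y * (f' (trace u y) * (trace \<xi> y)\<^sup>2)"

lemma stableD:
  assumes R: "0 < R" and \<xi>: "admissible \<mu> R \<xi>"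
  shows "integrable lebesgue (bulk_limit_term R \<xi>)" "integrable lebesgue (boundary_limit_term R \<xi>)"
    "0 \<le> integral\<^sup>L lebesgue (grad_term \<xi>) + integral\<^sup>L lebesgue (bulk_limit_term R \<xi>) - integral\<^sup>L lebesgue (boundary_limit_term R \<xi>)"
proof -
  have S: "set_integrable lebesgue (half_ball R) (\<lambda>p. g' (snd p) (u p) * (\<xi> p)\<^sup>2)"
    "set_integrable lebesgue (ball 0 R) (\<lambda>y. f' (trace u y) * (trace \<xi> y)\<^sup>2)"
    "(LINT p:half_ball R|lebesgue. \<mu> (snd p) * (norm (grad \<xi> p))\<^sup>2)
        + (LINT p:half_ball R|lebesgue. g' (snd p) (u p) * (\<xi> p)\<^sup>2)
        - (LINT y:ball 0 R|lebesgue. f' (trace u y) * (trace \<xi> y)\<^sup>2) \<ge> 0"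
    using u_stable R \<xi> unfolding stable_solution_def by blast+
  show "integrable lebesgue (bulk_limit_term R \<xi>)" "integrable lebesgue (boundary_limit_term R \<xi>)"
    using S(1,2) by (simp_all add: set_integrable_def bulk_limit_term_def[abs_def] boundary_limit_term_def[abs_def])
  have z: "\<forall>p\<in>half_space - ball 0 R. \<xi> p = 0"
    and int: "integrable lebesgue (\<lambda>p. indicator (half_ball R) p *\<^sub>R (\<mu> (snd p) * (norm (grad \<xi> p))\<^sup>2))"
    using \<xi> by (simp_all add: admissible_def set_integrable_def)
  have gt: "integrable lebesgue (grad_term \<xi>)"
    using admissible_integrable_half_space[OF \<xi>] by (simp add: grad_term_def[abs_def])
  have "(LINT p:half_ball R|lebesgue. \<mu> (snd p) * (norm (grad \<xi> p))\<^sup>2) = integral\<^sup>L lebesgue (grad_term \<xi>)"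
    unfolding set_lebesgue_integral_def
  proof (rule integral_cong_AE)
    show "AE p in lebesgue. indicator (half_ball R) p *\<^sub>R (\<mu> (snd p) * (norm (grad \<xi> p))\<^sup>2) = grad_term \<xi> p"
      using AE_grad_zero_outside_ball[OF z]
      by eventually_elim (auto simp: grad_term_def indicator_def half_ball_def)
  qed (use int gt in auto)
  then show "0 \<le> integral\<^sup>L lebesgue (grad_term \<xi>) + integral\<^sup>L lebesgue (bulk_limit_term R \<xi>) - integral\<^sup>L lebesgue (boundary_limit_term R \<xi>)"
    using S(3) by (simp add: set_lebesgue_integral_def bulk_limit_term_def[abs_def] boundary_limit_term_def[abs_def])
qed

lemma bulk_term_tendsto_of_differentiable:
  assumes p: "p \<in> half_space" and d: "g (snd p) differentiable (at (u p))"
  shows "(\<lambda>k. bulk_term \<eta> b (hk k) p) \<longlonglongrightarrow> g' (snd p) (u p) * (\<eta> p * du b p)\<^sup>2"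
proof -
  obtain D where D: "(g (snd p) has_real_derivative D) (at (u p))"
    using d by (auto simp: real_differentiable_def)
  have "0 < snd p" using p by (simp add: half_space_def)
  then have D': "D = g' (snd p) (u p)"
    using g' D unfolding derivative_version_def by metis
  have "((\<lambda>q. g (snd p) (u q)) has_derivative (\<lambda>h. D * (h \<bullet> grad u p))) (at p)"
    using has_derivative_compose[OF u_derivative[OF p] D[unfolded has_field_derivative_def]] .
  then have "(\<lambda>k. real (Suc k) *\<^sub>R (g (snd p) (u (p + (1 / real (Suc k)) *\<^sub>R (b, 0))) - g (snd p) (u p))) \<longlonglongrightarrow> D * ((b, 0) \<bullet> grad u p)"
    by (rule derivative_sequence)
  moreover have "real (Suc k) *\<^sub>R (g (snd p) (u (p + (1 / real (Suc k)) *\<^sub>R (b, 0))) - g (snd p) (u p))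
      = (g (snd p) (u (p + (hk k *\<^sub>R b, 0))) - g (snd p) (u p)) / hk k" for k
    by (simp add: hk_def mult.commute del: of_nat_Suc)
  moreover have "(b, 0) \<bullet> grad u p = du b p"
    by (simp add: du_def inner_prod_def inner_commute)
  ultimately have "(\<lambda>k. (g (snd p) (u (p + (hk k *\<^sub>R b, 0))) - g (snd p) (u p)) / hk k) \<longlonglongrightarrow> D * du b p"
    by simp
  then have "(\<lambda>k. indicator half_space p * ((g (snd p) (u (p + (hk k *\<^sub>R b, 0))) - g (snd p) (u p)) / hk k * ((\<eta> p)\<^sup>2 * dq b (hk k) p)))
      \<longlonglongrightarrow> indicator half_space p * (D * du b p * ((\<eta> p)\<^sup>2 * du b p))"
    by (intro tendsto_mult tendsto_const dq_tendsto p)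
  moreover have "indicator half_space p * (D * du b p * ((\<eta> p)\<^sup>2 * du b p)) = g' (snd p) (u p) * (\<eta> p * du b p)\<^sup>2"
    using p by (simp add: D' power_mult_distrib power2_eq_square)
  ultimately show ?thesis
    unfolding bulk_term_def by simp
qed

text \<open>\<open>g\<close> is Lipschitz on the range of \<open>u\<close>, so its quotient is
  bounded by that of \<open>u\<close>, which tends to 0. The argument involves no derivative of
  \<open>g\<close> and so covers the values at which there is none.\<close>

lemma bulk_term_tendsto_of_critical:
  assumes R: "0 < R" and p: "p \<in> half_ball R" and d: "du b p = 0"
  shows "(\<lambda>k. bulk_term \<eta> b (hk k) p) \<longlonglongrightarrow> 0"
proof -
  have pH: "p \<in> half_space" using p by (simp add: half_ball_def)
  obtain M where M: "0 < M" "\<forall>p\<in>half_space. \<bar>u p\<bar> < M"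
    by (rule u_bound)
  obtain G where G: "0 \<le> G" "\<forall>x s t. 0 < x \<and> x < R \<and> \<bar>s\<bar> < M \<and> \<bar>t\<bar> < M \<longrightarrow> \<bar>g x s - g x t\<bar> \<le> G * \<bar>s - t\<bar>"
    by (rule g_increment_bound[OF R M(1)])
  have x: "0 < snd p" "snd p < R"
    using p norm_snd_le[of "snd p" "fst p"] by (auto simp: half_ball_def half_space_def)
  have bd: "\<bar>bulk_term \<eta> b (hk k) p\<bar> \<le> (G * \<bar>dq b (hk k) p\<bar>) * ((\<eta> p)\<^sup>2 * \<bar>dq b (hk k) p\<bar>)" for k
  proof -
    have us: "\<bar>u p\<bar> < M" "\<bar>u (p + (hk k *\<^sub>R b, 0))\<bar> < M"
      using M(2) pH by (auto simp: half_space_shift)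
    have "\<bar>(g (snd p) (u (p + (hk k *\<^sub>R b, 0))) - g (snd p) (u p)) / hk k\<bar> = \<bar>g (snd p) (u (p + (hk k *\<^sub>R b, 0))) - g (snd p) (u p)\<bar> / hk k"
      using hk(1)[of k] by simp
    also have "\<dots> \<le> (G * \<bar>u (p + (hk k *\<^sub>R b, 0)) - u p\<bar>) / hk k"
      using G(2) x us hk(1)[of k] by (intro divide_right_mono) auto
    also have "\<dots> = G * \<bar>dq b (hk k) p\<bar>"
      using hk(1)[of k] by (simp add: dq_def)
    finally have a: "\<bar>(g (snd p) (u (p + (hk k *\<^sub>R b, 0))) - g (snd p) (u p)) / hk k\<bar> \<le> G * \<bar>dq b (hk k) p\<bar>" .
    then show ?thesis
      using pH mult_right_mono[OF a, of "\<bar>(\<eta> p)\<^sup>2 * dq b (hk k) p\<bar>"] by (simp add: bulk_term_def abs_mult)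
  qed
  have "(\<lambda>k. (G * \<bar>dq b (hk k) p\<bar>) * ((\<eta> p)\<^sup>2 * \<bar>dq b (hk k) p\<bar>)) \<longlonglongrightarrow> (G * \<bar>du b p\<bar>) * ((\<eta> p)\<^sup>2 * \<bar>du b p\<bar>)"
    by (intro tendsto_mult tendsto_const tendsto_rabs dq_tendsto pH)
  then have "(\<lambda>k. (G * \<bar>dq b (hk k) p\<bar>) * ((\<eta> p)\<^sup>2 * \<bar>dq b (hk k) p\<bar>)) \<longlonglongrightarrow> 0"
    by (simp add: d)
  then show ?thesis
    by (rule Lim_null_comparison[rotated]) (use bd in \<open>auto intro: always_eventually\<close>)
qed

text \<open>At a fixed height \<open>x\<close> the bad points are those where \<open>u\<close> takes
  a value at which \<open>g x\<close> has no derivative although \<open>du b\<close> is nonzero;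
  they form a null set. The argument goes section by section because the exceptional values vary
  with \<open>x\<close>. Measurability of the exceptional set comes from the integrability
  \<open>L\<close>, since \<open>derivative_version\<close> says nothing about measurability of
  \<open>g'\<close>.\<close>

lemma bulk_term_tendsto:
  assumes \<eta>: "cutoff R \<eta>" and R: "0 < R" and b: "b \<in> Basis"
    and L: "integrable lebesgue (bulk_limit_term R (\<lambda>p. \<eta> p * du b p))"
  shows "AE p in lebesgue. (\<lambda>k. bulk_term \<eta> b (hk k) p) \<longlonglongrightarrow> bulk_limit_term R (\<lambda>p. \<eta> p * du b p) p"
proof -
  let ?L = "bulk_limit_term R (\<lambda>p. \<eta> p * du b p)"
  define E where "E = {p\<in>space lebesgue. \<not> (\<lambda>k. bulk_term \<eta> b (hk k) p) \<longlonglongrightarrow> ?L p}"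
  have E: "E \<in> sets lebesgue"
    unfolding E_def using energy_identity(2)[OF \<eta> R b hk(1,2)] L
    by (intro nonconvergence_measurable borel_measurable_integrable)
  have z: "\<forall>p\<in>half_space - ball 0 R. \<eta> p = 0"
    using \<eta> by (simp add: cutoff_def)
  have "negligible E"
  proof (rule negligible_sections[OF E])
    fix x :: real
    show "negligible {y. (y, x) \<in> E}"
    proof (cases "0 < x")
      case False
      then have "(y, x) \<notin> E" for y
        by (simp add: E_def bulk_term_def bulk_limit_term_def half_ball_def half_space_def)
      then show ?thesis by simp
    next
      case True
      define N where "N = {t. \<not> g x differentiable (at t)}"
      have N: "negligible N"
        using rademacher_local[OF g_lipschitz[OF True] open_UNIV] by (simp add: N_def)
      have "{y. (y, x) \<in> E} \<subseteq> {y. u (y, x) \<in> N \<and> (\<exists>D. ((\<lambda>y. u (y, x)) has_derivative D) (at y) \<and> D b \<noteq> 0)}"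
      proof (rule subsetI, rule ccontr)
        fix y assume yE: "y \<in> {y. (y, x) \<in> E}"
          and n: "y \<notin> {y. u (y, x) \<in> N \<and> (\<exists>D. ((\<lambda>y. u (y, x)) has_derivative D) (at y) \<and> D b \<noteq> 0)}"
        let ?p = "(y, x)"
        have p: "?p \<in> half_space" using True by (simp add: half_space_def)
        have e: "((\<lambda>y. (y, x)) has_derivative (\<lambda>h. (h, 0))) (at y)"
          by (auto intro!: derivative_eq_intros)
        have D: "((\<lambda>y. u (y, x)) has_derivative (\<lambda>h. (h, 0) \<bullet> grad u ?p)) (at y)"
          using has_derivative_compose[OF e u_derivative[OF p]] .
        have Db: "(b, 0) \<bullet> grad u ?p = du b ?p"
          by (simp add: du_def inner_prod_def inner_commute)
        have "u ?p \<notin> N \<or> du b ?p = 0"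
          using n D Db by auto
        then have "(\<lambda>k. bulk_term \<eta> b (hk k) ?p) \<longlonglongrightarrow> ?L ?p"
        proof
          assume "u ?p \<notin> N"
          then have "(\<lambda>k. bulk_term \<eta> b (hk k) ?p) \<longlonglongrightarrow> g' x (u ?p) * (\<eta> ?p * du b ?p)\<^sup>2"
            using bulk_term_tendsto_of_differentiable[OF p, of \<eta> b] by (simp add: N_def)
          moreover have "g' x (u ?p) * (\<eta> ?p * du b ?p)\<^sup>2 = ?L ?p"
            using z p by (cases "?p \<in> half_ball R") (auto simp: bulk_limit_term_def half_ball_def)
          ultimately show ?thesis by simp
        next
          assume d: "du b ?p = 0"
          show ?thesis
          proof (cases "?p \<in> half_ball R")
            case True
            from bulk_term_tendsto_of_critical[OF R True d] show ?thesis
              by (simp add: bulk_limit_term_def d)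
          next
            case False
            then have "\<eta> ?p = 0" using z p by (auto simp: half_ball_def)
            then show ?thesis by (simp add: bulk_limit_term_def bulk_term_def)
          qed
        qed
        then show False using yE by (simp add: E_def)
      qed
      then show ?thesis
        using negligible_regular_preimage[OF N b] negligible_subset by blast
    qed
  qed
  then show ?thesis
    by (rule AE_lebesgueI) (simp add: E_def)
qed

text \<open>The argument of the bulk term with \<open>trace u\<close> in place of \<open>u\<close>.
  Agreement of \<open>trace (du b)\<close> with the derivative of \<open>trace u\<close> identifies
  the limit as the term that appears in the stability condition.\<close>

lemma boundary_term_tendsto:
  assumes \<eta>: "cutoff R \<eta>" and R: "0 < R" and b: "b \<in> Basis"
  shows "AE y in lebesgue. (\<lambda>k. boundary_term \<eta> b (hk k) y) \<longlonglongrightarrow> boundary_limit_term R (\<lambda>p. \<eta> p * du b p) y"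
proof -
  define N where "N = {t. \<not> f differentiable (at t)}"
  have N: "negligible N"
    using rademacher_local[OF f_lipschitz open_UNIV] by (simp add: N_def)
  have reg: "AE y in lebesgue. \<not> (trace u y \<in> N \<and> (\<exists>D. (trace u has_derivative D) (at y) \<and> D b \<noteq> 0))"
    using negligible_regular_preimage[OF N b, of "trace u"] by (rule AE_lebesgueI) blast
  have z: "\<forall>p\<in>half_space - ball 0 R. \<eta> p = 0"
    using \<eta> by (simp add: cutoff_def)
  obtain M where M: "0 < M" "\<forall>p\<in>half_space. \<bar>u p\<bar> < M"
    by (rule u_bound)
  obtain F where F: "F-lipschitz_on (cball 0 M) f"
    using locally_lipschitz_on_compact[OF f_lipschitz compact_cball] .
  show ?thesis
    using reg AE_trace_u_differentiable AE_trace_du[OF b] AE_trace_du_eq[OF b]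
  proof eventually_elim
    fix y assume reg: "\<not> (trace u y \<in> N \<and> (\<exists>D. (trace u has_derivative D) (at y) \<and> D b \<noteq> 0))"
      and diff: "trace u differentiable (at y)"
      and T: "((\<lambda>x. du b (y, x)) \<longlongrightarrow> trace (du b) y) (at_right 0)"
      and TG: "trace (du b) y = b \<bullet> grad (trace u) y"
    have tr: "trace (\<lambda>p. \<eta> p * du b p) y = trace \<eta> y * trace (du b) y"
      by (rule trace_mult[OF cutoff_trace[OF \<eta>] T])
    define X where "X k = (trace u (y + hk k *\<^sub>R b) - trace u y) / hk k" for k
    have X: "X \<longlonglongrightarrow> trace (du b) y"
      unfolding X_def TG by (rule trace_dq_tendsto[OF diff])
    define q where "q k = (f (trace u (y + hk k *\<^sub>R b)) - f (trace u y)) / hk k" for k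
    have bt: "boundary_term \<eta> b (hk k) y = q k * ((trace \<eta> y)\<^sup>2 * X k)" for k
      by (simp add: boundary_term_def X_def q_def)
    have lt: "boundary_limit_term R (\<lambda>p. \<eta> p * du b p) y = f' (trace u y) * (trace \<eta> y * trace (du b) y)\<^sup>2"
      using trace_outside_ball[OF z, of y] by (cases "y \<in> ball 0 R") (simp_all add: boundary_limit_term_def tr)
    have D: "(trace u has_derivative (\<lambda>h. h \<bullet> grad (trace u) y)) (at y)"
      by (rule grad_has_derivative[OF diff])
    have "trace u y \<notin> N \<or> trace (du b) y = 0"
      using reg D TG by auto
    then show "(\<lambda>k. boundary_term \<eta> b (hk k) y) \<longlonglongrightarrow> boundary_limit_term R (\<lambda>p. \<eta> p * du b p) y"
    proof
      assume "trace u y \<notin> N"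
      then obtain D' where D': "(f has_real_derivative D') (at (trace u y))"
        by (auto simp: N_def real_differentiable_def)
      have fD: "D' = f' (trace u y)"
        using f' D' unfolding derivative_version_def by metis
      have "((\<lambda>y. f (trace u y)) has_derivative (\<lambda>h. D' * (h \<bullet> grad (trace u) y))) (at y)"
        using has_derivative_compose[OF D D'[unfolded has_field_derivative_def]] .
      then have "(\<lambda>k. real (Suc k) *\<^sub>R (f (trace u (y + (1 / real (Suc k)) *\<^sub>R b)) - f (trace u y))) \<longlonglongrightarrow> D' * (b \<bullet> grad (trace u) y)"
        by (rule derivative_sequence)
      moreover have "real (Suc k) *\<^sub>R (f (trace u (y + (1 / real (Suc k)) *\<^sub>R b)) - f (trace u y)) = q k" for k
        by (simp add: q_def hk_def mult.commute del: of_nat_Suc)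
      ultimately have "q \<longlonglongrightarrow> D' * trace (du b) y"
        by (simp add: TG)
      then have "(\<lambda>k. q k * ((trace \<eta> y)\<^sup>2 * X k)) \<longlonglongrightarrow> D' * trace (du b) y * ((trace \<eta> y)\<^sup>2 * trace (du b) y)"
        by (intro tendsto_mult tendsto_const X)
      then show ?thesis
        by (simp add: bt lt fD power_mult_distrib power2_eq_square algebra_simps)
    next
      \<comment> \<open>As in the interior, the Lipschitz bound of \<open>f\<close> takes the place
        of the possibly missing derivative.\<close>
      assume T0: "trace (du b) y = 0"
      have bd: "\<bar>q k * ((trace \<eta> y)\<^sup>2 * X k)\<bar> \<le> (F * \<bar>X k\<bar>) * ((trace \<eta> y)\<^sup>2 * \<bar>X k\<bar>)" for k
      proof -
        have us: "trace u y \<in> cball 0 M" "trace u (y + hk k *\<^sub>R b) \<in> cball 0 M"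
          using trace_u_bound[OF M(2)] by auto
        have "\<bar>q k\<bar> = \<bar>f (trace u (y + hk k *\<^sub>R b)) - f (trace u y)\<bar> / hk k"
          using hk(1)[of k] by (simp add: q_def)
        also have "\<dots> \<le> (F * norm (trace u (y + hk k *\<^sub>R b) - trace u y)) / hk k"
          using hk(1)[of k] by (intro divide_right_mono lipschitz_on_real_bound[OF F us(2,1)]) auto
        also have "\<dots> = F * \<bar>X k\<bar>"
          using hk(1)[of k] by (simp add: X_def)
        finally have a: "\<bar>q k\<bar> \<le> F * \<bar>X k\<bar>" .
        then show ?thesis
          using mult_right_mono[OF a, of "\<bar>(trace \<eta> y)\<^sup>2 * X k\<bar>"] by (simp add: abs_mult)
      qed
      have "(\<lambda>k. (F * \<bar>X k\<bar>) * ((trace \<eta> y)\<^sup>2 * \<bar>X k\<bar>)) \<longlonglongrightarrow> (F * \<bar>trace (du b) y\<bar>) * ((trace \<eta> y)\<^sup>2 * \<bar>trace (du b) y\<bar>)"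
        by (intro tendsto_mult tendsto_const tendsto_rabs X)
      then have "(\<lambda>k. (F * \<bar>X k\<bar>) * ((trace \<eta> y)\<^sup>2 * \<bar>X k\<bar>)) \<longlonglongrightarrow> 0"
        by (simp add: T0)
      then have "(\<lambda>k. q k * ((trace \<eta> y)\<^sup>2 * X k)) \<longlonglongrightarrow> 0"
        by (rule Lim_null_comparison[rotated]) (use bd in \<open>auto intro: always_eventually\<close>)
      then show ?thesis
        by (simp add: bt lt T0)
    qed
  qed
qed

text \<open>In the limit of \<open>energy_identity\<close> equality is given up only in the gradient
  term, for which no dominating function is available and Fatou's lemma is applied.\<close>

lemma linearized_energy_inequality:
  assumes \<eta>: "cutoff R \<eta>" and R: "0 < R" and b: "b \<in> Basis"
  shows "admissible \<mu> R (\<lambda>p. \<eta> p * du b p)"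
    "integrable lebesgue (weight_term \<eta> (du b))"
    "integral\<^sup>L lebesgue (grad_term (\<lambda>p. \<eta> p * du b p))
      \<le> integral\<^sup>L lebesgue (weight_term \<eta> (du b)) - integral\<^sup>L lebesgue (bulk_limit_term R (\<lambda>p. \<eta> p * du b p))
        + integral\<^sup>L lebesgue (boundary_limit_term R (\<lambda>p. \<eta> p * du b p))"
proof -
  obtain C where C: "0 \<le> C" "\<forall>b\<in>Basis. \<forall>p\<in>half_ball R. \<bar>du b p\<bar> \<le> C"
    "\<forall>b\<in>Basis. \<forall>h. 0 < h \<and> h \<le> 1 \<longrightarrow> (\<forall>p\<in>half_ball R. \<bar>dq b h p\<bar> \<le> C)"
    by (rule du_dq_bounded[OF R])
  obtain D where D: "0 \<le> D" "\<forall>p\<in>half_space. \<bar>\<eta> p\<bar> \<le> D"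
    "\<forall>p\<in>half_space. \<eta> differentiable (at p) \<longrightarrow> norm (grad \<eta> p) \<le> D"
    by (rule cutoff_bounds[OF \<eta> R])
  have dC: "\<forall>p\<in>half_ball R. \<bar>du b p\<bar> \<le> C"
    using C(2) b by blast
  have wC: "\<forall>p\<in>half_ball R. \<bar>dq b (hk k) p\<bar> \<le> C" for k
    using C(3) b hk(1,2)[of k] by blast
  note adm = admissible_mult[OF \<eta> R C1_on_locally_lipschitz[OF open_half_space du_C1] dC energy_du_finite[OF R b]]
  show adm1: "admissible \<mu> R (\<lambda>p. \<eta> p * du b p)"
    by (rule adm(1))
  show wt: "integrable lebesgue (weight_term \<eta> (du b))"
    using weighted_cutoff_term(1)[OF \<eta> R du_C1 dC D(3)] by (simp add: weight_term_def[abs_def])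
  have wtk: "integrable lebesgue (weight_term \<eta> (dq b (hk k)))" for k
    using weighted_cutoff_term(1)[OF \<eta> R dq_C1 wC D(3)] by (simp add: weight_term_def[abs_def])
  \<comment> \<open>Stability enters this estimate through the integrability of the two limit terms;
    its inequality is applied later, to the product of \<open>\<eta>\<close> with
    \<open>gu\<close>.\<close>
  note S = stableD[OF R adm1]
  note I = energy_identity[OF \<eta> R b hk(1,2)]
  obtain K where K: "0 \<le> K"
    "\<forall>h. 0 < h \<and> h \<le> 1 \<longrightarrow> (AE p in lebesgue. \<bar>weight_term \<eta> (dq b h) p\<bar> \<le> K * (indicator (half_ball R) p * \<mu> (snd p)))"
    "\<forall>h p. 0 < h \<and> h \<le> 1 \<longrightarrow> \<bar>bulk_term \<eta> b h p\<bar> \<le> K * indicator (half_ball R) p"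
    "\<forall>h y. 0 < h \<and> h \<le> 1 \<longrightarrow> \<bar>boundary_term \<eta> b h y\<bar> \<le> K * indicator (ball 0 R) y"
    by (rule term_dominators[OF \<eta> R b])
  have i1: "integrable lebesgue (\<lambda>p :: (real^'n) \<times> real. K * (indicator (half_ball R) p * \<mu> (snd p)))"
    using mu_half_ball_integrable[OF R] unfolding set_integrable_def real_scaleR_def by (intro integrable_mult_right)
  have i2: "integrable lebesgue (\<lambda>p :: (real^'n) \<times> real. K * indicator (half_ball R) p)"
    and i3: "integrable lebesgue (\<lambda>y :: real^'n. K * indicator (ball 0 R) y)"
    by (intro integrable_mult_right ball_integrable)+
  have l1: "(\<lambda>k. integral\<^sup>L lebesgue (weight_term \<eta> (dq b (hk k)))) \<longlonglongrightarrow> integral\<^sup>L lebesgue (weight_term \<eta> (du b))"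
  proof (rule integral_dominated_convergence[OF _ _ i1])
    show "AE p in lebesgue. (\<lambda>k. weight_term \<eta> (dq b (hk k)) p) \<longlonglongrightarrow> weight_term \<eta> (du b) p"
    proof (rule AE_I2)
      fix p :: "(real^'n) \<times> real"
      show "(\<lambda>k. weight_term \<eta> (dq b (hk k)) p) \<longlonglongrightarrow> weight_term \<eta> (du b) p"
      proof (cases "p \<in> half_space")
        case True
        then show ?thesis
          unfolding weight_term_def by (intro tendsto_mult tendsto_const tendsto_power dq_tendsto)
      qed (simp add: weight_term_def)
    qed
    show "AE p in lebesgue. norm (weight_term \<eta> (dq b (hk k)) p) \<le> K * (indicator (half_ball R) p * \<mu> (snd p))" for k
      using K(2) hk(1,2)[of k] unfolding real_norm_def by blast
  qed (use wt wtk in auto)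
  have l2: "(\<lambda>k. integral\<^sup>L lebesgue (bulk_term \<eta> b (hk k))) \<longlonglongrightarrow> integral\<^sup>L lebesgue (bulk_limit_term R (\<lambda>p. \<eta> p * du b p))"
  proof (rule integral_dominated_convergence[OF _ _ i2])
    show "AE p in lebesgue. (\<lambda>k. bulk_term \<eta> b (hk k) p) \<longlonglongrightarrow> bulk_limit_term R (\<lambda>p. \<eta> p * du b p) p"
      by (rule bulk_term_tendsto[OF \<eta> R b S(1)])
    show "AE p in lebesgue. norm (bulk_term \<eta> b (hk k) p) \<le> K * indicator (half_ball R) p" for k
      using K(3) hk(1,2)[of k] unfolding real_norm_def by (intro AE_I2) blast
  qed (use S(1) I(2) in auto)
  have l3: "(\<lambda>k. integral\<^sup>L lebesgue (boundary_term \<eta> b (hk k))) \<longlonglongrightarrow> integral\<^sup>L lebesgue (boundary_limit_term R (\<lambda>p. \<eta> p * du b p))"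
  proof (rule integral_dominated_convergence[OF _ _ i3])
    show "AE y in lebesgue. (\<lambda>k. boundary_term \<eta> b (hk k) y) \<longlonglongrightarrow> boundary_limit_term R (\<lambda>p. \<eta> p * du b p) y"
      by (rule boundary_term_tendsto[OF \<eta> R b])
    show "AE y in lebesgue. norm (boundary_term \<eta> b (hk k) y) \<le> K * indicator (ball 0 R) y" for k
      using K(4) hk(1,2)[of k] unfolding real_norm_def by (intro AE_I2) blast
  qed (use S(2) I(3) in auto)
  let ?J = "integral\<^sup>L lebesgue (weight_term \<eta> (du b)) - integral\<^sup>L lebesgue (bulk_limit_term R (\<lambda>p. \<eta> p * du b p))
        + integral\<^sup>L lebesgue (boundary_limit_term R (\<lambda>p. \<eta> p * du b p))"
  have lim: "(\<lambda>k. integral\<^sup>L lebesgue (grad_term (\<lambda>p. \<eta> p * dq b (hk k) p))) \<longlonglongrightarrow> ?J"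
    unfolding I(4) by (intro tendsto_add tendsto_diff l1 l2 l3)
  have pos: "0 \<le> grad_term v p" for v p
    using mu_pos[of "snd p"] by (cases "p \<in> half_space") (auto simp: grad_term_def half_space_def)
  \<comment> \<open>\<open>ennreal\<close> truncates negative numbers to 0, so the final inequality
    returns to the reals only for a nonnegative right side.\<close>
  have J0: "0 \<le> ?J"
    by (rule tendsto_lowerbound[OF lim]) (auto intro!: always_eventually Bochner_Integration.integral_nonneg pos)
  have gt: "integrable lebesgue (grad_term (\<lambda>p. \<eta> p * du b p))"
    using admissible_integrable_half_space[OF adm1] by (simp add: grad_term_def[abs_def])
  have admk: "AE p in lebesgue. p \<in> half_space \<longrightarrow> \<eta> differentiable (at p) \<and> dq b (hk k) differentiable (at p) \<and>
      grad (\<lambda>p. \<eta> p * dq b (hk k) p) p = \<eta> p *\<^sub>R grad (dq b (hk k)) p + dq b (hk k) p *\<^sub>R grad \<eta> p" for k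
    by (rule admissible_mult(2)[OF \<eta> R C1_on_locally_lipschitz[OF open_half_space dq_C1] wC energy_dq_finite[OF R b hk(1,2)]])
  have "(\<integral>\<^sup>+p. ennreal (grad_term (\<lambda>p. \<eta> p * du b p) p) \<partial>lebesgue) \<le> ennreal ?J"
  proof (rule fatou_bound)
    show "(\<lambda>p. ennreal (grad_term (\<lambda>p. \<eta> p * dq b (hk k) p) p)) \<in> borel_measurable lebesgue" for k
      using I(1) by (intro measurable_compose[OF _ measurable_ennreal] borel_measurable_integrable)
    have "AE p in lebesgue. \<forall>k. p \<in> half_space \<longrightarrow> \<eta> differentiable (at p) \<and> dq b (hk k) differentiable (at p) \<and>
      grad (\<lambda>p. \<eta> p * dq b (hk k) p) p = \<eta> p *\<^sub>R grad (dq b (hk k)) p + dq b (hk k) p *\<^sub>R grad \<eta> p"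
      unfolding AE_all_countable using admk by blast
    then show "AE p in lebesgue. (\<lambda>k. ennreal (grad_term (\<lambda>p. \<eta> p * dq b (hk k) p) p)) \<longlonglongrightarrow> ennreal (grad_term (\<lambda>p. \<eta> p * du b p) p)"
      using adm(2)
    proof eventually_elim
      fix p assume a: "\<forall>k. p \<in> half_space \<longrightarrow> \<eta> differentiable (at p) \<and> dq b (hk k) differentiable (at p) \<and>
          grad (\<lambda>p. \<eta> p * dq b (hk k) p) p = \<eta> p *\<^sub>R grad (dq b (hk k)) p + dq b (hk k) p *\<^sub>R grad \<eta> p"
        and d: "p \<in> half_space \<longrightarrow> \<eta> differentiable (at p) \<and> du b differentiable (at p) \<and>
          grad (\<lambda>p. \<eta> p * du b p) p = \<eta> p *\<^sub>R grad (du b) p + du b p *\<^sub>R grad \<eta> p"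
      show "(\<lambda>k. ennreal (grad_term (\<lambda>p. \<eta> p * dq b (hk k) p) p)) \<longlonglongrightarrow> ennreal (grad_term (\<lambda>p. \<eta> p * du b p) p)"
      proof (cases "p \<in> half_space")
        case True
        have "(\<lambda>k. grad (\<lambda>p. \<eta> p * dq b (hk k) p) p) \<longlonglongrightarrow> grad (\<lambda>p. \<eta> p * du b p) p"
          using a d True
          by (simp add: tendsto_add tendsto_scaleR dq_tendsto grad_dq_tendsto)
        then show ?thesis
          unfolding grad_term_def by (intro tendsto_ennrealI tendsto_mult tendsto_const tendsto_power tendsto_norm)
      qed (simp add: grad_term_def)
    qed
    show "(\<integral>\<^sup>+p. ennreal (grad_term (\<lambda>p. \<eta> p * dq b (hk k) p) p) \<partial>lebesgue) \<le> ennreal (integral\<^sup>L lebesgue (grad_term (\<lambda>p. \<eta> p * dq b (hk k) p)))" for k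
      using nn_integral_eq_integral[OF I(1)] pos by simp
    show "(\<lambda>k. ennreal (integral\<^sup>L lebesgue (grad_term (\<lambda>p. \<eta> p * dq b (hk k) p)))) \<longlonglongrightarrow> ennreal ?J"
      by (intro tendsto_ennrealI lim)
  qed
  moreover have "(\<integral>\<^sup>+p. ennreal (grad_term (\<lambda>p. \<eta> p * du b p) p) \<partial>lebesgue) = ennreal (integral\<^sup>L lebesgue (grad_term (\<lambda>p. \<eta> p * du b p)))"
    using nn_integral_eq_integral[OF gt] pos by simp
  ultimately show "integral\<^sup>L lebesgue (grad_term (\<lambda>p. \<eta> p * du b p)) \<le> ?J"
    using J0 by (simp add: ennreal_le_iff)
qed

subsection \<open>The geometric inequality\<close>

definition gu :: "(real^'n) \<times> real \<Rightarrow> real"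
  where "gu p = norm (fst (grad u p))"

lemma gu_square: "(gu p)\<^sup>2 = (\<Sum>b\<in>Basis. (du b p)\<^sup>2)"
  unfolding gu_def du_def by (rule sum_norm_sq_eq)

text \<open>The norm need not be differentiable where the horizontal gradient vanishes, so local
  Lipschitz continuity and Rademacher's theorem take the place of C^1 regularity.\<close>

lemma gu_locally_lipschitz: "locally_lipschitz_on half_space gu"
proof (rule locally_lipschitz_onI)
  fix p :: "(real^'n) \<times> real" assume p: "p \<in> half_space"
  obtain H where H: "\<And>p. p \<in> half_space \<Longrightarrow> (grad u has_derivative H p) (at p)"
    "\<And>h. continuous_on half_space (\<lambda>p. H p h)"
    by (rule C2_onE[OF u_C2 open_half_space]) blast
  obtain r L where r: "0 < r" and L: "L-lipschitz_on (cball p r) (grad u)"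
    using C1_vector_lipschitz[OF open_half_space p H] by blast
  have "L-lipschitz_on (cball p r \<inter> half_space) gu"
  proof (rule lipschitz_onI)
    fix a b assume "a \<in> cball p r \<inter> half_space" "b \<in> cball p r \<inter> half_space"
    then have "dist (grad u a) (grad u b) \<le> L * dist a b"
      by (intro lipschitz_onD[OF L]) auto
    moreover have "dist (gu a) (gu b) \<le> norm (fst (grad u a) - fst (grad u b))"
      unfolding gu_def dist_real_def by (rule norm_triangle_ineq3)
    moreover have "norm (fst (grad u a - grad u b)) \<le> dist (grad u a) (grad u b)"
      using norm_fst_le[of "fst (grad u a - grad u b)" "snd (grad u a - grad u b)"] unfolding prod.collapse dist_norm .
    ultimately show "dist (gu a) (gu b) \<le> L * dist a b" by simp
  qed (use lipschitz_on_nonneg[OF L] in simp)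
  then show "\<exists>r>0. \<exists>L. L-lipschitz_on (cball p r \<inter> half_space) gu"
    using r by blast
qed

text \<open>Obtained by differentiating the square, which involves no division by \<open>gu\<close>
  and so covers its zeros as well.\<close>

lemma gu_grad_combination:
  assumes p: "p \<in> half_space" and d: "gu differentiable (at p)"
  shows "gu p *\<^sub>R grad gu p = (\<Sum>b\<in>Basis. du b p *\<^sub>R grad (du b) p)"
proof -
  have db: "(du b has_derivative (\<lambda>h. h \<bullet> grad (du b) p)) (at p)" for b
    using hessian p by metis
  have 1: "((\<lambda>q. (gu q)\<^sup>2) has_derivative (\<lambda>h. h \<bullet> (2 *\<^sub>R (gu p *\<^sub>R grad gu p)))) (at p)"
    using has_derivative_power[OF grad_has_derivative[OF d], of 2]
    by (simp add: algebra_simps)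
  have "((\<lambda>q. \<Sum>b\<in>Basis. (du b q)\<^sup>2) has_derivative (\<lambda>h. \<Sum>b\<in>Basis. h \<bullet> (2 *\<^sub>R (du b p *\<^sub>R grad (du b) p)))) (at p)"
  proof (rule has_derivative_sum)
    fix b :: "real^'n"
    show "((\<lambda>q. (du b q)\<^sup>2) has_derivative (\<lambda>h. h \<bullet> (2 *\<^sub>R (du b p *\<^sub>R grad (du b) p)))) (at p)"
      using has_derivative_power[OF db[of b], of 2] by (simp add: algebra_simps)
  qed
  then have 2: "((\<lambda>q. (gu q)\<^sup>2) has_derivative (\<lambda>h. h \<bullet> (2 *\<^sub>R (\<Sum>b\<in>Basis. du b p *\<^sub>R grad (du b) p)))) (at p)"
    unfolding gu_square by (simp add: inner_sum_right sum_distrib_left mult.assoc)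
  have "2 *\<^sub>R (gu p *\<^sub>R grad gu p) = 2 *\<^sub>R (\<Sum>b\<in>Basis. du b p *\<^sub>R grad (du b) p)"
    using grad_unique[OF 1] grad_unique[OF 2] by (rule trans[OF sym])
  then show ?thesis
    unfolding scaleR_cancel_left by simp
qed

text \<open>Compared with \<open>geometric_inequality\<close> on the slice, the full gradients add
  the mixed derivatives, collected in the vector \<open>w\<close>. Its squared length enters the
  sum, its squared component along \<open>\<nu>\<close> the subtracted term, and Cauchy-Schwarz
  gives the sign.\<close>

lemma geometric_inequality_slice:
  assumes p: "p \<in> half_space" and n: "gu p \<noteq> 0"
  shows "(level_curvature u p)\<^sup>2 * (gu p)\<^sup>2 + (norm (level_grad u (\<lambda>q. norm (grad_y u q)) p))\<^sup>2
    \<le> (\<Sum>b\<in>Basis. (norm (grad (du b) p))\<^sup>2) - (norm (grad gu p))\<^sup>2"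
proof -
  obtain H where H: "\<forall>p\<in>half_space. (grad u has_derivative H p) (at p)"
    "\<forall>p\<in>half_space. \<forall>h k. H p h \<bullet> k = H p k \<bullet> h"
    "\<forall>b. \<forall>p\<in>half_space. grad (du b) p = H p (b, 0)"
    by (rule hessian)
  obtain y x where yx: "p = (y, x)" by (cases p)
  have x: "0 < x" using p by (simp add: yx half_space_def)
  let ?v = "\<lambda>y. u (y, x)"
  have gv: "grad ?v = (\<lambda>y. fst (grad u (y, x)))"
  proof
    fix y' show "grad ?v y' = fst (grad u (y', x))"
      using grad_y_eq[of "(y', x)"] x by (simp add: grad_y_def half_space_def)
  qed
  define A where "A k = fst (H p (k, 0))" for k
  have e: "((\<lambda>y. (y, x)) has_derivative (\<lambda>h. (h, 0))) (at y)"
    by (auto intro!: derivative_eq_intros)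
  have A: "(grad ?v has_derivative A) (at y)"
    unfolding gv A_def
    using has_derivative_fst[OF has_derivative_compose[OF e H(1)[rule_format, OF p, unfolded yx]]] yx by simp
  have sym: "A h \<bullet> k = A k \<bullet> h" for h k
  proof -
    have "H p (h, 0) \<bullet> (k, 0) = H p (k, 0) \<bullet> (h, 0)"
      using H(2) p by blast
    then show ?thesis by (simp add: A_def inner_prod_def)
  qed
  define a where "a = grad ?v y"
  have a: "a = fst (grad u p)" by (simp add: a_def gv yx)
  have a0: "a \<noteq> 0" using n by (simp add: gu_def a)
  define \<nu> where "\<nu> = a /\<^sub>R norm a"
  have n\<nu>: "norm \<nu> = 1" using a0 by (simp add: \<nu>_def)
  have "(curvature_norm ?v y)\<^sup>2 * (norm a)\<^sup>2 + (norm (tangential_grad ?v (\<lambda>z. norm (grad ?v z)) y))\<^sup>2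
    \<le> (\<Sum>i\<in>Basis. (norm (A i))\<^sup>2) - (norm (A \<nu>))\<^sup>2"
    using geometric_inequality[OF A sym] a0 unfolding \<nu>_def a_def by blast
  moreover have "level_grad u (\<lambda>q. norm (grad_y u q)) p = tangential_grad ?v (\<lambda>z. norm (grad ?v z)) y"
    by (simp add: level_grad_def grad_y_def yx)
  moreover have "level_curvature u p = curvature_norm ?v y"
    by (simp add: level_curvature_def yx)
  moreover have "gu p = norm a"
    by (simp add: gu_def a)
  moreover have "(\<Sum>i\<in>Basis. (norm (A i))\<^sup>2) - (norm (A \<nu>))\<^sup>2
    \<le> (\<Sum>b\<in>Basis. (norm (grad (du b) p))\<^sup>2) - (norm (grad gu p))\<^sup>2"
  proof -
    define w where "w = fst (H p (0, 1))"
    have sH: "snd (H p (k, 0)) = w \<bullet> k" for k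
    proof -
      have "H p (k, 0) \<bullet> (0, 1) = H p (0, 1) \<bullet> (k, 0)"
        using H(2) p by blast
      then show ?thesis by (simp add: w_def inner_prod_def)
    qed
    have nH: "(norm (H p (k, 0)))\<^sup>2 = (norm (A k))\<^sup>2 + (w \<bullet> k)\<^sup>2" for k
      by (simp add: norm_prod_def A_def sH)
    have "(norm has_derivative (\<lambda>h. h \<bullet> sgn a)) (at (fst (grad u p)))"
      using has_derivative_norm[OF a0] a by simp
    then have "(gu has_derivative (\<lambda>h. fst (H p h) \<bullet> sgn a)) (at p)"
      unfolding gu_def[abs_def]
      using has_derivative_compose[OF has_derivative_fst[OF H(1)[rule_format, OF p]]] by blast
    moreover have "fst (H p h) \<bullet> sgn a = h \<bullet> H p (\<nu>, 0)" for h
    proof -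
      have "H p h \<bullet> (\<nu>, 0) = H p (\<nu>, 0) \<bullet> h"
        using H(2) p by blast
      moreover have "fst (H p h) \<bullet> sgn a = H p h \<bullet> (\<nu>, 0)"
        by (simp add: inner_prod_def \<nu>_def sgn_div_norm)
      ultimately show ?thesis by (simp add: inner_commute)
    qed
    ultimately have "grad gu p = H p (\<nu>, 0)"
      by (intro grad_unique) simp
    moreover have "grad (du b) p = H p (b, 0)" for b
      using H(3) p by blast
    moreover have "(\<Sum>b\<in>Basis. (norm (H p (b, 0)))\<^sup>2) = (\<Sum>b\<in>Basis. (norm (A b))\<^sup>2) + (norm w)\<^sup>2"
      unfolding nH sum_norm_sq_eq[of w] by (rule sum.distrib)
    moreover have "(w \<bullet> \<nu>)\<^sup>2 \<le> (norm w)\<^sup>2"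
      using Cauchy_Schwarz_ineq[of w \<nu>] n\<nu> by (simp add: power2_norm_eq_inner[symmetric])
    ultimately show ?thesis
      by (simp add: nH)
  qed
  ultimately show ?thesis by simp
qed

text \<open>At a zero \<open>gu\<close> is minimal, so its gradient vanishes; elsewhere the left
  side of \<open>geometric_inequality_slice\<close> is nonnegative.\<close>

lemma grad_gu_le:
  assumes p: "p \<in> half_space" and d: "gu differentiable (at p)"
  shows "(norm (grad gu p))\<^sup>2 \<le> (\<Sum>b\<in>Basis. (norm (grad (du b) p))\<^sup>2)"
proof (cases "gu p = 0")
  case True
  have "(\<lambda>h. h \<bullet> grad gu p) = (\<lambda>h. 0)"
    by (rule differential_zero_maxmin[OF p open_half_space grad_has_derivative[OF d]]) (use True in \<open>simp add: gu_def\<close>)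
  then have "grad gu p \<bullet> grad gu p = 0" by metis
  then show ?thesis by (simp add: sum_nonneg)
next
  case False
  have "0 \<le> (level_curvature u p)\<^sup>2 * (gu p)\<^sup>2 + (norm (level_grad u (\<lambda>q. norm (grad_y u q)) p))\<^sup>2"
    by simp
  with geometric_inequality_slice[OF p False] show ?thesis by linarith
qed

lemma energy_gu_finite:
  assumes R: "0 < R"
  shows "energy R gu < \<infinity>"
proof -
  have i: "integrable lebesgue (\<lambda>p. indicator (half_ball R) p *\<^sub>R (\<mu> (snd p) * (norm (grad (du b) p))\<^sup>2))" if "b \<in> Basis" for b
    using energy_integrable[OF C1_on_locally_lipschitz[OF open_half_space du_C1]] energy_du_finite[OF R that]
    unfolding set_integrable_def by blast
  define S where "S p = (\<Sum>b\<in>Basis. indicator (half_ball R) p *\<^sub>R (\<mu> (snd p) * (norm (grad (du b) p))\<^sup>2))" for p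
  have S: "integrable lebesgue S"
    unfolding S_def[abs_def] by (intro Bochner_Integration.integrable_sum i)
  have S0: "0 \<le> S p" for p
    unfolding S_def using mu_pos[of "snd p"]
    by (cases "p \<in> half_ball R") (auto simp: half_ball_def half_space_def intro!: sum_nonneg)
  have "energy R gu \<le> (\<integral>\<^sup>+p. ennreal (S p) \<partial>lebesgue)"
    unfolding energy_def
  proof (rule nn_integral_mono_AE)
    show "AE p in lebesgue. ennreal (\<mu> (snd p) * (norm (grad gu p))\<^sup>2) * indicator (half_ball R) p \<le> ennreal (S p)"
      using AE_differentiable_half_space[OF gu_locally_lipschitz]
    proof eventually_elim
      fix p assume d: "p \<in> half_space \<longrightarrow> gu differentiable (at p)"
      show "ennreal (\<mu> (snd p) * (norm (grad gu p))\<^sup>2) * indicator (half_ball R) p \<le> ennreal (S p)"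
      proof (cases "p \<in> half_ball R")
        case True
        then have p: "p \<in> half_space" by (simp add: half_ball_def)
        then have "0 < \<mu> (snd p)" by (intro mu_pos) (simp add: half_space_def)
        then have "\<mu> (snd p) * (norm (grad gu p))\<^sup>2 \<le> \<mu> (snd p) * (\<Sum>b\<in>Basis. (norm (grad (du b) p))\<^sup>2)"
          using grad_gu_le[OF p] d p by simp
        then show ?thesis
          using True by (simp add: S_def sum_distrib_left ennreal_leI)
      qed simp
    qed
  qed
  also have "\<dots> = ennreal (integral\<^sup>L lebesgue S)"
    by (rule nn_integral_eq_integral[OF S]) (simp add: S0)
  finally show ?thesis by (simp add: le_less_trans)
qed

text \<open>By continuity the trace of a Euclidean norm is the norm of the traces. This makes the
  boundary term for \<open>gu\<close> the sum of those for the \<open>du b\<close>.\<close>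

lemma trace_gu_square:
  assumes \<eta>: "cutoff R \<eta>"
  shows "AE y in lebesgue. (trace (\<lambda>p. \<eta> p * gu p) y)\<^sup>2 = (\<Sum>b\<in>Basis. (trace (\<lambda>p. \<eta> p * du b p) y)\<^sup>2)"
proof -
  have "AE y in lebesgue. \<forall>b\<in>Basis. ((\<lambda>x. du b (y, x)) \<longlongrightarrow> trace (du b) y) (at_right 0)"
    by (intro AE_finite_allI finite_Basis AE_trace_du)
  then show ?thesis
  proof eventually_elim
    fix y assume T: "\<forall>b\<in>Basis. ((\<lambda>x. du b (y, x)) \<longlongrightarrow> trace (du b) y) (at_right 0)"
    have "((\<lambda>x. sqrt (\<Sum>b\<in>Basis. (du b (y, x))\<^sup>2)) \<longlongrightarrow> sqrt (\<Sum>b\<in>Basis. (trace (du b) y)\<^sup>2)) (at_right 0)"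
      using T by (intro tendsto_real_sqrt tendsto_sum tendsto_power) blast
    moreover have "sqrt (\<Sum>b\<in>Basis. (du b (y, x))\<^sup>2) = gu (y, x)" for x
      unfolding gu_square[symmetric] by (simp add: gu_def)
    ultimately have G: "((\<lambda>x. gu (y, x)) \<longlongrightarrow> sqrt (\<Sum>b\<in>Basis. (trace (du b) y)\<^sup>2)) (at_right 0)"
      by simp
    have "(trace (\<lambda>p. \<eta> p * gu p) y)\<^sup>2 = (trace \<eta> y)\<^sup>2 * (\<Sum>b\<in>Basis. (trace (du b) y)\<^sup>2)"
      unfolding trace_mult[OF cutoff_trace[OF \<eta>] G] by (simp add: power_mult_distrib sum_nonneg)
    also have "\<dots> = (\<Sum>b\<in>Basis. (trace (\<lambda>p. \<eta> p * du b p) y)\<^sup>2)"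
      unfolding sum_distrib_left
    proof (rule sum.cong)
      fix b :: "real^'n" assume "b \<in> Basis"
      then have "trace (\<lambda>p. \<eta> p * du b p) y = trace \<eta> y * trace (du b) y"
        using T by (intro trace_mult cutoff_trace[OF \<eta>]) blast
      then show "(trace \<eta> y)\<^sup>2 * (trace (du b) y)\<^sup>2 = (trace (\<lambda>p. \<eta> p * du b p) y)\<^sup>2"
        by (simp add: power_mult_distrib)
    qed simp
    finally show "(trace (\<lambda>p. \<eta> p * gu p) y)\<^sup>2 = (\<Sum>b\<in>Basis. (trace (\<lambda>p. \<eta> p * du b p) y)\<^sup>2)" .
  qed
qed

text \<open>The cross terms agree by \<open>d\<close>, the terms with the square of \<open>e\<close>
  by \<open>w\<close>, and both cancel. With \<open>t\<close> a cutoff and \<open>e\<close> its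
  gradient, this is the excess of the summed energy densities of the products with
  \<open>du b\<close> over that of the product with \<open>gu\<close>; no derivative of the cutoff
  is left.\<close>

lemma product_gradient_defect:
  fixes a :: "'b \<Rightarrow> 'a::real_inner" and d e :: 'a
  assumes w: "w\<^sup>2 = (\<Sum>b\<in>B. (c b)\<^sup>2)" and d: "w *\<^sub>R d = (\<Sum>b\<in>B. c b *\<^sub>R a b)"
  shows "(\<Sum>b\<in>B. (norm (t *\<^sub>R a b + c b *\<^sub>R e))\<^sup>2) - (norm (t *\<^sub>R d + w *\<^sub>R e))\<^sup>2
    = t\<^sup>2 * ((\<Sum>b\<in>B. (norm (a b))\<^sup>2) - (norm d)\<^sup>2)"
proof -
  have expand: "(norm (t *\<^sub>R x + s *\<^sub>R e))\<^sup>2 = t\<^sup>2 * (norm x)\<^sup>2 + (2 * t) * ((s *\<^sub>R x) \<bullet> e) + s\<^sup>2 * (norm e)\<^sup>2" for x s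
    unfolding power2_norm_eq_inner
    by (simp add: inner_add_left inner_add_right inner_commute power2_eq_square algebra_simps)
  have "(\<Sum>b\<in>B. (norm (t *\<^sub>R a b + c b *\<^sub>R e))\<^sup>2)
      = t\<^sup>2 * (\<Sum>b\<in>B. (norm (a b))\<^sup>2) + (2 * t) * ((\<Sum>b\<in>B. c b *\<^sub>R a b) \<bullet> e) + (\<Sum>b\<in>B. (c b)\<^sup>2) * (norm e)\<^sup>2"
    unfolding expand sum.distrib inner_sum_left sum_distrib_left sum_distrib_right ..
  then show ?thesis
    unfolding d[symmetric] w[symmetric] expand[of d w] by (simp add: algebra_simps)
qed

lemma second_order_inequality:
  assumes \<eta>: "cutoff R \<eta>" and R: "0 < R"
  shows "(\<integral>\<^sup>+p. ennreal (indicator half_space p * (\<mu> (snd p) * ((\<eta> p)\<^sup>2 *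
      ((\<Sum>b\<in>Basis. (norm (grad (du b) p))\<^sup>2) - (norm (grad gu p))\<^sup>2)))) \<partial>lebesgue)
    \<le> (\<integral>\<^sup>+p. ennreal (weight_term \<eta> gu p) \<partial>lebesgue)"
proof -
  obtain C where C: "0 \<le> C" "\<forall>p\<in>half_ball R. norm (fst (grad u p)) \<le> C"
    by (rule grad_y_bounded[OF R])
  have gC: "\<forall>p\<in>half_ball R. \<bar>gu p\<bar> \<le> C"
    using C(2) by (simp add: gu_def)
  obtain C' where C': "\<forall>b\<in>Basis. \<forall>p\<in>half_ball R. \<bar>du b p\<bar> \<le> C'"
    by (rule du_dq_bounded[OF R])
  let ?T = "\<lambda>b p. \<eta> p * du b p" and ?W = "\<lambda>p. \<eta> p * gu p"
  note admW = admissible_mult[OF \<eta> R gu_locally_lipschitz gC energy_gu_finite[OF R]]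
  note S = stableD[OF R admW(1)]
  note I = linearized_energy_inequality[OF \<eta> R]
  have prod: "AE p in lebesgue. p \<in> half_space \<longrightarrow> \<eta> differentiable (at p) \<and> du b differentiable (at p) \<and>
      grad (?T b) p = \<eta> p *\<^sub>R grad (du b) p + du b p *\<^sub>R grad \<eta> p" if "b \<in> Basis" for b
    using admissible_mult(2)[OF \<eta> R C1_on_locally_lipschitz[OF open_half_space du_C1] _ energy_du_finite[OF R that]] C' that
    by blast
  have gT: "integrable lebesgue (grad_term (?T b))" if "b \<in> Basis" for b
    using admissible_integrable_half_space[OF I(1)[OF that]] by (simp add: grad_term_def[abs_def])
  have gW: "integrable lebesgue (grad_term ?W)"
    using admissible_integrable_half_space[OF admW(1)] by (simp add: grad_term_def[abs_def])
  note ST = stableD[OF R I(1)]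
  \<comment> \<open>The equality holds pointwise whatever the values of \<open>g'\<close>, because
    the test functions enter through their squares, which add up. On the boundary the squares of the
    traces add up only almost everywhere.\<close>
  have bulk: "integral\<^sup>L lebesgue (bulk_limit_term R ?W) = (\<Sum>b\<in>Basis. integral\<^sup>L lebesgue (bulk_limit_term R (?T b)))"
  proof -
    have "bulk_limit_term R ?W = (\<lambda>p. \<Sum>b\<in>Basis. bulk_limit_term R (?T b) p)"
      by (rule ext) (simp add: bulk_limit_term_def power_mult_distrib gu_square sum_distrib_left)
    then show ?thesis
      using ST(1) by (simp add: Bochner_Integration.integral_sum)
  qed
  have boundary: "integral\<^sup>L lebesgue (boundary_limit_term R ?W) = (\<Sum>b\<in>Basis. integral\<^sup>L lebesgue (boundary_limit_term R (?T b)))"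
  proof -
    have s: "integrable lebesgue (\<lambda>y. \<Sum>b\<in>Basis. boundary_limit_term R (?T b) y)"
      by (intro Bochner_Integration.integrable_sum ST(2))
    have "integral\<^sup>L lebesgue (boundary_limit_term R ?W) = (\<integral>y. (\<Sum>b\<in>Basis. boundary_limit_term R (?T b) y) \<partial>lebesgue)"
    proof (rule integral_cong_AE)
      show "AE y in lebesgue. boundary_limit_term R ?W y = (\<Sum>b\<in>Basis. boundary_limit_term R (?T b) y)"
        using trace_gu_square[OF \<eta>]
        by eventually_elim (simp add: boundary_limit_term_def sum_distrib_left)
    qed (use S(2) s in auto)
    then show ?thesis
      using ST(2) by (simp add: Bochner_Integration.integral_sum)
  qed
  define Q where "Q p = (\<Sum>b\<in>Basis. grad_term (?T b) p) - grad_term ?W p" for p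
  define Z where "Z p = (\<Sum>b\<in>Basis. weight_term \<eta> (du b) p)" for p
  have Q: "integrable lebesgue Q"
    unfolding Q_def[abs_def] by (intro Bochner_Integration.integrable_diff Bochner_Integration.integrable_sum gT gW)
  have Z: "integrable lebesgue Z"
    unfolding Z_def[abs_def] by (intro Bochner_Integration.integrable_sum I(2))
  have Zeq: "Z p = weight_term \<eta> gu p" for p
    by (simp add: Z_def weight_term_def gu_square sum_distrib_left sum_distrib_right)
  have "integral\<^sup>L lebesgue Q = (\<Sum>b\<in>Basis. integral\<^sup>L lebesgue (grad_term (?T b))) - integral\<^sup>L lebesgue (grad_term ?W)"
    unfolding Q_def[abs_def]
    using gT gW by (simp add: Bochner_Integration.integral_sum Bochner_Integration.integral_diff Bochner_Integration.integrable_sum)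
  also have "\<dots> \<le> (\<Sum>b\<in>Basis. integral\<^sup>L lebesgue (weight_term \<eta> (du b)) - integral\<^sup>L lebesgue (bulk_limit_term R (?T b))
        + integral\<^sup>L lebesgue (boundary_limit_term R (?T b))) - integral\<^sup>L lebesgue (grad_term ?W)"
    by (intro diff_right_mono sum_mono I(3))
  also have "\<dots> \<le> (\<Sum>b\<in>Basis. integral\<^sup>L lebesgue (weight_term \<eta> (du b)))"
    using S(3) by (simp add: sum.distrib sum_subtractf bulk boundary)
  also have "\<dots> = integral\<^sup>L lebesgue Z"
    unfolding Z_def[abs_def] using I(2) by (simp add: Bochner_Integration.integral_sum)
  finally have QZ: "integral\<^sup>L lebesgue Q \<le> integral\<^sup>L lebesgue Z" .
  let ?X = "\<lambda>p. indicator half_space p * (\<mu> (snd p) * ((\<eta> p)\<^sup>2 *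
      ((\<Sum>b\<in>Basis. (norm (grad (du b) p))\<^sup>2) - (norm (grad gu p))\<^sup>2)))"
  have "AE p in lebesgue. \<forall>b\<in>Basis. p \<in> half_space \<longrightarrow> \<eta> differentiable (at p) \<and> du b differentiable (at p) \<and>
      grad (?T b) p = \<eta> p *\<^sub>R grad (du b) p + du b p *\<^sub>R grad \<eta> p"
    by (intro AE_finite_allI finite_Basis prod)
  \<comment> \<open>Nonnegativity is what permits passing between the integral of \<open>Q\<close>
    and its \<open>ennreal\<close> integral.\<close>
  then have XQ: "AE p in lebesgue. ?X p = Q p \<and> 0 \<le> Q p"
    using admW(2)
  proof eventually_elim
    fix p assume dT: "\<forall>b\<in>Basis. p \<in> half_space \<longrightarrow> \<eta> differentiable (at p) \<and> du b differentiable (at p) \<and>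
        grad (?T b) p = \<eta> p *\<^sub>R grad (du b) p + du b p *\<^sub>R grad \<eta> p"
      and dW: "p \<in> half_space \<longrightarrow> \<eta> differentiable (at p) \<and> gu differentiable (at p) \<and>
        grad ?W p = \<eta> p *\<^sub>R grad gu p + gu p *\<^sub>R grad \<eta> p"
    show "?X p = Q p \<and> 0 \<le> Q p"
    proof (cases "p \<in> half_space")
      case True
      then have d: "gu differentiable (at p)" using dW by blast
      have "Q p = \<mu> (snd p) * ((\<Sum>b\<in>Basis. (norm (\<eta> p *\<^sub>R grad (du b) p + du b p *\<^sub>R grad \<eta> p))\<^sup>2)
          - (norm (\<eta> p *\<^sub>R grad gu p + gu p *\<^sub>R grad \<eta> p))\<^sup>2)"
        using dT dW True by (simp add: Q_def grad_term_def sum_distrib_left right_diff_distrib)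
      also have "\<dots> = ?X p"
        unfolding product_gradient_defect[OF gu_square gu_grad_combination[OF True d]] using True by simp
      finally have eq: "Q p = ?X p" .
      have "0 < \<mu> (snd p)" using True by (intro mu_pos) (simp add: half_space_def)
      then have "0 \<le> ?X p"
        using grad_gu_le[OF True d] by simp
      then show ?thesis using eq by simp
    qed (simp add: Q_def grad_term_def)
  qed
  have "(\<integral>\<^sup>+p. ennreal (?X p) \<partial>lebesgue) = (\<integral>\<^sup>+p. ennreal (Q p) \<partial>lebesgue)"
    by (rule nn_integral_cong_AE) (use XQ in eventually_elim, simp)
  also have "\<dots> = ennreal (integral\<^sup>L lebesgue Q)"
    by (rule nn_integral_eq_integral[OF Q]) (use XQ in eventually_elim, simp)
  also have "\<dots> \<le> ennreal (integral\<^sup>L lebesgue Z)"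
    by (rule ennreal_leI[OF QZ])
  also have "\<dots> = (\<integral>\<^sup>+p. ennreal (Z p) \<partial>lebesgue)"
  proof (rule nn_integral_eq_integral[OF Z, symmetric], rule AE_I2)
    fix p :: "(real^'n) \<times> real"
    show "0 \<le> Z p"
      unfolding Zeq weight_term_def using mu_pos[of "snd p"] by (cases "p \<in> half_space") (auto simp: half_space_def)
  qed
  finally show ?thesis
    unfolding Zeq .
qed

text \<open>The curvature integrand is compared pointwise, and monotonicity of the
  \<open>ennreal\<close> integral applies to it without any discussion of its measurability.\<close>

lemma geometric_poincare:
  assumes \<eta>: "cutoff R \<eta>" and R: "0 < R"
  shows "(\<integral>\<^sup>+p\<in>regular_set u. ennreal (\<mu> (snd p) * (\<eta> p)\<^sup>2 *
            ((level_curvature u p)\<^sup>2 * (norm (grad_y u p))\<^sup>2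
              + (norm (level_grad u (\<lambda>q. norm (grad_y u q)) p))\<^sup>2)) \<partial>lebesgue)
         \<le> (\<integral>\<^sup>+p\<in>half_space. ennreal (\<mu> (snd p) * (norm (grad_y u p))\<^sup>2 * (norm (grad \<eta> p))\<^sup>2) \<partial>lebesgue)"
    (is "(\<integral>\<^sup>+p\<in>_. ennreal (?G p) \<partial>_) \<le> (\<integral>\<^sup>+p\<in>_. ennreal (?E p) \<partial>_)")
proof -
  let ?X = "\<lambda>p. indicator half_space p * (\<mu> (snd p) * ((\<eta> p)\<^sup>2 *
      ((\<Sum>b\<in>Basis. (norm (grad (du b) p))\<^sup>2) - (norm (grad gu p))\<^sup>2)))"
  have le: "ennreal (?G p) * indicator (regular_set u) p \<le> ennreal (?X p)" for p
  proof (cases "p \<in> regular_set u")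
    case True
    then have p: "p \<in> half_space" and n: "gu p \<noteq> 0"
      by (auto simp: regular_set_def gu_def grad_y_eq)
    have "0 < \<mu> (snd p)" using p by (intro mu_pos) (simp add: half_space_def)
    then have "\<mu> (snd p) * (\<eta> p)\<^sup>2 * ((level_curvature u p)\<^sup>2 * (gu p)\<^sup>2 + (norm (level_grad u (\<lambda>q. norm (grad_y u q)) p))\<^sup>2)
        \<le> \<mu> (snd p) * (\<eta> p)\<^sup>2 * ((\<Sum>b\<in>Basis. (norm (grad (du b) p))\<^sup>2) - (norm (grad gu p))\<^sup>2)"
      by (intro mult_left_mono geometric_inequality_slice[OF p n]) simp
    then have "?G p \<le> ?X p"
      using p by (simp add: gu_def grad_y_eq[OF p] mult.assoc)
    then show ?thesis
      using True by (simp add: ennreal_leI)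
  qed simp
  have "(\<integral>\<^sup>+p\<in>regular_set u. ennreal (?G p) \<partial>lebesgue) \<le> (\<integral>\<^sup>+p. ennreal (?X p) \<partial>lebesgue)"
    by (intro nn_integral_mono le)
  also have "\<dots> \<le> (\<integral>\<^sup>+p. ennreal (weight_term \<eta> gu p) \<partial>lebesgue)"
    by (rule second_order_inequality[OF \<eta> R])
  also have "\<dots> = (\<integral>\<^sup>+p\<in>half_space. ennreal (?E p) \<partial>lebesgue)"
  proof (rule nn_integral_cong)
    fix p :: "(real^'n) \<times> real"
    show "ennreal (weight_term \<eta> gu p) = ennreal (?E p) * indicator half_space p"
      by (cases "p \<in> half_space") (simp_all add: weight_term_def gu_def grad_y_eq mult.assoc)
  qed
  finally show ?thesis .
qed

end

theorem theorem1:
  fixes \<mu> :: "real \<Rightarrow> real"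
    and g g' :: "real \<Rightarrow> real \<Rightarrow> real"
    and f f' :: "real \<Rightarrow> real"
    and u \<phi> :: "(real^'n) \<times> real \<Rightarrow> real"
    and R :: real
  assumes \<mu>_L1: "\<And>r. 0 < r \<Longrightarrow> set_integrable lebesgue {0<..<r} \<mu>"
    and \<mu>_bounds: "\<And>K :: ((real^'n) \<times> real) set. compact (closure K) \<Longrightarrow> closure K \<subseteq> half_space \<Longrightarrow>
      \<exists>\<mu>1>0. \<exists>\<mu>2>0. \<forall>(y, x)\<in>K. \<mu>1 \<le> \<mu> x \<and> \<mu> x \<le> \<mu>2"
    and \<mu>_A2: "muckenhoupt_A2 \<mu>"
    and g_0: "\<And>r. 0 < r \<Longrightarrow> Linfty_on {0<..<r} (\<lambda>x. g x 0)"
    and g_lipschitz: "\<And>x. 0 < x \<Longrightarrow> locally_lipschitz_on UNIV (g x)"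
    and g_deriv_bound: "\<And>r M. 0 < r \<Longrightarrow> 0 < M \<Longrightarrow>
      \<exists>C>0. \<forall>x t D. 0 < x \<and> x < r \<and> \<bar>t\<bar> < M \<and> (g x has_real_derivative D) (at t) \<longrightarrow> \<bar>D\<bar> \<le> C"
    and f_lipschitz: "locally_lipschitz_on UNIV f"
    and g': "\<And>x. 0 < x \<Longrightarrow> derivative_version (g x) (g' x)"
    and f': "derivative_version f f'"
    and u_C2: "C2_on half_space u"
    and u_bounded: "bounded (u ` half_space)"
    and u_solution: "weak_solution \<mu> g f u"
    and u_stable: "stable_solution \<mu> g' f' u"
    and u_grad_y: "\<And>r. 0 < r \<Longrightarrow> Linfty_on (closure (half_ball r)) (\<lambda>p. norm (grad_y u p))"
    and R: "0 < R"
    and \<phi>_lipschitz: "\<exists>L. L-lipschitz_on UNIV \<phi>"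
    and \<phi>_support: "\<forall>p\<in>half_space - ball 0 R. \<phi> p = 0"
  shows "(\<integral>\<^sup>+p\<in>regular_set u. ennreal (\<mu> (snd p) * (\<phi> p)\<^sup>2 *
            ((level_curvature u p)\<^sup>2 * (norm (grad_y u p))\<^sup>2
              + (norm (level_grad u (\<lambda>q. norm (grad_y u q)) p))\<^sup>2)) \<partial>lebesgue)
         \<le> (\<integral>\<^sup>+p\<in>half_space. ennreal (\<mu> (snd p) * (norm (grad_y u p))\<^sup>2 * (norm (grad \<phi> p))\<^sup>2) \<partial>lebesgue)"
proof -
  interpret stable_weak_solution \<mu> g g' f f' u
    by unfold_locales (fact \<mu>_L1 \<mu>_bounds \<mu>_A2 g_lipschitz g_deriv_bound f_lipschitz g' f' u_C2 u_bounded u_solution u_stable u_grad_y)+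
  have "cutoff R \<phi>"
    unfolding cutoff_def using \<phi>_lipschitz \<phi>_support lipschitz_on_subset[OF _ subset_UNIV] by blast
  then show ?thesis
    by (rule geometric_poincare[OF _ R])
qed

end
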